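(* Let $\mathscr{A}$ be an essential strictly supersolvable toric arrangement of rank $r$, with associated arrangements $\mathscr{A}_1,\dots,\mathscr{A}_r=\mathscr{A}$, root maps $\mathbf{b}_j\colon M(\mathscr{A}_{j-1})\to\mathrm{Conf}_{n_j}(\mathbb{C})$ ($2\le j\le r$) and homological root homomorphisms $(\mathbf{b}_j)_*\colon H_1(M(\mathscr{A}_{j-1});\mathbb{Z})\to H_1(\mathrm{Conf}_{n_j}(\mathbb{C});\mathbb{Z})$. Then the (integral) lower central series Lie algebra $\mathfrak{h}(\mathscr{A})$ of the fundamental group $G(\mathscr{A})=\pi_1(M(\mathscr{A}))$ is an iterated semidirect product of free Lie algebras, determined by the sequence of homological root homomorphisms and the infinitesimal pure braid relations. Explicitly: $\mathfrak{h}(\mathscr{A}_1)\cong\mathbb{L}[n_1]$, and for each $2\le j\le r$, $\mathfrak{h}(\mathscr{A}_j)$ is isomorphic to the semidirect product of $\mathfrak{h}(\mathscr{A}_{j-1})$ by the free Lie algebra $\mathbb{L}[n_j]$ determined by the Lie homomorphism $\theta_{n_j}\circ(\mathbf{b}_j)_*\colon\mathfrak{h}(\mathscr{A}_{j-1})\to\mathrm{Der}(\mathbb{L}[n_j])$, where $(\mathbf{b}_j)_*\colon\mathfrak{h}(\mathscr{A}_{j-1})\to\mathfrak{h}(P_{n_j})$ is the Lie homomorphism extending the homological root homomorphism.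
   Context: Toric arrangements. Let $\Gamma\cong\mathbb{Z}^d$ and $T=\mathrm{Hom}(\Gamma,\mathbb{C}^\times)$. For $\chi\in\Gamma$ put $H_\chi=\{t\in T\mid t(\chi)=1\}$. A toric arrangement $\mathscr{A}$ in $T$ is the set of all connected components of the $H_\chi$, $\chi\in\mathfrak{X}$, for a finite set $\mathfrak{X}\subseteq\Gamma\smallsetminus\{0\}$; its complement is $M(\mathscr{A})=T\smallsetminus\bigcup_{\chi\in\mathfrak X}H_\chi$; its poset of layers $\mathscr{P}(\mathscr{A})$ consists of the nonempty connected components of intersections $\bigcap_{\chi\in S}H_\chi$, $S\subseteq\mathfrak{X}$, ordered by reverse inclusion. $\mathscr{A}$ is essential if the maximal elements of $\mathscr{P}(\mathscr{A})$ are points; then its rank is $d$. A subgroup $Y\subseteq T$ is admissible if there is a decomposition $\Gamma=\Gamma'\oplus\Gamma''$ with $\Gamma'$ of rank one and $Y=\{t\mid t|_{\Gamma''}\equiv1\}$. Let $p\colon T\to T/Y\cong\mathrm{Hom}(\Gamma'',\mathbb{C}^\times)$ be the projection, $\mathscr{A}_Y=\{H\in\mathscr{A}\mid H\text{ is a union of cosets of }Y\}$, $\mathscr{A}/Y=\{p(H)\mid H\in\mathscr{A}_Y\}$, a toric arrangement in $T/Y$. $\mathscr{P}(\mathscr{A}_Y)$ is a TM-ideal of $\mathscr{P}(\mathscr{A})$ if for any distinct $H_1,H_2\in\mathscr{A}\smallsetminus\mathscr{A}_Y$ and any connected component $X$ of $H_1\cap H_2$ there is $H_3\in\mathscr{A}_Y$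 with $H_3\supseteq X$, and $H\cap Y$ is connected for all $H\in\mathscr{A}\smallsetminus\mathscr{A}_Y$. An essential $\mathscr{A}$ of rank $r$ is strictly supersolvable if there are essential toric arrangements $\mathscr{A}_r=\mathscr{A},\mathscr{A}_{r-1},\dots,\mathscr{A}_1$, with $\mathscr{A}_j$ in a torus $T_j\cong(\mathbb{C}^\times)^j$, and admissible subgroups $Y_{j-1}\subseteq T_j$ such that $\mathscr{P}((\mathscr{A}_j)_{Y_{j-1}})$ is a TM-ideal of $\mathscr{P}(\mathscr{A}_j)$ and $\mathscr{A}_{j-1}=\mathscr{A}_j/Y_{j-1}$, $2\le j\le r$. Fix such a sequence. Root maps. Put $|\mathscr{A}_0|=0$ and $n_j=1+|\mathscr{A}_j|-|\mathscr{A}_{j-1}|$ for $1\le j\le r$. For $2\le j\le r$ choose coordinates $(\mathbf{x},y)=(x_1,\dots,x_{j-1},y)$ on $T_j$ with $Y_{j-1}=\{\mathbf{x}=(1,\dots,1)\}$; the hypersurfaces in $\mathscr{A}_j\smallsetminus(\mathscr{A}_j)_{Y_{j-1}}$ are then given by $y=\mu_i\mathbf{x}^{\mathbf{m}_i}$, $1\le i\le n_j-1$, with $\mu_i$ a root of unity and $\mathbf{m}_i\in\mathbb{Z}^{j-1}$. The root map is $\mathbf{b}_j(\mathbf{x})=(0,\mu_1\mathbf{x}^{\mathbf{m}_1},\dots,\mu_{n_j-1}\mathbf{x}^{\mathbf{m}_{n_j-1}})\in\mathrm{Conf}_{n_j}(\mathbb{C})$, where $\mathrm{Conf}_n(\mathbb{C})$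 is the ordered configuration space of $n$ distinct points in $\mathbb{C}$. Lie algebras. The LCS Lie algebra of a group $G$ is $\mathfrak{h}(G)=\bigoplus_{k\ge1}G_k/G_{k+1}$, where $G_1=G$, $G_{k+1}=[G,G_k]$, with bracket induced by the commutator; it is generated by its degree one part $H_1(G;\mathbb{Z})$. Write $\mathfrak{h}(\mathscr{A}_j)=\mathfrak{h}(\pi_1(M(\mathscr{A}_j)))$. Let $P_n=\pi_1(\mathrm{Conf}_n(\mathbb{C}))$ be the pure braid group, and let $A_{i,j}\in H_1(\mathrm{Conf}_n(\mathbb{C});\mathbb{Z})$, $1\le i<j\le n$, be the basis dual to the classes $\frac{1}{2\pi\sqrt{-1}}\mathrm{dlog}(x_j-x_i)$. It is known (Kohno) that $\mathfrak{h}(P_n)$ is generated by the $A_{i,j}$ with relations $[A_{i,j},A_{k,l}]=0$ for $i,j,k,l$ distinct and $[A_{q,k},A_{i,j}+A_{i,k}+A_{j,k}]=0$ for $q=i,j$ (with $A_{i,j}=A_{j,i}$). $\mathbb{L}[n]$ is the free Lie algebra over $\mathbb{Z}$ on $n$ generators, denoted $A_{1,n+1},\dots,A_{n,n+1}$, and $\theta_n\colon\mathfrak{h}(P_n)\to\mathrm{Der}(\mathbb{L}[n])$ is the Lie homomorphism given by the infinitesimal pure braid relations: $\theta_n(A_{i,j})(A_{q,n+1})=[A_{q,n+1},A_{i,n+1}+A_{j,n+1}]$ if $q\in\{i,j\}$, and $0$ otherwise. *)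

theory Defs
  imports "HOL-Complex_Analysis.Complex_Analysis" "HOL-Homology.Homology"
begin

section \<open>Lie algebras over the integers\<close>

text \<open>A Lie algebra over the integers is an abelian group with a biadditive bracket. It is carried
  by the ring record: \<open>\<otimes>\<close> is the bracket and the field \<open>one\<close> is unused (left \<^term>\<open>undefined\<close>).\<close>

locale lie_ring = abelian_group L for L (structure) +
  assumes br_closed: "\<lbrakk>x \<in> carrier L; y \<in> carrier L\<rbrakk> \<Longrightarrow> x \<otimes> y \<in> carrier L"
    and br_add_left: "\<lbrakk>x \<in> carrier L; y \<in> carrier L; z \<in> carrier L\<rbrakk>
          \<Longrightarrow> (x \<oplus> y) \<otimes> z = x \<otimes> z \<oplus> y \<otimes> z"
    and br_add_right: "\<lbrakk>x \<in> carrier L; y \<in> carrier L; z \<in> carrier L\<rbrakk>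
          \<Longrightarrow> x \<otimes> (y \<oplus> z) = x \<otimes> y \<oplus> x \<otimes> z"
    and br_self: "x \<in> carrier L \<Longrightarrow> x \<otimes> x = \<zero>"
    and jacobi: "\<lbrakk>x \<in> carrier L; y \<in> carrier L; z \<in> carrier L\<rbrakk>
          \<Longrightarrow> x \<otimes> (y \<otimes> z) \<oplus> (y \<otimes> (z \<otimes> x) \<oplus> z \<otimes> (x \<otimes> y)) = \<zero>"

definition lie_hom :: "('a, 'm) ring_scheme \<Rightarrow> ('b, 'n) ring_scheme \<Rightarrow> ('a \<Rightarrow> 'b) set" where
  "lie_hom K L = {f \<in> carrier K \<rightarrow> carrier L.
     \<forall>x\<in>carrier K. \<forall>y\<in>carrier K.
       f (x \<oplus>\<^bsub>K\<^esub> y) = f x \<oplus>\<^bsub>L\<^esub> f y \<and> f (x \<otimes>\<^bsub>K\<^esub> y) = f x \<otimes>\<^bsub>L\<^esub> f y}"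

definition lie_isomorphic :: "('a, 'm) ring_scheme \<Rightarrow> ('b, 'n) ring_scheme \<Rightarrow> bool" where
  "lie_isomorphic K L \<longleftrightarrow> (\<exists>f\<in>lie_hom K L. bij_betw f (carrier K) (carrier L))"

definition derivations :: "('a, 'm) ring_scheme \<Rightarrow> ('a \<Rightarrow> 'a) set" where
  "derivations L = {D \<in> carrier L \<rightarrow>\<^sub>E carrier L.
     \<forall>x\<in>carrier L. \<forall>y\<in>carrier L.
       D (x \<oplus>\<^bsub>L\<^esub> y) = D x \<oplus>\<^bsub>L\<^esub> D y \<and>
       D (x \<otimes>\<^bsub>L\<^esub> y) = D x \<otimes>\<^bsub>L\<^esub> y \<oplus>\<^bsub>L\<^esub> x \<otimes>\<^bsub>L\<^esub> D y}"

definition Der :: "('a, 'm) ring_scheme \<Rightarrow> ('a \<Rightarrow> 'a) ring" where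
  "Der L = \<lparr>carrier = derivations L,
     monoid.mult = (\<lambda>D E. \<lambda>x\<in>carrier L. D (E x) \<ominus>\<^bsub>L\<^esub> E (D x)),
     monoid.one = undefined,
     ring.zero = (\<lambda>x\<in>carrier L. \<zero>\<^bsub>L\<^esub>),
     ring.add = (\<lambda>D E. \<lambda>x\<in>carrier L. D x \<oplus>\<^bsub>L\<^esub> E x)\<rparr>"

text \<open>The semidirect product of \<open>H\<close> by the ideal \<open>L\<close>, for \<open>\<rho>\<close> a Lie homomorphism from \<open>H\<close> to
  \<^term>\<open>Der L\<close>: for \<open>h\<close> in \<open>H\<close> and \<open>a\<close> in \<open>L\<close> the bracket of \<open>h\<close> with \<open>a\<close> is \<open>\<rho> h a\<close>.\<close>

definition lie_semidirect ::
  "('h, 'm) ring_scheme \<Rightarrow> ('a, 'n) ring_scheme \<Rightarrow> ('h \<Rightarrow> 'a \<Rightarrow> 'a) \<Rightarrow> ('a \<times> 'h) ring" where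
  "lie_semidirect H L \<rho> = \<lparr>carrier = carrier L \<times> carrier H,
     monoid.mult = (\<lambda>(a, h) (b, k).
        ((a \<otimes>\<^bsub>L\<^esub> b \<oplus>\<^bsub>L\<^esub> \<rho> h b) \<ominus>\<^bsub>L\<^esub> \<rho> k a, h \<otimes>\<^bsub>H\<^esub> k)),
     monoid.one = undefined,
     ring.zero = (\<zero>\<^bsub>L\<^esub>, \<zero>\<^bsub>H\<^esub>),
     ring.add = (\<lambda>(a, h) (b, k). (a \<oplus>\<^bsub>L\<^esub> b, h \<oplus>\<^bsub>H\<^esub> k))\<rparr>"


subsection \<open>Free Lie algebras\<close>

datatype 'a lie_term =
    LGen 'a
  | LZero
  | LNeg "'a lie_term"
  | LAdd "'a lie_term" "'a lie_term"
  | LBr "'a lie_term" "'a lie_term"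

text \<open>The least congruence on terms that contains the axioms of Lie algebras over the integers.\<close>

inductive lie_eq :: "'a lie_term \<Rightarrow> 'a lie_term \<Rightarrow> bool" where
  refl: "lie_eq s s"
| sym: "lie_eq s t \<Longrightarrow> lie_eq t s"
| trans: "lie_eq s t \<Longrightarrow> lie_eq t u \<Longrightarrow> lie_eq s u"
| neg_cong: "lie_eq s s' \<Longrightarrow> lie_eq (LNeg s) (LNeg s')"
| add_cong: "lie_eq s s' \<Longrightarrow> lie_eq t t' \<Longrightarrow> lie_eq (LAdd s t) (LAdd s' t')"
| br_cong: "lie_eq s s' \<Longrightarrow> lie_eq t t' \<Longrightarrow> lie_eq (LBr s t) (LBr s' t')"
| add_assoc: "lie_eq (LAdd (LAdd s t) u) (LAdd s (LAdd t u))"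
| add_comm: "lie_eq (LAdd s t) (LAdd t s)"
| add_zero: "lie_eq (LAdd LZero s) s"
| add_neg: "lie_eq (LAdd (LNeg s) s) LZero"
| br_add_left: "lie_eq (LBr (LAdd s t) u) (LAdd (LBr s u) (LBr t u))"
| br_add_right: "lie_eq (LBr s (LAdd t u)) (LAdd (LBr s t) (LBr s u))"
| br_self: "lie_eq (LBr s s) LZero"
| jacobi: "lie_eq (LAdd (LBr s (LBr t u)) (LAdd (LBr t (LBr u s)) (LBr u (LBr s t)))) LZero"

quotient_type 'a free_lie = "'a lie_term" / lie_eq
  by (intro equivpI reflpI sympI transpI) (blast intro: lie_eq.intros)+

lift_definition fl_zero :: "'a free_lie" is LZero .
lift_definition fl_neg :: "'a free_lie \<Rightarrow> 'a free_lie" is LNeg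
  by (rule lie_eq.neg_cong)
lift_definition fl_add :: "'a free_lie \<Rightarrow> 'a free_lie \<Rightarrow> 'a free_lie" is LAdd
  by (rule lie_eq.add_cong)
lift_definition fl_br :: "'a free_lie \<Rightarrow> 'a free_lie \<Rightarrow> 'a free_lie" is LBr
  by (rule lie_eq.br_cong)
lift_definition fl_gen :: "'a \<Rightarrow> 'a free_lie" is LGen .

definition free_lie :: "'a set \<Rightarrow> 'a free_lie ring" where
  "free_lie S = \<lparr>carrier = abs_free_lie ` {t. set_lie_term t \<subseteq> S},
     monoid.mult = fl_br, monoid.one = undefined, ring.zero = fl_zero, ring.add = fl_add\<rparr>"

lemma free_lie_is_lie_ring: "lie_ring (free_lie S)"
proof -
  have mem: "x \<in> carrier (free_lie S) \<longleftrightarrow> (\<exists>t. set_lie_term t \<subseteq> S \<and> x = abs_free_lie t)" for x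
    by (auto simp: free_lie_def)
  have cl: "fl_zero \<in> carrier (free_lie S)"
    "\<And>x y. \<lbrakk>x \<in> carrier (free_lie S); y \<in> carrier (free_lie S)\<rbrakk> \<Longrightarrow> fl_add x y \<in> carrier (free_lie S)"
    "\<And>x y. \<lbrakk>x \<in> carrier (free_lie S); y \<in> carrier (free_lie S)\<rbrakk> \<Longrightarrow> fl_br x y \<in> carrier (free_lie S)"
    "\<And>x. x \<in> carrier (free_lie S) \<Longrightarrow> fl_neg x \<in> carrier (free_lie S)"
    unfolding mem
    by (metis fl_zero_def empty_subsetI lie_term.set(2),
        metis fl_add.abs_eq Un_least lie_term.set(4),
        metis fl_br.abs_eq Un_least lie_term.set(5),
        metis fl_neg.abs_eq lie_term.set(3))
  have ax: "fl_add (fl_add x y) z = fl_add x (fl_add y z)" "fl_add x y = fl_add y x"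
    "fl_add fl_zero x = x" "fl_add (fl_neg x) x = fl_zero"
    "fl_br (fl_add x y) z = fl_add (fl_br x z) (fl_br y z)"
    "fl_br x (fl_add y z) = fl_add (fl_br x y) (fl_br x z)"
    "fl_br x x = fl_zero"
    "fl_add (fl_br x (fl_br y z)) (fl_add (fl_br y (fl_br z x)) (fl_br z (fl_br x y))) = fl_zero"
    for x y z :: "'a free_lie"
    by (transfer, rule lie_eq.add_assoc lie_eq.add_comm lie_eq.add_zero lie_eq.add_neg
        lie_eq.br_add_left lie_eq.br_add_right lie_eq.br_self lie_eq.jacobi)+
  have "abelian_group (free_lie S)"
  proof (rule abelian_groupI)
    fix x assume "x \<in> carrier (free_lie S)"
    then have "fl_neg x \<in> carrier (free_lie S)"
      by (rule cl(4))
    moreover have "fl_neg x \<oplus>\<^bsub>free_lie S\<^esub> x = \<zero>\<^bsub>free_lie S\<^esub>"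
      by (simp add: free_lie_def ax(4))
    ultimately show "\<exists>y\<in>carrier (free_lie S). y \<oplus>\<^bsub>free_lie S\<^esub> x = \<zero>\<^bsub>free_lie S\<^esub>"
      by blast
  next
    show "x \<oplus>\<^bsub>free_lie S\<^esub> y = y \<oplus>\<^bsub>free_lie S\<^esub> x" for x y
      by (simp add: free_lie_def) (rule ax(2))
  qed (use cl in \<open>simp_all add: free_lie_def ax(1) ax(3)\<close>)
  then show ?thesis
    by (intro lie_ring.intro lie_ring_axioms.intro)
      (use cl(3) in \<open>simp_all add: free_lie_def ax(5-8)\<close>)
qed


section \<open>The lower central series Lie algebra of a group\<close>

definition commutator :: "('a, 'm) monoid_scheme \<Rightarrow> 'a \<Rightarrow> 'a \<Rightarrow> 'a" where
  "commutator G g h = g \<otimes>\<^bsub>G\<^esub> h \<otimes>\<^bsub>G\<^esub> inv\<^bsub>G\<^esub> g \<otimes>\<^bsub>G\<^esub> inv\<^bsub>G\<^esub> h"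

text \<open>The series starts at index 1; the value at index 0 is a dummy.\<close>

fun lower_central :: "('a, 'm) monoid_scheme \<Rightarrow> nat \<Rightarrow> 'a set" where
  "lower_central G 0 = carrier G"
| "lower_central G (Suc 0) = carrier G"
| "lower_central G (Suc (Suc k)) =
     generate G {commutator G g h |g h. g \<in> carrier G \<and> h \<in> lower_central G (Suc k)}"

definition lcs_quotient :: "('a, 'm) monoid_scheme \<Rightarrow> nat \<Rightarrow> 'a set monoid" where
  "lcs_quotient G k = G\<lparr>carrier := lower_central G k\<rparr> Mod lower_central G (Suc k)"

text \<open>The bracket of the cosets of \<open>g\<close> (degree \<open>k\<close>) and \<open>h\<close> (degree \<open>l\<close>) is the coset of their
  commutator in degree \<open>k + l\<close>; the union is over all representatives, which give the same coset.\<close>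

definition lcs_bracket ::
  "('a, 'm) monoid_scheme \<Rightarrow> nat \<Rightarrow> nat \<Rightarrow> 'a set \<Rightarrow> 'a set \<Rightarrow> 'a set" where
  "lcs_bracket G k l a b =
     (\<Union>g\<in>a. \<Union>h\<in>b. lower_central G (Suc (k + l)) #>\<^bsub>G\<^esub> commutator G g h)"

definition lcs_lie :: "('a, 'm) monoid_scheme \<Rightarrow> (nat \<Rightarrow> 'a set) ring" where
  "lcs_lie G = \<lparr>carrier = carrier (sum_group {1..} (lcs_quotient G)),
     monoid.mult = (\<lambda>x y. \<lambda>d\<in>{1..}.
        finprod (lcs_quotient G d) (\<lambda>k. lcs_bracket G k (d - k) (x k) (y (d - k))) {1..<d}),
     monoid.one = undefined,
     ring.zero = \<one>\<^bsub>sum_group {1..} (lcs_quotient G)\<^esub>,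
     ring.add = (\<otimes>\<^bsub>sum_group {1..} (lcs_quotient G)\<^esub>)\<rparr>"

text \<open>The class of a group element in the degree one part, that is, in the abelianization.\<close>

definition lcs_degree_one :: "('a, 'm) monoid_scheme \<Rightarrow> 'a \<Rightarrow> nat \<Rightarrow> 'a set" where
  "lcs_degree_one G g =
     (\<lambda>k\<in>{1..}. if k = 1 then lower_central G 2 #>\<^bsub>G\<^esub> g else \<one>\<^bsub>lcs_quotient G k\<^esub>)"


section \<open>Fundamental groups\<close>

definition loops :: "'a::topological_space set \<Rightarrow> 'a \<Rightarrow> (real \<Rightarrow> 'a) set" where
  "loops S x = {p. path p \<and> path_image p \<subseteq> S \<and> pathstart p = x \<and> pathfinish p = x}"

definition loop_class :: "'a::topological_space set \<Rightarrow> (real \<Rightarrow> 'a) \<Rightarrow> (real \<Rightarrow> 'a) set" where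
  "loop_class S p = {q. homotopic_paths S p q}"

definition fundamental_group ::
  "'a::topological_space set \<Rightarrow> 'a \<Rightarrow> (real \<Rightarrow> 'a) set monoid" where
  "fundamental_group S x = \<lparr>carrier = loop_class S ` loops S x,
     monoid.mult = (\<lambda>a b. \<Union>p\<in>a. \<Union>q\<in>b. loop_class S (p +++ q)),
     monoid.one = loop_class S (\<lambda>_. x)\<rparr>"

text \<open>The class of a loop in the first singular homology group; a point of the standard
  1-simplex is parametrized by its coordinate with index 1.\<close>

definition hurewicz :: "'a::topological_space set \<Rightarrow> (real \<Rightarrow> 'a) \<Rightarrow> 'a chain set" where
  "hurewicz S p = homologous_rel_set 1 (top_of_set S) {}
     (frag_of (\<lambda>x\<in>standard_simplex 1. p (x 1)))"

text \<open>\<open>\<beta>\<close> is a Lie homomorphism whose degree one part is the map induced by \<open>f\<close> on first integral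
  homology, where the abelianization of the fundamental group is identified with the first
  homology group by the Hurewicz map.\<close>

definition extends_homology_map ::
  "'a::topological_space set \<Rightarrow> 'a \<Rightarrow> 'b::topological_space set \<Rightarrow> 'b \<Rightarrow> ('a \<Rightarrow> 'b)
    \<Rightarrow> ((nat \<Rightarrow> (real \<Rightarrow> 'a) set set) \<Rightarrow> (nat \<Rightarrow> (real \<Rightarrow> 'b) set set)) \<Rightarrow> bool" where
  "extends_homology_map S x T y f \<beta> \<longleftrightarrow>
     \<beta> \<in> lie_hom (lcs_lie (fundamental_group S x)) (lcs_lie (fundamental_group T y)) \<and>
     (\<forall>p\<in>loops S x. \<forall>q\<in>loops T y.
        hom_induced 1 (top_of_set S) {} (top_of_set T) {} f (hurewicz S p) = hurewicz T q \<longrightarrow>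
        \<beta> (lcs_degree_one (fundamental_group S x) (loop_class S p)) =
          lcs_degree_one (fundamental_group T y) (loop_class T q))"


section \<open>Configuration spaces and the infinitesimal pure braid relations\<close>

definition Conf :: "nat \<Rightarrow> (nat \<Rightarrow> complex) set" where
  "Conf n = {w \<in> extensional {1..n}. inj_on w {1..n}}"

text \<open>The loop \<open>p\<close> represents the element \<open>A\<^sub>i\<^sub>j\<close> of the first homology group of \<^term>\<open>Conf n\<close>: the
  integral of \<open>dlog (x\<^sub>l - x\<^sub>k) / (2 \<pi> i)\<close> along a loop is a winding number, so these integrals
  over \<open>p\<close> are 1 if \<open>(k, l) = (i, j)\<close> and 0 otherwise.\<close>

definition represents_A :: "nat \<Rightarrow> nat \<Rightarrow> nat \<Rightarrow> (real \<Rightarrow> nat \<Rightarrow> complex) \<Rightarrow> bool" where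
  "represents_A n i j p \<longleftrightarrow>
     (\<forall>k l. 1 \<le> k \<and> k < l \<and> l \<le> n \<longrightarrow>
        winding_number (\<lambda>s. p s l - p s k) 0 = (if k = i \<and> l = j then 1 else 0))"

text \<open>The Lie homomorphism \<open>\<theta>\<^sub>n\<close>, for the pure braid group with base point \<open>w\<close>. The generator
  \<^term>\<open>fl_gen q\<close> stands for \<open>A\<close> with indices \<open>q\<close> and \<open>n + 1\<close>.\<close>

definition inf_pure_braid_action ::
  "nat \<Rightarrow> (nat \<Rightarrow> complex)
    \<Rightarrow> ((nat \<Rightarrow> (real \<Rightarrow> nat \<Rightarrow> complex) set set) \<Rightarrow> nat free_lie \<Rightarrow> nat free_lie) \<Rightarrow> bool" where
  "inf_pure_braid_action n w \<theta> \<longleftrightarrow>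
     \<theta> \<in> lie_hom (lcs_lie (fundamental_group (Conf n) w)) (Der (free_lie {1..n})) \<and>
     (\<forall>i j. \<forall>p\<in>loops (Conf n) w. 1 \<le> i \<and> i < j \<and> j \<le> n \<and> represents_A n i j p \<longrightarrow>
       (\<forall>q\<in>{1..n}.
          \<theta> (lcs_degree_one (fundamental_group (Conf n) w) (loop_class (Conf n) p)) (fl_gen q) =
            (if q \<in> {i, j} then fl_br (fl_gen q) (fl_add (fl_gen i) (fl_gen j)) else fl_zero)))"


section \<open>Toric arrangements\<close>

text \<open>Character lattices are written multiplicatively, as commutative groups. Elements of a torus
  are extensional functions, so the topology of the function type induces on a torus the topology
  of pointwise convergence, that is, its usual topology.\<close>

definition nonzero_complex_group :: "complex monoid" where
  "nonzero_complex_group = \<lparr>carrier = - {0}, monoid.mult = (*), monoid.one = 1\<rparr>"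

definition torus :: "'g monoid \<Rightarrow> ('g \<Rightarrow> complex) monoid" where
  "torus \<Gamma> = \<lparr>carrier = hom \<Gamma> nonzero_complex_group \<inter> extensional (carrier \<Gamma>),
     monoid.mult = (\<lambda>s t. \<lambda>\<gamma>\<in>carrier \<Gamma>. s \<gamma> * t \<gamma>),
     monoid.one = (\<lambda>\<gamma>\<in>carrier \<Gamma>. 1)\<rparr>"

definition toric_hypersurface :: "'g monoid \<Rightarrow> 'g \<Rightarrow> ('g \<Rightarrow> complex) set" where
  "toric_hypersurface \<Gamma> \<gamma> = {t \<in> carrier (torus \<Gamma>). t \<gamma> = 1}"

definition arrangement_of :: "'g monoid \<Rightarrow> 'g set \<Rightarrow> ('g \<Rightarrow> complex) set set" where
  "arrangement_of \<Gamma> X = (\<Union>\<gamma>\<in>X. components (toric_hypersurface \<Gamma> \<gamma>))"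

definition layers :: "'g monoid \<Rightarrow> 'g set \<Rightarrow> ('g \<Rightarrow> complex) set set" where
  "layers \<Gamma> X =
     (\<Union>S\<in>Pow X. components (carrier (torus \<Gamma>) \<inter> (\<Inter>\<gamma>\<in>S. toric_hypersurface \<Gamma> \<gamma>)))"

text \<open>The order on layers is reverse inclusion, so the maximal layers are the inclusion-minimal ones.\<close>

definition essential_arrangement :: "'g monoid \<Rightarrow> ('g \<Rightarrow> complex) set set \<Rightarrow> bool" where
  "essential_arrangement \<Gamma> \<A> \<longleftrightarrow>
     (\<exists>X. finite X \<and> X \<subseteq> carrier \<Gamma> - {\<one>\<^bsub>\<Gamma>\<^esub>} \<and> \<A> = arrangement_of \<Gamma> X \<and>
       (\<forall>C\<in>layers \<Gamma> X. (\<forall>D\<in>layers \<Gamma> X. D \<subseteq> C \<longrightarrow> D = C) \<longrightarrow> (\<exists>t. C = {t})))"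

definition arr_complement ::
  "'g monoid \<Rightarrow> ('g \<Rightarrow> complex) set set \<Rightarrow> ('g \<Rightarrow> complex) set" where
  "arr_complement \<Gamma> \<A> = carrier (torus \<Gamma>) - \<Union>\<A>"

text \<open>\<open>K\<close> is the direct summand of \<open>\<Gamma>\<close> complementary to a summand of rank one. The quotient of the
  torus by \<open>Y\<close> is identified with the torus of \<open>K\<close>, the projection being restriction to \<open>K\<close>.\<close>

definition admissible :: "'g monoid \<Rightarrow> 'g set \<Rightarrow> ('g \<Rightarrow> complex) set \<Rightarrow> bool" where
  "admissible \<Gamma> K Y \<longleftrightarrow>
     (\<exists>L. subgroup L \<Gamma> \<and> subgroup K \<Gamma> \<and> L \<inter> K = {\<one>\<^bsub>\<Gamma>\<^esub>} \<and> L <#>\<^bsub>\<Gamma>\<^esub> K = carrier \<Gamma> \<and>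
        \<Gamma>\<lparr>carrier := L\<rparr> \<cong> integer_group) \<and>
     Y = {t \<in> carrier (torus \<Gamma>). \<forall>\<gamma>\<in>K. t \<gamma> = 1}"

definition subarrangement ::
  "'g monoid \<Rightarrow> ('g \<Rightarrow> complex) set \<Rightarrow> ('g \<Rightarrow> complex) set set \<Rightarrow> ('g \<Rightarrow> complex) set set" where
  "subarrangement \<Gamma> Y \<A> = {H \<in> \<A>. \<exists>C. C \<subseteq> rcosets\<^bsub>torus \<Gamma>\<^esub> Y \<and> H = \<Union>C}"

definition quotient_arrangement ::
  "'g monoid \<Rightarrow> 'g set \<Rightarrow> ('g \<Rightarrow> complex) set \<Rightarrow> ('g \<Rightarrow> complex) set set
    \<Rightarrow> ('g \<Rightarrow> complex) set set" where
  "quotient_arrangement \<Gamma> K Y \<A> = (\<lambda>H. (\<lambda>t. restrict t K) ` H) ` subarrangement \<Gamma> Y \<A>"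

definition TM_ideal ::
  "'g monoid \<Rightarrow> ('g \<Rightarrow> complex) set \<Rightarrow> ('g \<Rightarrow> complex) set set \<Rightarrow> bool" where
  "TM_ideal \<Gamma> Y \<A> \<longleftrightarrow>
     (\<forall>H1\<in>\<A> - subarrangement \<Gamma> Y \<A>. \<forall>H2\<in>\<A> - subarrangement \<Gamma> Y \<A>. H1 \<noteq> H2 \<longrightarrow>
        (\<forall>X\<in>components (H1 \<inter> H2). \<exists>H3\<in>subarrangement \<Gamma> Y \<A>. X \<subseteq> H3)) \<and>
     (\<forall>H\<in>\<A> - subarrangement \<Gamma> Y \<A>. connected (H \<inter> Y))"

text \<open>The arrangement \<open>\<A> r\<close> is strictly supersolvable of rank \<open>r\<close>, as witnessed by the arrangements
  \<open>\<A> r, \<dots>, \<A> 1\<close> in the tori of the lattices \<open>\<Lambda> r, \<dots>, \<Lambda> 1\<close> and by the admissible subgroups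
  \<open>Y (r - 1), \<dots>, Y 1\<close>, with \<open>Y (j - 1)\<close> in the torus of \<open>\<Lambda> j\<close>.\<close>

definition strictly_supersolvable ::
  "nat \<Rightarrow> (nat \<Rightarrow> 'g monoid) \<Rightarrow> (nat \<Rightarrow> ('g \<Rightarrow> complex) set)
    \<Rightarrow> (nat \<Rightarrow> ('g \<Rightarrow> complex) set set) \<Rightarrow> bool" where
  "strictly_supersolvable r \<Lambda> Y \<A> \<longleftrightarrow>
     1 \<le> r \<and>
     (\<forall>j\<in>{1..r}. comm_group (\<Lambda> j) \<and> \<Lambda> j \<cong> product_group {1..j} (\<lambda>_. integer_group) \<and>
        essential_arrangement (\<Lambda> j) (\<A> j)) \<and>
     (\<forall>j\<in>{2..r}.
        admissible (\<Lambda> j) (carrier (\<Lambda> (j - 1))) (Y (j - 1)) \<and>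
        \<Lambda> (j - 1) = (\<Lambda> j)\<lparr>carrier := carrier (\<Lambda> (j - 1))\<rparr> \<and>
        TM_ideal (\<Lambda> j) (Y (j - 1)) (\<A> j) \<and>
        \<A> (j - 1) = quotient_arrangement (\<Lambda> j) (carrier (\<Lambda> (j - 1))) (Y (j - 1)) (\<A> j))"


subsection \<open>Root maps\<close>

definition fibre_rank :: "(nat \<Rightarrow> ('g \<Rightarrow> complex) set set) \<Rightarrow> nat \<Rightarrow> nat" where
  "fibre_rank \<A> j = 1 + card (\<A> j) - (if j = 1 then 0 else card (\<A> (j - 1)))"

definition lattice_basis :: "'g monoid \<Rightarrow> nat \<Rightarrow> (nat \<Rightarrow> 'g) \<Rightarrow> bool" where
  "lattice_basis \<Gamma> d e \<longleftrightarrow> e \<in> {1..d} \<rightarrow> carrier \<Gamma> \<and>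
     bij_betw (\<lambda>c::nat \<Rightarrow> int. \<Otimes>\<^bsub>\<Gamma>\<^esub>i\<in>{1..d}. e i [^]\<^bsub>\<Gamma>\<^esub> c i) ({1..d} \<rightarrow>\<^sub>E UNIV) (carrier \<Gamma>)"

text \<open>A basis \<open>e 1, \<dots>, e j\<close> of the lattice gives the coordinates \<open>x\<^sub>k = t (e k)\<close> for \<open>k < j\<close> and
  \<open>y = t (e j)\<close> of the torus.\<close>

definition adapted_coordinates ::
  "'g monoid \<Rightarrow> nat \<Rightarrow> ('g \<Rightarrow> complex) set \<Rightarrow> (nat \<Rightarrow> 'g) \<Rightarrow> bool" where
  "adapted_coordinates \<Gamma> j Y e \<longleftrightarrow>
     lattice_basis \<Gamma> j e \<and> Y = {t \<in> carrier (torus \<Gamma>). \<forall>k\<in>{1..<j}. t (e k) = 1}"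

definition root_monomial ::
  "nat \<Rightarrow> (nat \<Rightarrow> 'g) \<Rightarrow> complex \<Rightarrow> (nat \<Rightarrow> int) \<Rightarrow> ('g \<Rightarrow> complex) \<Rightarrow> complex" where
  "root_monomial j e \<mu> m t = \<mu> * (\<Prod>k\<in>{1..<j}. t (e k) powi m k)"

text \<open>The members of \<open>\<A> - \<A>\<^sub>Y\<close> are, without repetition, the hypersurfaces given by
  \<open>y = \<mu>\<^sub>i x\<^sup>m\<^sup>i\<close> for \<open>1 \<le> i \<le> n - 1\<close>.\<close>

definition root_presentation ::
  "'g monoid \<Rightarrow> nat \<Rightarrow> ('g \<Rightarrow> complex) set \<Rightarrow> ('g \<Rightarrow> complex) set set \<Rightarrow> nat
    \<Rightarrow> (nat \<Rightarrow> 'g) \<Rightarrow> (nat \<Rightarrow> complex) \<Rightarrow> (nat \<Rightarrow> nat \<Rightarrow> int) \<Rightarrow> bool" where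
  "root_presentation \<Gamma> j Y \<A> n e \<mu> m \<longleftrightarrow>
     (\<forall>i\<in>{1..n - 1}. \<exists>N>0. \<mu> i ^ N = 1) \<and>
     bij_betw (\<lambda>i. {t \<in> carrier (torus \<Gamma>). t (e j) = root_monomial j e (\<mu> i) (m i) t})
       {1..n - 1} (\<A> - subarrangement \<Gamma> Y \<A>)"

definition root_map ::
  "nat \<Rightarrow> nat \<Rightarrow> (nat \<Rightarrow> 'g) \<Rightarrow> (nat \<Rightarrow> complex) \<Rightarrow> (nat \<Rightarrow> nat \<Rightarrow> int)
    \<Rightarrow> ('g \<Rightarrow> complex) \<Rightarrow> nat \<Rightarrow> complex" where
  "root_map j n e \<mu> m t =
     (\<lambda>i\<in>{1..n}. if i = 1 then 0 else root_monomial j e (\<mu> (i - 1)) (m (i - 1)) t)"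

end

theory Submission
  imports Defs
begin

text \<open>Projecting along \<open>Y\<close> makes \<open>M(\<A>\<^sub>j)\<close> the complement in
 \<open>M(\<A>\<^sub>j\<^sub>-\<^sub>1) \<times> \<complex>\<close> of the graphs of the components of the root map.
 Pushing the punctures along paths and choosing a point of large modulus in every fibre gives a split extension of
 \<open>\<pi>\<^sub>1(M(\<A>\<^sub>j\<^sub>-\<^sub>1))\<close> by the fundamental group of a plane with \<open>n\<^sub>j\<close> punctures, which is free; as the roots are
 single valued, the base acts trivially on the abelianized kernel. For such extensions the lower central
 series split (Falk--Randell), so the Lie ring is a semidirect product of those of base and fibre. Lazard
 elimination gives enough representations on power series to separate the points of a free Lie ring, so that the Magnus
 expansion identifies the Lie ring of the fibre group with the free one. Finally, over a loop \<open>p\<close> the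
 meridian of the \<open>q\<close>-th root sweeps out a torus, so that, modulo triple commutators, \<open>p\<close> brackets
 with \<open>x\<^sub>q\<close> to \<open>[x\<^sub>q, \<Sum>\<^sub>i w\<^sub>i x\<^sub>i]\<close>, where \<open>w\<^sub>i\<close> is the winding number of the difference of the roots \<open>i\<close> and \<open>q\<close>
 along \<open>p\<close>. The \<open>w\<^sub>i\<close> are the coordinates of the image of \<open>p\<close> under the homological root homomorphism,
 and the formula is that of the infinitesimal pure braid relations.\<close>

section \<open>Rings acting on free Lie algebras\<close>

text \<open>Free Lie rings are terms modulo a congruence, so an element is seen to be nonzero only
  through a representation that does not kill it. Coefficients are integral; the representations act
  on integral power series, where an integer is determined by its action on 1. The maps
  \<open>\<beta>\<close> and \<open>\<theta>\<close> are Lie homomorphisms prescribed only on some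
  classes of degree one. Every comparison is therefore reduced to degree one, where loops are
  recognised by winding numbers; neither the homology nor the fundamental group of a configuration
  space is computed. The section \<open>\<sigma>\<close> has larger real part than all roots. This
  one choice makes it avoid the roots, keeps it free of winding around them, and places the base
  point of the fibre off the slits that define the meridians. The slits are vertical, so the roots
  over the base point need distinct real parts; multiplying the fibre coordinate by a constant
  \<open>\<omega>\<close> achieves this and changes no winding number. The section also settles that
  the fibre group injects, where second homotopy of the base could otherwise interfere.\<close>

instantiation free_lie :: (type) ab_group_add
begin

definition "zero_free_lie = fl_zero"
definition "plus_free_lie = fl_add"
definition "uminus_free_lie = fl_neg"
definition "minus_free_lie x y = fl_add x (fl_neg y)" for x y :: "'a free_lie"

instance
 by standard
  (unfold zero_free_lie_def plus_free_lie_def uminus_free_lie_def minus_free_lie_def,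
   transfer, simp add: lie_eq.intros,
   transfer, simp add: lie_eq.intros,
   transfer, simp add: lie_eq.intros,
   transfer, simp add: lie_eq.intros,
   simp)

end

lemma fl_br_add_left: "fl_br (x + y) z = fl_br x z + fl_br y z"
 unfolding plus_free_lie_def by transfer (rule lie_eq.br_add_left)

lemma fl_br_add_right: "fl_br x (y + z) = fl_br x y + fl_br x z"
 unfolding plus_free_lie_def by transfer (rule lie_eq.br_add_right)

lemma fl_br_self [simp]: "fl_br x x = 0"
 unfolding zero_free_lie_def by transfer (rule lie_eq.br_self)

lemma fl_jacobi: "fl_br x (fl_br y z) + (fl_br y (fl_br z x) + fl_br z (fl_br x y)) = 0"
 unfolding plus_free_lie_def zero_free_lie_def by transfer (rule lie_eq.jacobi)

lemma fl_br_zero [simp]: "fl_br 0 x = 0" "fl_br x 0 = 0"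
 using fl_br_add_left[of 0 0 x] fl_br_add_right[of x 0 0] by simp_all

lemma fl_br_minus_right: "fl_br x (- y) = - fl_br x y"
 using fl_br_add_right[of x "- y" y] by (simp add: eq_neg_iff_add_eq_0)

lemma fl_br_anticomm: "fl_br y x = - fl_br x y"
proof -
 have "fl_br x y + fl_br y x = 0"
  using fl_br_self[of "x + y"] unfolding fl_br_add_left fl_br_add_right by (simp add: add.commute)
 thus ?thesis
  by (simp add: eq_neg_iff_add_eq_0 add.commute)
qed

lemma fl_leibniz: "fl_br x (fl_br y z) = fl_br (fl_br x y) z + fl_br y (fl_br x z)"
proof -
 have "fl_br x (fl_br y z) = - (fl_br y (fl_br z x) + fl_br z (fl_br x y))"
  using fl_jacobi[of x y z] unfolding eq_neg_iff_add_eq_0 .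
 also have "... = fl_br (fl_br x y) z + fl_br y (fl_br x z)"
  using fl_br_anticomm[of x z] fl_br_anticomm[of z "fl_br x y"] by (simp add: fl_br_minus_right)
 finally show ?thesis .
qed

lemma fl_abs_simps:
 "abs_free_lie LZero = 0" "abs_free_lie (LNeg s) = - abs_free_lie s"
 "abs_free_lie (LAdd s t) = abs_free_lie s + abs_free_lie t"
 "abs_free_lie (LBr s t) = fl_br (abs_free_lie s) (abs_free_lie t)"
 "abs_free_lie (LGen a) = fl_gen a"
 by (simp_all add: zero_free_lie_def plus_free_lie_def uminus_free_lie_def fl_zero_def fl_neg.abs_eq
   fl_add.abs_eq fl_br.abs_eq fl_gen_def)

section \<open>Evaluation of terms, substitution, integer multiples\<close>

primrec leval :: "('a => 'r::ring) => 'a lie_term => 'r" where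
 "leval v (LGen a) = v a"
| "leval v LZero = 0"
| "leval v (LNeg t) = - leval v t"
| "leval v (LAdd s t) = leval v s + leval v t"
| "leval v (LBr s t) = leval v s * leval v t - leval v t * leval v s"

lemma leval_cong: "lie_eq s t ==> leval v s = leval v t"
 by (induction rule: lie_eq.induct) (auto simp: algebra_simps)

lift_definition fl_eval :: "('a => 'r::ring) => 'a free_lie => 'r" is leval
 by (rule leval_cong)

lemma fl_eval_abs: "fl_eval v (abs_free_lie t) = leval v t"
 by (rule fl_eval.abs_eq)

lemma fl_eval_simps [simp]:
 "fl_eval v (fl_gen a) = v a" "fl_eval v 0 = 0" "fl_eval v (- x) = - fl_eval v x"
 "fl_eval v (x + y) = fl_eval v x + fl_eval v y"
 "fl_eval v (fl_br x y) = fl_eval v x * fl_eval v y - fl_eval v y * fl_eval v x"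
 unfolding zero_free_lie_def plus_free_lie_def uminus_free_lie_def by (transfer, simp)+

primrec lsubst :: "('a => 'b free_lie) => 'a lie_term => 'b free_lie" where
 "lsubst f (LGen a) = f a"
| "lsubst f LZero = 0"
| "lsubst f (LNeg t) = - lsubst f t"
| "lsubst f (LAdd s t) = lsubst f s + lsubst f t"
| "lsubst f (LBr s t) = fl_br (lsubst f s) (lsubst f t)"

lemma lsubst_cong: "lie_eq s t ==> lsubst f s = lsubst f t"
proof (induction rule: lie_eq.induct)
 case (jacobi s t u) thus ?case by (simp add: fl_jacobi)
qed (simp_all add: fl_br_add_left fl_br_add_right)

text \<open>The integer multiple, for groups that carry no scalar multiplication. One of the two
  iterates is always empty; by \<open>zscale_diff\<close> every way of writing \<open>c\<close> as a
  difference of naturals gives the same element, which makes additivity in \<open>c\<close>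
  easy.\<close>

definition zscale :: "int => 'a::ab_group_add => 'a" where
 "zscale c x = ((+) x ^^ nat c) 0 - ((+) x ^^ nat (- c)) 0"

lemma funpow_plus_add: "((+) x ^^ (a + b)) (0::'a::ab_group_add) = ((+) x ^^ a) 0 + ((+) x ^^ b) 0"
 by (induction a) (simp_all add: add.assoc)

lemma zscale_diff: "zscale (int a - int b) x = ((+) x ^^ a) 0 - ((+) x ^^ b) 0"
proof (cases "a \<ge> b")
 case True
 then obtain d where "a = b + d" using le_Suc_ex by blast
 thus ?thesis by (simp add: zscale_def funpow_plus_add)
next
 case False
 then obtain d where "b = a + d" using le_Suc_ex nat_le_linear by blast
 thus ?thesis by (simp add: zscale_def funpow_plus_add)
qed

lemma zscale_simps [simp]: "zscale 0 x = 0" "zscale 1 x = x"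
 by (simp_all add: zscale_def)

lemma zscale_zero_right [simp]: "zscale c 0 = 0"
proof -
 have "((+) 0 ^^ n) 0 = (0::'a)" for n by (induction n) simp_all
 thus ?thesis by (simp add: zscale_def)
qed

lemma zscale_add: "zscale (c + d) x = zscale c x + zscale d x"
proof -
 obtain a b where "c = int a - int b" by (metis int_diff_cases)
 moreover obtain a' b' where "d = int a' - int b'" by (metis int_diff_cases)
 moreover have "int a - int b + (int a' - int b') = int (a + a') - int (b + b')" by simp
 ultimately show ?thesis by (simp only: zscale_diff funpow_plus_add) (simp add: algebra_simps)
qed

lemma zscale_neg: "zscale (- c) x = - zscale c x"
 by (simp add: zscale_def)

lemma zscale_additive:
 assumes "!!x y. f (x + y) = f x + (f y :: 'b::ab_group_add)"
 shows "f (zscale c x) = zscale c (f x)"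
proof -
 have 0: "f 0 = 0" using assms[of 0 0] by simp
 have m: "f (x - y) = f x - f y" for x y using assms[of "x - y" y] by (simp add: algebra_simps)
 have "f (((+) x ^^ n) 0) = ((+) (f x) ^^ n) 0" for n
  by (induction n) (simp_all add: 0 assms)
 thus ?thesis by (simp add: zscale_def m)
qed

text \<open>A bound for the weighted degree rather than the degree itself: a sum counts its heavier
  part, and cancellation is not noticed. It bounds the weights of the occurring letters, on which
  the recursion for \<open>free_lie_rep_separates_aux\<close> rests.\<close>

primrec lweight :: "('a => nat) => 'a lie_term => nat" where
 "lweight w (LGen a) = w a"
| "lweight w LZero = 0"
| "lweight w (LNeg t) = lweight w t"
| "lweight w (LAdd s t) = max (lweight w s) (lweight w t)"
| "lweight w (LBr s t) = lweight w s + lweight w t"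

lemma lweight_gen: "a \<in> set_lie_term t ==> w a \<le> lweight w t"
 by (induction t) auto

lemma lsubst_zscale_term:
 "\<exists>s. lsubst f s = zscale c (lsubst f t) \<and> lweight w s \<le> lweight w t \<and> set_lie_term s \<subseteq> set_lie_term t"
proof -
 define p where "p n = ((LAdd t) ^^ n) LZero" for n
 have p: "lsubst f (p n) = ((+) (lsubst f t) ^^ n) 0 \<and> lweight w (p n) \<le> lweight w t \<and>
   set_lie_term (p n) \<subseteq> set_lie_term t" for n
  by (induction n) (auto simp: p_def)
 show ?thesis
  by (rule exI[of _ "LAdd (p (nat c)) (LNeg (p (nat (- c))))"]) (use p in \<open>auto simp: zscale_def\<close>)
qed

subsection \<open>Lazard elimination\<close>

text \<open>The letter \<^term>\<open>prod_encode (k, x)\<close> stands for the \<open>k\<close>-fold bracket of \<open>y\<close> with \<open>x\<close>.\<close>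

definition elim_gen :: "nat => nat => nat free_lie" where
 "elim_gen y p = (case prod_decode p of (k, x) => (fl_br (fl_gen y) ^^ k) (fl_gen x))"

text \<open>The weight of the bracket that a new letter abbreviates, so that rewriting in new
  letters does not raise weights.\<close>

definition elim_weight :: "nat => (nat => nat) => nat => nat" where
 "elim_weight y w p = (case prod_decode p of (k, x) => w x + k * w y)"

definition next_letter :: "nat => nat" where
 "next_letter p = (case prod_decode p of (k, x) => prod_encode (Suc k, x))"

text \<open>The derivation induced by \<open>y\<close>, written on terms: it gives every letter one
  further bracket with \<open>y\<close> and obeys the Leibniz rule. Working on terms keeps letters
  and weights visible.\<close>

primrec lshift :: "nat lie_term => nat lie_term" where
 "lshift (LGen p) = LGen (next_letter p)"
| "lshift LZero = LZero"
| "lshift (LNeg t) = LNeg (lshift t)"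
| "lshift (LAdd s t) = LAdd (lshift s) (lshift t)"
| "lshift (LBr s t) = LAdd (LBr (lshift s) t) (LBr s (lshift t))"

lemma lsubst_lshift: "lsubst (elim_gen y) (lshift t) = fl_br (fl_gen y) (lsubst (elim_gen y) t)"
 by (induction t) (simp_all add: elim_gen_def next_letter_def fl_br_add_right fl_br_minus_right
   fl_leibniz[of "fl_gen y"] split: prod.splits)

lemma lweight_lshift: "lweight (elim_weight y w) (lshift t) \<le> lweight (elim_weight y w) t + w y"
 by (induction t) (auto simp: elim_weight_def next_letter_def split: prod.splits)

definition elim_letters :: "nat => nat set => nat set" where
 "elim_letters y S = {prod_encode (k, x) |k x. x \<in> S \<and> x ~= y}"

lemma set_lshift: "set_lie_term t \<subseteq> elim_letters y S ==> set_lie_term (lshift t) \<subseteq> elim_letters y S"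
 by (induction t) (auto simp: elim_letters_def next_letter_def split: prod.splits)

lemma elim_letters_mono: "S \<subseteq> T ==> elim_letters y S \<subseteq> elim_letters y T"
 by (auto simp: elim_letters_def)

lemma zscale_fl_br_left: "fl_br (zscale c x) y = zscale c (fl_br x y)"
 by (rule zscale_additive[where f = "%x. fl_br x y"]) (rule fl_br_add_left)

lemma zscale_fl_br_right: "fl_br x (zscale c y) = zscale c (fl_br x y)"
 by (rule zscale_additive[where f = "%y. fl_br x y"]) (rule fl_br_add_right)

text \<open>The multiples of \<open>y\<close> and the subring generated by the iterated brackets of
  \<open>y\<close> with the other generators span everything: \<open>y\<close> acts on that subring
  through \<open>lshift\<close>, so the sum is closed under brackets. Only this decomposition is
  claimed, not that the subring is free. The clause on \<open>c\<close> serves the bracket case,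
  where a shift costs the weight of \<open>y\<close>.\<close>

lemma lazard_elimination:
 "\<exists>c t'. abs_free_lie t = zscale c (fl_gen y) + lsubst (elim_gen y) t' \<and>
   set_lie_term t' \<subseteq> elim_letters y (set_lie_term t) \<and>
   lweight (elim_weight y w) t' \<le> lweight w t \<and> (c ~= 0 \<longrightarrow> w y \<le> lweight w t)"
proof (induction t)
 case (LGen a)
 show ?case
 proof (cases "a = y")
  case True
  thus ?thesis
   by (intro exI[of _ 1] exI[of _ LZero]) (simp add: fl_abs_simps)
 next
  case False
  thus ?thesis
   by (intro exI[of _ 0] exI[of _ "LGen (prod_encode (0, a))"])
    (auto simp add: fl_abs_simps elim_gen_def elim_letters_def elim_weight_def)
 qed
next
 case LZero
 show ?case
  by (intro exI[of _ 0] exI[of _ LZero]) (simp add: fl_abs_simps)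
next
 case (LNeg t)
 then obtain c t' where "abs_free_lie t = zscale c (fl_gen y) + lsubst (elim_gen y) t'"
   "set_lie_term t' \<subseteq> elim_letters y (set_lie_term t)"
   "lweight (elim_weight y w) t' \<le> lweight w t" "c ~= 0 \<longrightarrow> w y \<le> lweight w t" by blast
 thus ?case
  by (intro exI[of _ "- c"] exI[of _ "LNeg t'"]) (simp add: fl_abs_simps zscale_neg)
next
 case (LAdd s t)
 obtain c t' where t: "abs_free_lie t = zscale c (fl_gen y) + lsubst (elim_gen y) t'"
   "set_lie_term t' \<subseteq> elim_letters y (set_lie_term t)"
   "lweight (elim_weight y w) t' \<le> lweight w t" "c ~= 0 \<longrightarrow> w y \<le> lweight w t"
  using LAdd.IH(2) by blast
 obtain d s' where s: "abs_free_lie s = zscale d (fl_gen y) + lsubst (elim_gen y) s'"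
   "set_lie_term s' \<subseteq> elim_letters y (set_lie_term s)"
   "lweight (elim_weight y w) s' \<le> lweight w s" "d ~= 0 \<longrightarrow> w y \<le> lweight w s"
  using LAdd.IH(1) by blast
 have "set_lie_term (LAdd s' t') \<subseteq> elim_letters y (set_lie_term (LAdd s t))"
  using s(2) t(2) by (auto simp add: elim_letters_def)
 thus ?case
  using s t by (intro exI[of _ "d + c"] exI[of _ "LAdd s' t'"]) (auto simp add: fl_abs_simps zscale_add)
next
 case (LBr s t)
 obtain c t' where t: "abs_free_lie t = zscale c (fl_gen y) + lsubst (elim_gen y) t'"
   "set_lie_term t' \<subseteq> elim_letters y (set_lie_term t)"
   "lweight (elim_weight y w) t' \<le> lweight w t" "c ~= 0 \<longrightarrow> w y \<le> lweight w t"
  using LBr.IH(2) by blast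
 obtain d s' where s: "abs_free_lie s = zscale d (fl_gen y) + lsubst (elim_gen y) s'"
   "set_lie_term s' \<subseteq> elim_letters y (set_lie_term s)"
   "lweight (elim_weight y w) s' \<le> lweight w s" "d ~= 0 \<longrightarrow> w y \<le> lweight w s"
  using LBr.IH(1) by blast
 obtain t2 where t2: "lsubst (elim_gen y) t2 = zscale d (lsubst (elim_gen y) (lshift t'))"
   "lweight (elim_weight y w) t2 \<le> lweight (elim_weight y w) (lshift t')" "set_lie_term t2 \<subseteq> set_lie_term (lshift t')"
  using lsubst_zscale_term[of "elim_gen y" d "lshift t'" "elim_weight y w"] by blast
 obtain s2 where s2: "lsubst (elim_gen y) s2 = zscale (- c) (lsubst (elim_gen y) (lshift s'))"
   "lweight (elim_weight y w) s2 \<le> lweight (elim_weight y w) (lshift s')" "set_lie_term s2 \<subseteq> set_lie_term (lshift s')"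
  using lsubst_zscale_term[of "elim_gen y" "- c" "lshift s'" "elim_weight y w"] by blast
 \<comment> \<open>With a zero coefficient the summand has to be dropped: the shift may cost
   \<open>w y\<close>, and the other factor is known to pay for that only if its coefficient of
   \<open>y\<close> is nonzero.\<close>
 define t3 where "t3 = (if d = 0 then LZero else t2)"
 define s3 where "s3 = (if c = 0 then LZero else s2)"
 have t3: "lsubst (elim_gen y) t3 = zscale d (lsubst (elim_gen y) (lshift t'))"
   "lweight (elim_weight y w) t3 \<le> lweight w s + lweight w t"
   "set_lie_term t3 \<subseteq> elim_letters y (set_lie_term t)"
 proof -
  show "lsubst (elim_gen y) t3 = zscale d (lsubst (elim_gen y) (lshift t'))"
   using t2(1) by (simp add: t3_def)
  show "lweight (elim_weight y w) t3 \<le> lweight w s + lweight w t"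
   using t2(2) s(4) t(3) lweight_lshift[of y w t'] by (cases "d = 0") (simp_all add: t3_def)
  show "set_lie_term t3 \<subseteq> elim_letters y (set_lie_term t)"
   using t2(3) set_lshift[OF t(2)] by (cases "d = 0") (simp_all add: t3_def)
 qed
 have s3: "lsubst (elim_gen y) s3 = zscale (- c) (lsubst (elim_gen y) (lshift s'))"
   "lweight (elim_weight y w) s3 \<le> lweight w s + lweight w t"
   "set_lie_term s3 \<subseteq> elim_letters y (set_lie_term s)"
 proof -
  show "lsubst (elim_gen y) s3 = zscale (- c) (lsubst (elim_gen y) (lshift s'))"
   using s2(1) by (simp add: s3_def)
  show "lweight (elim_weight y w) s3 \<le> lweight w s + lweight w t"
   using s2(2) t(4) s(3) lweight_lshift[of y w s'] by (cases "c = 0") (simp_all add: s3_def)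
  show "set_lie_term s3 \<subseteq> elim_letters y (set_lie_term s)"
   using s2(3) set_lshift[OF s(2)] by (cases "c = 0") (simp_all add: s3_def)
 qed
 \<comment> \<open>Expanding the bracket of \<open>d y + s'\<close> with \<open>c y + t'\<close>
   leaves \<open>d\<close> times the shift of \<open>t'\<close>, \<open>- c\<close> times the shift
   of \<open>s'\<close>, and the bracket of \<open>s'\<close> with \<open>t'\<close>. The term with
   \<open>y\<close> twice vanishes, so the new coefficient of \<open>y\<close> is 0.\<close>
 show ?case
 proof (intro exI[of _ 0] exI[of _ "LAdd (LAdd t3 s3) (LBr s' t')"] conjI)
  show "abs_free_lie (LBr s t) = zscale 0 (fl_gen y) + lsubst (elim_gen y) (LAdd (LAdd t3 s3) (LBr s' t'))"
   using t3 s3 fl_br_anticomm[of "fl_gen y" "lsubst (elim_gen y) s'"]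
   by (simp add: fl_abs_simps s(1) t(1) fl_br_add_left fl_br_add_right zscale_fl_br_left
     zscale_fl_br_right lsubst_lshift zscale_neg
     zscale_additive[where f = uminus])
  show "lweight (elim_weight y w) (LAdd (LAdd t3 s3) (LBr s' t')) \<le> lweight w (LBr s t)"
   using t3 s3 s t by simp
  show "set_lie_term (LAdd (LAdd t3 s3) (LBr s' t')) \<subseteq> elim_letters y (set_lie_term (LBr s t))"
  proof -
   have "elim_letters y (set_lie_term s) \<subseteq> elim_letters y (set_lie_term (LBr s t))"
      "elim_letters y (set_lie_term t) \<subseteq> elim_letters y (set_lie_term (LBr s t))"
    by (rule elim_letters_mono; simp)+
   hence "set_lie_term u \<subseteq> elim_letters y (set_lie_term (LBr s t))" if "u \<in> {s', t', s3, t3}" for u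
    using that t3(3) s3(3) s(2) t(2) by blast
   thus ?thesis by simp
  qed
 qed simp
qed

subsection \<open>Representations separate the points of a free Lie algebra\<close>

text \<open>Additive maps, which form a ring under composition. The underlying group comes from a
  nonzero commutative ring, so that zero and the identity differ and integers act by
  multiplication.\<close>

typedef (overloaded) 'v endo = "{f :: 'v::comm_ring_1 => 'v. \<forall>x y. f (x + y) = f x + f y}"
 by (rule exI[of _ "%x. x"]) simp

setup_lifting type_definition_endo

instantiation endo :: (comm_ring_1) ring_1
begin

lift_definition zero_endo :: "'a endo" is "%x. 0" by simp
lift_definition one_endo :: "'a endo" is "%x. x" by simp
lift_definition plus_endo :: "'a endo => 'a endo => 'a endo" is "%f g x. f x + g x"
 by (simp add: algebra_simps)
lift_definition minus_endo :: "'a endo => 'a endo => 'a endo" is "%f g x. f x - g x"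
 by (simp add: algebra_simps)
lift_definition uminus_endo :: "'a endo => 'a endo" is "%f x. - f x"
 by (simp add: algebra_simps)
lift_definition times_endo :: "'a endo => 'a endo => 'a endo" is "%f g x. f (g x)"
 by simp

instance
proof
 fix a b c :: "'a endo"
 show "a * b * c = a * (b * c)" "(a + b) * c = a * c + b * c" "a * (b + c) = a * b + a * c"
    "1 * a = a" "a * 1 = a" "a + b + c = a + (b + c)" "0 + a = a" "- a + a = 0" "a - b = a + - b"
  by (transfer; simp add: fun_eq_iff algebra_simps)+
 show "a + b = b + a" by transfer (simp add: add.commute)
 show "(0::'a endo) ~= 1" by transfer (metis zero_neq_one)
qed

end

lift_definition endo_app :: "'v::comm_ring_1 endo => 'v => 'v" is "%f. f" .

lemma endo_app_simps [simp]:
 "endo_app 0 x = 0" "endo_app 1 x = x" "endo_app (a + b) x = endo_app a x + endo_app b x"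
 "endo_app (a - b) x = endo_app a x - endo_app b x" "endo_app (- a) x = - endo_app a x"
 "endo_app (a * b) x = endo_app a (endo_app b x)" "endo_app a (x + y) = endo_app a x + endo_app a y"
 by (transfer, simp)+

lemma endo_eqI: "(!!x. endo_app a x = endo_app b x) ==> a = b"
 by transfer auto

lemma endo_of_int: "endo_app (of_int c) x = of_int c * x"
proof -
 have 1: "endo_app (of_nat n) x = of_nat n * x" for n
  by (induction n) (simp_all add: algebra_simps)
 show ?thesis by (cases c) (simp_all add: 1 algebra_simps del: of_nat_Suc)
qed

text \<open>A power series over the integers encodes a sequence of such power series.\<close>

definition fps_slice :: "int fps => nat => int fps" where
 "fps_slice f m = Abs_fps (%l. fps_nth f (prod_encode (m, l)))"

definition fps_unslice :: "(nat => int fps) => int fps" where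
 "fps_unslice F = Abs_fps (%p. case prod_decode p of (m, l) => fps_nth (F m) l)"

lemma fps_slice_unslice [simp]: "fps_slice (fps_unslice F) = F"
 by (simp add: fps_slice_def fps_unslice_def fps_eq_iff fun_eq_iff)

lemma fps_unslice_slice [simp]: "fps_unslice (fps_slice f) = f"
proof -
 have "(case prod_decode p of (m, l) => fps_nth f (prod_encode (m, l))) = fps_nth f p" for p
  by (cases "prod_decode p") (metis case_prod_conv prod_decode_inverse)
 thus ?thesis
  by (simp add: fps_slice_def fps_unslice_def fps_eq_iff)
qed

lemma fps_slice_eqI: "(!!m. fps_slice f m = fps_slice g m) ==> f = g"
 by (metis ext fps_unslice_slice)

lemma fps_slice_simps [simp]:
 "fps_slice (f + g) m = fps_slice f m + fps_slice g m" "fps_slice (f - g) m = fps_slice f m - fps_slice g m"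
 "fps_slice (- f) m = - fps_slice f m" "fps_slice 0 m = 0"
 by (simp_all add: fps_slice_def fps_eq_iff)

definition seq_endo :: "((nat => int fps) => (nat => int fps)) => int fps endo" where
 "seq_endo G = Abs_endo (%f. fps_unslice (G (fps_slice f)))"

lemma seq_endo_app:
 assumes "!!F H m. G (%m. F m + H m) m = G F m + G H m"
 shows "fps_slice (endo_app (seq_endo G) f) m = G (fps_slice f) m"
proof -
 have sl: "fps_slice (f + g) = (%m. fps_slice f m + fps_slice g m)" for f g
  by auto
 have un: "fps_unslice (%m. F m + H m) = fps_unslice F + fps_unslice H" for F H
  by (rule fps_slice_eqI) simp
 have G: "G (%m. F m + H m) = (%m. G F m + G H m)" for F H
  using assms by auto
 have "fps_unslice (G (fps_slice (f + g))) = fps_unslice (G (fps_slice f)) + fps_unslice (G (fps_slice g))" for f g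
  unfolding sl G un ..
 hence "endo_app (seq_endo G) f = fps_unslice (G (fps_slice f))"
  unfolding seq_endo_def endo_app.rep_eq by (subst Abs_endo_inverse) simp_all
 thus ?thesis by simp
qed

definition shift_endo :: "int fps endo" where
 "shift_endo = seq_endo (%F m. F (Suc m))"

text \<open>The module coinduced from the ideal of the new letters. A sequence \<open>F\<close>
  stands for a map on the powers of \<open>y\<close>, with \<open>F m\<close> its value at
  \<open>y^m\<close>, and \<open>y\<close> acts by the shift. Moving \<open>y^m\<close> past
  \<open>x\<close> produces \<open>m choose i\<close> times the \<open>i\<close>-fold bracket of
  \<open>y\<close> with \<open>x\<close>, followed by \<open>y^(m - i)\<close>; this is the
  resulting action of the letter that arises from \<open>x\<close> by \<open>k\<close>
  brackets.\<close>

definition lift_endo :: "(nat => int fps endo) => nat => nat => int fps endo" where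
 "lift_endo v k x = seq_endo (%F m. \<Sum>i\<le>m. of_nat (m choose i) * endo_app (v (prod_encode (k + i, x))) (F (m - i)))"

lemma shift_endo_app: "fps_slice (endo_app shift_endo f) m = fps_slice f (Suc m)"
 unfolding shift_endo_def by (rule seq_endo_app) simp

lemma lift_endo_app: "fps_slice (endo_app (lift_endo v k x) f) m =
  (\<Sum>i\<le>m. of_nat (m choose i) * endo_app (v (prod_encode (k + i, x))) (fps_slice f (m - i)))"
 unfolding lift_endo_def by (rule seq_endo_app) (simp add: algebra_simps sum.distrib)

text \<open>The bracket with the shift is Pascal's rule.\<close>

lemma shift_lift_commutator:
 "shift_endo * lift_endo v k x - lift_endo v k x * shift_endo = lift_endo v (Suc k) x"
proof (rule endo_eqI, rule fps_slice_eqI)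
 fix f m
 define g where "g i = endo_app (v (prod_encode (k + i, x))) (fps_slice f (Suc m - i))" for i
 have "(\<Sum>i\<le>Suc m. of_nat (Suc m choose i) * g i) = g 0 + (\<Sum>i\<le>m. of_nat (Suc m choose Suc i) * g (Suc i))"
  unfolding sum.atMost_Suc_shift by simp
 also have "... = g 0 + (\<Sum>i\<le>m. of_nat (m choose Suc i) * g (Suc i)) + (\<Sum>i\<le>m. of_nat (m choose i) * g (Suc i))"
  by (simp add: algebra_simps sum.distrib)
 also have "g 0 + (\<Sum>i\<le>m. of_nat (m choose Suc i) * g (Suc i)) = (\<Sum>i\<le>Suc m. of_nat (m choose i) * g i)"
  by (subst sum.atMost_Suc_shift) simp
 also have "... = (\<Sum>i\<le>m. of_nat (m choose i) * g i)"
  by simp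
 finally have "(\<Sum>i\<le>Suc m. of_nat (Suc m choose i) * g i) - (\<Sum>i\<le>m. of_nat (m choose i) * g i) =
  (\<Sum>i\<le>m. of_nat (m choose i) * g (Suc i))" by simp
 moreover have "(\<Sum>i\<le>m. of_nat (m choose i) * g i) = (\<Sum>i\<le>m. of_nat (m choose i) * endo_app (v (prod_encode (k + i, x))) (fps_slice f (Suc (m - i))))"
  by (intro sum.cong) (auto simp: g_def Suc_diff_le)
 ultimately show "fps_slice (endo_app (shift_endo * lift_endo v k x - lift_endo v k x * shift_endo) f) m =
   fps_slice (endo_app (lift_endo v (Suc k) x) f) m"
  by (simp add: shift_endo_app lift_endo_app g_def del: sum.atMost_Suc)
qed

definition induced_rep :: "(nat => int fps endo) => nat => nat => int fps endo" where
 "induced_rep v y z = (if z = y then shift_endo else lift_endo v 0 z)"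

lemma fl_eval_induced_elim_gen:
 assumes "p \<in> elim_letters y S"
 shows "fl_eval (induced_rep v y) (elim_gen y p) = (case prod_decode p of (k, x) => lift_endo v k x)"
proof -
 obtain k x where p: "p = prod_encode (k, x)" "x ~= y"
  using assms by (auto simp: elim_letters_def)
 have "fl_eval (induced_rep v y) ((fl_br (fl_gen y) ^^ k) (fl_gen x)) = lift_endo v k x"
  by (induction k) (use p in \<open>simp_all add: induced_rep_def shift_lift_commutator\<close>)
 thus ?thesis by (simp add: elim_gen_def p)
qed

lemma fl_eval_induced_lsubst:
 assumes "set_lie_term t \<subseteq> elim_letters y S"
 shows "fl_eval (induced_rep v y) (lsubst (elim_gen y) t) =
  leval (%p. case prod_decode p of (k, x) => lift_endo v k x) t"
 using assms by (induction t) (simp_all add: fl_eval_induced_elim_gen)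

text \<open>At slice 0 only the summand \<open>i = 0\<close> survives, so there the coinduced
  representation reduces to \<open>v\<close>. If it annihilates a term, then so does
  \<open>v\<close>.\<close>

lemma fps_slice_zero_leval:
 "fps_slice (endo_app (leval (%p. case prod_decode p of (k, x) => lift_endo v k x) t) f) 0 =
  endo_app (leval v t) (fps_slice f 0)"
proof (induction t arbitrary: f)
 case (LGen p)
 thus ?case
  by (cases "prod_decode p") (simp add: lift_endo_app, metis prod_decode_inverse)
qed simp_all

lemma fl_eval_zscale: "fl_eval v (zscale c x) = of_int c * (fl_eval v x :: 'r::ring_1)"
proof -
 have "fl_eval v (((+) x ^^ n) 0) = of_nat n * (fl_eval v x :: 'r)" for n
  by (induction n) (simp_all add: algebra_simps)
 moreover have "fl_eval v (a - b) = (fl_eval v a - fl_eval v b :: 'r)" for a b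
  by (metis (no_types) fl_eval_simps(3,4) diff_conv_add_uminus)
 ultimately show ?thesis
  by (cases "c \<ge> 0") (simp_all add: zscale_def)
qed

lemma abs_free_lie_no_letters: "set_lie_term t = {} ==> abs_free_lie t = 0"
 by (induction t) (simp_all add: fl_abs_simps)

text \<open>Eliminating a letter \<open>y\<close> turns a term killed by all representations into
  another such term, because any \<open>v\<close> on the new letters can be coinduced. The other
  letters keep their weights, and only letters heavier than \<open>y\<close> are added. Weights are
  bounded by \<open>N\<close>, so the process ends with a term without letters, which is
  zero.\<close>

lemma free_lie_rep_separates_aux:
 fixes t :: "nat lie_term"
 assumes "!!v. leval v t = (0 :: int fps endo)" "!!a. a \<in> set_lie_term t ==> 0 < w a" "lweight w t \<le> N"
 shows "abs_free_lie t = 0"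
proof -
 \<comment> \<open>The multiset of the defects \<open>N - w a\<close> of the occurring letters:
   replacing one entry by finitely many smaller ones decreases it.\<close>
 define R where "R = inv_image (Multiset.mult (less_than)) (%(t, w). image_mset (%a. N - w a) (mset_set (set_lie_term (t::nat lie_term))))"
 have "wf R" unfolding R_def by (intro wf_inv_image wf_mult wf_less_than)
 define Q where "Q t w \<longleftrightarrow> (\<forall>v. leval v t = (0 :: int fps endo)) \<and> (\<forall>a \<in> set_lie_term t. 0 < w a) \<and> lweight w t \<le> N"
  for t :: "nat lie_term" and w
 have "Q t w \<longrightarrow> abs_free_lie t = 0"
 proof (induction "(t, w)" arbitrary: t w rule: wf_induct_rule[OF \<open>wf R\<close>])
  case (1 t w)
  show ?case
  proof
   assume Q: "Q t w"
   show "abs_free_lie t = 0"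
   proof (cases "set_lie_term t = {}")
    case True
    thus ?thesis by (rule abs_free_lie_no_letters)
   next
    case False
    then obtain y where y: "y \<in> set_lie_term t" by blast
    obtain c t' where t': "abs_free_lie t = zscale c (fl_gen y) + lsubst (elim_gen y) t'"
     "set_lie_term t' \<subseteq> elim_letters y (set_lie_term t)" "lweight (elim_weight y w) t' \<le> lweight w t"
     using lazard_elimination[of t y w] by blast
    have ev: "fl_eval v (abs_free_lie t) = (0 :: int fps endo)" for v
     using Q by (simp add: Q_def fl_eval_abs)
    \<comment> \<open>A representation by commuting operators in which only \<open>y\<close> is
      nonzero: all brackets vanish and the coefficient of \<open>y\<close> remains.\<close>
    define v0 where "v0 z = (if z = y then 1 else 0 :: int fps endo)" for z
    have 0: "fl_eval v0 ((fl_br (fl_gen y) ^^ k) (fl_gen x)) = 0" if "x ~= y" for k x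
     by (induction k) (simp_all add: v0_def that)
    hence elim0: "fl_eval v0 (elim_gen y p) = 0" if "p \<in> elim_letters y S" for p S
     using that by (auto simp: elim_gen_def elim_letters_def)
    have "fl_eval v0 (lsubst (elim_gen y) t') = 0"
     using t'(2) by (induction t') (simp_all add: elim0)
    hence "of_int c = (0 :: int fps endo)"
     using ev[of v0] by (simp add: t'(1) fl_eval_zscale v0_def)
    hence "of_int c * (1 :: int fps) = 0"
     by (metis endo_of_int endo_app_simps(1))
    hence "(of_int c :: int fps) = 0" by simp
    hence "fps_const (of_int c :: int) = 0" unfolding fps_of_int .
    hence c: "c = 0" by simp
    have "leval v t' = 0" for v :: "nat => int fps endo"
    proof (rule endo_eqI)
     fix x
     have "fl_eval (induced_rep v y) (lsubst (elim_gen y) t') = 0"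
      using ev[of "induced_rep v y"] by (simp add: t'(1) c)
     hence "endo_app (leval v t') (fps_slice (fps_unslice (%_. x)) 0) = 0"
      using fl_eval_induced_lsubst[OF t'(2)] fps_slice_zero_leval[of v t' "fps_unslice (%_. x)"]
      by simp
     thus "endo_app (leval v t') x = endo_app 0 x" by simp
    qed
    moreover have pos: "\<forall>a \<in> set_lie_term t'. 0 < elim_weight y w a"
     using t'(2) Q by (auto simp: elim_letters_def elim_weight_def Q_def)
    moreover have wN: "lweight (elim_weight y w) t' \<le> N" using t'(3) Q by (simp add: Q_def)
    ultimately have Q': "Q t' (elim_weight y w)" by (simp add: Q_def)
    have fin: "finite (set_lie_term s)" for s :: "nat lie_term" by (induction s) simp_all
    \<comment> \<open>The letters without any bracket with \<open>y\<close>; they inherit the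
      weights of the old letters other than \<open>y\<close>.\<close>
    define A where "A = (%x. prod_encode (0, x)) ` (set_lie_term t - {y})"
    define B where "B = set_lie_term t' - A"
    have split: "mset_set X = mset_set (X \<inter> Z) + mset_set (X - Z)" if "finite X" for X Z :: "nat set"
     using that by (subst mset_set_Union[symmetric]) (auto simp: Int_Diff_Un)
    let ?f = "%a. N - elim_weight y w a"
    have "image_mset ?f (mset_set (set_lie_term t')) = image_mset ?f (mset_set (set_lie_term t' \<inter> A)) + image_mset ?f (mset_set B)"
     unfolding B_def image_mset_union[symmetric] by (subst split[of _ A]) (simp_all add: fin)
    moreover have "image_mset ?f (mset_set A) = image_mset (%a. N - w a) (mset_set (set_lie_term t - {y}))"
    proof -
     have "inj_on (%x. prod_encode (0, x)) (set_lie_term t - {y})" by (auto simp: inj_on_def)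
     hence "mset_set A = image_mset (%x. prod_encode (0, x)) (mset_set (set_lie_term t - {y}))"
      unfolding A_def by (rule image_mset_mset_set[symmetric])
     thus ?thesis
      by (simp add: multiset.map_comp o_def elim_weight_def)
    qed
    moreover have "mset_set (set_lie_term t) = add_mset y (mset_set (set_lie_term t - {y}))"
     using y fin by (metis mset_set.remove)
    moreover have "image_mset ?f (mset_set A) = image_mset ?f (mset_set (set_lie_term t' \<inter> A)) + image_mset ?f (mset_set (A - set_lie_term t'))"
     unfolding image_mset_union[symmetric]
     by (subst split[of _ "set_lie_term t'"]) (simp_all add: fin A_def Int_commute)
    moreover have "(image_mset ?f (mset_set (set_lie_term t' \<inter> A)) + image_mset ?f (mset_set B),
      image_mset ?f (mset_set (set_lie_term t' \<inter> A)) + add_mset (N - w y) (image_mset ?f (mset_set (A - set_lie_term t')))) \<in> Multiset.mult less_than"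
    proof (rule one_step_implies_mult)
     show "\<forall>k\<in>#image_mset ?f (mset_set B). \<exists>j\<in>#add_mset (N - w y) (image_mset ?f (mset_set (A - set_lie_term t'))). (k, j) \<in> less_than"
     proof
      fix k assume "k \<in># image_mset ?f (mset_set B)"
      then obtain b where b: "b \<in> B" "k = ?f b" using fin by (auto simp: B_def)
      then obtain i x where ix: "b = prod_encode (i, x)" "x \<in> set_lie_term t" "x ~= y"
       using t'(2) by (auto simp: B_def elim_letters_def)
      \<comment> \<open>Every letter in \<open>B\<close> has been bracketed with \<open>y\<close> at
        least once. It weighs more than \<open>y\<close>, since the weight of \<open>x\<close> is
        positive, and so its defect is smaller than that of \<open>y\<close>.\<close>
      with b have "i ~= 0" by (auto simp: B_def A_def)
      have "elim_weight y w b \<le> N"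
       using b lweight_gen[of b t' "elim_weight y w"] wN by (auto simp: B_def)
      moreover have "elim_weight y w b > w y"
       using ix Q \<open>i ~= 0\<close> y by (cases i) (auto simp: elim_weight_def Q_def)
      ultimately have "k < N - w y" using b by simp
      thus "\<exists>j\<in>#add_mset (N - w y) (image_mset ?f (mset_set (A - set_lie_term t'))). (k, j) \<in> less_than"
       by auto
     qed
    qed auto
    ultimately have "((t', elim_weight y w), (t, w)) \<in> R"
     by (simp add: R_def)
    hence "abs_free_lie t' = 0" using 1 Q' by blast
    hence "lie_eq t' LZero"
     by (simp add: fl_abs_simps(1)[symmetric] free_lie.abs_eq_iff)
    from lsubst_cong[OF this] show ?thesis by (simp add: t'(1) c)
   qed
  qed
 qed
 thus ?thesis using assms by (simp add: Q_def)
qed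

theorem free_lie_rep_separates:
 fixes a :: "nat free_lie"
 assumes "!!v. fl_eval v a = (0 :: int fps endo)"
 shows "a = 0"
proof -
 obtain t where t: "a = abs_free_lie t" by (metis Quotient_free_lie Quotient_abs_rep)
 have "leval v t = (0 :: int fps endo)" for v using assms[of v] by (simp add: t fl_eval_abs)
 thus ?thesis unfolding t
  by (rule free_lie_rep_separates_aux[where w = "%_. 1" and N = "lweight (%_. 1) t"]) simp_all
qed

section \<open>Commutator calculus\<close>

context group
begin

abbreviation comm_bracket :: "'a => 'a => 'a" (\<open>\<kappa>\<close>)
 where "\<kappa> \<equiv> commutator G"

abbreviation lower_central_here :: "nat => 'a set" (\<open>\<gamma>\<close>)
 where "\<gamma> \<equiv> lower_central G"

lemma cancel_left [simp]:
 assumes "x \<in> carrier G" "y \<in> carrier G"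
 shows "x \<otimes> (inv x \<otimes> y) = y" "inv x \<otimes> (x \<otimes> y) = y"
 using assms by (simp_all add: m_assoc[symmetric])

lemmas word_simps = commutator_def m_assoc inv_mult_group

lemma commutator_closed [simp, intro]: "x \<in> carrier G ==> y \<in> carrier G ==> \<kappa> x y \<in> carrier G"
 by (simp add: commutator_def)

lemma inv_commutator: "x \<in> carrier G ==> y \<in> carrier G ==> inv (\<kappa> x y) = \<kappa> y x"
 by (simp add: word_simps)

lemma commutator_mult_left:
 assumes "x \<in> carrier G" "y \<in> carrier G" "z \<in> carrier G"
 shows "\<kappa> (x \<otimes> y) z = (x \<otimes> \<kappa> y z \<otimes> inv x) \<otimes> \<kappa> x z"
 using assms by (simp add: word_simps)

lemma commutator_mult_right:
 assumes "x \<in> carrier G" "y \<in> carrier G" "z \<in> carrier G"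
 shows "\<kappa> x (y \<otimes> z) = \<kappa> x y \<otimes> (y \<otimes> \<kappa> x z \<otimes> inv y)"
 using assms by (simp add: word_simps)

lemma commutator_inv_left:
 assumes "x \<in> carrier G" "y \<in> carrier G"
 shows "\<kappa> (inv x) y = inv x \<otimes> inv (\<kappa> x y) \<otimes> inv (inv x)"
 using assms by (simp add: word_simps)

lemma commutator_one [simp]: "x \<in> carrier G ==> \<kappa> x \<one> = \<one>" "x \<in> carrier G ==> \<kappa> \<one> x = \<one>"
 "x \<in> carrier G ==> \<kappa> x x = \<one>"
 by (simp_all add: word_simps)

lemma conj_eq_commutator:
 assumes "x \<in> carrier G" "y \<in> carrier G"
 shows "x \<otimes> y \<otimes> inv x = \<kappa> x y \<otimes> y"
 using assms by (simp add: word_simps)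

text \<open>The Hall-Witt identity in the convention of \<open>commutator\<close>, by free
  cancellation. Modulo deeper terms of the series the conjugations disappear and it becomes the
  Jacobi identity.\<close>

lemma hall_witt:
 assumes "x \<in> carrier G" "y \<in> carrier G" "z \<in> carrier G"
 shows "\<kappa> (\<kappa> x y) (y \<otimes> z \<otimes> inv y) \<otimes> (\<kappa> (\<kappa> y z) (z \<otimes> x \<otimes> inv z) \<otimes> \<kappa> (\<kappa> z x) (x \<otimes> y \<otimes> inv x)) = \<one>"
 using assms by (simp add: word_simps)

text \<open>Modulo the normal subgroup \<open>N\<close>, the elements that commute with
  \<open>y\<close> form a subgroup, so generators suffice.\<close>

lemma commutator_generate_left:
 assumes N: "N \<lhd> G" and A: "A \<subseteq> carrier G" and y: "y \<in> carrier G"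
  and gen: "!!a. a \<in> A ==> \<kappa> a y \<in> N" and x: "x \<in> generate G A"
 shows "\<kappa> x y \<in> N"
proof -
 interpret N: normal N G by (rule N)
 have "x \<in> carrier G \<and> \<kappa> x y \<in> N"
  using x
 proof (induction rule: generate.induct)
  case one thus ?case using y by simp
 next
  case (incl h) thus ?case using A gen by auto
 next
  case (inv h)
  hence "h \<in> carrier G" "\<kappa> h y \<in> N" using A gen by auto
  moreover from this have "inv h \<otimes> inv (\<kappa> h y) \<otimes> inv (inv h) \<in> N"
   by (intro N.inv_op_closed2) auto
  ultimately show ?case using y by (simp only: commutator_inv_left inv_closed)
 next
  case (eng h1 h2)
  thus ?case using y by (simp add: commutator_mult_left N.inv_op_closed2)
 qed
 thus ?thesis ..
qed

lemma commutator_swap_mem: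
 "[|subgroup N G; x \<in> carrier G; y \<in> carrier G; \<kappa> x y \<in> N|] ==> \<kappa> y x \<in> N"
 using subgroup.m_inv_closed[of N G "\<kappa> x y"] by (simp add: inv_commutator)

lemma commutator_generate_right:
 assumes N: "N \<lhd> G" and A: "A \<subseteq> carrier G" and y: "y \<in> carrier G"
  and gen: "!!a. a \<in> A ==> \<kappa> y a \<in> N" and x: "x \<in> generate G A"
 shows "\<kappa> y x \<in> N"
proof -
 interpret N: normal N G by (rule N)
 have xc: "x \<in> carrier G" using generate_incl[OF A] x by blast
 have "\<kappa> x y \<in> N"
  by (rule commutator_generate_left[OF N A y _ x]) (meson A N.subgroup_axioms commutator_swap_mem gen subsetD y)
 thus ?thesis using xc y N.subgroup_axioms commutator_swap_mem by blast
qed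

lemma lower_central_Suc:
 "1 \<le> k ==> \<gamma> (Suc k) = generate G {\<kappa> g h |g h. g \<in> carrier G \<and> h \<in> \<gamma> k}"
 by (cases k) auto

lemma lower_central_one [simp]: "\<gamma> (Suc 0) = carrier G"
 by simp

lemma normal_carrier: "carrier G \<lhd> G"
 by (simp add: normal_inv_iff subgroup_self)

lemma normal_lower_central: "\<gamma> k \<lhd> G"
proof (induction k)
 case 0 thus ?case by (simp add: normal_carrier)
next
 case (Suc k)
 show ?case
 proof (cases k)
  case 0 thus ?thesis by (simp add: normal_carrier)
 next
  case (Suc l)
  then interpret N: normal "\<gamma> (Suc l)" G using Suc.IH by simp
  have sub: "{\<kappa> g h |g h. g \<in> carrier G \<and> h \<in> \<gamma> (Suc l)} \<subseteq> carrier G"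
   using N.subset by auto
  show ?thesis unfolding Suc lower_central.simps
  proof (rule normal_generateI[OF sub])
   fix h g assume "h \<in> {\<kappa> g h |g h. g \<in> carrier G \<and> h \<in> \<gamma> (Suc l)}" and g: "g \<in> carrier G"
   then obtain a b where ab: "h = \<kappa> a b" "a \<in> carrier G" "b \<in> \<gamma> (Suc l)" by blast
   hence b: "b \<in> carrier G" using N.subset by auto
   have "g \<otimes> h \<otimes> inv g = \<kappa> (g \<otimes> a \<otimes> inv g) (g \<otimes> b \<otimes> inv g)"
    using ab b g by (simp add: word_simps)
   moreover have "g \<otimes> b \<otimes> inv g \<in> \<gamma> (Suc l)" using ab g by (simp add: N.inv_op_closed2)
   ultimately show "g \<otimes> h \<otimes> inv g \<in> {\<kappa> g h |g h. g \<in> carrier G \<and> h \<in> \<gamma> (Suc l)}"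
    using ab g by blast
  qed
 qed
qed

lemma lower_central_subset: "\<gamma> k \<subseteq> carrier G"
 using normal_imp_subgroup[OF normal_lower_central] subgroup.subset by blast

lemma lower_central_closed [simp]: "x \<in> \<gamma> k ==> x \<in> carrier G"
 using lower_central_subset by blast

lemma commutator_lower_Suc:
 "[|1 \<le> k; g \<in> carrier G; h \<in> \<gamma> k|] ==> \<kappa> g h \<in> \<gamma> (Suc k)"
 by (auto simp: lower_central_Suc intro!: generate.incl)

lemma lower_central_Suc_subset: "\<gamma> (Suc k) \<subseteq> \<gamma> k"
proof (cases "k = 0")
 case False
 interpret N: normal "\<gamma> k" G by (rule normal_lower_central)
 have "{\<kappa> g h |g h. g \<in> carrier G \<and> h \<in> \<gamma> k} \<subseteq> \<gamma> k"
  by (auto simp: commutator_def N.inv_op_closed2)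
 thus ?thesis using False generate_subgroup_incl[OF _ N.subgroup_axioms] by (simp add: lower_central_Suc)
qed simp

lemma lower_central_antimono: "k \<le> l ==> \<gamma> l \<subseteq> \<gamma> k"
 by (rule lift_Suc_antimono_le[of "\<gamma>"]) (rule lower_central_Suc_subset)

text \<open>The three subgroups argument: for a generator \<open>\<kappa> g u\<close> of the left
  term, Hall-Witt expresses its commutator with \<open>y\<close> by two others, and to both of them
  the induction hypothesis applies with an element one step higher in the series.\<close>

lemma lower_central_commutator_Suc:
 "[|1 \<le> j; x \<in> \<gamma> (Suc i); y \<in> \<gamma> j|] ==> \<kappa> x y \<in> \<gamma> (Suc i + j)"
proof (induction i arbitrary: j x y)
 case 0
 thus ?case using commutator_lower_Suc[of j x y] by simp
next
 case (Suc i)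
 interpret N: normal "\<gamma> (Suc (Suc i) + j)" G by (rule normal_lower_central)
 interpret M: normal "\<gamma> j" G by (rule normal_lower_central)
 interpret I: normal "\<gamma> (Suc i)" G by (rule normal_lower_central)
 have y: "y \<in> carrier G" using Suc.prems by simp
 show ?case
 proof (rule commutator_generate_left[OF normal_lower_central _ y])
  show "x \<in> generate G {\<kappa> g h |g h. g \<in> carrier G \<and> h \<in> \<gamma> (Suc i)}"
   using Suc.prems by (simp only: lower_central_Suc[of "Suc i"] le_add1 plus_1_eq_Suc)
  show "{\<kappa> g h |g h. g \<in> carrier G \<and> h \<in> \<gamma> (Suc i)} \<subseteq> carrier G" by auto
  fix a assume "a \<in> {\<kappa> g h |g h. g \<in> carrier G \<and> h \<in> \<gamma> (Suc i)}"
  then obtain g u where a: "a = \<kappa> g u" "g \<in> carrier G" "u \<in> \<gamma> (Suc i)" by blast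
  hence u: "u \<in> carrier G" by simp
  \<comment> \<open>Hall-Witt needs \<open>y\<close> as a conjugate by \<open>u\<close>; with this
    \<open>w\<close>, the element \<open>u w u^-1\<close> is \<open>y\<close> itself.\<close>
  define w where "w = inv u \<otimes> y \<otimes> u"
  have w: "w \<in> \<gamma> j" unfolding w_def using Suc.prems u by (intro M.inv_op_closed1) auto
  hence wc: "w \<in> carrier G" by simp
  have yw: "u \<otimes> w \<otimes> inv u = y" using u y by (simp add: w_def m_assoc)
  have hw: "\<kappa> (\<kappa> g u) y \<otimes> (\<kappa> (\<kappa> u w) (w \<otimes> g \<otimes> inv w) \<otimes> \<kappa> (\<kappa> w g) (g \<otimes> u \<otimes> inv g)) = \<one>"
   using hall_witt[of g u w] a u wc yw by simp
  have "\<kappa> u w \<in> \<gamma> (Suc i + j)" using Suc.IH[of j u w] Suc.prems a w by simp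
  hence "\<kappa> (w \<otimes> g \<otimes> inv w) (\<kappa> u w) \<in> \<gamma> (Suc (Suc i + j))"
   by (intro commutator_lower_Suc) (use a(2) wc in auto)
  hence "\<kappa> (w \<otimes> g \<otimes> inv w) (\<kappa> u w) \<in> \<gamma> (Suc (Suc i) + j)"
   by (simp only: add_Suc)
  hence t2: "\<kappa> (\<kappa> u w) (w \<otimes> g \<otimes> inv w) \<in> \<gamma> (Suc (Suc i) + j)"
   by (rule commutator_swap_mem[OF N.subgroup_axioms, rotated 2]) (use a u wc in auto)
  have "\<kappa> g w \<in> \<gamma> (Suc j)" using a(2) w Suc.prems(1) by (intro commutator_lower_Suc)
  hence "\<kappa> w g \<in> \<gamma> (Suc j)"
   using commutator_swap_mem[OF normal_imp_subgroup[OF normal_lower_central]] a wc by blast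
  moreover have "g \<otimes> u \<otimes> inv g \<in> \<gamma> (Suc i)" using a by (simp add: I.inv_op_closed2)
  ultimately have "\<kappa> (g \<otimes> u \<otimes> inv g) (\<kappa> w g) \<in> \<gamma> (Suc i + Suc j)"
   by (intro Suc.IH) auto
  hence "\<kappa> (g \<otimes> u \<otimes> inv g) (\<kappa> w g) \<in> \<gamma> (Suc (Suc i) + j)"
   by (simp only: add_Suc add_Suc_right)
  hence t3: "\<kappa> (\<kappa> w g) (g \<otimes> u \<otimes> inv g) \<in> \<gamma> (Suc (Suc i) + j)"
   by (rule commutator_swap_mem[OF N.subgroup_axioms, rotated 2]) (use a u wc in auto)
  define t where "t = \<kappa> (\<kappa> u w) (w \<otimes> g \<otimes> inv w) \<otimes> \<kappa> (\<kappa> w g) (g \<otimes> u \<otimes> inv g)"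
  have t: "t \<in> \<gamma> (Suc (Suc i) + j)" unfolding t_def using t2 t3 by (rule N.m_closed)
  have "inv t = \<kappa> (\<kappa> g u) y"
   using hw a u y wc by (intro inv_equality) (simp_all add: t_def)
  moreover have "inv t \<in> \<gamma> (Suc (Suc i) + j)"
   using t by (rule N.m_inv_closed)
  ultimately show "\<kappa> a y \<in> \<gamma> (Suc (Suc i) + j)" using a by simp
 qed
qed

lemma lower_central_commutator:
 "[|1 \<le> i; 1 \<le> j; x \<in> \<gamma> i; y \<in> \<gamma> j|] ==> \<kappa> x y \<in> \<gamma> (i + j)"
 using lower_central_commutator_Suc[of j x "i - 1" y] by simp

end

section \<open>The lower central series Lie ring\<close>

context group
begin

abbreviation lcs_quotient_here (\<open>\<Q>\<close>) where "\<Q> \<equiv> lcs_quotient G"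
abbreviation lcs_carrier (\<open>\<L>\<close>) where "\<L> \<equiv> carrier (lcs_lie G)"
abbreviation lcs_zero (\<open>\<zero>\<^sub>L\<close>) where "\<zero>\<^sub>L \<equiv> \<zero>\<^bsub>lcs_lie G\<^esub>"
abbreviation lcs_add (infixl \<open>+\<^sub>L\<close> 65) where "x +\<^sub>L y \<equiv> x \<oplus>\<^bsub>lcs_lie G\<^esub> y"
abbreviation lcs_br (infixl \<open>*\<^sub>L\<close> 70) where "x *\<^sub>L y \<equiv> x \<otimes>\<^bsub>lcs_lie G\<^esub> y"
abbreviation conv_term :: "(nat => 'a set) => (nat => 'a set) => nat => nat => 'a set"
 where "conv_term x y d k \<equiv> lcs_bracket G k (d - k) (x k) (y (d - k))"

lemma coset_eqI:
 assumes "N \<lhd> G" "x \<in> carrier G" "y \<in> carrier G" "x \<otimes> inv y \<in> N"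
 shows "N #> x = N #> y"
proof -
 interpret N: normal N G by fact
 have "x \<in> N #> y" using assms N.subset by (auto simp: r_coset_def m_assoc intro!: bexI[of _ "x \<otimes> inv y"])
 thus ?thesis using repr_independence[of x N y] assms N.subgroup_axioms by simp
qed

lemma coset_eqD:
 assumes "N \<lhd> G" "x \<in> carrier G" "y \<in> carrier G" "N #> x = N #> y"
 shows "x \<otimes> inv y \<in> N"
proof -
 interpret N: normal N G by fact
 have "x \<in> N #> y" using rcos_self[of x N] assms N.subgroup_axioms by auto
 then obtain n where "n \<in> N" "x = n \<otimes> y" by (auto simp: r_coset_def)
 thus ?thesis using assms N.subset by (auto simp: m_assoc)
qed

lemma coset_eq_self:
 assumes "N \<lhd> G" "x \<in> carrier G"
 shows "N #> x = N \<longleftrightarrow> x \<in> N"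
proof -
 interpret N: normal N G by fact
 have "N #> \<one> = N" by (rule coset_mult_one[OF N.subset])
 thus ?thesis using assms coset_eqI[of N x \<one>] coset_eqD[of N x \<one>] by auto
qed

lemma coset_conj:
 assumes "1 \<le> d" "x \<in> carrier G" "m \<in> \<gamma> d"
 shows "\<gamma> (Suc d) #> (x \<otimes> m \<otimes> inv x) = \<gamma> (Suc d) #> m"
proof (rule coset_eqI[OF normal_lower_central])
 have "x \<otimes> m \<otimes> inv x \<otimes> inv m = \<kappa> x m" using assms by (simp add: commutator_def)
 thus "x \<otimes> m \<otimes> inv x \<otimes> inv m \<in> \<gamma> (Suc d)"
  using assms commutator_lower_Suc by simp
qed (use assms in auto)

lemma lcs_quotient_carrier:
 "carrier (\<Q> d) = (%g. \<gamma> (Suc d) #> g) ` \<gamma> d"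
 by (auto simp: lcs_quotient_def FactGroup_def RCOSETS_def r_coset_def)

lemma lcs_quotient_one [simp]: "\<one>\<^bsub>\<Q> d\<^esub> = \<gamma> (Suc d)"
 by (simp add: lcs_quotient_def FactGroup_def)

lemma lcs_quotient_mult:
 assumes "g \<in> carrier G" "h \<in> carrier G"
 shows "(\<gamma> (Suc d) #> g) \<otimes>\<^bsub>\<Q> d\<^esub> (\<gamma> (Suc d) #> h) = \<gamma> (Suc d) #> (g \<otimes> h)"
proof -
 have "(\<otimes>\<^bsub>\<Q> d\<^esub>) = (<#>\<^bsub>G\<^esub>)" by (simp add: lcs_quotient_def set_mult_def fun_eq_iff)
 thus ?thesis using normal.rcos_sum[OF normal_lower_central] assms by simp
qed

lemma normal_lower_central_step: "\<gamma> (Suc d) \<lhd> G\<lparr>carrier := \<gamma> d\<rparr>"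
proof -
 interpret H: normal "\<gamma> d" G by (rule normal_lower_central)
 have "\<gamma> (Suc d) \<inter> \<gamma> d \<lhd> G\<lparr>carrier := \<gamma> d\<rparr>"
  using normal_Int_subgroup[OF H.subgroup_axioms normal_lower_central] by simp
 moreover have "\<gamma> (Suc d) \<inter> \<gamma> d = \<gamma> (Suc d)"
  using lower_central_Suc_subset by blast
 ultimately show ?thesis by simp
qed

lemma lcs_quotient_group: "group (\<Q> d)"
 unfolding lcs_quotient_def by (rule normal.factorgroup_is_group[OF normal_lower_central_step])

lemma lcs_quotient_comm_group:
 assumes "1 \<le> d"
 shows "comm_group (\<Q> d)"
proof (rule group.group_comm_groupI[OF lcs_quotient_group])
 fix x y assume "x \<in> carrier (\<Q> d)" "y \<in> carrier (\<Q> d)"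
 then obtain g h where gh: "g \<in> \<gamma> d" "h \<in> \<gamma> d"
  "x = \<gamma> (Suc d) #> g" "y = \<gamma> (Suc d) #> h" by (auto simp: lcs_quotient_carrier)
 have "\<gamma> (Suc d) #> (g \<otimes> h) = \<gamma> (Suc d) #> (h \<otimes> g)"
 proof (rule coset_eqI[OF normal_lower_central])
  have "g \<otimes> h \<otimes> inv (h \<otimes> g) = \<kappa> g h" using gh by (simp add: word_simps)
  thus "g \<otimes> h \<otimes> inv (h \<otimes> g) \<in> \<gamma> (Suc d)"
   using commutator_lower_Suc[OF assms, of g h] gh by simp
 qed (use gh in auto)
 thus "x \<otimes>\<^bsub>\<Q> d\<^esub> y = y \<otimes>\<^bsub>\<Q> d\<^esub> x"
  using gh by (simp add: lcs_quotient_mult)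
qed

lemma lcs_commutator_mult_left:
 assumes "1 \<le> k" "1 \<le> l" "x \<in> \<gamma> k" "y \<in> \<gamma> k" "z \<in> \<gamma> l"
 shows "\<gamma> (Suc (k + l)) #> \<kappa> (x \<otimes> y) z = \<gamma> (Suc (k + l)) #> (\<kappa> y z \<otimes> \<kappa> x z)"
proof -
 let ?N = "\<gamma> (Suc (k + l))"
 have c: "\<kappa> y z \<in> \<gamma> (k + l)" using assms by (intro lower_central_commutator)
 have "?N #> \<kappa> (x \<otimes> y) z = ?N #> (x \<otimes> \<kappa> y z \<otimes> inv x \<otimes> \<kappa> x z)"
  using assms by (simp add: commutator_mult_left)
 also have "... = (?N #> (x \<otimes> \<kappa> y z \<otimes> inv x)) \<otimes>\<^bsub>\<Q> (k + l)\<^esub> (?N #> \<kappa> x z)"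
  using assms by (intro lcs_quotient_mult[symmetric]) auto
 also have "... = (?N #> \<kappa> y z) \<otimes>\<^bsub>\<Q> (k + l)\<^esub> (?N #> \<kappa> x z)"
  using assms c by (subst coset_conj) auto
 also have "... = ?N #> (\<kappa> y z \<otimes> \<kappa> x z)"
  using assms by (intro lcs_quotient_mult) auto
 finally show ?thesis .
qed

lemma lcs_commutator_mult_right:
 assumes "1 \<le> k" "1 \<le> l" "x \<in> \<gamma> k" "y \<in> \<gamma> l" "z \<in> \<gamma> l"
 shows "\<gamma> (Suc (k + l)) #> \<kappa> x (y \<otimes> z) = \<gamma> (Suc (k + l)) #> (\<kappa> x y \<otimes> \<kappa> x z)"
proof -
 let ?N = "\<gamma> (Suc (k + l))"
 have c: "\<kappa> x z \<in> \<gamma> (k + l)" using assms by (intro lower_central_commutator)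
 have "?N #> \<kappa> x (y \<otimes> z) = ?N #> (\<kappa> x y \<otimes> (y \<otimes> \<kappa> x z \<otimes> inv y))"
  using assms by (simp add: commutator_mult_right)
 also have "... = (?N #> \<kappa> x y) \<otimes>\<^bsub>\<Q> (k + l)\<^esub> (?N #> (y \<otimes> \<kappa> x z \<otimes> inv y))"
  using assms by (intro lcs_quotient_mult[symmetric]) auto
 also have "... = (?N #> \<kappa> x y) \<otimes>\<^bsub>\<Q> (k + l)\<^esub> (?N #> \<kappa> x z)"
  using assms c by (subst coset_conj) auto
 also have "... = ?N #> (\<kappa> x y \<otimes> \<kappa> x z)"
  using assms by (intro lcs_quotient_mult) auto
 finally show ?thesis .
qed

text \<open>Representatives that differ by the next term have commutators that differ only in degree
  \<open>k + l + 1\<close>. This makes the union in \<open>lcs_bracket\<close> a single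
  coset.\<close>

lemma lcs_commutator_cong:
 assumes "1 \<le> k" "1 \<le> l" "x \<in> \<gamma> k" "y \<in> \<gamma> l"
  and "m \<in> \<gamma> (Suc k)" "n \<in> \<gamma> (Suc l)"
 shows "\<gamma> (Suc (k + l)) #> \<kappa> (m \<otimes> x) (n \<otimes> y) = \<gamma> (Suc (k + l)) #> \<kappa> x y"
proof -
 let ?N = "\<gamma> (Suc (k + l))"
 interpret N: normal ?N G by (rule normal_lower_central)
 have m: "m \<in> \<gamma> k" and n: "n \<in> \<gamma> l"
  using assms lower_central_Suc_subset by blast+
 interpret L: normal "\<gamma> l" G by (rule normal_lower_central)
 have ny: "n \<otimes> y \<in> \<gamma> l" using n assms by (intro L.m_closed)
 have mk: "\<kappa> m (n \<otimes> y) \<in> ?N" using lower_central_commutator[of "Suc k" l m "n \<otimes> y"] assms ny by simp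
 have nk: "\<kappa> x n \<in> ?N" using lower_central_commutator[of k "Suc l" x n] assms by simp
 have "?N #> \<kappa> (m \<otimes> x) (n \<otimes> y) = ?N #> (\<kappa> x (n \<otimes> y) \<otimes> \<kappa> m (n \<otimes> y))"
  using assms ny m by (intro lcs_commutator_mult_left)
 also have "... = (?N #> \<kappa> x (n \<otimes> y)) \<otimes>\<^bsub>\<Q> (k + l)\<^esub> (?N #> \<kappa> m (n \<otimes> y))"
  using assms by (intro lcs_quotient_mult[symmetric]) auto
 also have "... = (?N #> \<kappa> x (n \<otimes> y)) \<otimes>\<^bsub>\<Q> (k + l)\<^esub> \<one>\<^bsub>\<Q> (k + l)\<^esub>"
  using mk coset_eq_self[OF normal_lower_central, of "\<kappa> m (n \<otimes> y)" "Suc (k + l)"] by simp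
 also have "... = ?N #> \<kappa> x (n \<otimes> y)"
  using lower_central_commutator[of k l x "n \<otimes> y"] assms ny
  by (intro monoid.r_one[OF group.is_monoid[OF lcs_quotient_group]]) (auto simp: lcs_quotient_carrier)
 also have "... = ?N #> (\<kappa> x n \<otimes> \<kappa> x y)"
  using assms n by (intro lcs_commutator_mult_right)
 also have "... = (?N #> \<kappa> x n) \<otimes>\<^bsub>\<Q> (k + l)\<^esub> (?N #> \<kappa> x y)"
  using assms by (intro lcs_quotient_mult[symmetric]) auto
 also have "... = \<one>\<^bsub>\<Q> (k + l)\<^esub> \<otimes>\<^bsub>\<Q> (k + l)\<^esub> (?N #> \<kappa> x y)"
  using nk coset_eq_self[OF normal_lower_central, of "\<kappa> x n" "Suc (k + l)"] by simp
 also have "... = ?N #> \<kappa> x y"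
  using lower_central_commutator[of k l x y] assms
  by (intro monoid.l_one[OF group.is_monoid[OF lcs_quotient_group]]) (auto simp: lcs_quotient_carrier)
 finally show ?thesis .
qed

lemma lcs_bracket_coset:
 assumes "1 \<le> k" "1 \<le> l" "x \<in> \<gamma> k" "y \<in> \<gamma> l"
 shows "lcs_bracket G k l (\<gamma> (Suc k) #> x) (\<gamma> (Suc l) #> y) =
  \<gamma> (Suc (k + l)) #> \<kappa> x y"
proof -
 have "\<gamma> (Suc (k + l)) #> \<kappa> g h = \<gamma> (Suc (k + l)) #> \<kappa> x y"
  if gh: "g \<in> \<gamma> (Suc k) #> x" "h \<in> \<gamma> (Suc l) #> y" for g h
 proof -
  obtain m n where "m \<in> \<gamma> (Suc k)" "n \<in> \<gamma> (Suc l)" "g = m \<otimes> x" "h = n \<otimes> y"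
   using gh by (auto simp: r_coset_def)
  thus ?thesis using lcs_commutator_cong[OF assms] by simp
 qed
 moreover have "x \<in> \<gamma> (Suc k) #> x" "y \<in> \<gamma> (Suc l) #> y"
  using assms by (auto intro!: rcos_self normal_imp_subgroup normal_lower_central)
 ultimately show ?thesis unfolding lcs_bracket_def by blast
qed

text \<open>The element of the direct sum concentrated in degree \<open>k\<close>. The zero of
  degree \<open>d\<close> is the subgroup \<open>\<gamma> (Suc d)\<close> itself, and index 0 lies
  outside the domain.\<close>

definition lcs_homog :: "nat => 'a => nat => 'a set" where
 "lcs_homog k g = (\<lambda>d\<in>{1..}. if d = k then \<gamma> (Suc k) #> g else \<gamma> (Suc d))"

lemma lcs_degree_one_eq: "lcs_degree_one G g = lcs_homog 1 g"
 by (auto simp: lcs_degree_one_def lcs_homog_def fun_eq_iff numeral_2_eq_2)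

lemma carrier_lcs_lie:
 "x \<in> \<L> \<longleftrightarrow> x \<in> (\<Pi>\<^sub>E d\<in>{1..}. (%g. \<gamma> (Suc d) #> g) ` \<gamma> d) \<and>
   finite {d \<in> {1..}. x d ~= \<gamma> (Suc d)}"
 unfolding lcs_lie_def by (subst ring.simps partial_object.simps, subst carrier_sum_group) (simp_all add: lcs_quotient_group lcs_quotient_carrier)

lemma lcs_lie_simps [simp]:
 "\<zero>\<^sub>L = (\<lambda>d\<in>{1..}. \<gamma> (Suc d))"
 "x +\<^sub>L y = (\<lambda>d\<in>{1..}. x d \<otimes>\<^bsub>\<Q> d\<^esub> y d)"
 by (simp_all add: lcs_lie_def)

lemma lcs_lie_mult: "x *\<^sub>L y = (\<lambda>d\<in>{1..}.
    finprod (\<Q> d) (%k. conv_term x y d k) {1..<d})"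
 by (simp add: lcs_lie_def)

lemma lcs_lie_abelian_group: "abelian_group (lcs_lie G)"
proof -
 let ?S = "sum_group {1..} (\<Q>)"
 interpret S: group ?S by (rule sum_group) (rule lcs_quotient_group)
 have cS: "\<L> = carrier ?S" and zS: "\<zero>\<^sub>L = \<one>\<^bsub>?S\<^esub>"
  and aS: "x +\<^sub>L y = x \<otimes>\<^bsub>?S\<^esub> y" for x y by (simp_all add: lcs_lie_def)
 show ?thesis
 proof (rule abelian_groupI; unfold cS zS aS)
  fix x y assume xy: "x \<in> carrier ?S" "y \<in> carrier ?S"
  have "x d \<otimes>\<^bsub>\<Q> d\<^esub> y d = y d \<otimes>\<^bsub>\<Q> d\<^esub> x d" if "1 \<le> d" for d
  proof -
   interpret Q: comm_group "\<Q> d" by (rule lcs_quotient_comm_group[OF that])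
   show ?thesis using xy that
    by (intro Q.m_comm) (auto simp: carrier_sum_group lcs_quotient_group PiE_iff)
  qed
  thus "x \<otimes>\<^bsub>?S\<^esub> y = y \<otimes>\<^bsub>?S\<^esub> x" by (auto simp: fun_eq_iff)
 next
  fix x assume "x \<in> carrier ?S"
  thus "\<exists>y\<in>carrier ?S. y \<otimes>\<^bsub>?S\<^esub> x = \<one>\<^bsub>?S\<^esub>" using S.l_inv S.inv_closed by blast
 qed (rule S.m_closed S.one_closed S.m_assoc S.l_one; assumption)+
qed

lemma lcs_lie_component:
 assumes "x \<in> \<L>" "1 \<le> d"
 shows "x d \<in> carrier (\<Q> d)"
 using assms by (auto simp: carrier_lcs_lie lcs_quotient_carrier PiE_iff)

lemma lcs_bracket_closed:
 assumes "1 \<le> k" "1 \<le> l" "a \<in> carrier (\<Q> k)" "b \<in> carrier (\<Q> l)"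
 shows "lcs_bracket G k l a b \<in> carrier (\<Q> (k + l))"
 using assms lower_central_commutator[of k l] by (auto simp: lcs_bracket_coset lcs_quotient_carrier)

lemma lcs_bracket_add_left:
 assumes "1 \<le> k" "1 \<le> l" "a \<in> carrier (\<Q> k)" "a' \<in> carrier (\<Q> k)"
  "b \<in> carrier (\<Q> l)"
 shows "lcs_bracket G k l (a \<otimes>\<^bsub>\<Q> k\<^esub> a') b =
   lcs_bracket G k l a b \<otimes>\<^bsub>\<Q> (k + l)\<^esub> lcs_bracket G k l a' b"
proof -
 interpret Q: comm_group "\<Q> (k + l)" using lcs_quotient_comm_group assms by simp
 obtain x x' y where xy: "x \<in> \<gamma> k" "x' \<in> \<gamma> k" "y \<in> \<gamma> l"
  "a = \<gamma> (Suc k) #> x" "a' = \<gamma> (Suc k) #> x'" "b = \<gamma> (Suc l) #> y"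
  using assms by (auto simp: lcs_quotient_carrier)
 have c: "x \<otimes> x' \<in> \<gamma> k"
  using xy by (intro subgroup.m_closed[OF normal_imp_subgroup[OF normal_lower_central]])
 have "lcs_bracket G k l (a \<otimes>\<^bsub>\<Q> k\<^esub> a') b = lcs_bracket G k l a' b \<otimes>\<^bsub>\<Q> (k + l)\<^esub> lcs_bracket G k l a b"
  using assms(1,2) xy c
  by (simp add: lcs_quotient_mult lcs_bracket_coset lcs_commutator_mult_left)
 also have "... = lcs_bracket G k l a b \<otimes>\<^bsub>\<Q> (k + l)\<^esub> lcs_bracket G k l a' b"
  using assms by (intro Q.m_comm lcs_bracket_closed)
 finally show ?thesis .
qed

lemma lcs_bracket_add_right:
 assumes "1 \<le> k" "1 \<le> l" "a \<in> carrier (\<Q> k)" "b \<in> carrier (\<Q> l)"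
  "b' \<in> carrier (\<Q> l)"
 shows "lcs_bracket G k l a (b \<otimes>\<^bsub>\<Q> l\<^esub> b') =
   lcs_bracket G k l a b \<otimes>\<^bsub>\<Q> (k + l)\<^esub> lcs_bracket G k l a b'"
proof -
 obtain x y' y where xy: "x \<in> \<gamma> k" "y' \<in> \<gamma> l" "y \<in> \<gamma> l"
  "a = \<gamma> (Suc k) #> x" "b' = \<gamma> (Suc l) #> y'" "b = \<gamma> (Suc l) #> y"
  using assms by (auto simp: lcs_quotient_carrier)
 have c: "y \<otimes> y' \<in> \<gamma> l"
  using xy by (intro subgroup.m_closed[OF normal_imp_subgroup[OF normal_lower_central]])
 show ?thesis
  using assms(1,2) xy c
  by (simp add: lcs_quotient_mult lcs_bracket_coset lcs_commutator_mult_right)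
qed

lemma lower_central_one_mem [simp]: "\<one> \<in> \<gamma> k"
 using subgroup.one_closed[OF normal_imp_subgroup[OF normal_lower_central]] .

lemma coset_one [simp]: "\<gamma> k #> \<one> = \<gamma> k"
 by (simp add: coset_eq_self normal_lower_central)

lemma lcs_bracket_one:
 assumes "1 \<le> k" "1 \<le> l"
 shows "b \<in> carrier (\<Q> l) ==> lcs_bracket G k l (\<gamma> (Suc k)) b = \<gamma> (Suc (k + l))"
  "a \<in> carrier (\<Q> k) ==> lcs_bracket G k l a (\<gamma> (Suc l)) = \<gamma> (Suc (k + l))"
 using assms lcs_bracket_coset[of k l \<one>] lcs_bracket_coset[of k l _ \<one>] by (auto simp: lcs_quotient_carrier)

lemma lcs_lie_mult_component:
 assumes "x \<in> \<L>" "y \<in> \<L>" "1 \<le> d" "k \<in> {1..<d}"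
 shows "conv_term x y d k \<in> carrier (\<Q> d)"
proof -
 have "1 \<le> k" "1 \<le> d - k" "k + (d - k) = d" using assms by auto
 thus ?thesis
  using lcs_bracket_closed[of k "d - k" "x k" "y (d - k)"] assms lcs_lie_component[of x k]
   lcs_lie_component[of y "d - k"] by simp
qed

lemma lcs_lie_mult_closed:
 assumes x: "x \<in> \<L>" and y: "y \<in> \<L>"
 shows "x *\<^sub>L y \<in> \<L>"
proof -
 have "finite {d \<in> {1..}. x d ~= \<gamma> (Suc d)}" using x by (simp add: carrier_lcs_lie)
 then obtain A where "\<forall>d \<in> {d \<in> {1..}. x d ~= \<gamma> (Suc d)}. d \<le> A"
  unfolding finite_nat_set_iff_bounded_le by blast
 hence A: "!!d. 1 \<le> d ==> x d ~= \<gamma> (Suc d) ==> d \<le> A" by simp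
 have "finite {d \<in> {1..}. y d ~= \<gamma> (Suc d)}" using y by (simp add: carrier_lcs_lie)
 then obtain B where "\<forall>d \<in> {d \<in> {1..}. y d ~= \<gamma> (Suc d)}. d \<le> B"
  unfolding finite_nat_set_iff_bounded_le by blast
 hence B: "!!d. 1 \<le> d ==> y d ~= \<gamma> (Suc d) ==> d \<le> B" by simp
 have cl: "finprod (\<Q> d) (%k. conv_term x y d k) {1..<d} \<in> carrier (\<Q> d)"
  if "1 \<le> d" for d
 proof -
  interpret Q: comm_group "\<Q> d" by (rule lcs_quotient_comm_group[OF that])
  show ?thesis by (rule Q.finprod_closed) (use lcs_lie_mult_component[OF x y that] in blast)
 qed
 \<comment> \<open>Above \<open>A + B\<close> one of the two degrees lies beyond the support of its
   factor, so every summand vanishes.\<close>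
 have zero: "finprod (\<Q> d) (%k. conv_term x y d k) {1..<d} = \<gamma> (Suc d)"
  if "1 \<le> d" "d > A + B" for d
 proof -
  interpret Q: comm_group "\<Q> d" by (rule lcs_quotient_comm_group[OF that(1)])
  have "conv_term x y d k = \<one>\<^bsub>\<Q> d\<^esub>" if "k \<in> {1..<d}" for k
  proof -
   have k: "1 \<le> k" "1 \<le> d - k" "k + (d - k) = d" using that by auto
   consider "k > A" | "d - k > B" using \<open>d > A + B\<close> by linarith
   thus ?thesis
   proof cases
    case 1
    hence "x k = \<gamma> (Suc k)" using A[of k] that by auto
    thus ?thesis using lcs_bracket_one(1)[of k "d - k" "y (d - k)"] k lcs_lie_component[OF y, of "d - k"] by simp
   next
    case 2
    hence "y (d - k) = \<gamma> (Suc (d - k))" using B[of "d - k"] that by auto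
    thus ?thesis using lcs_bracket_one(2)[of k "d - k" "x k"] k lcs_lie_component[OF x, of k] by simp
   qed
  qed
  hence "finprod (\<Q> d) (%k. conv_term x y d k) {1..<d} = \<one>\<^bsub>\<Q> d\<^esub>"
   by (rule Q.finprod_one_eqI)
  thus ?thesis by simp
 qed
 have "{d \<in> {1..}. (x *\<^sub>L y) d ~= \<gamma> (Suc d)} \<subseteq> {..A + B}"
  using zero by (force simp: lcs_lie_mult)
 hence "finite {d \<in> {1..}. (x *\<^sub>L y) d ~= \<gamma> (Suc d)}"
  using finite_subset by blast
 moreover have "(x *\<^sub>L y) \<in> (\<Pi>\<^sub>E d\<in>{1..}. (%g. \<gamma> (Suc d) #> g) ` \<gamma> d)"
  using cl unfolding lcs_quotient_carrier[symmetric] by (simp add: lcs_lie_mult)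
 ultimately show ?thesis by (simp add: carrier_lcs_lie)
qed

lemma lcs_lie_add_left:
 assumes "x \<in> \<L>" "x' \<in> \<L>" "y \<in> \<L>"
 shows "(x +\<^sub>L x') *\<^sub>L y = x *\<^sub>L y +\<^sub>L x' *\<^sub>L y"
proof -
 have "finprod (\<Q> d) (%k. conv_term (x +\<^sub>L x') y d k) {1..<d} =
   finprod (\<Q> d) (%k. conv_term x y d k) {1..<d} \<otimes>\<^bsub>\<Q> d\<^esub>
   finprod (\<Q> d) (%k. conv_term x' y d k) {1..<d}" if d: "1 \<le> d" for d
 proof -
  interpret Q: comm_group "\<Q> d" by (rule lcs_quotient_comm_group[OF d])
  have "finprod (\<Q> d) (%k. conv_term (x +\<^sub>L x') y d k) {1..<d} =
   finprod (\<Q> d) (%k. conv_term x y d k \<otimes>\<^bsub>\<Q> d\<^esub>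
    conv_term x' y d k) {1..<d}"
  proof (rule Q.finprod_cong'[OF HOL.refl])
   show "(%k. conv_term x y d k \<otimes>\<^bsub>\<Q> d\<^esub>
    conv_term x' y d k) \<in> {1..<d} \<rightarrow> carrier (\<Q> d)"
    using lcs_lie_mult_component assms d by (blast intro: Q.m_closed)
   fix k assume "k \<in> {1..<d}"
   hence "1 \<le> k" "1 \<le> d - k" "k + (d - k) = d" by auto
   thus "conv_term (x +\<^sub>L x') y d k = conv_term x y d k \<otimes>\<^bsub>\<Q> d\<^esub>
    conv_term x' y d k"
    using lcs_bracket_add_left[of k "d - k" "x k" "x' k" "y (d - k)"] assms
    by (simp add: lcs_lie_component)
  qed
  also have "... = finprod (\<Q> d) (%k. conv_term x y d k) {1..<d} \<otimes>\<^bsub>\<Q> d\<^esub>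
   finprod (\<Q> d) (%k. conv_term x' y d k) {1..<d}"
   using lcs_lie_mult_component assms d by (intro Q.finprod_multf) blast+
  finally show ?thesis .
 qed
 thus ?thesis by (auto simp: lcs_lie_mult fun_eq_iff)
qed

lemma lcs_lie_add_right:
 assumes "x \<in> \<L>" "y \<in> \<L>" "y' \<in> \<L>"
 shows "x *\<^sub>L (y +\<^sub>L y') = x *\<^sub>L y +\<^sub>L x *\<^sub>L y'"
proof -
 have "finprod (\<Q> d) (%k. conv_term x (y +\<^sub>L y') d k) {1..<d} =
   finprod (\<Q> d) (%k. conv_term x y d k) {1..<d} \<otimes>\<^bsub>\<Q> d\<^esub>
   finprod (\<Q> d) (%k. conv_term x y' d k) {1..<d}" if d: "1 \<le> d" for d
 proof -
  interpret Q: comm_group "\<Q> d" by (rule lcs_quotient_comm_group[OF d])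
  have "finprod (\<Q> d) (%k. conv_term x (y +\<^sub>L y') d k) {1..<d} =
   finprod (\<Q> d) (%k. conv_term x y d k \<otimes>\<^bsub>\<Q> d\<^esub>
    conv_term x y' d k) {1..<d}"
  proof (rule Q.finprod_cong'[OF HOL.refl])
   show "(%k. conv_term x y d k \<otimes>\<^bsub>\<Q> d\<^esub>
    conv_term x y' d k) \<in> {1..<d} \<rightarrow> carrier (\<Q> d)"
    using lcs_lie_mult_component assms d by (blast intro: Q.m_closed)
   fix k assume "k \<in> {1..<d}"
   hence "1 \<le> k" "1 \<le> d - k" "k + (d - k) = d" by auto
   thus "conv_term x (y +\<^sub>L y') d k = conv_term x y d k \<otimes>\<^bsub>\<Q> d\<^esub>
    conv_term x y' d k"
    using lcs_bracket_add_right[of k "d - k" "x k" "y (d - k)" "y' (d - k)"] assms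
    by (simp add: lcs_lie_component)
  qed
  also have "... = finprod (\<Q> d) (%k. conv_term x y d k) {1..<d} \<otimes>\<^bsub>\<Q> d\<^esub>
   finprod (\<Q> d) (%k. conv_term x y' d k) {1..<d}"
   using lcs_lie_mult_component assms d by (intro Q.finprod_multf) blast+
  finally show ?thesis .
 qed
 thus ?thesis by (auto simp: lcs_lie_mult fun_eq_iff)
qed

end

section \<open>Lie ring axioms, verified on homogeneous elements\<close>

context group
begin

declare lcs_lie_simps [simp del]

lemma lower_central_mult [intro]: "x \<in> \<gamma> k ==> y \<in> \<gamma> k ==> x \<otimes> y \<in> \<gamma> k"
 by (rule subgroup.m_closed[OF normal_imp_subgroup[OF normal_lower_central]])

lemma lower_central_inv [intro]: "x \<in> \<gamma> k ==> inv x \<in> \<gamma> k"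
 by (rule subgroup.m_inv_closed[OF normal_imp_subgroup[OF normal_lower_central]])

lemma lcs_homog_closed [simp]: "g \<in> \<gamma> k ==> lcs_homog k g \<in> \<L>"
proof -
 assume g: "g \<in> \<gamma> k"
 have "{d \<in> {1..}. lcs_homog k g d ~= \<gamma> (Suc d)} \<subseteq> {k}"
  by (auto simp: lcs_homog_def)
 hence "finite {d \<in> {1..}. lcs_homog k g d ~= \<gamma> (Suc d)}"
  using finite_subset by blast
 moreover have "\<gamma> (Suc d) \<in> (%g. \<gamma> (Suc d) #> g) ` \<gamma> d" for d
  by (rule image_eqI[of _ _ \<one>]) simp_all
 ultimately show ?thesis
  using g by (auto simp: carrier_lcs_lie lcs_homog_def)
qed

lemma lcs_homog_mult:
 assumes "g \<in> \<gamma> k" "h \<in> \<gamma> k"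
 shows "lcs_homog k (g \<otimes> h) = lcs_homog k g +\<^sub>L lcs_homog k h"
proof
 fix d
 show "lcs_homog k (g \<otimes> h) d = (lcs_homog k g +\<^sub>L lcs_homog k h) d"
  using assms lcs_quotient_mult[of g h k] lcs_quotient_mult[of \<one> \<one> d]
  by (simp add: lcs_lie_simps lcs_homog_def)
qed

lemma lcs_homog_zero_iff:
 assumes "1 \<le> k" "g \<in> carrier G"
 shows "lcs_homog k g = \<zero>\<^sub>L \<longleftrightarrow> g \<in> \<gamma> (Suc k)"
proof
 assume "lcs_homog k g = \<zero>\<^sub>L"
 hence "lcs_homog k g k = \<zero>\<^sub>L k" by simp
 thus "g \<in> \<gamma> (Suc k)"
  using assms coset_eq_self[OF normal_lower_central] by (simp add: lcs_homog_def lcs_lie_simps)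
next
 assume "g \<in> \<gamma> (Suc k)"
 hence "\<gamma> (Suc k) #> g = \<gamma> (Suc k)"
  using assms coset_eq_self[OF normal_lower_central] by simp
 thus "lcs_homog k g = \<zero>\<^sub>L" by (auto simp: lcs_homog_def lcs_lie_simps fun_eq_iff)
qed

lemma lcs_homog_bracket:
 assumes k: "1 \<le> k" and l: "1 \<le> l" and g: "g \<in> \<gamma> k" and h: "h \<in> \<gamma> l"
 shows "lcs_homog k g *\<^sub>L lcs_homog l h = lcs_homog (k + l) (\<kappa> g h)"
proof
 fix d
 show "(lcs_homog k g *\<^sub>L lcs_homog l h) d = lcs_homog (k + l) (\<kappa> g h) d"
 proof (cases "1 \<le> d")
  case False
  thus ?thesis by (simp add: lcs_lie_mult lcs_homog_def)
 next
  case d: True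
  interpret Q: comm_group "\<Q> d" by (rule lcs_quotient_comm_group[OF d])
  let ?f = "%i. lcs_bracket G i (d - i) (lcs_homog k g i) (lcs_homog l h (d - i))"
  have cl: "lcs_homog k g \<in> \<L>" "lcs_homog l h \<in> \<L>" using g h by simp_all
  have zero: "?f i = \<one>\<^bsub>\<Q> d\<^esub>" if i: "i \<in> {1..<d}" "\<not> (i = k \<and> d - i = l)" for i
  proof -
   have i': "1 \<le> i" "1 \<le> d - i" "i + (d - i) = d" using i by auto
   show ?thesis
   proof (cases "i = k")
    case False
    thus ?thesis using i' lcs_bracket_one(1)[OF i'(1,2) lcs_lie_component[OF cl(2) i'(2)]]
     by (simp add: lcs_homog_def)
   next
    case True
    hence "d - i ~= l" using i by simp
    thus ?thesis using i' lcs_bracket_one(2)[OF i'(1,2) lcs_lie_component[OF cl(1) i'(1)]]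
     by (simp add: lcs_homog_def)
   qed
  qed
  have clf: "?f \<in> {1..<d} \<rightarrow> carrier (\<Q> d)"
   using lcs_lie_mult_component[OF cl d] by blast
  show ?thesis
  proof (cases "d = k + l")
   case False
   hence "?f i = \<one>\<^bsub>\<Q> d\<^esub>" if "i \<in> {1..<d}" for i
    using zero[OF that] that by fastforce
   hence "finprod (\<Q> d) ?f {1..<d} = \<one>\<^bsub>\<Q> d\<^esub>"
    by (rule Q.finprod_one_eqI)
   thus ?thesis using d False by (simp add: lcs_lie_mult lcs_homog_def)
  next
   case True
   have ins: "{1..<d} = insert k ({1..<d} - {k})" using True k l by auto
   have "finprod (\<Q> d) ?f ({1..<d} - {k}) = \<one>\<^bsub>\<Q> d\<^esub>"
    by (rule Q.finprod_one_eqI) (use zero in auto)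
   moreover have fk: "?f k \<in> carrier (\<Q> d)" by (rule funcset_mem[OF clf]) (use True k l in auto)
   moreover have "finprod (\<Q> d) ?f (insert k ({1..<d} - {k})) =
     ?f k \<otimes>\<^bsub>\<Q> d\<^esub> finprod (\<Q> d) ?f ({1..<d} - {k})"
    by (rule Q.finprod_insert) (use clf fk in auto)
   ultimately have "finprod (\<Q> d) ?f {1..<d} = ?f k"
    using ins Q.r_one by metis
   also have "... = \<gamma> (Suc d) #> \<kappa> g h"
    using True k l lcs_bracket_coset[OF k l g h] by (simp add: lcs_homog_def)
   finally show ?thesis using True d by (simp add: lcs_lie_mult lcs_homog_def)
  qed
 qed
qed

lemma lcs_lie_induct [consumes 1, case_names zero homog add]:
 assumes x: "x \<in> \<L>"
  and zero: "P \<zero>\<^sub>L"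
  and homog: "!!k g. 1 \<le> k ==> g \<in> \<gamma> k ==> P (lcs_homog k g)"
  and add: "!!x y. x \<in> \<L> ==> y \<in> \<L> ==> P x ==> P y ==> P (x +\<^sub>L y)"
 shows "P x"
proof -
 have "P x" if "finite F" "x \<in> \<L>" "{d \<in> {1..}. x d ~= \<gamma> (Suc d)} \<subseteq> F" for F x
  using that
 proof (induction F arbitrary: x rule: finite_induct)
  case empty
  hence "x = \<zero>\<^sub>L"
   by (auto simp: carrier_lcs_lie lcs_lie_simps fun_eq_iff PiE_iff extensional_def)
  thus ?case using zero by simp
 next
  case (insert k F)
  show ?case
  proof (cases "1 \<le> k")
   case False
   hence "{d \<in> {1..}. x d ~= \<gamma> (Suc d)} \<subseteq> F" using insert.prems by auto
   thus ?thesis using insert by blast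
  next
   case k: True
   hence "x k \<in> carrier (\<Q> k)" using insert.prems by (intro lcs_lie_component)
   then obtain g where g: "g \<in> \<gamma> k" "x k = \<gamma> (Suc k) #> g"
    unfolding lcs_quotient_carrier by blast
   define x' where "x' = x(k := \<gamma> (Suc k))"
   have sub: "{d \<in> {1..}. x' d ~= \<gamma> (Suc d)} \<subseteq> F" using insert.prems by (auto simp: x'_def)
   have one: "\<gamma> (Suc d) \<in> (%g. \<gamma> (Suc d) #> g) ` \<gamma> d" for d
    by (rule image_eqI[of _ _ \<one>]) simp_all
   have x': "x' \<in> \<L>"
    using insert.prems finite_subset[OF sub insert.hyps(1)] k one
    by (auto simp: carrier_lcs_lie x'_def PiE_iff extensional_def)
   have "x = lcs_homog k g +\<^sub>L x'"
   proof
    fix d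
    show "x d = (lcs_homog k g +\<^sub>L x') d"
    proof (cases "1 \<le> d")
     case False
     thus ?thesis using insert.prems by (auto simp: lcs_lie_simps carrier_lcs_lie PiE_iff extensional_def)
    next
     case d: True
     interpret Q: group "\<Q> d" by (rule lcs_quotient_group)
     have xd: "x d \<in> carrier (\<Q> d)" using insert.prems d by (intro lcs_lie_component)
     show ?thesis
      using d g Q.l_one[OF xd] Q.r_one[OF xd] by (auto simp: lcs_lie_simps lcs_homog_def x'_def)
    qed
   qed
   thus ?thesis using add homog k g x' insert.IH[OF x' sub] by simp
  qed
 qed
 thus ?thesis using x by (auto simp: carrier_lcs_lie)
qed

lemma lcs_lie_zero_mult:
 assumes "x \<in> \<L>"
 shows "\<zero>\<^sub>L *\<^sub>L x = \<zero>\<^sub>L" "x *\<^sub>L \<zero>\<^sub>L = \<zero>\<^sub>L"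
proof -
 interpret L: abelian_group "lcs_lie G" by (rule lcs_lie_abelian_group)
 show "\<zero>\<^sub>L *\<^sub>L x = \<zero>\<^sub>L"
  using lcs_lie_add_left[of "\<zero>\<^sub>L" "\<zero>\<^sub>L" x] assms lcs_lie_mult_closed[of "\<zero>\<^sub>L" x]
  by (simp add: L.add.l_cancel_one')
 show "x *\<^sub>L \<zero>\<^sub>L = \<zero>\<^sub>L"
  using lcs_lie_add_right[of x "\<zero>\<^sub>L" "\<zero>\<^sub>L"] assms lcs_lie_mult_closed[of x "\<zero>\<^sub>L"]
  by (simp add: L.add.l_cancel_one')
qed

lemma lcs_lie_antisym:
 assumes x: "x \<in> \<L>" and y: "y \<in> \<L>"
 shows "x *\<^sub>L y +\<^sub>L y *\<^sub>L x = \<zero>\<^sub>L"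
proof -
 interpret L: abelian_group "lcs_lie G" by (rule lcs_lie_abelian_group)
 note simps = lcs_lie_zero_mult lcs_lie_mult_closed lcs_lie_add_left lcs_lie_add_right
 have swap: "(a +\<^sub>L b) +\<^sub>L (c +\<^sub>L d) = (a +\<^sub>L c) +\<^sub>L (b +\<^sub>L d)"
  if "a \<in> \<L>" "b \<in> \<L>" "c \<in> \<L>" "d \<in> \<L>" for a b c d
  using that by (simp add: L.a_ac)
 show ?thesis using x y
 proof (induction x rule: lcs_lie_induct)
  case zero thus ?case by (simp add: simps)
 next
  case (add u v)
  thus ?case using y swap[of "u *\<^sub>L y" "v *\<^sub>L y" "y *\<^sub>L u" "y *\<^sub>L v"]
   by (simp add: simps)
 next
  case (homog k g)
  note kg = this
  show ?case using y
  proof (induction y rule: lcs_lie_induct)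
   case zero thus ?case using kg by (simp add: simps)
  next
   case (add u v) thus ?case using kg by (simp add: simps swap)
  next
   case (homog l h)
   have "\<kappa> g h \<in> \<gamma> (k + l)" "\<kappa> h g \<in> \<gamma> (k + l)"
    using kg homog lower_central_commutator[of k l g h] lower_central_commutator[of l k h g] by (simp_all add: add.commute)
   hence "lcs_homog (k + l) (\<kappa> g h) +\<^sub>L lcs_homog (k + l) (\<kappa> h g) = lcs_homog (k + l) (\<kappa> g h \<otimes> \<kappa> h g)"
    by (simp add: lcs_homog_mult)
   also have "\<kappa> g h \<otimes> \<kappa> h g = \<one>" using kg homog by (simp add: inv_commutator[of g h, symmetric])
   also have "lcs_homog (k + l) \<one> = \<zero>\<^sub>L" using kg by (subst lcs_homog_zero_iff) auto
   finally show ?case using kg homog by (simp add: lcs_homog_bracket add.commute)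
  qed
 qed
qed

text \<open>Hall-Witt without its conjugations: \<open>b c b^-1\<close> is
  \<open>\<kappa> b c \<otimes> c\<close>, and \<open>\<kappa> b c\<close> lies deeper in the series
  than \<open>c\<close>, so replacing one by the other does not change the class.\<close>

lemma lcs_jacobi_homog:
 assumes k: "1 \<le> i" "1 \<le> j" "1 \<le> k" and x: "x \<in> \<gamma> i" and y: "y \<in> \<gamma> j"
  and z: "z \<in> \<gamma> k"
 shows "\<kappa> (\<kappa> x y) z \<otimes> (\<kappa> (\<kappa> y z) x \<otimes> \<kappa> (\<kappa> z x) y) \<in> \<gamma> (Suc (i + j + k))"
proof -
 let ?N = "\<gamma> (Suc (i + j + k))"
 let ?Q = "\<Q> (i + j + k)"
 have step: "?N #> \<kappa> (\<kappa> a b) (b \<otimes> c \<otimes> inv b) = ?N #> \<kappa> (\<kappa> a b) c"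
  if "1 \<le> p" "1 \<le> q" "1 \<le> r" "p + q + r = i + j + k" "a \<in> \<gamma> p" "b \<in> \<gamma> q" "c \<in> \<gamma> r"
  for a b c p q r
 proof -
  have 1: "\<kappa> a b \<in> \<gamma> (p + q)" using that by (intro lower_central_commutator)
  have "\<kappa> b c \<in> \<gamma> (q + r)" using that by (intro lower_central_commutator)
  moreover have "\<gamma> (q + r) \<subseteq> \<gamma> (Suc r)" by (rule lower_central_antimono) (use that in simp)
  ultimately have "\<kappa> b c \<in> \<gamma> (Suc r)" by blast
  hence "\<gamma> (Suc (p + q + r)) #> \<kappa> (\<one> \<otimes> \<kappa> a b) (\<kappa> b c \<otimes> c) = \<gamma> (Suc (p + q + r)) #> \<kappa> (\<kappa> a b) c"
   using that 1 by (intro lcs_commutator_cong) auto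
  moreover have "\<kappa> b c \<otimes> c = b \<otimes> c \<otimes> inv b" using that by (intro conj_eq_commutator[symmetric]) auto
  ultimately show ?thesis using that by simp
 qed
 have m: "?N #> (a \<otimes> b) = (?N #> a) \<otimes>\<^bsub>?Q\<^esub> (?N #> b)" if "a \<in> carrier G" "b \<in> carrier G" for a b
  using that by (rule lcs_quotient_mult[symmetric])
 have c: "x \<in> carrier G" "y \<in> carrier G" "z \<in> carrier G" using x y z by auto
 have "?N #> (\<kappa> (\<kappa> x y) z \<otimes> (\<kappa> (\<kappa> y z) x \<otimes> \<kappa> (\<kappa> z x) y)) =
   ?N #> (\<kappa> (\<kappa> x y) (y \<otimes> z \<otimes> inv y) \<otimes> (\<kappa> (\<kappa> y z) (z \<otimes> x \<otimes> inv z) \<otimes> \<kappa> (\<kappa> z x) (x \<otimes> y \<otimes> inv x)))"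
  using c step[of i j k x y z] step[of j k i y z x] step[of k i j z x y] k x y z
  by (simp add: m)
 also have "... = ?N" using hall_witt[OF c] by simp
 finally show ?thesis using c by (subst (asm) coset_eq_self[OF normal_lower_central]) auto
qed

lemma lcs_lie_jacobi:
 assumes x: "x \<in> \<L>" and y: "y \<in> \<L>" and z: "z \<in> \<L>"
 shows "(x *\<^sub>L y) *\<^sub>L z +\<^sub>L ((y *\<^sub>L z) *\<^sub>L x
   +\<^sub>L (z *\<^sub>L x) *\<^sub>L y) = \<zero>\<^sub>L"
proof -
 interpret L: abelian_group "lcs_lie G" by (rule lcs_lie_abelian_group)
 note simps = lcs_lie_zero_mult lcs_lie_mult_closed lcs_lie_add_left lcs_lie_add_right
 have swap: "(a +\<^sub>L b) +\<^sub>L ((c +\<^sub>L d) +\<^sub>L (e +\<^sub>L f)) =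
   (a +\<^sub>L (c +\<^sub>L e)) +\<^sub>L (b +\<^sub>L (d +\<^sub>L f))"
  if "a \<in> \<L>" "b \<in> \<L>" "c \<in> \<L>" "d \<in> \<L>"
   "e \<in> \<L>" "f \<in> \<L>" for a b c d e f
  using that by (simp add: L.a_ac)
 show ?thesis using x
 proof (induction x rule: lcs_lie_induct)
  case zero thus ?case using y z by (simp add: simps)
 next
  case (add u v) thus ?case using y z by (simp add: simps swap)
 next
  case (homog i a)
  note ia = this
  show ?case using y
  proof (induction y rule: lcs_lie_induct)
   case zero thus ?case using ia z by (simp add: simps)
  next
   case (add u v) thus ?case using ia z by (simp add: simps swap)
  next
   case (homog j b)
   note jb = this
   show ?case using z
   proof (induction z rule: lcs_lie_induct)
    case zero thus ?case using ia jb by (simp add: simps)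
   next
    case (add u v) thus ?case using ia jb by (simp add: simps swap)
   next
    case (homog k c)
    have 1: "\<kappa> a b \<in> \<gamma> (i + j)" "\<kappa> b c \<in> \<gamma> (j + k)" "\<kappa> c a \<in> \<gamma> (k + i)"
     using ia jb homog by (auto intro: lower_central_commutator)
    hence 2: "\<kappa> (\<kappa> a b) c \<in> \<gamma> (i + j + k)" "\<kappa> (\<kappa> b c) a \<in> \<gamma> (j + k + i)"
      "\<kappa> (\<kappa> c a) b \<in> \<gamma> (k + i + j)"
     using ia jb homog by (auto intro!: lower_central_commutator)
    have e: "j + k + i = i + j + k" "k + i + j = i + j + k" by simp_all
    have "lcs_homog (i + j + k) (\<kappa> (\<kappa> a b) c \<otimes> (\<kappa> (\<kappa> b c) a \<otimes> \<kappa> (\<kappa> c a) b)) = \<zero>\<^sub>L"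
     using lcs_jacobi_homog[of i j k a b c] ia jb homog by (subst lcs_homog_zero_iff) auto
    thus ?case
     using ia jb homog 1 2[unfolded e] by (simp add: lcs_homog_bracket lcs_homog_mult e lower_central_mult)
   qed
  qed
 qed
qed

lemma lcs_lie_lie_ring: "lie_ring (lcs_lie G)"
proof -
 interpret L: abelian_group "lcs_lie G" by (rule lcs_lie_abelian_group)
 note simps = lcs_lie_zero_mult lcs_lie_mult_closed lcs_lie_add_left lcs_lie_add_right
 show ?thesis
 proof
  fix x assume x: "x \<in> \<L>"
  thus "x *\<^sub>L x = \<zero>\<^sub>L"
  proof (induction x rule: lcs_lie_induct)
   case zero thus ?case by (simp add: simps)
  next
   case (homog k g)
   hence "lcs_homog (k + k) \<one> = \<zero>\<^sub>L" by (subst lcs_homog_zero_iff) auto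
   thus ?case using homog by (simp add: lcs_homog_bracket)
  next
   case (add u v)
   thus ?case using lcs_lie_antisym[of v u] by (simp add: simps)
  qed
 next
  fix x y z assume xyz: "x \<in> \<L>" "y \<in> \<L>" "z \<in> \<L>"
  have anti: "a *\<^sub>L b = \<ominus>\<^bsub>lcs_lie G\<^esub> (b *\<^sub>L a)" if "a \<in> \<L>" "b \<in> \<L>" for a b
   using that lcs_lie_antisym[of a b] by (intro L.minus_equality[symmetric]) (simp_all add: simps)
  have "x *\<^sub>L (y *\<^sub>L z) +\<^sub>L (y *\<^sub>L (z *\<^sub>L x) +\<^sub>L z *\<^sub>L (x *\<^sub>L y)) =
   \<ominus>\<^bsub>lcs_lie G\<^esub> ((x *\<^sub>L y) *\<^sub>L z +\<^sub>L ((y *\<^sub>L z) *\<^sub>L x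
   +\<^sub>L (z *\<^sub>L x) *\<^sub>L y))"
   using xyz anti[of x "y *\<^sub>L z"] anti[of y "z *\<^sub>L x"] anti[of z "x *\<^sub>L y"]
   by (simp add: simps L.minus_add L.a_ac)
  also have "... = \<zero>\<^sub>L" using lcs_lie_jacobi[OF xyz] by simp
  finally show "x *\<^sub>L (y *\<^sub>L z) +\<^sub>L (y *\<^sub>L (z *\<^sub>L x) +\<^sub>L z *\<^sub>L (x *\<^sub>L y)) = \<zero>\<^sub>L" .
 qed (rule lcs_lie_mult_closed lcs_lie_add_left lcs_lie_add_right; assumption)+
qed

end

subsection \<open>Lie homomorphisms\<close>

context lie_ring
begin

lemma br_zero [simp]:
 assumes "x \<in> carrier L"
 shows "\<zero> \<otimes> x = \<zero>" "x \<otimes> \<zero> = \<zero>"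
 using br_add_left[of \<zero> \<zero> x] br_add_right[of x \<zero> \<zero>] br_closed[of \<zero> x] br_closed[of x \<zero>] assms
 by (simp_all add: add.l_cancel_one')

lemma br_minus_left: "x \<in> carrier L ==> y \<in> carrier L ==> (\<ominus> x) \<otimes> y = \<ominus> (x \<otimes> y)"
 using br_add_left[of "\<ominus> x" x y] br_closed by (intro minus_equality[symmetric]) (simp_all add: l_neg)

lemma br_minus_right: "x \<in> carrier L ==> y \<in> carrier L ==> x \<otimes> (\<ominus> y) = \<ominus> (x \<otimes> y)"
 using br_add_right[of x "\<ominus> y" y] br_closed by (intro minus_equality[symmetric]) (simp_all add: l_neg)

lemma br_anticomm:
 assumes "x \<in> carrier L" "y \<in> carrier L"
 shows "y \<otimes> x = \<ominus> (x \<otimes> y)"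
proof -
 have "(x \<oplus> y) \<otimes> (x \<oplus> y) = \<zero>" using assms by (intro br_self) simp
 hence "x \<otimes> y \<oplus> y \<otimes> x = \<zero>"
  using assms br_self[of x] br_self[of y] a_comm[of "x \<otimes> y" "y \<otimes> x"]
  by (simp add: br_add_left br_add_right br_closed)
 thus ?thesis using assms by (intro minus_equality[symmetric]) (simp_all add: br_closed a_comm)
qed

lemma leibniz:
 assumes "x \<in> carrier L" "y \<in> carrier L" "z \<in> carrier L"
 shows "x \<otimes> (y \<otimes> z) = (x \<otimes> y) \<otimes> z \<oplus> y \<otimes> (x \<otimes> z)"
proof -
 have "x \<otimes> (y \<otimes> z) = \<ominus> (y \<otimes> (z \<otimes> x) \<oplus> z \<otimes> (x \<otimes> y))"
  using jacobi[OF assms] assms by (intro minus_equality[symmetric]) (simp_all add: br_closed)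
 also have "... = \<ominus> (y \<otimes> (z \<otimes> x)) \<oplus> \<ominus> (z \<otimes> (x \<otimes> y))"
  using assms by (simp add: minus_add br_closed)
 also have "\<ominus> (y \<otimes> (z \<otimes> x)) = y \<otimes> (x \<otimes> z)"
  using assms br_anticomm[of x z] by (simp add: br_minus_right br_closed)
 also have "\<ominus> (z \<otimes> (x \<otimes> y)) = (x \<otimes> y) \<otimes> z"
  using assms br_anticomm[of z "x \<otimes> y"] by (simp add: br_closed)
 finally show ?thesis using assms by (simp add: a_comm br_closed)
qed

end

lemma lie_homD:
 assumes "f \<in> lie_hom K L"
 shows "x \<in> carrier K ==> f x \<in> carrier L"
  "x \<in> carrier K ==> y \<in> carrier K ==> f (x \<oplus>\<^bsub>K\<^esub> y) = f x \<oplus>\<^bsub>L\<^esub> f y"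
  "x \<in> carrier K ==> y \<in> carrier K ==> f (x \<otimes>\<^bsub>K\<^esub> y) = f x \<otimes>\<^bsub>L\<^esub> f y"
 using assms by (auto simp: lie_hom_def)

lemma additive_zero_neg:
 assumes "abelian_group K" "abelian_group L" "!!x. x \<in> carrier K ==> f x \<in> carrier L"
  and add: "!!x y. x \<in> carrier K ==> y \<in> carrier K ==> f (x \<oplus>\<^bsub>K\<^esub> y) = f x \<oplus>\<^bsub>L\<^esub> f y"
 shows "f \<zero>\<^bsub>K\<^esub> = \<zero>\<^bsub>L\<^esub>" "x \<in> carrier K ==> f (\<ominus>\<^bsub>K\<^esub> x) = \<ominus>\<^bsub>L\<^esub> f x"
proof -
 interpret K: abelian_group K by fact
 interpret L: abelian_group L by fact
 show 0: "f \<zero>\<^bsub>K\<^esub> = \<zero>\<^bsub>L\<^esub>"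
  using add[of "\<zero>\<^bsub>K\<^esub>" "\<zero>\<^bsub>K\<^esub>"] assms(3)[of "\<zero>\<^bsub>K\<^esub>"] by (simp add: L.add.l_cancel_one')
 assume x: "x \<in> carrier K"
 thus "f (\<ominus>\<^bsub>K\<^esub> x) = \<ominus>\<^bsub>L\<^esub> f x"
  using add[of "\<ominus>\<^bsub>K\<^esub> x" x] 0 assms(3) by (intro L.minus_equality[symmetric]) (simp_all add: K.l_neg)
qed

lemma lie_hom_zero_neg:
 assumes "f \<in> lie_hom K L" "lie_ring K" "lie_ring L"
 shows "f \<zero>\<^bsub>K\<^esub> = \<zero>\<^bsub>L\<^esub>" "x \<in> carrier K ==> f (\<ominus>\<^bsub>K\<^esub> x) = \<ominus>\<^bsub>L\<^esub> f x"
 using additive_zero_neg[of K L f] assms lie_homD[OF assms(1)] by (auto simp: lie_ring_def)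

lemma lie_hom_compose: "f \<in> lie_hom K L ==> g \<in> lie_hom L M ==> g \<circ> f \<in> lie_hom K M"
 by (simp add: lie_hom_def Pi_iff)

subsection \<open>The universal property of free Lie algebras\<close>

primrec lieval :: "('l, 'm) ring_scheme => ('a => 'l) => 'a lie_term => 'l" where
 "lieval L f (LGen a) = f a"
| "lieval L f LZero = \<zero>\<^bsub>L\<^esub>"
| "lieval L f (LNeg t) = \<ominus>\<^bsub>L\<^esub> lieval L f t"
| "lieval L f (LAdd s t) = lieval L f s \<oplus>\<^bsub>L\<^esub> lieval L f t"
| "lieval L f (LBr s t) = lieval L f s \<otimes>\<^bsub>L\<^esub> lieval L f t"

text \<open>Evaluates a chosen representative. By \<open>lieval_cong\<close> the choice does not
  matter as soon as \<open>f\<close> takes all letters, not just those of a given set, into the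
  carrier.\<close>

definition free_lie_lift :: "('l, 'm) ring_scheme => ('a => 'l) => 'a free_lie => 'l" where
 "free_lie_lift L f a = lieval L f (rep_free_lie a)"

context lie_ring
begin

lemma lieval_closed: "f \<in> UNIV \<rightarrow> carrier L ==> lieval L f t \<in> carrier L"
 by (induction t) (auto simp: br_closed)

lemma lieval_cong:
 assumes "lie_eq s t" "f \<in> UNIV \<rightarrow> carrier L"
 shows "lieval L f s = lieval L f t"
proof -
 note jac = jacobi
 show ?thesis using assms
 proof (induction rule: lie_eq.induct)
  case (jacobi s t u)
  thus ?case using lieval_closed[OF jacobi.prems] jac by simp
 qed (simp_all add: lieval_closed br_add_left br_add_right br_self a_ac l_neg r_neg)
qed

lemma free_lie_lift_abs: "f \<in> UNIV \<rightarrow> carrier L ==> free_lie_lift L f (abs_free_lie t) = lieval L f t"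
 unfolding free_lie_lift_def
 by (rule lieval_cong) (metis Quotient_free_lie Quotient_rep_abs lie_eq.refl)

end

lemma free_lie_carrier_iff: "x \<in> carrier (free_lie S) \<longleftrightarrow> (\<exists>t. set_lie_term t \<subseteq> S \<and> x = abs_free_lie t)"
 by (auto simp: free_lie_def)

lemma free_lie_ops [simp]:
 "x \<oplus>\<^bsub>free_lie S\<^esub> y = x + y" "x \<otimes>\<^bsub>free_lie S\<^esub> y = fl_br x y" "\<zero>\<^bsub>free_lie S\<^esub> = 0"
 by (simp_all add: free_lie_def plus_free_lie_def zero_free_lie_def)

lemma free_lie_closed [simp]:
 "x \<in> carrier (free_lie S) ==> y \<in> carrier (free_lie S) ==> x + y \<in> carrier (free_lie S)"
 "x \<in> carrier (free_lie S) ==> y \<in> carrier (free_lie S) ==> fl_br x y \<in> carrier (free_lie S)"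
 "0 \<in> carrier (free_lie S)" "x \<in> carrier (free_lie S) ==> - x \<in> carrier (free_lie S)"
 "a \<in> S ==> fl_gen a \<in> carrier (free_lie S)"
proof -
 interpret F: lie_ring "free_lie S" by (rule free_lie_is_lie_ring)
 show "x + y \<in> carrier (free_lie S)" "fl_br x y \<in> carrier (free_lie S)"
  if "x \<in> carrier (free_lie S)" "y \<in> carrier (free_lie S)"
  using F.a_closed[OF that] F.br_closed[OF that] by simp_all
 show "0 \<in> carrier (free_lie S)" using F.zero_closed by simp
 show "- x \<in> carrier (free_lie S)" if "x \<in> carrier (free_lie S)"
  using that unfolding free_lie_carrier_iff by (metis fl_abs_simps(2) lie_term.set(3))
 show "fl_gen a \<in> carrier (free_lie S)" if "a \<in> S"
  unfolding free_lie_carrier_iff by (rule exI[of _ "LGen a"]) (simp add: that fl_abs_simps)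
qed

lemma free_lie_uminus [simp]:
 assumes "x \<in> carrier (free_lie S)"
 shows "\<ominus>\<^bsub>free_lie S\<^esub> x = - x"
proof -
 interpret F: lie_ring "free_lie S" by (rule free_lie_is_lie_ring)
 show ?thesis by (rule F.minus_equality) (use assms in simp_all)
qed

lemma free_lie_minus [simp]:
 assumes "x \<in> carrier (free_lie S)" "y \<in> carrier (free_lie S)"
 shows "x \<ominus>\<^bsub>free_lie S\<^esub> y = x - y"
 using assms by (simp add: a_minus_def)

lemma free_lie_induct [consumes 1, case_names gen zero neg add br]:
 assumes "x \<in> carrier (free_lie S)"
  and "!!a. a \<in> S ==> P (fl_gen a)" "P 0"
  and "!!x. x \<in> carrier (free_lie S) ==> P x ==> P (- x)"
  and "!!x y. x \<in> carrier (free_lie S) ==> y \<in> carrier (free_lie S) ==> P x ==> P y ==> P (x + y)"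
  and "!!x y. x \<in> carrier (free_lie S) ==> y \<in> carrier (free_lie S) ==> P x ==> P y ==> P (fl_br x y)"
 shows "P x"
proof -
 obtain t where t: "set_lie_term t \<subseteq> S" "x = abs_free_lie t"
  using assms(1) by (auto simp: free_lie_carrier_iff)
 have c: "abs_free_lie s \<in> carrier (free_lie S)" if "set_lie_term s \<subseteq> S" for s
  using that by (auto simp: free_lie_carrier_iff)
 have "P (abs_free_lie t)" using t(1)
  by (induction t) (auto simp: fl_abs_simps intro!: assms(2-) c)
 thus ?thesis by (simp add: t)
qed

lemma free_lie_lift_hom:
 fixes L :: "('l, 'm) ring_scheme" and f :: "'x => 'l"
 assumes "lie_ring L" "f \<in> UNIV \<rightarrow> carrier L"
 shows "free_lie_lift L f \<in> lie_hom (free_lie S) L" "free_lie_lift L f (fl_gen a) = f a"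
  "free_lie_lift L f (x + y) = free_lie_lift L f x \<oplus>\<^bsub>L\<^esub> free_lie_lift L f y"
  "free_lie_lift L f (fl_br x y) = free_lie_lift L f x \<otimes>\<^bsub>L\<^esub> free_lie_lift L f y"
  "free_lie_lift L f x \<in> carrier L"
  "free_lie_lift L f 0 = \<zero>\<^bsub>L\<^esub>" "free_lie_lift L f (- x) = \<ominus>\<^bsub>L\<^esub> free_lie_lift L f x"
proof -
 interpret lie_ring L by fact
 have rep: "\<exists>t. x = abs_free_lie t" for x :: "'x free_lie" by (metis Quotient_free_lie Quotient_abs_rep)
 note lift = free_lie_lift_abs[OF assms(2)]
 show add: "free_lie_lift L f (x + y) = free_lie_lift L f x \<oplus>\<^bsub>L\<^esub> free_lie_lift L f y" for x y
  using rep[of x] rep[of y] by (auto simp: lift simp flip: fl_abs_simps)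
 show br: "free_lie_lift L f (fl_br x y) = free_lie_lift L f x \<otimes>\<^bsub>L\<^esub> free_lie_lift L f y" for x y
  using rep[of x] rep[of y] by (auto simp: lift simp flip: fl_abs_simps)
 show cl: "free_lie_lift L f x \<in> carrier L" for x
  by (simp add: free_lie_lift_def lieval_closed[OF assms(2)])
 show "free_lie_lift L f (- x) = \<ominus>\<^bsub>L\<^esub> free_lie_lift L f x"
  using rep[of x] by (auto simp: lift simp flip: fl_abs_simps)
 show "free_lie_lift L f 0 = \<zero>\<^bsub>L\<^esub>" "free_lie_lift L f (fl_gen a) = f a"
  by (simp_all add: lift flip: fl_abs_simps)
 show "free_lie_lift L f \<in> lie_hom (free_lie S) L"
  by (auto simp: lie_hom_def add br cl)
qed

subsection \<open>Functoriality of the lower central series\<close>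

definition lcs_map :: "('a, 'm) monoid_scheme => ('b, 'n) monoid_scheme => ('a => 'b) => (nat => 'a set) => nat => 'b set" where
 "lcs_map G K f x = (\<lambda>d\<in>{1..}. \<Union>g\<in>x d. lower_central K (Suc d) #>\<^bsub>K\<^esub> f g)"

context group_hom
begin

lemma hom_commutator:
 "x \<in> carrier G ==> y \<in> carrier G ==> h (commutator G x y) = commutator H (h x) (h y)"
 by (simp add: commutator_def)

lemma hom_lower_central: "g \<in> lower_central G k ==> h g \<in> lower_central H k"
proof (induction k arbitrary: g)
 case (Suc k)
 show ?case
 proof (cases "k = 0")
  case False
  hence k: "1 \<le> k" by simp
  have "g \<in> generate G {commutator G a b |a b. a \<in> carrier G \<and> b \<in> lower_central G k}"
   using Suc.prems by (simp add: G.lower_central_Suc[OF k])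
  hence "g \<in> carrier G \<and> h g \<in> lower_central H (Suc k)"
  proof (induction rule: generate.induct)
   case (incl x)
   then obtain a b where "x = commutator G a b" "a \<in> carrier G" "b \<in> lower_central G k" by blast
   thus ?case using Suc.IH[of b] H.commutator_lower_Suc[OF k, of "h a" "h b"] by (simp add: hom_commutator)
  next
   case (inv x)
   then obtain a b where "x = commutator G a b" "a \<in> carrier G" "b \<in> lower_central G k" by blast
   thus ?case using Suc.IH[of b] H.commutator_lower_Suc[OF k, of "h a" "h b"]
    by (auto simp: hom_commutator)
  qed auto
  thus ?thesis by simp
 qed (use Suc.prems in simp)
qed simp

lemma lcs_map_coset:
 assumes "g \<in> lower_central G d"
 shows "(\<Union>x\<in>lower_central G (Suc d) #> g. lower_central H (Suc d) #>\<^bsub>H\<^esub> h x) = lower_central H (Suc d) #>\<^bsub>H\<^esub> h g"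
proof -
 have "lower_central H (Suc d) #>\<^bsub>H\<^esub> h x = lower_central H (Suc d) #>\<^bsub>H\<^esub> h g" if x: "x \<in> lower_central G (Suc d) #> g" for x
 proof -
  obtain n where n: "n \<in> lower_central G (Suc d)" "x = n \<otimes> g" using x by (auto simp: r_coset_def)
  have hn: "h n \<in> lower_central H (Suc d)" using n by (intro hom_lower_central)
  show ?thesis
  proof (rule H.coset_eqI[OF H.normal_lower_central])
   show "h x \<otimes>\<^bsub>H\<^esub> inv\<^bsub>H\<^esub> h g \<in> lower_central H (Suc d)"
    using n assms hn by (simp add: H.m_assoc)
  qed (use n assms in auto)
 qed
 moreover have "g \<in> lower_central G (Suc d) #> g"
  using assms by (auto intro!: G.rcos_self normal_imp_subgroup G.normal_lower_central)
 ultimately show ?thesis by blast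
qed

lemma lcs_map_component:
 assumes "x \<in> carrier (lcs_lie G)" "1 \<le> d"
 obtains g where "g \<in> lower_central G d" "x d = lower_central G (Suc d) #> g"
  "lcs_map G H h x d = lower_central H (Suc d) #>\<^bsub>H\<^esub> h g"
 using G.lcs_lie_component[OF assms] assms lcs_map_coset that
 by (fastforce simp: G.lcs_quotient_carrier lcs_map_def)

lemma lcs_map_closed:
 assumes x: "x \<in> carrier (lcs_lie G)"
 shows "lcs_map G H h x \<in> carrier (lcs_lie H)"
proof -
 have one: "lcs_map G H h x d = lower_central H (Suc d)" if "1 \<le> d" "x d = lower_central G (Suc d)" for d
  using lcs_map_coset[of \<one> d] that by (simp add: lcs_map_def)
 have "{d \<in> {1..}. lcs_map G H h x d ~= lower_central H (Suc d)} \<subseteq> {d \<in> {1..}. x d ~= lower_central G (Suc d)}"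
  using one by force
 moreover have "finite {d \<in> {1..}. x d ~= lower_central G (Suc d)}" using x by (simp add: G.carrier_lcs_lie)
 ultimately have fin: "finite {d \<in> {1..}. lcs_map G H h x d ~= lower_central H (Suc d)}"
  by (rule finite_subset)
 have "lcs_map G H h x d \<in> carrier (lcs_quotient H d)" if "1 \<le> d" for d
  by (rule lcs_map_component[OF x that]) (auto simp: H.lcs_quotient_carrier hom_lower_central)
 thus ?thesis using fin
  by (simp add: H.carrier_lcs_lie H.lcs_quotient_carrier PiE_iff) (simp add: lcs_map_def)
qed

lemma lcs_map_add:
 assumes x: "x \<in> carrier (lcs_lie G)" and y: "y \<in> carrier (lcs_lie G)"
 shows "lcs_map G H h (x \<oplus>\<^bsub>lcs_lie G\<^esub> y) = lcs_map G H h x \<oplus>\<^bsub>lcs_lie H\<^esub> lcs_map G H h y"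
proof
 fix d
 show "lcs_map G H h (x \<oplus>\<^bsub>lcs_lie G\<^esub> y) d = (lcs_map G H h x \<oplus>\<^bsub>lcs_lie H\<^esub> lcs_map G H h y) d"
 proof (cases "1 \<le> d")
  case False
  thus ?thesis by (simp add: lcs_map_def H.lcs_lie_simps)
 next
  case d: True
  obtain g where g: "g \<in> lower_central G d" "x d = lower_central G (Suc d) #> g"
    "lcs_map G H h x d = lower_central H (Suc d) #>\<^bsub>H\<^esub> h g" by (rule lcs_map_component[OF x d])
  obtain g' where g': "g' \<in> lower_central G d" "y d = lower_central G (Suc d) #> g'"
    "lcs_map G H h y d = lower_central H (Suc d) #>\<^bsub>H\<^esub> h g'" by (rule lcs_map_component[OF y d])
  have "lcs_map G H h (x \<oplus>\<^bsub>lcs_lie G\<^esub> y) d = lower_central H (Suc d) #>\<^bsub>H\<^esub> h (g \<otimes> g')"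
   using lcs_map_coset[OF G.lower_central_mult[OF g(1) g'(1)]] d g g'
   by (simp add: lcs_map_def G.lcs_lie_simps G.lcs_quotient_mult)
  thus ?thesis using d g g' by (simp add: H.lcs_lie_simps H.lcs_quotient_mult)
 qed
qed

lemma lcs_map_homog:
 assumes "g \<in> lower_central G k"
 shows "lcs_map G H h (G.lcs_homog k g) = H.lcs_homog k (h g)"
proof
 fix d show "lcs_map G H h (G.lcs_homog k g) d = H.lcs_homog k (h g) d"
  using lcs_map_coset[OF assms] lcs_map_coset[of \<one> d]
  by (auto simp: lcs_map_def G.lcs_homog_def H.lcs_homog_def)
qed

lemma lcs_map_zero: "lcs_map G H h \<zero>\<^bsub>lcs_lie G\<^esub> = \<zero>\<^bsub>lcs_lie H\<^esub>"
 by (rule additive_zero_neg(1)[where f = "lcs_map G H h", OF G.lcs_lie_abelian_group H.lcs_lie_abelian_group lcs_map_closed lcs_map_add])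

lemma lcs_map_lie_hom: "lcs_map G H h \<in> lie_hom (lcs_lie G) (lcs_lie H)"
proof -
 interpret LG: lie_ring "lcs_lie G" by (rule G.lcs_lie_lie_ring)
 interpret LH: lie_ring "lcs_lie H" by (rule H.lcs_lie_lie_ring)
 have "lcs_map G H h (x \<otimes>\<^bsub>lcs_lie G\<^esub> y) = lcs_map G H h x \<otimes>\<^bsub>lcs_lie H\<^esub> lcs_map G H h y"
  if x: "x \<in> carrier (lcs_lie G)" and y: "y \<in> carrier (lcs_lie G)" for x y
  using x
 proof (induction x rule: G.lcs_lie_induct)
  case zero thus ?case using y by (simp add: lcs_map_zero lcs_map_closed)
 next
  case (add u v) thus ?case using y by (simp add: LG.br_add_left LH.br_add_left LG.br_closed lcs_map_add lcs_map_closed)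
 next
  case (homog k a)
  note ka = this
  show ?case using y
  proof (induction y rule: G.lcs_lie_induct)
   case zero thus ?case using ka by (simp add: lcs_map_zero lcs_map_closed)
  next
   case (add u v) thus ?case using ka by (simp add: LG.br_add_right LH.br_add_right LG.br_closed lcs_map_add lcs_map_closed)
  next
   case (homog l b)
   have "commutator G a b \<in> lower_central G (k + l)" using ka homog by (intro G.lower_central_commutator)
   thus ?case using ka homog
    by (simp add: G.lcs_homog_bracket H.lcs_homog_bracket lcs_map_homog hom_lower_central hom_commutator)
  qed
 qed
 thus ?thesis by (auto simp: lie_hom_def lcs_map_add lcs_map_closed)
qed

text \<open>A graded map is injective when the two filtrations are strictly compatible, that is,
  when membership of an image in the next term can be pulled back. For the kernel of a split
  extension \<open>lower_central_kernel\<close> provides this.\<close>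

lemma lcs_map_inj:
 assumes inj: "!!k g. 1 \<le> k ==> g \<in> lower_central G k ==> h g \<in> lower_central H (Suc k) ==> g \<in> lower_central G (Suc k)"
  and x: "x \<in> carrier (lcs_lie G)" and zero: "lcs_map G H h x = \<zero>\<^bsub>lcs_lie H\<^esub>"
 shows "x = \<zero>\<^bsub>lcs_lie G\<^esub>"
proof
 fix d
 show "x d = \<zero>\<^bsub>lcs_lie G\<^esub> d"
 proof (cases "1 \<le> d")
  case False
  thus ?thesis using x by (auto simp: G.lcs_lie_simps G.carrier_lcs_lie PiE_iff extensional_def)
 next
  case d: True
  obtain g where g: "g \<in> lower_central G d" "x d = lower_central G (Suc d) #> g"
    "lcs_map G H h x d = lower_central H (Suc d) #>\<^bsub>H\<^esub> h g" by (rule lcs_map_component[OF x d])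
  hence "lower_central H (Suc d) #>\<^bsub>H\<^esub> h g = lower_central H (Suc d)"
   using zero d by (simp add: H.lcs_lie_simps)
  hence "h g \<in> lower_central H (Suc d)"
   using g H.coset_eq_self[OF H.normal_lower_central] by simp
  hence "g \<in> lower_central G (Suc d)" using inj d g by simp
  thus ?thesis using g d G.coset_eq_self[OF G.normal_lower_central] by (simp add: G.lcs_lie_simps)
 qed
qed

end

declare lower_central.simps(3) [simp del]

text \<open>Each term of the series is generated by commutators of arbitrary elements with the
  preceding term, so every homogeneous piece is additively spanned by brackets with elements of
  degree one. Lie homomorphisms therefore need to be compared in degree one only.\<close>

lemma (in group) lcs_lie_induct_degree_one [consumes 1, case_names deg_one neg add br]:
 assumes x: "x \<in> carrier (lcs_lie G)"
  and one: "!!g. g \<in> carrier G ==> P (lcs_homog 1 g)"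
  and neg: "!!x. x \<in> carrier (lcs_lie G) ==> P x ==> P (\<ominus>\<^bsub>lcs_lie G\<^esub> x)"
  and add: "!!x y. x \<in> carrier (lcs_lie G) ==> y \<in> carrier (lcs_lie G) ==> P x ==> P y ==> P (x \<oplus>\<^bsub>lcs_lie G\<^esub> y)"
  and br: "!!x y. x \<in> carrier (lcs_lie G) ==> y \<in> carrier (lcs_lie G) ==> P x ==> P y ==> P (x \<otimes>\<^bsub>lcs_lie G\<^esub> y)"
 shows "P x"
proof -
 interpret L: lie_ring "lcs_lie G" by (rule lcs_lie_lie_ring)
 have zero: "P \<zero>\<^bsub>lcs_lie G\<^esub>" using one[of \<one>] lcs_homog_zero_iff[of 1 \<one>] by simp
 have hom: "P (lcs_homog (Suc k) g)" if "g \<in> lower_central G (Suc k)" for k g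
  using that
 proof (induction k arbitrary: g)
  case 0 thus ?case using one by simp
 next
  case (Suc k)
  have br': "P (lcs_homog (Suc (Suc k)) (\<kappa> a b)) \<and> \<kappa> a b \<in> lower_central G (Suc (Suc k))"
   if "a \<in> carrier G" "b \<in> lower_central G (Suc k)" for a b
   using br[of "lcs_homog 1 a" "lcs_homog (Suc k) b"] one[of a] Suc.IH[of b] that lcs_homog_closed[of a 1]
    lcs_homog_bracket[of 1 "Suc k" a b] commutator_lower_Suc[of "Suc k" a b] by simp
  have "g \<in> generate G {\<kappa> a b |a b. a \<in> carrier G \<and> b \<in> lower_central G (Suc k)}"
   using Suc.prems by (simp add: lower_central.simps(3))
  hence "P (lcs_homog (Suc (Suc k)) g) \<and> g \<in> lower_central G (Suc (Suc k))"
  proof (induction rule: generate.induct)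
   case one
   thus ?case using zero lcs_homog_zero_iff[of "Suc (Suc k)" \<one>] lower_central_one_mem by auto
  next
   case (incl x) thus ?case using br' by blast
  next
   case (inv x)
   hence x: "P (lcs_homog (Suc (Suc k)) x)" "x \<in> lower_central G (Suc (Suc k))" using br' by auto
   have "lcs_homog (Suc (Suc k)) (inv x) \<oplus>\<^bsub>lcs_lie G\<^esub> lcs_homog (Suc (Suc k)) x = lcs_homog (Suc (Suc k)) (inv x \<otimes> x)"
    using x by (intro lcs_homog_mult[symmetric] lower_central_inv)
   also have "... = \<zero>\<^bsub>lcs_lie G\<^esub>" using x lcs_homog_zero_iff[of "Suc (Suc k)" \<one>] lower_central_one_mem
    by simp
   finally have "\<ominus>\<^bsub>lcs_lie G\<^esub> lcs_homog (Suc (Suc k)) x = lcs_homog (Suc (Suc k)) (inv x)"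
    using x lower_central_inv by (intro L.minus_equality) simp_all
   thus ?case using neg[of "lcs_homog (Suc (Suc k)) x"] x lower_central_inv by simp
  next
   case (eng a b)
   thus ?case using add lcs_homog_mult[of a "Suc (Suc k)" b] lower_central_mult
    by simp
  qed
  thus ?case by simp
 qed
 show ?thesis using x
 proof (induction x rule: lcs_lie_induct)
  case (homog k g) thus ?case using hom[of g "k - 1"] by simp
 qed (use zero add in auto)
qed

section \<open>Split extensions acting trivially on the abelianized kernel\<close>

lemma (in group_hom) image_commutators:
 assumes X: "X \<subseteq> carrier G" and Z: "Z \<subseteq> carrier G"
 shows "h ` {commutator G a b |a b. a \<in> X \<and> b \<in> Z} = {commutator H a b |a b. a \<in> h ` X \<and> b \<in> h ` Z}"
proof -
 have e: "h (commutator G a b) = commutator H (h a) (h b)" if "a \<in> X" "b \<in> Z" for a b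
  using that X Z by (intro hom_commutator) auto
 show ?thesis
 proof (intro equalityI subsetI)
  fix x assume "x \<in> h ` {commutator G a b |a b. a \<in> X \<and> b \<in> Z}"
  then obtain a b where "x = h (commutator G a b)" "a \<in> X" "b \<in> Z" by blast
  thus "x \<in> {commutator H a b |a b. a \<in> h ` X \<and> b \<in> h ` Z}" using e by blast
 next
  fix x assume "x \<in> {commutator H a b |a b. a \<in> h ` X \<and> b \<in> h ` Z}"
  then obtain a b where ab: "x = commutator H (h a) (h b)" "a \<in> X" "b \<in> Z" by blast
  hence "x = h (commutator G a b)" using e by simp
  thus "x \<in> h ` {commutator G a b |a b. a \<in> X \<and> b \<in> Z}" using ab by blast
 qed
qed

locale split_extension = i: group_hom N G i + p: group_hom G H p + s: group_hom H G s
 for N :: "('n, 'x) monoid_scheme" and G :: "('g, 'y) monoid_scheme" (structure) and H :: "('h, 'z) monoid_scheme"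
  and i p s +
 assumes inj_i: "inj_on i (carrier N)"
  and p_s: "h \<in> carrier H ==> p (s h) = h"
  and p_i: "u \<in> carrier N ==> p (i u) = \<one>\<^bsub>H\<^esub>"
  and kernel_p: "g \<in> carrier G ==> p g = \<one>\<^bsub>H\<^esub> ==> g \<in> i ` carrier N"
begin

abbreviation A :: "nat => 'g set" where "A k \<equiv> i ` lower_central N k"
abbreviation B :: "nat => 'g set" where "B k \<equiv> s ` lower_central H k"

lemma A_subgroup: "subgroup (A k) G"
 using i.subgroup_img_is_subgroup[OF normal_imp_subgroup[OF i.G.normal_lower_central]] .

lemma A_Suc: "1 \<le> k ==> A (Suc k) = generate G {commutator G a b |a b. a \<in> A 1 \<and> b \<in> A k}"
proof -
 assume k: "1 \<le> k"
 have "A (Suc k) = generate G (i ` {commutator N g h |g h. g \<in> carrier N \<and> h \<in> lower_central N k})"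
  unfolding i.G.lower_central_Suc[OF k] by (rule i.generate_img[symmetric]) auto
 also have "i ` {commutator N g h |g h. g \<in> carrier N \<and> h \<in> lower_central N k} = {commutator G a b |a b. a \<in> A 1 \<and> b \<in> A k}"
  using i.image_commutators[of "carrier N" "lower_central N k"] i.G.lower_central_subset by simp
 finally show ?thesis .
qed

lemma A_one_normal: "A 1 \<lhd> G"
proof -
 have "g \<otimes> i u \<otimes> inv g \<in> A 1" if "g \<in> carrier G" "u \<in> carrier N" for g u
  using kernel_p[of "g \<otimes> i u \<otimes> inv g"] that by (simp add: p_i)
 thus ?thesis using A_subgroup[of 1] by (auto simp: i.H.normal_inv_iff)
qed

lemma A_normal: "1 \<le> k ==> A k \<lhd> G"
proof (induction k rule: nat_induct_at_least)
 case base thus ?case by (rule A_one_normal)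
next
 case (Suc k)
 interpret M: normal "A k" G by (rule Suc.IH)
 interpret M1: normal "A 1" G by (rule A_one_normal)
 show ?case unfolding A_Suc[OF Suc.hyps]
 proof (rule i.H.normal_generateI)
  show "{commutator G a b |a b. a \<in> A 1 \<and> b \<in> A k} \<subseteq> carrier G" by auto
  fix x g assume "x \<in> {commutator G a b |a b. a \<in> A 1 \<and> b \<in> A k}" and g: "g \<in> carrier G"
  then obtain a b where ab: "x = commutator G a b" "a \<in> A 1" "b \<in> A k" by blast
  hence c: "a \<in> carrier G" "b \<in> carrier G" by auto
  have "g \<otimes> x \<otimes> inv g = commutator G (g \<otimes> a \<otimes> inv g) (g \<otimes> b \<otimes> inv g)"
   using ab c g by (simp add: i.H.word_simps)
  moreover have "g \<otimes> a \<otimes> inv g \<in> A 1" "g \<otimes> b \<otimes> inv g \<in> A k"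
   using M.inv_op_closed2 M1.inv_op_closed2 ab g by auto
  ultimately show "g \<otimes> x \<otimes> inv g \<in> {commutator G a b |a b. a \<in> A 1 \<and> b \<in> A k}" by blast
 qed
qed

lemma A_antimono: "k \<le> l ==> a \<in> A l ==> a \<in> A k"
 using i.G.lower_central_antimono[of k l] by blast

lemma A_commutator: "1 \<le> k ==> 1 \<le> l ==> a \<in> A k ==> b \<in> A l ==> commutator G a b \<in> A (k + l)"
 using i.G.lower_central_commutator[of k l] by (auto simp flip: i.hom_commutator)

lemma commutator_swap: "1 \<le> k ==> x \<in> carrier G ==> y \<in> carrier G ==> commutator G x y \<in> A k ==> commutator G y x \<in> A k"
 by (rule i.H.commutator_swap_mem[OF A_subgroup])

lemma commutator_mult_cancel:
 assumes "1 \<le> k" "c \<in> carrier G" "m \<in> carrier G" "x \<in> carrier G" "commutator G c m \<in> A k"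
 shows "commutator G c (m \<otimes> x) \<in> A k \<longleftrightarrow> commutator G c x \<in> A k"
proof -
 interpret M: normal "A k" G by (rule A_normal[OF assms(1)])
 let ?y = "m \<otimes> commutator G c x \<otimes> inv m"
 have e: "commutator G c (m \<otimes> x) = commutator G c m \<otimes> ?y"
  using assms by (intro i.H.commutator_mult_right)
 have e2: "inv m \<otimes> ?y \<otimes> m = commutator G c x"
  using assms by (simp add: i.H.m_assoc)
 have e3: "inv commutator G c m \<otimes> commutator G c (m \<otimes> x) = ?y"
  using assms by (simp add: e)
 show ?thesis
 proof
  assume "commutator G c (m \<otimes> x) \<in> A k"
  hence "?y \<in> A k" unfolding e3[symmetric] using assms(5) by (intro M.m_closed M.m_inv_closed)
  hence "inv m \<otimes> ?y \<otimes> m \<in> A k" using assms by (intro M.inv_op_closed1)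
  thus "commutator G c x \<in> A k" by (simp only: e2)
 next
  assume "commutator G c x \<in> A k"
  thus "commutator G c (m \<otimes> x) \<in> A k" unfolding e using assms by (intro M.m_closed M.inv_op_closed2)
 qed
qed

end

locale split_extension_trivial = split_extension +
 assumes trivial_action: "h \<in> carrier H ==> u \<in> carrier N ==>
     commutator G (s h) (i u) \<in> i ` lower_central N 2"
begin

text \<open>Trivial action on the abelianization of \<open>N\<close> propagates to all quotients of
  its lower central series, because these are generated by commutators and Hall-Witt moves
  \<open>h\<close> onto their entries.\<close>

lemma commutator_B1_A:
 assumes "1 \<le> k" and h: "h \<in> B 1" and "b \<in> A k"
 shows "commutator G h b \<in> A (Suc k)"
 using assms(1,3)
proof (induction k arbitrary: b rule: nat_induct_at_least)
 case base
 thus ?case using trivial_action h by (auto simp: numeral_2_eq_2)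
next
 case (Suc k)
 have hc: "h \<in> carrier G" using h by auto
 show ?case
 proof (rule i.H.commutator_generate_right[OF A_normal _ hc])
  show "b \<in> generate G {commutator G a b |a b. a \<in> A 1 \<and> b \<in> A k}" using Suc.prems A_Suc[OF Suc.hyps] by simp
  show "{commutator G a b |a b. a \<in> A 1 \<and> b \<in> A k} \<subseteq> carrier G" by auto
  fix x assume "x \<in> {commutator G a b |a b. a \<in> A 1 \<and> b \<in> A k}"
  then obtain a b where ab: "x = commutator G a b" "a \<in> A 1" "b \<in> A k" by blast
  hence c: "a \<in> carrier G" "b \<in> carrier G" by auto
  interpret M: normal "A (Suc (Suc k))" G by (rule A_normal) simp
  interpret M1: normal "A 1" G by (rule A_one_normal)
  interpret Mk: normal "A k" G by (rule A_normal[OF Suc.hyps])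
  define t2 where "t2 = commutator G (commutator G b h) (h \<otimes> a \<otimes> inv h)"
  define t3 where "t3 = commutator G (commutator G h a) (a \<otimes> b \<otimes> inv a)"
  have bh: "commutator G b h \<in> A (Suc k)" using Suc.IH[OF ab(3)] hc c commutator_swap[of "Suc k" h b] by simp
  hence "commutator G (commutator G b h) (h \<otimes> a \<otimes> inv h) \<in> A (Suc k + 1)"
   using M1.inv_op_closed2[OF hc ab(2)] by (intro A_commutator) auto
  hence t2: "t2 \<in> A (Suc (Suc k))" by (simp add: t2_def)
  have "commutator G h a \<in> A 2" using trivial_action h ab(2) by auto
  hence "commutator G (commutator G h a) (a \<otimes> b \<otimes> inv a) \<in> A (2 + k)"
   using Mk.inv_op_closed2[OF c(1) ab(3)] Suc.hyps by (intro A_commutator) auto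
  hence t3: "t3 \<in> A (Suc (Suc k))" by (simp add: t3_def)
  \<comment> \<open>Hall-Witt yields the commutator of \<open>x\<close> with a conjugate of
    \<open>h\<close>. Conjugating by \<open>b\<close> changes \<open>h\<close> by an element of
    \<open>A (Suc k)\<close>, whose commutator with \<open>x\<close> is deep enough to be
    cancelled.\<close>
  have "commutator G x (b \<otimes> h \<otimes> inv b) \<otimes> (t2 \<otimes> t3) = \<one>"
   unfolding t2_def t3_def ab(1) using c hc by (intro i.H.hall_witt)
  hence "inv (t2 \<otimes> t3) = commutator G x (b \<otimes> h \<otimes> inv b)"
   using c hc ab by (intro i.H.inv_equality) (simp_all add: t2_def t3_def)
  moreover have "inv (t2 \<otimes> t3) \<in> A (Suc (Suc k))" using t2 t3 by (intro M.m_inv_closed M.m_closed)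
  ultimately have "commutator G x (b \<otimes> h \<otimes> inv b) \<in> A (Suc (Suc k))" by simp
  hence "commutator G x (commutator G b h \<otimes> h) \<in> A (Suc (Suc k))" using i.H.conj_eq_commutator[of b h] c hc by simp
  moreover have "commutator G x (commutator G b h) \<in> A (Suc (Suc k))"
  proof -
   have "x \<in> A (1 + k)" unfolding ab(1) using ab Suc.hyps by (intro A_commutator) auto
   hence "commutator G x (commutator G b h) \<in> A (1 + k + Suc k)" using bh by (intro A_commutator) auto
   thus ?thesis using Suc.hyps by (elim A_antimono[rotated]) simp
  qed
  ultimately have "commutator G x h \<in> A (Suc (Suc k))"
   using commutator_mult_cancel[of "Suc (Suc k)" x "commutator G b h" h] ab c hc by simp
  thus "commutator G h x \<in> A (Suc (Suc k))" using commutator_swap[of "Suc (Suc k)" x h] ab c hc by simp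
 qed simp
qed

text \<open>The three subgroups argument again, by induction on the degree in \<open>H\<close>; the
  preceding lemma treats the factors of degree one.\<close>

lemma commutator_B_A:
 assumes "1 \<le> j" "1 \<le> k" "h \<in> B j" "b \<in> A k"
 shows "commutator G h b \<in> A (j + k)"
 using assms
proof (induction j arbitrary: h k b rule: nat_induct_at_least)
 case base
 thus ?case using commutator_B1_A by simp
next
 case (Suc j)
 have bc: "b \<in> carrier G" using Suc.prems by auto
 have B: "B (Suc j) = generate G {commutator G x u |x u. x \<in> B 1 \<and> u \<in> B j}"
 proof -
  have "B (Suc j) = generate G (s ` {commutator H g h |g h. g \<in> carrier H \<and> h \<in> lower_central H j})"
   unfolding p.H.lower_central_Suc[OF Suc.hyps] by (rule s.generate_img[symmetric]) auto
  also have "s ` {commutator H g h |g h. g \<in> carrier H \<and> h \<in> lower_central H j} = {commutator G a b |a b. a \<in> B 1 \<and> b \<in> B j}"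
   using s.image_commutators[of "carrier H" "lower_central H j"] p.H.lower_central_subset by simp
  finally show ?thesis .
 qed
 show ?case
 proof (rule i.H.commutator_generate_left[OF A_normal _ bc])
  show "h \<in> generate G {commutator G x u |x u. x \<in> B 1 \<and> u \<in> B j}" using Suc.prems B by simp
  show "{commutator G x u |x u. x \<in> B 1 \<and> u \<in> B j} \<subseteq> carrier G" by auto
  fix y assume "y \<in> {commutator G x u |x u. x \<in> B 1 \<and> u \<in> B j}"
  then obtain x u where xu: "y = commutator G x u" "x \<in> B 1" "u \<in> B j" by blast
  hence c: "x \<in> carrier G" "u \<in> carrier G" by auto
  interpret M: normal "A (Suc j + k)" G by (rule A_normal) simp
  interpret Mk: normal "A k" G by (rule A_normal[OF Suc.prems(1)])
  \<comment> \<open>Conjugating \<open>z\<close> by \<open>u\<close> gives back \<open>b\<close>, so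
    that Hall-Witt speaks of \<open>b\<close> and not of a conjugate.\<close>
  define z where "z = inv u \<otimes> b \<otimes> u"
  have z: "z \<in> A k" unfolding z_def using c Suc.prems by (intro Mk.inv_op_closed1)
  hence zc: "z \<in> carrier G" by auto
  have bz: "u \<otimes> z \<otimes> inv u = b" using c bc by (simp add: z_def i.H.m_assoc)
  define t2 where "t2 = commutator G (commutator G u z) (z \<otimes> x \<otimes> inv z)"
  define t3 where "t3 = commutator G (commutator G z x) (x \<otimes> u \<otimes> inv x)"
  have uz: "commutator G u z \<in> A (j + k)" using Suc.IH Suc.prems xu z by simp
  have xz: "commutator G x z \<in> A (Suc k)" using commutator_B1_A xu z Suc.prems by simp
  hence zx: "commutator G z x \<in> A (Suc k)" using commutator_swap[of "Suc k" x z] c zc by simp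
  have "commutator G x (commutator G u z) \<in> A (Suc (j + k))" using commutator_B1_A[of "j + k"] xu uz Suc.prems by simp
  hence "commutator G (commutator G u z) x \<in> A (Suc j + k)" using commutator_swap[of "Suc (j + k)" x "commutator G u z"] c zc by simp
  moreover have "commutator G (commutator G u z) (commutator G z x) \<in> A (Suc j + k)"
   by (rule A_antimono[of "Suc j + k" "j + k + Suc k"], simp, rule A_commutator[OF _ _ uz zx])
    (use Suc.prems in simp_all)
  ultimately have "commutator G (commutator G u z) (commutator G z x \<otimes> x) \<in> A (Suc j + k)"
   using commutator_mult_cancel[of "Suc j + k" "commutator G u z" "commutator G z x" x] c zc by simp
  hence t2: "t2 \<in> A (Suc j + k)" unfolding t2_def using i.H.conj_eq_commutator[of z x] c zc by simp
  have "x \<otimes> u \<otimes> inv x \<in> B j"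
  proof -
   obtain x' u' where x': "x = s x'" "x' \<in> carrier H" "u = s u'" "u' \<in> lower_central H j"
    using xu by auto
   have "x' \<otimes>\<^bsub>H\<^esub> u' \<otimes>\<^bsub>H\<^esub> inv\<^bsub>H\<^esub> x' \<in> lower_central H j"
    using normal.inv_op_closed2[OF p.H.normal_lower_central] x' by blast
   moreover have "s (x' \<otimes>\<^bsub>H\<^esub> u' \<otimes>\<^bsub>H\<^esub> inv\<^bsub>H\<^esub> x') = x \<otimes> u \<otimes> inv x" using x' by simp
   ultimately show ?thesis by (metis imageI)
  qed
  hence "commutator G (x \<otimes> u \<otimes> inv x) (commutator G z x) \<in> A (j + Suc k)"
   by (intro Suc.IH[OF _ _ zx]) simp_all
  hence t3: "t3 \<in> A (Suc j + k)" unfolding t3_def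
   using commutator_swap[of "j + Suc k" "x \<otimes> u \<otimes> inv x" "commutator G z x"] c zc by simp
  have "commutator G y (u \<otimes> z \<otimes> inv u) \<otimes> (t2 \<otimes> t3) = \<one>"
   unfolding t2_def t3_def xu(1) using c zc by (intro i.H.hall_witt)
  hence "inv (t2 \<otimes> t3) = commutator G y b"
   using c zc bz bc xu by (intro i.H.inv_equality) (simp_all add: t2_def t3_def)
  moreover have "inv (t2 \<otimes> t3) \<in> A (Suc j + k)" using t2 t3 by (intro M.m_inv_closed M.m_closed)
  ultimately show "commutator G y b \<in> A (Suc j + k)" by simp
 qed simp
qed

lemma normal_coset_absorb:
 assumes "M \<lhd> G" "x \<in> carrier G" "m \<in> M"
 shows "M #> (m \<otimes> x) = M #> x" "M #> (x \<otimes> m) = M #> x"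
proof -
 interpret M: normal M G by fact
 have m: "m \<in> carrier G" using assms M.subset by blast
 show "M #> (m \<otimes> x) = M #> x"
  by (rule i.H.coset_eqI) (use assms m in \<open>simp_all add: i.H.m_assoc\<close>)
 have "x \<otimes> m \<otimes> inv x \<in> M" using assms by (intro M.inv_op_closed2)
 thus "M #> (x \<otimes> m) = M #> x"
  by (intro i.H.coset_eqI) (use assms m in simp_all)
qed

lemma normal_coset_conj:
 assumes "M \<lhd> G" "x \<in> carrier G" "y \<in> carrier G" "commutator G x y \<in> M"
 shows "M #> (x \<otimes> y \<otimes> inv x) = M #> y"
 using assms by (simp add: i.H.conj_eq_commutator normal_coset_absorb)

text \<open>Mixed commutators fall into the term of \<open>N\<close> whose index is the sum of the
  degrees. A commutator generating the next term is therefore congruent to its own image under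
  \<open>s\<close> after \<open>p\<close> modulo \<open>A (Suc k)\<close>, and as
  \<open>A (Suc k)\<close> is normal, this congruence passes to products and inverses.\<close>

theorem falk_randell:
 assumes "1 \<le> k" "g \<in> lower_central G k"
 shows "\<exists>a\<in>A k. g = a \<otimes> s (p g)"
 using assms
proof (induction k arbitrary: g rule: nat_induct_at_least)
 case base
 have "p (g \<otimes> inv s (p g)) = \<one>\<^bsub>H\<^esub>" using base by (simp add: p_s)
 hence "g \<otimes> inv s (p g) \<in> A 1" using kernel_p base by simp
 moreover have "g = (g \<otimes> inv s (p g)) \<otimes> s (p g)" using base by (simp add: i.H.m_assoc)
 ultimately show ?case by blast
next
 case (Suc k)
 let ?M = "A (Suc k)"
 have M: "?M \<lhd> G" by (rule A_normal) simp
 interpret M: normal ?M G by (rule M)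
 have gen: "?M #> commutator G g c = ?M #> s (p (commutator G g c))"
  if g: "g \<in> carrier G" and c: "c \<in> lower_central G k" for g c
 proof -
  have gc: "g \<in> lower_central G 1" using g by simp
  have "\<exists>a\<in>A 1. g = a \<otimes> s (p g)"
  proof -
   have "p (g \<otimes> inv s (p g)) = \<one>\<^bsub>H\<^esub>" using g by (simp add: p_s)
   hence "g \<otimes> inv s (p g) \<in> A 1" using kernel_p g by simp
   moreover have "g = (g \<otimes> inv s (p g)) \<otimes> s (p g)" using g by (simp add: i.H.m_assoc)
   ultimately show ?thesis by blast
  qed
  then obtain a where a: "a \<in> A 1" "g = a \<otimes> s (p g)" by blast
  obtain a' where a': "a' \<in> A k" "c = a' \<otimes> s (p c)" using Suc.IH[OF c] by blast
  define x where "x = s (p g)"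
  define y where "y = s (p c)"
  have pc: "p c \<in> lower_central H k" using c by (rule p.hom_lower_central)
  have cl: "a \<in> carrier G" "a' \<in> carrier G" "x \<in> carrier G" "y \<in> carrier G" "c \<in> carrier G"
   using a a' g c by (auto simp: x_def y_def)
  have ge: "g = a \<otimes> x" and ce: "c = a' \<otimes> y"
   unfolding x_def y_def by (fact a(2), fact a'(2))
  define w where "w = commutator G x y"
  have w: "w = s (commutator H (p g) (p c))" using cl g by (simp add: w_def x_def y_def s.hom_commutator)
  have wB: "w \<in> B (Suc k)" unfolding w
   using p.H.commutator_lower_Suc[OF Suc.hyps, of "p g" "p c"] pc g by simp
  have wc: "w \<in> carrier G" using wB by auto
  have x: "x \<in> B 1" using g by (simp add: x_def)
  have y: "y \<in> B k" using pc by (simp add: y_def)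
  have pw: "s (p (commutator G g c)) = w" using g cl by (simp add: w p.hom_commutator)
  have 1: "commutator G g a' \<in> ?M"
  proof -
   have "commutator G g a' = (a \<otimes> commutator G x a' \<otimes> inv a) \<otimes> commutator G a a'"
    unfolding ge using cl by (intro i.H.commutator_mult_left)
   moreover have "commutator G x a' \<in> ?M" using commutator_B1_A[OF Suc.hyps x a'(1)] .
   moreover have "commutator G a a' \<in> ?M" using A_commutator[of 1 k a a'] Suc.hyps a a' by simp
   ultimately show ?thesis using M.inv_op_closed2 cl by simp
  qed
  have "?M #> commutator G g y = ?M #> ((a \<otimes> w \<otimes> inv a) \<otimes> commutator G a y)"
   unfolding ge w_def using cl by (subst i.H.commutator_mult_left) auto
  also have "... = ?M #> (a \<otimes> w \<otimes> inv a)"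
  proof -
   have "commutator G y a \<in> A (k + 1)" using commutator_B_A[OF Suc.hyps _ y a(1)] by simp
   hence "commutator G a y \<in> ?M" using commutator_swap[of "Suc k" y a] cl by simp
   thus ?thesis using normal_coset_absorb(2)[OF M] cl wc by simp
  qed
  also have "... = ?M #> w"
  proof -
   have "commutator G w a \<in> A (Suc k + 1)" using commutator_B_A[OF _ _ wB a(1)] by simp
   hence "commutator G w a \<in> ?M" by (elim A_antimono[rotated]) simp
   hence "commutator G a w \<in> ?M" using commutator_swap[of "Suc k" w a] cl wc by simp
   thus ?thesis using normal_coset_conj[OF M] cl wc by simp
  qed
  finally have gy: "?M #> commutator G g y = ?M #> w" .
  define m where "m = commutator G g y \<otimes> inv w"
  have m: "m \<in> ?M" "commutator G g y = m \<otimes> w"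
   using gy i.H.coset_eqD[OF M] cl wc g by (simp_all add: m_def i.H.m_assoc)
  have mc: "m \<in> carrier G" using m by auto
  have "commutator G g c = commutator G g a' \<otimes> (a' \<otimes> commutator G g y \<otimes> inv a')"
   unfolding ce using cl g by (intro i.H.commutator_mult_right)
  hence "?M #> commutator G g c = ?M #> (a' \<otimes> commutator G g y \<otimes> inv a')"
   using normal_coset_absorb(1)[OF M _ 1] cl g by simp
  also have "... = ?M #> ((a' \<otimes> m \<otimes> inv a') \<otimes> (a' \<otimes> w \<otimes> inv a'))"
   using cl wc mc by (simp add: m i.H.m_assoc)
  also have "... = ?M #> (a' \<otimes> w \<otimes> inv a')"
   using normal_coset_absorb(1)[OF M _ M.inv_op_closed2[OF cl(2) m(1)]] cl wc by simp
  also have "... = ?M #> w"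
  proof -
   have "commutator G w a' \<in> A (Suc k + k)" using commutator_B_A[OF _ Suc.hyps wB a'(1)] by simp
   hence "commutator G w a' \<in> ?M" by (elim A_antimono[rotated]) simp
   hence "commutator G a' w \<in> ?M" using commutator_swap[of "Suc k" w a'] cl wc by simp
   thus ?thesis using normal_coset_conj[OF M] cl wc by simp
  qed
  finally show ?thesis using pw by simp
 qed
 have "g \<in> generate G {commutator G g h |g h. g \<in> carrier G \<and> h \<in> lower_central G k}"
  using Suc.prems by (simp add: i.H.lower_central_Suc[OF Suc.hyps])
 hence "g \<in> carrier G \<and> ?M #> g = ?M #> s (p g)"
 proof (induction rule: generate.induct)
  case (incl h) thus ?case using gen by auto
 next
  case (inv h)
  hence h: "h \<in> carrier G" "?M #> h = ?M #> s (p h)" using gen by auto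
  have "?M #> inv h = ?M #> inv s (p h)"
   using M.rcos_inv[of h] M.rcos_inv[of "s (p h)"] h by simp
  thus ?case using h by simp
 next
  case (eng a b)
  thus ?case using M.rcos_sum[of a b] M.rcos_sum[of "s (p a)" "s (p b)"] by simp
 qed simp
 hence g: "g \<in> carrier G" "g \<otimes> inv s (p g) \<in> ?M" using i.H.coset_eqD[OF M] by auto
 moreover have "g = (g \<otimes> inv s (p g)) \<otimes> s (p g)" using g by (simp add: i.H.m_assoc)
 ultimately show ?case by blast
qed

text \<open>On the kernel of \<open>p\<close> the factor from \<open>H\<close> is trivial, so the
  splitting leaves only the factor from \<open>N\<close>.\<close>

corollary lower_central_kernel:
 assumes "1 \<le> k" "u \<in> carrier N" "i u \<in> lower_central G k"
 shows "u \<in> lower_central N k"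
proof -
 obtain a where "a \<in> A k" "i u = a \<otimes> s (p (i u))" using falk_randell[OF assms(1,3)] by blast
 hence "i u \<in> A k" using assms by (auto simp: p_i)
 thus ?thesis using inj_i assms(2) by (metis (no_types, lifting) i.G.lower_central_subset imageE inj_onD subsetD)
qed

end

section \<open>The Magnus expansion\<close>

text \<open>The target of the Magnus expansion. The coefficients need not commute with each other;
  the variable of the series is central and only records the degree.\<close>

definition fps_units :: "'r::ring_1 fps monoid" where
 "fps_units = \<lparr>carrier = {f. fps_nth f 0 = 1}, monoid.mult = (*), monoid.one = 1\<rparr>"

lemma fps_units_simps [simp]:
 "f \<in> carrier fps_units \<longleftrightarrow> fps_nth f 0 = 1" "f \<otimes>\<^bsub>fps_units\<^esub> g = f * g" "\<one>\<^bsub>fps_units\<^esub> = 1"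
 by (simp_all add: fps_units_def)

lemma fps_units_group: "group (fps_units :: 'r::ring_1 fps monoid)"
proof (rule groupI)
 fix f :: "'r fps" assume "f \<in> carrier fps_units"
 hence f: "fps_nth f 0 = 1" by simp
 have "fps_left_inverse f 1 * f = 1" by (rule fps_left_inverse) (simp add: f)
 moreover from this have "fps_nth (fps_left_inverse f 1) 0 = 1" by simp
 ultimately show "\<exists>y\<in>carrier fps_units. y \<otimes>\<^bsub>fps_units\<^esub> f = \<one>\<^bsub>fps_units\<^esub>"
  by (intro bexI[of _ "fps_left_inverse f 1"]) simp_all
qed (simp_all add: mult.assoc)

definition fps_level :: "nat => 'r::ring_1 fps set" where
 "fps_level m = {f. \<forall>i<m. fps_nth f i = 0}"

lemma fps_level_mult:
 assumes "u \<in> fps_level a" "v \<in> fps_level b"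
 shows "u * v \<in> fps_level (a + b)" "fps_nth (u * v) (a + b) = fps_nth u a * fps_nth v b"
proof -
 have z: "fps_nth u i * fps_nth v (n - i) = 0" if "n \<le> a + b" "i \<le> n" "i ~= a \<or> n ~= a + b" for n i
 proof (cases "i < a")
  case True thus ?thesis using assms by (simp add: fps_level_def)
 next
  case False
  hence "n - i < b" using that by auto
  thus ?thesis using assms by (simp add: fps_level_def)
 qed
 show "u * v \<in> fps_level (a + b)"
  unfolding fps_level_def
 proof (intro CollectI allI impI)
  fix n assume n: "n < a + b"
  show "fps_nth (u * v) n = 0" unfolding fps_mult_nth
   by (rule sum.neutral) (use n in \<open>auto intro!: z\<close>)
 qed
 have "fps_nth (u * v) (a + b) = (\<Sum>i\<in>{0..a + b}. if i = a then fps_nth u a * fps_nth v b else 0)"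
  unfolding fps_mult_nth by (rule sum.cong) (auto intro!: z)
 thus "fps_nth (u * v) (a + b) = fps_nth u a * fps_nth v b" by simp
qed

lemma fps_level_simps:
 "u \<in> fps_level a ==> v \<in> fps_level a ==> u - v \<in> fps_level a"
 "u \<in> fps_level a ==> v \<in> fps_level a ==> u + v \<in> fps_level a"
 "u \<in> fps_level a ==> b \<le> a ==> u \<in> fps_level b" "u \<in> fps_level 0"
 by (auto simp: fps_level_def)

context
begin

interpretation U: group "fps_units :: 'r::ring_1 fps monoid" by (rule fps_units_group)

lemma fps_units_inv:
 assumes "fps_nth f 0 = 1"
 shows "inv\<^bsub>fps_units\<^esub> f * f = (1::'r::ring_1 fps)" "f * inv\<^bsub>fps_units\<^esub> f = 1" "fps_nth (inv\<^bsub>fps_units\<^esub> f) 0 = 1"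
 using U.l_inv[of f] U.r_inv[of f] U.inv_closed[of f] assms by simp_all

text \<open>For \<open>u = f - 1\<close> and \<open>v = g - 1\<close> one has
  \<open>f g - g f = u v - v u\<close>, and multiplying by \<open>f^-1 g^-1\<close> gives the
  commutator minus 1. That factor has constant term 1 and does not change the leading coefficient,
  which is thus a ring commutator.\<close>

lemma fps_units_commutator:
 assumes f: "fps_nth f 0 = 1" "f - 1 \<in> fps_level a" and g: "fps_nth g 0 = 1" "g - 1 \<in> fps_level b"
 shows "commutator fps_units f g - 1 \<in> fps_level (a + b)"
  "fps_nth (commutator fps_units f g - 1) (a + b) = fps_nth (f - 1) a * fps_nth (g - 1) b - fps_nth (g - 1) b * fps_nth (f - (1::'r::ring_1 fps)) a"
proof -
 define u v where "u = f - 1" and "v = g - 1"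
 define w where "w = inv\<^bsub>fps_units\<^esub> f * inv\<^bsub>fps_units\<^esub> g"
 have w0: "fps_nth w 0 = 1" using f g by (simp add: w_def fps_units_inv)
 have c: "commutator fps_units f g = f * g * w"
  by (simp add: commutator_def w_def mult.assoc)
 have "g * f * w = g * (f * inv\<^bsub>fps_units\<^esub> f) * inv\<^bsub>fps_units\<^esub> g" by (simp add: w_def mult.assoc)
 hence gfw: "g * f * w = 1" using f g by (simp add: fps_units_inv)
 have e: "commutator fps_units f g - 1 = (u * v - v * u) * w"
 proof -
  have "commutator fps_units f g - 1 = (f * g - g * f) * w" unfolding c gfw[symmetric] by (simp add: algebra_simps)
  also have "f * g - g * f = u * v - v * u" by (simp add: u_def v_def algebra_simps)
  finally show ?thesis .
 qed
 have uv: "u * v \<in> fps_level (a + b)" "fps_nth (u * v) (a + b) = fps_nth u a * fps_nth v b"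
  using fps_level_mult[of u a v b] f g by (simp_all add: u_def v_def)
 have vu: "v * u \<in> fps_level (a + b)" "fps_nth (v * u) (a + b) = fps_nth v b * fps_nth u a"
  using fps_level_mult[of v b u a] f g by (simp_all add: u_def v_def add.commute)
 have "u * v - v * u \<in> fps_level (a + b)" using uv vu by (simp add: fps_level_simps)
 from fps_level_mult[OF this fps_level_simps(4), of w]
 show "commutator fps_units f g - 1 \<in> fps_level (a + b)"
  "fps_nth (commutator fps_units f g - 1) (a + b) = fps_nth (f - 1) a * fps_nth (g - 1) b - fps_nth (g - 1) b * fps_nth (f - (1::'r::ring_1 fps)) a"
  unfolding e using uv vu w0 by (simp_all add: u_def v_def)
qed

lemma fps_units_mult_level:
 assumes "f - 1 \<in> fps_level a" "g - 1 \<in> fps_level a" "1 \<le> a"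
 shows "f * g - 1 \<in> fps_level a" "fps_nth (f * g - 1) a = fps_nth (f - 1) a + fps_nth (g - (1::'r::ring_1 fps)) a"
proof -
 have e: "f * g - 1 = (f - 1) + (g - 1) + (f - 1) * (g - 1)" by (simp add: algebra_simps)
 have m: "(f - 1) * (g - 1) \<in> fps_level (a + a)" using fps_level_mult assms by blast
 thus "f * g - 1 \<in> fps_level a" unfolding e using assms
  by (intro fps_level_simps(2)) (auto elim: fps_level_simps(3))
 have "fps_nth ((f - 1) * (g - 1)) a = 0" using m assms by (auto simp: fps_level_def)
 thus "fps_nth (f * g - 1) a = fps_nth (f - 1) a + fps_nth (g - 1) a" unfolding e by simp
qed

lemma fps_units_lower_central:
 assumes "1 \<le> k" "f \<in> lower_central fps_units k"
 shows "f - (1::'r::ring_1 fps) \<in> fps_level k"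
 using assms
proof (induction k arbitrary: f rule: nat_induct_at_least)
 case base
 thus ?case by (simp add: fps_level_def)
next
 case (Suc k)
 have lev: "f - 1 \<in> fps_level 1" if "fps_nth f 0 = 1" for f :: "'r fps"
  using that by (simp add: fps_level_def)
 have gen: "commutator fps_units g h - 1 \<in> fps_level (Suc k)" if "fps_nth g 0 = 1" "h \<in> lower_central fps_units k"
  for g h :: "'r fps"
 proof -
  have "fps_nth h 0 = 1" using U.lower_central_closed[OF that(2)] by simp
  thus ?thesis using fps_units_commutator(1)[OF that(1) lev _ Suc.IH, of h] that by simp
 qed
 have "f \<in> generate fps_units {commutator fps_units g h |g h. g \<in> carrier fps_units \<and> h \<in> lower_central fps_units k}"
  using Suc.prems by (simp only: U.lower_central_Suc[OF Suc.hyps])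
 hence "fps_nth f 0 = 1 \<and> f - 1 \<in> fps_level (Suc k)"
 proof (induction rule: generate.induct)
  case one thus ?case by (simp add: fps_level_def)
 next
  case (incl x)
  then obtain g h where gh: "x = commutator fps_units g h" "g \<in> carrier fps_units" "h \<in> lower_central fps_units k" by blast
  have "x \<in> carrier fps_units"
   unfolding gh(1) by (rule U.commutator_closed[OF gh(2) U.lower_central_closed[OF gh(3)]])
  thus ?case using gen gh by simp
 next
  case (inv x)
  then obtain g h where gh: "x = commutator fps_units g h" "g \<in> carrier fps_units" "h \<in> lower_central fps_units k" by blast
  have h: "h \<in> carrier fps_units" by (rule U.lower_central_closed[OF gh(3)])
  have "inv\<^bsub>fps_units\<^esub> x = commutator fps_units h g"
   unfolding gh(1) by (rule U.inv_commutator[OF gh(2) h])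
  moreover have "commutator fps_units h g \<in> carrier fps_units" by (rule U.commutator_closed[OF h gh(2)])
  moreover have "commutator fps_units h g - 1 \<in> fps_level (k + 1)"
   using fps_units_commutator(1)[of h k g 1] Suc.IH[OF gh(3)] lev gh U.lower_central_closed[OF gh(3)] by simp
  ultimately show ?case by simp
 next
  case (eng a b) thus ?case using fps_units_mult_level(1)[of a "Suc k" b] by simp
 qed
 thus ?case by simp
qed

text \<open>Collects the leading coefficients of all homogeneous parts in one series. By
  \<open>lead_series_coset\<close> the chosen representatives do not matter. Nothing lives in degree
  0, so that coefficient is set to 0.\<close>

definition lead_series :: "(nat => 'r fps set) => 'r::ring_1 fps" where
 "lead_series x = Abs_fps (%d. if d = 0 then 0 else fps_nth (SOME f. f \<in> x d) d)"

definition fps_single :: "nat => 'r::ring_1 => 'r fps" where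
 "fps_single k c = Abs_fps (%d. if d = k then c else 0)"

lemma fps_single_nth [simp]: "fps_nth (fps_single k c) d = (if d = k then c else 0)"
 by (simp add: fps_single_def)

lemma fps_single_mult: "fps_single k c * fps_single l e = fps_single (k + l) (c * e)"
proof (rule fps_ext)
 fix n
 have "fps_nth (fps_single k c * fps_single l e) n = (\<Sum>i = 0..n. if i = k then (if n - k = l then c * e else 0) else 0)"
  unfolding fps_mult_nth by (rule sum.cong) auto
 thus "fps_nth (fps_single k c * fps_single l e) n = fps_nth (fps_single (k + l) (c * e)) n"
  by auto
qed

lemma lead_series_coset:
 assumes "1 \<le> d" "g \<in> lower_central fps_units d" "x d = lower_central fps_units (Suc d) #>\<^bsub>fps_units\<^esub> g"
 shows "fps_nth (lead_series x) d = fps_nth (g :: 'r::ring_1 fps) d"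
proof -
 have "g \<in> x d"
  unfolding assms(3)
  by (rule U.rcos_self[OF U.lower_central_closed[OF assms(2)] normal_imp_subgroup[OF U.normal_lower_central]])
 hence "(SOME f. f \<in> x d) \<in> x d" by (rule someI)
 then obtain n where n: "n \<in> lower_central fps_units (Suc d)" "(SOME f. f \<in> x d) = n * g"
  unfolding assms(3) by (auto simp: r_coset_def)
 have "n - 1 \<in> fps_level (Suc d)" using n by (intro fps_units_lower_central) auto
 hence "fps_nth (n - 1) d = 0" "n - 1 \<in> fps_level d" by (auto simp: fps_level_def)
 hence "fps_nth (n * g - 1) d = fps_nth (g - 1) d"
  using fps_units_mult_level(2)[of n d g] fps_units_lower_central[OF assms(1,2)] assms(1) by simp
 thus ?thesis using assms(1) n by (simp add: lead_series_def)
qed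

lemma lead_series_homog:
 assumes "1 \<le> k" "g \<in> lower_central fps_units k"
 shows "lead_series (U.lcs_homog k g) = fps_single k (fps_nth (g :: 'r::ring_1 fps) k)"
proof (rule fps_ext)
 fix d
 show "fps_nth (lead_series (U.lcs_homog k g)) d = fps_nth (fps_single k (fps_nth g k)) d"
 proof (cases "d = 0")
  case True thus ?thesis using assms by (simp add: lead_series_def)
 next
  case False
  hence d: "1 \<le> d" by simp
  show ?thesis
  proof (cases "d = k")
   case True
   have "U.lcs_homog k g d = lower_central fps_units (Suc d) #>\<^bsub>fps_units\<^esub> g"
    using d True by (simp add: U.lcs_homog_def)
   from lead_series_coset[of d g "U.lcs_homog k g", OF d _ this] show ?thesis using True assms by simp
  next
   case False
   have "U.lcs_homog k g d = lower_central fps_units (Suc d) #>\<^bsub>fps_units\<^esub> \<one>\<^bsub>fps_units\<^esub>"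
    unfolding U.coset_one using d False by (simp add: U.lcs_homog_def)
   from lead_series_coset[of d "\<one>\<^bsub>fps_units\<^esub>" "U.lcs_homog k g", OF d U.lower_central_one_mem this] show ?thesis using False d by simp
  qed
 qed
qed

lemma lead_series_add:
 assumes x: "x \<in> carrier (lcs_lie fps_units)" and y: "y \<in> carrier (lcs_lie fps_units)"
 shows "lead_series (x \<oplus>\<^bsub>lcs_lie fps_units\<^esub> y) = lead_series x + (lead_series y :: 'r::ring_1 fps)"
proof (rule fps_ext)
 fix d
 show "fps_nth (lead_series (x \<oplus>\<^bsub>lcs_lie fps_units\<^esub> y)) d = fps_nth (lead_series x + (lead_series y :: 'r::ring_1 fps)) d"
 proof (cases "d = 0")
  case True thus ?thesis by (simp add: lead_series_def)
 next
  case False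
  hence d: "1 \<le> d" by simp
  obtain g where g: "g \<in> lower_central fps_units d" "x d = lower_central fps_units (Suc d) #>\<^bsub>fps_units\<^esub> g"
   using U.lcs_lie_component[OF x d] unfolding U.lcs_quotient_carrier by blast
  obtain h where h: "h \<in> lower_central fps_units d" "y d = lower_central fps_units (Suc d) #>\<^bsub>fps_units\<^esub> h"
   using U.lcs_lie_component[OF y d] unfolding U.lcs_quotient_carrier by blast
  have gh: "g * h \<in> lower_central fps_units d" using U.lower_central_mult[OF g(1) h(1)] by simp
  have "(x \<oplus>\<^bsub>lcs_lie fps_units\<^esub> y) d = lower_central fps_units (Suc d) #>\<^bsub>fps_units\<^esub> (g * h)"
   using d U.lcs_quotient_mult[OF U.lower_central_closed[OF g(1)] U.lower_central_closed[OF h(1)], of d]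
   by (simp add: U.lcs_lie_simps g(2) h(2))
  hence "fps_nth (lead_series (x \<oplus>\<^bsub>lcs_lie fps_units\<^esub> y)) d = fps_nth (g * h) d"
   by (rule lead_series_coset[of d _ "x \<oplus>\<^bsub>lcs_lie fps_units\<^esub> y", OF d gh])
  also have "... = fps_nth g d + fps_nth h d"
   using fps_units_mult_level(2)[OF fps_units_lower_central[OF d g(1)] fps_units_lower_central[OF d h(1)] d] d by simp
  finally show ?thesis using lead_series_coset[of d g x, OF d g] lead_series_coset[of d h y, OF d h] by simp
 qed
qed

lemma lead_series_zero: "lead_series \<zero>\<^bsub>lcs_lie fps_units\<^esub> = (0 :: 'r::ring_1 fps)"
proof -
 interpret L: lie_ring "lcs_lie (fps_units :: 'r fps monoid)" by (rule U.lcs_lie_lie_ring)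
 show ?thesis
  using lead_series_add[OF L.zero_closed L.zero_closed] by (simp add: L.l_zero[OF L.zero_closed])
qed

lemma lead_series_bracket:
 assumes x: "x \<in> carrier (lcs_lie fps_units)" and y: "y \<in> carrier (lcs_lie fps_units)"
 shows "lead_series (x \<otimes>\<^bsub>lcs_lie fps_units\<^esub> y) = lead_series x * lead_series y - lead_series y * (lead_series x :: 'r::ring_1 fps)"
proof -
 interpret L: lie_ring "lcs_lie (fps_units :: 'r fps monoid)" by (rule U.lcs_lie_lie_ring)
 show ?thesis using x
 proof (induction x rule: U.lcs_lie_induct)
  case zero thus ?case using y by (simp add: lead_series_zero)
 next
  case (add u v)
  thus ?case using y by (simp add: L.br_add_left L.br_closed lead_series_add algebra_simps)
 next
  case (homog k g)
  note kg = this
  show ?case using y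
  proof (induction y rule: U.lcs_lie_induct)
   case zero thus ?case using kg by (simp add: lead_series_zero)
  next
   case (add u v)
   thus ?case using kg by (simp add: L.br_add_right L.br_closed lead_series_add algebra_simps)
  next
   case (homog l h)
   have c: "commutator fps_units g h \<in> lower_central fps_units (k + l)"
    using kg homog by (intro U.lower_central_commutator)
   have gh: "fps_nth g 0 = 1" "fps_nth h 0 = 1"
    using U.lower_central_closed[OF kg(2)] U.lower_central_closed[OF homog(2)] by simp_all
   have "fps_nth (commutator fps_units g h) (k + l) = fps_nth g k * fps_nth h l - fps_nth h l * fps_nth g k"
    using fps_units_commutator(2)[OF gh(1) fps_units_lower_central[OF kg] gh(2) fps_units_lower_central[OF homog]]
     kg(1) homog(1) by simp
   moreover have "lead_series (U.lcs_homog (k + l) (commutator fps_units g h)) = fps_single (k + l) (fps_nth (commutator fps_units g h) (k + l))"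
    using kg(1) by (intro lead_series_homog c) simp
   moreover have "fps_single (k + l) (a - b) = fps_single (k + l) a - fps_single (k + l) b" for a b :: 'r
    by (simp add: fps_eq_iff)
   moreover have "fps_single l (fps_nth h l) * fps_single k (fps_nth g k) = fps_single (k + l) (fps_nth h l * fps_nth g k)"
    by (simp add: fps_single_mult add.commute)
   ultimately show ?case
    using kg homog by (simp add: U.lcs_homog_bracket lead_series_homog fps_single_mult)
  qed
 qed
qed

end

section \<open>Setting the variable of the series to 1, and the Magnus criterion\<close>

lemma sum_fps_mult:
 assumes "!!i. i > a ==> fps_nth f i = 0" "!!i. i > b ==> fps_nth g i = 0"
 shows "(\<Sum>n\<le>a + b. fps_nth (f * g) n) = (\<Sum>i\<le>a. fps_nth f i) * (\<Sum>j\<le>b. fps_nth g (j::nat) :: 'r::ring_1)"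
proof -
 have "(\<Sum>n\<le>a + b. fps_nth (f * g) n) = (\<Sum>n\<le>a + b. \<Sum>i\<le>n. fps_nth f i * fps_nth g (n - i))"
  by (simp add: fps_mult_nth atMost_atLeast0)
 also have "... = (\<Sum>(i,j)\<in>{(i,j). i + j \<le> a + b}. fps_nth f i * fps_nth g j)"
  by (rule sum.triangle_reindex_eq[symmetric])
 also have "... = (\<Sum>(i,j)\<in>{..a} \<times> {..b}. fps_nth f i * fps_nth g j)"
 proof (rule sum.mono_neutral_right)
  have "{(i, j). i + j \<le> a + b} \<subseteq> {..a + b} \<times> {..a + b}" by auto
  thus "finite {(i, j). i + j \<le> a + b}" by (rule finite_subset) simp
  show "\<forall>i\<in>{(i, j). i + j \<le> a + b} - {..a} \<times> {..b}. (case i of (i, j) => fps_nth f i * fps_nth g j) = 0"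
  proof
   fix p assume p: "p \<in> {(i, j). i + j \<le> a + b} - {..a} \<times> {..b}"
   obtain i j where ij: "p = (i, j)" by (cases p)
   have "i > a \<or> j > b" using p ij by auto
   thus "(case p of (i, j) => fps_nth f i * fps_nth g j) = 0" using assms ij by auto
  qed
 qed auto
 also have "... = (\<Sum>i\<le>a. fps_nth f i) * (\<Sum>j\<le>b. fps_nth g j)"
  by (simp add: sum_product sum.cartesian_product)
 finally show ?thesis .
qed

text \<open>A term evaluates to a polynomial whose degree is bounded by its weight, and summing the
  coefficients, that is, putting the variable equal to 1, is multiplicative on polynomials. So the
  graded evaluation determines the ungraded one.\<close>

lemma leval_fps_single:
 "(\<forall>i > lweight (%_. 1) t. fps_nth (leval (%q. fps_single 1 (v q)) t) i = 0) \<and>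
  (\<forall>n \<ge> lweight (%_. 1) t. (\<Sum>i\<le>n. fps_nth (leval (%q. fps_single 1 (v q)) t) i) = leval v (t :: 'a lie_term) )"
proof (induction t)
 case (LBr s t)
 let ?w = "lweight (%_. 1) :: 'a lie_term => nat"
 let ?e = "leval (%q. fps_single 1 (v q))"
 have z: "fps_nth (f * g) i = 0" if "i > a + b" "\<forall>i>a. fps_nth f i = 0" "\<forall>i>b. fps_nth g i = 0" for f g :: "'b fps" and i a b
  unfolding fps_mult_nth
 proof (rule sum.neutral, rule ballI)
  fix j assume "j \<in> {0..i}"
  hence "j > a \<or> i - j > b" using that by auto
  thus "fps_nth f j * fps_nth g (i - j) = 0" using that by auto
 qed
 have zero: "fps_nth (?e (LBr s t)) i = 0" if "i > ?w s + ?w t" for i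
  using z[of "?w s" "?w t" i "?e s" "?e t"] z[of "?w t" "?w s" i "?e t" "?e s"] LBr that by simp
 have "(\<Sum>i\<le>n. fps_nth (?e (LBr s t)) i) = leval v (LBr s t)" if "n \<ge> ?w s + ?w t" for n
 proof -
  have "(\<Sum>i\<le>n. fps_nth (?e (LBr s t)) i) = (\<Sum>i\<le>?w s + ?w t. fps_nth (?e (LBr s t)) i)"
   by (rule sum.mono_neutral_right) (use that zero in auto)
  also have "... = (\<Sum>i\<le>?w s + ?w t. fps_nth (?e s * ?e t) i) - (\<Sum>i\<le>?w t + ?w s. fps_nth (?e t * ?e s) i)"
   by (simp add: sum_subtractf add.commute)
  also have "... = leval v (LBr s t)"
   using LBr sum_fps_mult[of "?w s" "?e s" "?w t" "?e t"] sum_fps_mult[of "?w t" "?e t" "?w s" "?e s"] by simp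
  finally show ?thesis .
 qed
 thus ?case using zero by simp
qed (auto simp: sum.distrib sum_negf)

text \<open>Letters outside \<open>S\<close> go to zero because \<open>free_lie_lift\<close> needs a
  value in the carrier for every letter.\<close>

definition degree_one_map :: "('a, 'm) monoid_scheme => 'q set => ('q => 'a) => 'q free_lie => nat => 'a set" where
 "degree_one_map G S x = free_lie_lift (lcs_lie G) (%q. if q \<in> S then lcs_degree_one G (x q) else \<zero>\<^bsub>lcs_lie G\<^esub>)"

context group
begin

lemma lcs_homog_one_closed [simp]: "g \<in> carrier G ==> lcs_homog (Suc 0) g \<in> \<L>"
 by (rule lcs_homog_closed) simp

lemma degree_one_map:
 assumes x: "x \<in> S \<rightarrow> carrier G"
 shows "degree_one_map G S x \<in> lie_hom (free_lie S) (lcs_lie G)"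
  "q \<in> S ==> degree_one_map G S x (fl_gen q) = lcs_homog 1 (x q)"
  "degree_one_map G S x (a + b) = degree_one_map G S x a +\<^sub>L degree_one_map G S x b"
  "degree_one_map G S x (fl_br a b) = degree_one_map G S x a *\<^sub>L degree_one_map G S x b"
  "degree_one_map G S x a \<in> \<L>"
  "degree_one_map G S x 0 = \<zero>\<^sub>L" "degree_one_map G S x (- a) = \<ominus>\<^bsub>lcs_lie G\<^esub> degree_one_map G S x a"
proof -
 interpret L: lie_ring "lcs_lie G" by (rule lcs_lie_lie_ring)
 have "(%q. if q \<in> S then lcs_degree_one G (x q) else \<zero>\<^sub>L) \<in> UNIV \<rightarrow> \<L>"
  using x by (auto simp: lcs_degree_one_eq intro!: lcs_homog_one_closed)
 from free_lie_lift_hom[OF lcs_lie_lie_ring this]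
 show "degree_one_map G S x \<in> lie_hom (free_lie S) (lcs_lie G)"
  "q \<in> S ==> degree_one_map G S x (fl_gen q) = lcs_homog 1 (x q)"
  "degree_one_map G S x (a + b) = degree_one_map G S x a +\<^sub>L degree_one_map G S x b"
  "degree_one_map G S x (fl_br a b) = degree_one_map G S x a *\<^sub>L degree_one_map G S x b"
  "degree_one_map G S x a \<in> \<L>"
  "degree_one_map G S x 0 = \<zero>\<^sub>L" "degree_one_map G S x (- a) = \<ominus>\<^bsub>lcs_lie G\<^esub> degree_one_map G S x a"
  by (auto simp: degree_one_map_def lcs_degree_one_eq)
qed

text \<open>A homomorphism that maps \<open>x q\<close> to \<open>1 + v q X\<close> turns the degree
  one map, after taking leading coefficients, into evaluation at \<open>v q X\<close>. If the image
  of \<open>a\<close> vanishes, then so does this evaluation, and putting \<open>X = 1\<close> shows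
  that \<open>v\<close> annihilates \<open>a\<close>. As \<open>v\<close> is arbitrary, the
  separation theorem applies.\<close>

theorem degree_one_map_injective:
 fixes S :: "nat set"
 assumes x: "x \<in> S \<rightarrow> carrier G"
  and magnus: "!!v :: nat => int fps endo. \<exists>f\<in>hom G fps_units. \<forall>q\<in>S. f (x q) = 1 + fps_single 1 (v q)"
  and a: "a \<in> carrier (free_lie S)" and zero: "degree_one_map G S x a = \<zero>\<^sub>L"
 shows "a = 0"
proof (rule free_lie_rep_separates)
 fix v :: "nat => int fps endo"
 interpret U: group "fps_units :: int fps endo fps monoid" by (rule fps_units_group)
 interpret LG: lie_ring "lcs_lie G" by (rule lcs_lie_lie_ring)
 interpret LU: lie_ring "lcs_lie (fps_units :: int fps endo fps monoid)" by (rule U.lcs_lie_lie_ring)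
 obtain f where f: "f \<in> hom G fps_units" "!!q. q \<in> S ==> f (x q) = 1 + fps_single 1 (v q)"
  using magnus by blast
 interpret f: group_hom G fps_units f by unfold_locales (rule f)
 define T where "T a = lead_series (lcs_map G fps_units f (degree_one_map G S x a))" for a
 have T_eq: "T a = fl_eval (%q. fps_single 1 (v q)) a" if "a \<in> carrier (free_lie S)" for a
  using that
 proof (induction a rule: free_lie_induct)
  case (gen q)
  hence xq: "x q \<in> \<gamma> 1" using x by auto
  have "f (x q) \<in> lower_central fps_units 1" using xq by (rule f.hom_lower_central)
  thus ?case
   using gen f(2) by (simp add: T_def degree_one_map(2)[OF x] f.lcs_map_homog[OF xq, simplified] lead_series_homog)
 next
  case zero
  thus ?case by (simp add: T_def degree_one_map[OF x] f.lcs_map_zero lead_series_zero)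
 next
  case (neg a)
  have "T a + T (- a) = T 0"
   unfolding T_def
   by (subst lead_series_add[symmetric])
    (simp_all add: degree_one_map[OF x] f.lcs_map_closed LG.r_neg flip: f.lcs_map_add)
  also have "T 0 = 0" by (simp add: T_def degree_one_map[OF x] f.lcs_map_zero lead_series_zero)
  finally show ?case using neg by (simp add: add_eq_0_iff)
 next
  case (add a b)
  thus ?case by (simp add: T_def degree_one_map[OF x] f.lcs_map_add f.lcs_map_closed lead_series_add)
 next
  case (br a b)
  thus ?case by (simp add: T_def degree_one_map[OF x] lie_homD(3)[OF f.lcs_map_lie_hom] f.lcs_map_closed lead_series_bracket)
 qed
 have "T a = 0" by (simp add: T_def zero f.lcs_map_zero lead_series_zero)
 hence ev: "fl_eval (%q. fps_single 1 (v q)) a = 0" using T_eq[OF a] by simp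
 obtain t where t: "a = abs_free_lie t" by (metis Quotient_free_lie Quotient_abs_rep)
 have "leval v t = 0" using leval_fps_single[of t v] ev by (auto simp: t fl_eval_abs)
 thus "fl_eval v a = 0" by (simp add: t fl_eval_abs)
qed

end

section \<open>The structure of the Lie ring of a split extension\<close>

lemma lie_isomorphic_inverse:
 assumes f: "f \<in> lie_hom K L" "bij_betw f (carrier K) (carrier L)"
  and cl: "!!x y. x \<in> carrier K ==> y \<in> carrier K ==> x \<oplus>\<^bsub>K\<^esub> y \<in> carrier K"
   "!!x y. x \<in> carrier K ==> y \<in> carrier K ==> x \<otimes>\<^bsub>K\<^esub> y \<in> carrier K"
 shows "lie_isomorphic L K"
proof -
 define g where "g = inv_into (carrier K) f"
 have g: "bij_betw g (carrier L) (carrier K)" unfolding g_def by (rule bij_betw_inv_into[OF f(2)])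
 have fg: "f (g y) = y" if "y \<in> carrier L" for y
  using f(2) that by (simp add: g_def bij_betw_inv_into_right)
 have gf: "g (f x) = x" if "x \<in> carrier K" for x
  using f(2) that by (simp add: g_def bij_betw_inv_into_left)
 have gc: "g y \<in> carrier K" if "y \<in> carrier L" for y using g that by (auto simp: bij_betw_def)
 have "g \<in> lie_hom L K"
  unfolding lie_hom_def
 proof (intro CollectI conjI ballI)
  show "g \<in> carrier L \<rightarrow> carrier K" using gc by blast
  fix x y assume "x \<in> carrier L" "y \<in> carrier L"
  hence xy: "x = f (g x)" "y = f (g y)" "g x \<in> carrier K" "g y \<in> carrier K" using fg gc by simp_all
  have "x \<oplus>\<^bsub>L\<^esub> y = f (g x \<oplus>\<^bsub>K\<^esub> g y)" using lie_homD(2)[OF f(1) xy(3,4)] xy(1,2) by simp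
  thus "g (x \<oplus>\<^bsub>L\<^esub> y) = g x \<oplus>\<^bsub>K\<^esub> g y" using gf cl xy(3,4) by simp
  have "x \<otimes>\<^bsub>L\<^esub> y = f (g x \<otimes>\<^bsub>K\<^esub> g y)" using lie_homD(3)[OF f(1) xy(3,4)] xy(1,2) by simp
  thus "g (x \<otimes>\<^bsub>L\<^esub> y) = g x \<otimes>\<^bsub>K\<^esub> g y" using gf cl xy(3,4) by simp
 qed
 thus ?thesis using g by (auto simp: lie_isomorphic_def)
qed

lemma lie_hom_inj_onI:
 assumes "lie_ring K" "lie_ring L" "f \<in> lie_hom K L" "!!x. x \<in> carrier K ==> f x = \<zero>\<^bsub>L\<^esub> ==> x = \<zero>\<^bsub>K\<^esub>"
 shows "inj_on f (carrier K)"
proof (rule inj_onI)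
 fix x y assume xy: "x \<in> carrier K" "y \<in> carrier K" "f x = f y"
 interpret K: lie_ring K by fact
 interpret L: lie_ring L by fact
 have y: "\<ominus>\<^bsub>K\<^esub> y \<in> carrier K" using xy by simp
 have "f (x \<oplus>\<^bsub>K\<^esub> \<ominus>\<^bsub>K\<^esub> y) = f y \<oplus>\<^bsub>L\<^esub> \<ominus>\<^bsub>L\<^esub> f y"
  unfolding lie_homD(2)[OF assms(3) xy(1) y] lie_hom_zero_neg(2)[OF assms(3,1,2) xy(2)] xy(3) ..
 also have "... = \<zero>\<^bsub>L\<^esub>" by (rule L.r_neg[OF lie_homD(1)[OF assms(3) xy(2)]])
 finally have "x \<oplus>\<^bsub>K\<^esub> \<ominus>\<^bsub>K\<^esub> y = \<zero>\<^bsub>K\<^esub>" using xy y by (intro assms(4)) simp_all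
 hence "\<ominus>\<^bsub>K\<^esub> (\<ominus>\<^bsub>K\<^esub> y) = x" using xy y by (intro K.minus_equality)
 thus "x = y" using xy by simp
qed

context group
begin

lemma degree_one_map_surj:
 assumes x: "x \<in> S \<rightarrow> carrier G" and gen: "carrier G = generate G (x ` S)"
 shows "degree_one_map G S x ` carrier (free_lie S) = \<L>"
proof
 let ?f = "degree_one_map G S x"
 note f = degree_one_map[OF x]
 interpret L: lie_ring "lcs_lie G" by (rule lcs_lie_lie_ring)
 show "?f ` carrier (free_lie S) \<subseteq> \<L>" using f(5) by blast
 have add: "u +\<^sub>L v \<in> ?f ` carrier (free_lie S)"
  if "u \<in> ?f ` carrier (free_lie S)" "v \<in> ?f ` carrier (free_lie S)" for u v
  using that by (auto simp: f(3)[symmetric])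
 have br: "u *\<^sub>L v \<in> ?f ` carrier (free_lie S)"
  if "u \<in> ?f ` carrier (free_lie S)" "v \<in> ?f ` carrier (free_lie S)" for u v
  using that by (auto simp: f(4)[symmetric])
 have neg: "\<ominus>\<^bsub>lcs_lie G\<^esub> u \<in> ?f ` carrier (free_lie S)" if "u \<in> ?f ` carrier (free_lie S)" for u
  using that by (auto simp: f(7)[symmetric])
 have gens: "lcs_homog 1 (x q) \<in> ?f ` carrier (free_lie S)" if "q \<in> S" for q
  using f(2)[OF that] that by (intro image_eqI[of _ _ "fl_gen q"]) simp_all
 have inv1: "lcs_homog 1 (inv g) = \<ominus>\<^bsub>lcs_lie G\<^esub> lcs_homog 1 g" if g: "g \<in> carrier G" for g
 proof (rule L.minus_equality[symmetric])
  have "lcs_homog 1 (inv g) +\<^sub>L lcs_homog 1 g = lcs_homog 1 (inv g \<otimes> g)"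
   using g by (intro lcs_homog_mult[symmetric]) auto
  also have "... = \<zero>\<^sub>L" using g lcs_homog_zero_iff[of 1 \<one>] by simp
  finally show "lcs_homog 1 (inv g) +\<^sub>L lcs_homog 1 g = \<zero>\<^sub>L" .
 qed (use g in simp_all)
 show "\<L> \<subseteq> ?f ` carrier (free_lie S)"
 proof
  fix y assume "y \<in> \<L>"
  thus "y \<in> ?f ` carrier (free_lie S)"
  proof (induction y rule: lcs_lie_induct_degree_one)
   case (deg_one g)
   hence "g \<in> generate G (x ` S)" using gen by simp
   hence "g \<in> carrier G \<and> lcs_homog 1 g \<in> ?f ` carrier (free_lie S)"
   proof (induction rule: generate.induct)
    case one
    have "lcs_homog 1 \<one> = ?f 0" using lcs_homog_zero_iff[of 1 \<one>] f(6) by simp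
    thus ?case by auto
   next
    case (incl h) thus ?case using gens x by auto
   next
    case (inv h)
    hence "h \<in> carrier G" "lcs_homog 1 h \<in> ?f ` carrier (free_lie S)" using gens x by auto
    thus ?case using inv1[of h] neg by simp
   next
    case (eng a b)
    hence "lcs_homog 1 (a \<otimes> b) = lcs_homog 1 a +\<^sub>L lcs_homog 1 b" by (intro lcs_homog_mult) auto
    thus ?case using eng add by simp
   qed
   thus ?case ..
  qed (use add br neg in blast)+
 qed
qed

theorem lcs_lie_free:
 fixes S :: "nat set"
 assumes x: "x \<in> S \<rightarrow> carrier G" and gen: "carrier G = generate G (x ` S)"
  and magnus: "!!v :: nat => int fps endo. \<exists>f\<in>hom G fps_units. \<forall>q\<in>S. f (x q) = 1 + fps_single 1 (v q)"
 shows "lie_isomorphic (lcs_lie G) (free_lie S)"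
proof (rule lie_isomorphic_inverse)
 show "degree_one_map G S x \<in> lie_hom (free_lie S) (lcs_lie G)" by (rule degree_one_map[OF x])
 have "inj_on (degree_one_map G S x) (carrier (free_lie S))"
  using lie_hom_inj_onI[OF free_lie_is_lie_ring lcs_lie_lie_ring degree_one_map(1)[OF x]]
   degree_one_map_injective[OF x magnus] by simp
 thus "bij_betw (degree_one_map G S x) (carrier (free_lie S)) (\<L>)"
  using degree_one_map_surj[OF x gen] by (simp add: bij_betw_def)
qed simp_all

end

section \<open>Derivations, semidirect products and the Lie ring of an extension\<close>

lemma free_lie_diff_closed [simp]:
 "x \<in> carrier (free_lie S) ==> y \<in> carrier (free_lie S) ==> x - y \<in> carrier (free_lie S)"
 using free_lie_closed(1)[of x S "- y"] free_lie_closed(4)[of y S] by simp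

lemma Der_simps:
 "carrier (Der L) = derivations L"
 "x \<in> carrier L ==> (D \<oplus>\<^bsub>Der L\<^esub> E) x = D x \<oplus>\<^bsub>L\<^esub> E x"
 "x \<in> carrier L ==> (D \<otimes>\<^bsub>Der L\<^esub> E) x = D (E x) \<ominus>\<^bsub>L\<^esub> E (D x)"
 by (simp_all add: Der_def)

lemma derivationD:
 assumes "D \<in> derivations L"
 shows "x \<in> carrier L ==> D x \<in> carrier L"
  "x \<in> carrier L ==> y \<in> carrier L ==> D (x \<oplus>\<^bsub>L\<^esub> y) = D x \<oplus>\<^bsub>L\<^esub> D y"
  "x \<in> carrier L ==> y \<in> carrier L ==> D (x \<otimes>\<^bsub>L\<^esub> y) = D x \<otimes>\<^bsub>L\<^esub> y \<oplus>\<^bsub>L\<^esub> x \<otimes>\<^bsub>L\<^esub> D y"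
 using assms by (auto simp: derivations_def)

lemma lie_semidirect_simps:
 "carrier (lie_semidirect H L \<rho>) = carrier L \<times> carrier H"
 "(a, h) \<oplus>\<^bsub>lie_semidirect H L \<rho>\<^esub> (b, k) = (a \<oplus>\<^bsub>L\<^esub> b, h \<oplus>\<^bsub>H\<^esub> k)"
 "(a, h) \<otimes>\<^bsub>lie_semidirect H L \<rho>\<^esub> (b, k) = ((a \<otimes>\<^bsub>L\<^esub> b \<oplus>\<^bsub>L\<^esub> \<rho> h b) \<ominus>\<^bsub>L\<^esub> \<rho> k a, h \<otimes>\<^bsub>H\<^esub> k)"
 by (simp_all add: lie_semidirect_def)

context split_extension
begin

text \<open>Conjugation by an element of \<open>N\<close> is trivial on the abelianization of
  \<open>N\<close>; if \<open>s h\<close> acts on each generator by such a conjugation, it acts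
  trivially there as a whole.\<close>

lemma trivial_action_from_generators:
 assumes gen: "carrier N = generate N (x ` S)" and x: "x \<in> S \<rightarrow> carrier N"
  and act: "!!h q. h \<in> carrier H ==> q \<in> S ==> \<exists>k\<in>carrier N. s h \<otimes> i (x q) \<otimes> inv s h = i (inv\<^bsub>N\<^esub> k \<otimes>\<^bsub>N\<^esub> x q \<otimes>\<^bsub>N\<^esub> k)"
  and h: "h \<in> carrier H" and u: "u \<in> carrier N"
 shows "commutator G (s h) (i u) \<in> A 2"
proof (rule i.H.commutator_generate_right[OF A_normal])
 have "x ` S \<subseteq> carrier N" using x by auto
 from i.generate_img[OF this] show "i u \<in> generate G (i ` (x ` S))"
  using u gen by auto
 fix a assume "a \<in> i ` (x ` S)"
 then obtain q where q: "q \<in> S" "a = i (x q)" by auto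
 obtain k where k: "k \<in> carrier N" "s h \<otimes> i (x q) \<otimes> inv s h = i (inv\<^bsub>N\<^esub> k \<otimes>\<^bsub>N\<^esub> x q \<otimes>\<^bsub>N\<^esub> k)"
  using act[OF h q(1)] by blast
 have xq: "x q \<in> carrier N" using x q by auto
 have "commutator G (s h) a = i (inv\<^bsub>N\<^esub> k \<otimes>\<^bsub>N\<^esub> x q \<otimes>\<^bsub>N\<^esub> k) \<otimes> inv i (x q)"
  using k q by (simp add: commutator_def)
 also have "... = i (commutator N (inv\<^bsub>N\<^esub> k) (x q))"
  using k xq by (simp add: commutator_def)
 finally show "commutator G (s h) a \<in> A 2"
  using i.G.commutator_lower_Suc[of 1 "inv\<^bsub>N\<^esub> k" "x q"] k xq by (simp add: numeral_2_eq_2)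
qed (use h x in \<open>auto intro!: i.hom_closed dest: funcset_mem\<close>)

text \<open>The isomorphism adds the image of \<open>a\<close> in the Lie ring of \<open>G\<close>
  to the image of \<open>h\<close> under the section. It respects brackets once bracketing with
  \<open>h\<close> in \<open>G\<close> is the derivation \<open>\<rho> h\<close>. Both sides are
  derivations in \<open>a\<close> and compatible with brackets in \<open>h\<close>, so generators of
  \<open>N\<close> and elements of degree one of \<open>H\<close> suffice. There the commutator of
  \<open>s h\<close> with \<open>x q\<close> is that of \<open>k^-1\<close> with \<open>x q\<close>,
  and its class is the bracket of \<open>x q\<close> with \<open>k\<close>.\<close>

theorem lcs_lie_split_extension:
 fixes S :: "nat set"
 assumes x: "x \<in> S \<rightarrow> carrier N" and gen: "carrier N = generate N (x ` S)"
  and magnus: "!!v :: nat => int fps endo. \<exists>f\<in>hom N fps_units. \<forall>q\<in>S. f (x q) = 1 + fps_single 1 (v q)"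
  and \<rho>: "\<rho> \<in> lie_hom (lcs_lie H) (Der (free_lie S))"
  and act: "!!h q. h \<in> carrier H ==> q \<in> S ==> \<exists>k\<in>carrier N. \<exists>l\<in>carrier (free_lie S).
    s h \<otimes> i (x q) \<otimes> inv s h = i (inv\<^bsub>N\<^esub> k \<otimes>\<^bsub>N\<^esub> x q \<otimes>\<^bsub>N\<^esub> k) \<and>
    degree_one_map N S x l = lcs_degree_one N k \<and>
    \<rho> (lcs_degree_one H h) (fl_gen q) = fl_br (fl_gen q) l"
 shows "lie_isomorphic (lcs_lie G) (lie_semidirect (lcs_lie H) (free_lie S) \<rho>)"
proof -
 interpret split_extension_trivial N G H i p s
 proof unfold_locales
  fix h u assume hu: "h \<in> carrier H" "u \<in> carrier N"
  show "commutator G (s h) (i u) \<in> i ` lower_central N 2"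
   by (rule trivial_action_from_generators[OF gen x _ hu]) (use act in blast)
 qed
 let ?F = "free_lie S" and ?LN = "lcs_lie N" and ?LG = "lcs_lie G" and ?LH = "lcs_lie H"
 interpret F: lie_ring ?F by (rule free_lie_is_lie_ring)
 interpret LN: lie_ring ?LN by (rule i.G.lcs_lie_lie_ring)
 interpret LG: lie_ring ?LG by (rule i.H.lcs_lie_lie_ring)
 interpret LH: lie_ring ?LH by (rule p.H.lcs_lie_lie_ring)
 let ?f = "degree_one_map N S x"
 note f = i.G.degree_one_map[OF x]
 define inc where "inc = lcs_map N G i"
 define ss where "ss = lcs_map H G s"
 have inc: "inc \<in> lie_hom ?LN ?LG" unfolding inc_def by (rule i.lcs_map_lie_hom)
 have ss: "ss \<in> lie_hom ?LH ?LG" unfolding ss_def by (rule s.lcs_map_lie_hom)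
 note incD = lie_homD[OF inc] lie_hom_zero_neg[OF inc LN.lie_ring_axioms LG.lie_ring_axioms]
 note ssD = lie_homD[OF ss] lie_hom_zero_neg[OF ss LH.lie_ring_axioms LG.lie_ring_axioms]
 define \<phi> where "\<phi> a = inc (?f a)" for a
 have \<phi>: "\<phi> (a + b) = \<phi> a \<oplus>\<^bsub>?LG\<^esub> \<phi> b" "\<phi> (fl_br a b) = \<phi> a \<otimes>\<^bsub>?LG\<^esub> \<phi> b"
  "\<phi> a \<in> carrier ?LG" "\<phi> 0 = \<zero>\<^bsub>?LG\<^esub>" "\<phi> (- a) = \<ominus>\<^bsub>?LG\<^esub> \<phi> a" for a b
  by (simp_all add: \<phi>_def f incD)
 have \<rho>D: "\<rho> h \<in> derivations ?F" if "h \<in> carrier ?LH" for h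
  using lie_homD(1)[OF \<rho> that] by (simp add: Der_simps)
 have \<rho>c: "\<rho> h a \<in> carrier ?F" if "h \<in> carrier ?LH" "a \<in> carrier ?F" for h a
  using derivationD(1)[OF \<rho>D] that by blast
 have \<rho>a: "\<rho> h (a + b) = \<rho> h a + \<rho> h b" "\<rho> h (fl_br a b) = fl_br (\<rho> h a) b + fl_br a (\<rho> h b)"
  if "h \<in> carrier ?LH" "a \<in> carrier ?F" "b \<in> carrier ?F" for h a b
  using derivationD(2,3)[OF \<rho>D[OF that(1)] that(2,3)] by simp_all
 have \<rho>0: "\<rho> h 0 = 0" if "h \<in> carrier ?LH" for h
  using \<rho>a(1)[OF that, of 0 0] by simp
 have \<rho>n: "\<rho> h (- a) = - \<rho> h a" if "h \<in> carrier ?LH" "a \<in> carrier ?F" for h a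
  using \<rho>a(1)[OF that(1), of a "- a"] \<rho>0[OF that(1)] that by (simp add: add_eq_0_iff)
 have \<rho>h: "\<rho> (h \<oplus>\<^bsub>?LH\<^esub> k) a = \<rho> h a + \<rho> k a" "\<rho> (h \<otimes>\<^bsub>?LH\<^esub> k) a = \<rho> h (\<rho> k a) - \<rho> k (\<rho> h a)"
  if "h \<in> carrier ?LH" "k \<in> carrier ?LH" "a \<in> carrier ?F" for h k a
  using that lie_homD(2,3)[OF \<rho>, of h k] \<rho>c by (simp_all add: Der_simps)
 have \<rho>z: "\<rho> \<zero>\<^bsub>?LH\<^esub> a = 0" if "a \<in> carrier ?F" for a
  using \<rho>h(1)[of "\<zero>\<^bsub>?LH\<^esub>" "\<zero>\<^bsub>?LH\<^esub>" a] that by simp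
 have \<rho>m: "\<rho> (\<ominus>\<^bsub>?LH\<^esub> h) a = - \<rho> h a" if "h \<in> carrier ?LH" "a \<in> carrier ?F" for h a
  using \<rho>h(1)[of h "\<ominus>\<^bsub>?LH\<^esub> h" a] that \<rho>z by (simp add: LH.r_neg add_eq_0_iff)
 have ext: "\<forall>a\<in>carrier ?F. ss h \<otimes>\<^bsub>?LG\<^esub> \<phi> a = \<phi> (\<rho> h a)"
  if h: "h \<in> carrier ?LH" and g: "\<forall>q\<in>S. ss h \<otimes>\<^bsub>?LG\<^esub> \<phi> (fl_gen q) = \<phi> (\<rho> h (fl_gen q))" for h
 proof
  fix a assume "a \<in> carrier ?F"
  thus "ss h \<otimes>\<^bsub>?LG\<^esub> \<phi> a = \<phi> (\<rho> h a)"
  proof (induction a rule: free_lie_induct)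
   case (br a b)
   thus ?case using h LG.leibniz[of "ss h" "\<phi> a" "\<phi> b"]
    by (simp add: \<phi> \<rho>a ssD)
  qed (use h g in \<open>simp_all add: \<phi> \<rho>a \<rho>0 \<rho>n ssD LG.br_add_right LG.br_minus_right\<close>)
 qed
 have bracket: "\<forall>a\<in>carrier ?F. ss h \<otimes>\<^bsub>?LG\<^esub> \<phi> a = \<phi> (\<rho> h a)" if "h \<in> carrier ?LH" for h
  using that
 proof (induction h rule: p.H.lcs_lie_induct_degree_one)
  case (deg_one h)
  have h1: "p.H.lcs_homog 1 h \<in> carrier ?LH" using deg_one by simp
  show ?case
  proof (rule ext[OF h1], rule ballI)
   fix q assume q: "q \<in> S"
   obtain k l where k: "k \<in> carrier N" "l \<in> carrier ?F"
    "s h \<otimes> i (x q) \<otimes> inv s h = i (inv\<^bsub>N\<^esub> k \<otimes>\<^bsub>N\<^esub> x q \<otimes>\<^bsub>N\<^esub> k)"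
    "?f l = i.G.lcs_homog 1 k" "\<rho> (p.H.lcs_homog 1 h) (fl_gen q) = fl_br (fl_gen q) l"
    using act[OF deg_one q] by (auto simp: i.G.lcs_degree_one_eq p.H.lcs_degree_one_eq)
   have xq: "x q \<in> carrier N" using x q by auto
   have e1: "commutator G (s h) (i (x q)) = i (commutator N (inv\<^bsub>N\<^esub> k) (x q))"
    using k xq deg_one by (simp add: commutator_def)
   have "ss (p.H.lcs_homog 1 h) \<otimes>\<^bsub>?LG\<^esub> \<phi> (fl_gen q) = i.H.lcs_homog 1 (s h) \<otimes>\<^bsub>?LG\<^esub> i.H.lcs_homog 1 (i (x q))"
    using deg_one xq q by (simp add: ss_def \<phi>_def inc_def f(2)[simplified] s.lcs_map_homog i.lcs_map_homog)
   also have "... = i.H.lcs_homog (1 + 1) (commutator G (s h) (i (x q)))"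
    using deg_one xq by (intro i.H.lcs_homog_bracket) auto
   also have "... = inc (i.G.lcs_homog (1 + 1) (commutator N (inv\<^bsub>N\<^esub> k) (x q)))"
    unfolding e1 inc_def using k xq i.G.lower_central_commutator[of 1 1 "inv\<^bsub>N\<^esub> k" "x q"]
    by (intro i.lcs_map_homog[symmetric]) simp
   also have "i.G.lcs_homog (1 + 1) (commutator N (inv\<^bsub>N\<^esub> k) (x q)) = i.G.lcs_homog 1 (inv\<^bsub>N\<^esub> k) \<otimes>\<^bsub>?LN\<^esub> i.G.lcs_homog 1 (x q)"
    using k xq by (intro i.G.lcs_homog_bracket[symmetric]) auto
   \<comment> \<open>The inverse of \<open>k\<close> contributes a sign, which reversing the order
     of the bracket cancels.\<close>
   also have "i.G.lcs_homog 1 (inv\<^bsub>N\<^esub> k) = \<ominus>\<^bsub>?LN\<^esub> ?f l"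
   proof (rule LN.minus_equality[symmetric])
    have "i.G.lcs_homog 1 (inv\<^bsub>N\<^esub> k) \<oplus>\<^bsub>?LN\<^esub> i.G.lcs_homog 1 k = i.G.lcs_homog 1 (inv\<^bsub>N\<^esub> k \<otimes>\<^bsub>N\<^esub> k)"
     using k by (intro i.G.lcs_homog_mult[symmetric]) auto
    also have "... = \<zero>\<^bsub>?LN\<^esub>" using k i.G.lcs_homog_zero_iff[of 1 "\<one>\<^bsub>N\<^esub>"] by simp
    finally show "i.G.lcs_homog 1 (inv\<^bsub>N\<^esub> k) \<oplus>\<^bsub>?LN\<^esub> ?f l = \<zero>\<^bsub>?LN\<^esub>" by (simp add: k)
   qed (use k f in simp_all)
   also have "(\<ominus>\<^bsub>?LN\<^esub> ?f l) \<otimes>\<^bsub>?LN\<^esub> i.G.lcs_homog 1 (x q) = i.G.lcs_homog 1 (x q) \<otimes>\<^bsub>?LN\<^esub> ?f l"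
    using LN.br_anticomm[of "?f l" "i.G.lcs_homog 1 (x q)"] f(5) xq by (simp add: LN.br_minus_left)
   also have "... = ?f (fl_br (fl_gen q) l)" using q by (simp add: f)
   finally show "ss (p.H.lcs_homog 1 h) \<otimes>\<^bsub>?LG\<^esub> \<phi> (fl_gen q) = \<phi> (\<rho> (p.H.lcs_homog 1 h) (fl_gen q))"
    unfolding \<phi>_def k(5) .
  qed
 next
  case (neg h)
  thus ?case by (simp add: ssD LG.br_minus_left \<phi> \<rho>m)
 next
  case (add h k)
  thus ?case by (simp add: ssD LG.br_add_left \<phi> \<rho>h)
 next
  case (br h k)
  show ?case
  proof
   fix a assume a: "a \<in> carrier ?F"
   have "ss h \<otimes>\<^bsub>?LG\<^esub> (ss k \<otimes>\<^bsub>?LG\<^esub> \<phi> a) = (ss h \<otimes>\<^bsub>?LG\<^esub> ss k) \<otimes>\<^bsub>?LG\<^esub> \<phi> a \<oplus>\<^bsub>?LG\<^esub> ss k \<otimes>\<^bsub>?LG\<^esub> (ss h \<otimes>\<^bsub>?LG\<^esub> \<phi> a)"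
    using br by (intro LG.leibniz) (simp_all add: ssD \<phi>)
   hence e: "\<phi> (\<rho> h (\<rho> k a)) = (ss h \<otimes>\<^bsub>?LG\<^esub> ss k) \<otimes>\<^bsub>?LG\<^esub> \<phi> a \<oplus>\<^bsub>?LG\<^esub> \<phi> (\<rho> k (\<rho> h a))"
    using br a \<rho>c by simp
   have "ss (h \<otimes>\<^bsub>?LH\<^esub> k) \<otimes>\<^bsub>?LG\<^esub> \<phi> a = (ss h \<otimes>\<^bsub>?LG\<^esub> ss k) \<otimes>\<^bsub>?LG\<^esub> \<phi> a" using br by (simp add: ssD)
   also have "... = \<phi> (\<rho> h (\<rho> k a)) \<oplus>\<^bsub>?LG\<^esub> \<ominus>\<^bsub>?LG\<^esub> \<phi> (\<rho> k (\<rho> h a))"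
    unfolding e using br by (simp add: LG.a_assoc LG.r_neg \<phi> ssD LG.br_closed)
   also have "... = \<phi> (\<rho> (h \<otimes>\<^bsub>?LH\<^esub> k) a)"
    using br a by (simp add: \<rho>h \<phi>(5)[symmetric] \<phi>(1)[symmetric])
   finally show "ss (h \<otimes>\<^bsub>?LH\<^esub> k) \<otimes>\<^bsub>?LG\<^esub> \<phi> a = \<phi> (\<rho> (h \<otimes>\<^bsub>?LH\<^esub> k) a)" .
  qed
 qed
 let ?SD = "lie_semidirect ?LH ?F \<rho>"
 define \<Phi> where "\<Phi> = (%(a, h). \<phi> a \<oplus>\<^bsub>?LG\<^esub> ss h)"
 have ss_c: "ss h \<in> carrier ?LG" if "h \<in> carrier ?LH" for h using ssD(1) that .
 have swap: "(a \<oplus>\<^bsub>?LG\<^esub> b) \<oplus>\<^bsub>?LG\<^esub> (c \<oplus>\<^bsub>?LG\<^esub> d) = (a \<oplus>\<^bsub>?LG\<^esub> c) \<oplus>\<^bsub>?LG\<^esub> (b \<oplus>\<^bsub>?LG\<^esub> d)"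
  if "a \<in> carrier ?LG" "b \<in> carrier ?LG" "c \<in> carrier ?LG" "d \<in> carrier ?LG" for a b c d
  using that by (simp add: LG.a_ac)
 have \<Phi>_hom: "\<Phi> \<in> lie_hom ?SD ?LG"
  unfolding lie_hom_def
 proof (intro CollectI conjI ballI)
  show "\<Phi> \<in> carrier ?SD \<rightarrow> carrier ?LG" by (auto simp: lie_semidirect_simps \<Phi>_def \<phi> ss_c)
  fix y z assume "y \<in> carrier ?SD" "z \<in> carrier ?SD"
  then obtain a h b k where yz: "y = (a, h)" "z = (b, k)" "a \<in> carrier ?F" "b \<in> carrier ?F"
   "h \<in> carrier ?LH" "k \<in> carrier ?LH" by (auto simp: lie_semidirect_simps)
  show "\<Phi> (y \<oplus>\<^bsub>?SD\<^esub> z) = \<Phi> y \<oplus>\<^bsub>?LG\<^esub> \<Phi> z"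
   using yz swap[of "\<phi> a" "ss h" "\<phi> b" "ss k"] by (simp add: lie_semidirect_simps \<Phi>_def \<phi> ssD)
  have 1: "ss h \<otimes>\<^bsub>?LG\<^esub> \<phi> b = \<phi> (\<rho> h b)" "ss k \<otimes>\<^bsub>?LG\<^esub> \<phi> a = \<phi> (\<rho> k a)"
   using bracket yz by auto
  have 2: "\<phi> a \<otimes>\<^bsub>?LG\<^esub> ss k = \<ominus>\<^bsub>?LG\<^esub> \<phi> (\<rho> k a)"
   using LG.br_anticomm[of "ss k" "\<phi> a"] 1 yz \<phi> ss_c by simp
  have "\<Phi> y \<otimes>\<^bsub>?LG\<^esub> \<Phi> z = (\<phi> a \<otimes>\<^bsub>?LG\<^esub> \<phi> b \<oplus>\<^bsub>?LG\<^esub> \<ominus>\<^bsub>?LG\<^esub> \<phi> (\<rho> k a)) \<oplus>\<^bsub>?LG\<^esub> (\<phi> (\<rho> h b) \<oplus>\<^bsub>?LG\<^esub> ss h \<otimes>\<^bsub>?LG\<^esub> ss k)"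
   using yz \<phi>(3) ss_c 1 2 by (simp add: \<Phi>_def LG.br_add_left LG.br_add_right LG.br_closed)
    (simp add: LG.a_ac LG.br_closed)
  also have "... = \<phi> a \<otimes>\<^bsub>?LG\<^esub> \<phi> b \<oplus>\<^bsub>?LG\<^esub> \<phi> (\<rho> h b) \<oplus>\<^bsub>?LG\<^esub> \<ominus>\<^bsub>?LG\<^esub> \<phi> (\<rho> k a) \<oplus>\<^bsub>?LG\<^esub> ss h \<otimes>\<^bsub>?LG\<^esub> ss k"
   using yz \<phi>(3) ss_c by (simp add: LG.a_ac LG.br_closed)
  also have "... = \<Phi> (y \<otimes>\<^bsub>?SD\<^esub> z)"
  proof -
   have "\<phi> (fl_br a b + \<rho> h b - \<rho> k a) = \<phi> a \<otimes>\<^bsub>?LG\<^esub> \<phi> b \<oplus>\<^bsub>?LG\<^esub> \<phi> (\<rho> h b) \<oplus>\<^bsub>?LG\<^esub> \<ominus>\<^bsub>?LG\<^esub> \<phi> (\<rho> k a)"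
    unfolding diff_conv_add_uminus \<phi> ..
   thus ?thesis using yz \<rho>c by (simp add: lie_semidirect_simps \<Phi>_def ssD)
  qed
  finally show "\<Phi> (y \<otimes>\<^bsub>?SD\<^esub> z) = \<Phi> y \<otimes>\<^bsub>?LG\<^esub> \<Phi> z" ..
 qed
 have cl: "y \<oplus>\<^bsub>?SD\<^esub> z \<in> carrier ?SD" "y \<otimes>\<^bsub>?SD\<^esub> z \<in> carrier ?SD" if yz: "y \<in> carrier ?SD" "z \<in> carrier ?SD" for y z
 proof -
  obtain a h b k where *: "y = (a, h)" "z = (b, k)" "a \<in> carrier ?F" "b \<in> carrier ?F"
   "h \<in> carrier ?LH" "k \<in> carrier ?LH" using yz by (auto simp: lie_semidirect_simps)
  show "y \<oplus>\<^bsub>?SD\<^esub> z \<in> carrier ?SD" "y \<otimes>\<^bsub>?SD\<^esub> z \<in> carrier ?SD"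
   using * \<rho>c by (auto simp: lie_semidirect_simps LH.br_closed)
 qed
 define pp where "pp = lcs_map G H p"
 have pp: "pp \<in> lie_hom ?LG ?LH" unfolding pp_def by (rule p.lcs_map_lie_hom)
 note ppD = lie_homD[OF pp] lie_hom_zero_neg[OF pp LG.lie_ring_axioms LH.lie_ring_axioms]
 have pps: "pp (ss h) = h" if "h \<in> carrier ?LH" for h
  using that
 proof (induction h rule: p.H.lcs_lie_induct_degree_one)
  case (deg_one h)
  thus ?case by (simp add: pp_def ss_def s.lcs_map_homog p.lcs_map_homog p_s)
 qed (simp_all add: ssD ppD)
 have ppi: "pp (inc y) = \<zero>\<^bsub>?LH\<^esub>" if "y \<in> carrier ?LN" for y
  using that
 proof (induction y rule: i.G.lcs_lie_induct_degree_one)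
  case (deg_one u)
  thus ?case using p.H.lcs_homog_zero_iff[of 1 "\<one>\<^bsub>H\<^esub>"]
   by (simp add: pp_def inc_def i.lcs_map_homog p.lcs_map_homog p_i)
 qed (simp_all add: incD ppD)
 have inj: "inj_on \<Phi> (carrier ?SD)"
 proof (rule inj_onI)
  fix y z assume "y \<in> carrier ?SD" "z \<in> carrier ?SD" and eq: "\<Phi> y = \<Phi> z"
  then obtain a h b k where yz: "y = (a, h)" "z = (b, k)" "a \<in> carrier ?F" "b \<in> carrier ?F"
   "h \<in> carrier ?LH" "k \<in> carrier ?LH" by (auto simp: lie_semidirect_simps)
  \<comment> \<open>Applying the projection recovers \<open>h\<close>, which leaves injectivity on
    the free Lie ring.\<close>
  have "pp (\<Phi> (a, h)) = h" if "a \<in> carrier ?F" "h \<in> carrier ?LH" for a h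
   using that by (simp add: \<Phi>_def ppD \<phi> ss_c pps) (simp add: \<phi>_def ppi f)
  hence hk: "h = k" using yz eq by metis
  hence "\<phi> a = \<phi> b" using eq yz ss_c \<phi>(3) by (simp add: \<Phi>_def)
  hence "\<phi> (a - b) = \<zero>\<^bsub>?LG\<^esub>" unfolding diff_conv_add_uminus \<phi> by (simp add: LG.r_neg \<phi>)
  hence "inc (?f (a - b)) = \<zero>\<^bsub>?LG\<^esub>" by (simp add: \<phi>_def)
  \<comment> \<open>Strictness of the filtration on the kernel makes \<open>inc\<close> injective;
    the Magnus expansion then does the same for \<open>?f\<close>.\<close>
  hence "?f (a - b) = \<zero>\<^bsub>?LN\<^esub>" unfolding inc_def
   by (intro i.lcs_map_inj[OF _ f(5)]) (use lower_central_kernel[of "Suc _"] in auto)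
  moreover have "a - b \<in> carrier ?F" using yz by simp
  ultimately have "a - b = 0" by (intro i.G.degree_one_map_injective[OF x magnus])
  thus "y = z" using yz hk by simp
 qed
 have surj: "\<Phi> ` carrier ?SD = carrier ?LG"
 proof
  show "\<Phi> ` carrier ?SD \<subseteq> carrier ?LG" using lie_homD(1)[OF \<Phi>_hom] by blast
  show "carrier ?LG \<subseteq> \<Phi> ` carrier ?SD"
  proof
   fix y assume "y \<in> carrier ?LG"
   thus "y \<in> \<Phi> ` carrier ?SD"
   proof (induction y rule: i.H.lcs_lie_induct_degree_one)
    case (deg_one g)
    have "p (g \<otimes> inv s (p g)) = \<one>\<^bsub>H\<^esub>" using deg_one by (simp add: p_s)
    hence "g \<otimes> inv s (p g) \<in> i ` carrier N" using deg_one by (intro kernel_p) simp_all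
    then obtain u where u: "u \<in> carrier N" "g \<otimes> inv s (p g) = i u" by blast
    have g: "g = i u \<otimes> s (p g)" unfolding u(2)[symmetric] using deg_one by (simp add: i.H.m_assoc)
    have "i.G.lcs_homog 1 u \<in> ?f ` carrier ?F" unfolding i.G.degree_one_map_surj[OF x gen] using u by simp
    then obtain a where a: "a \<in> carrier ?F" "i.G.lcs_homog 1 u = ?f a" by blast
    have "i.H.lcs_homog 1 (i u \<otimes> s (p g)) = i.H.lcs_homog 1 (i u) \<oplus>\<^bsub>?LG\<^esub> i.H.lcs_homog 1 (s (p g))"
     by (rule i.H.lcs_homog_mult) (use u deg_one in auto)
    hence "i.H.lcs_homog 1 g = i.H.lcs_homog 1 (i u) \<oplus>\<^bsub>?LG\<^esub> i.H.lcs_homog 1 (s (p g))"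
     unfolding g[symmetric] .
    also have "i.H.lcs_homog 1 (i u) = \<phi> a" unfolding \<phi>_def a(2)[symmetric] inc_def
     using u by (intro i.lcs_map_homog[symmetric]) simp
    also have "i.H.lcs_homog 1 (s (p g)) = ss (p.H.lcs_homog 1 (p g))" unfolding ss_def
     using deg_one by (intro s.lcs_map_homog[symmetric]) simp
    finally have e: "i.H.lcs_homog 1 g = \<Phi> (a, p.H.lcs_homog 1 (p g))" by (simp add: \<Phi>_def)
    have "p.H.lcs_homog 1 (p g) \<in> carrier ?LH" using deg_one by (intro p.H.lcs_homog_closed) simp
    hence "(a, p.H.lcs_homog 1 (p g)) \<in> carrier ?SD"
     unfolding lie_semidirect_simps by (rule SigmaI[OF a(1)])
    thus ?case unfolding e by (rule imageI)
   next
    case (neg y)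
    then obtain a h where ah: "a \<in> carrier ?F" "h \<in> carrier ?LH" "y = \<phi> a \<oplus>\<^bsub>?LG\<^esub> ss h"
     by (auto simp: lie_semidirect_simps \<Phi>_def)
    hence e: "\<ominus>\<^bsub>?LG\<^esub> y = \<Phi> (- a, \<ominus>\<^bsub>?LH\<^esub> h)" by (simp add: \<Phi>_def \<phi> ssD LG.minus_add)
    have "(- a, \<ominus>\<^bsub>?LH\<^esub> h) \<in> carrier ?SD"
     unfolding lie_semidirect_simps
     by (rule SigmaI[OF free_lie_closed(4)[OF ah(1)] LH.a_inv_closed[OF ah(2)]])
    thus ?case unfolding e by (rule imageI)
   next
    case (add y z)
    then obtain y' z' where "y = \<Phi> y'" "z = \<Phi> z'" "y' \<in> carrier ?SD" "z' \<in> carrier ?SD" by blast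
    thus ?case using lie_homD(2)[OF \<Phi>_hom] cl(1) by (metis imageI)
   next
    case (br y z)
    then obtain y' z' where "y = \<Phi> y'" "z = \<Phi> z'" "y' \<in> carrier ?SD" "z' \<in> carrier ?SD" by blast
    thus ?case using lie_homD(3)[OF \<Phi>_hom] cl(2) by (metis imageI)
   qed
  qed
 qed
 show ?thesis
  by (rule lie_isomorphic_inverse[OF \<Phi>_hom _ cl]) (use inj surj in \<open>simp_all add: bij_betw_def\<close>)
qed

end

section \<open>Fundamental groups\<close>

abbreviation unit_sq :: "(real \<times> real) set" where "unit_sq \<equiv> {0..1} \<times> {0..1}"

definition path_in :: "'a::topological_space set => (real => 'a) => bool" where
 "path_in S p \<longleftrightarrow> path p \<and> path_image p \<subseteq> S"

lemma homotopic_paths_const_right: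
 assumes "path_in S p" "x = pathfinish p"
 shows "homotopic_paths S (p +++ (%_. x)) p"
proof (rule homotopic_paths_sym)
 have "continuous_on {0..1} (%t::real. if t \<le> 1/2 then 2 * t else 1)"
  by (rule continuous_on_cases_1) (auto intro!: continuous_intros)
 thus "homotopic_paths S p (p +++ (%_. x))"
  using assms
  by (intro homotopic_paths_reparametrize[where f = "%t. if t \<le> 1/2 then 2 * t else 1"])
   (auto simp: path_in_def joinpaths_def pathfinish_def)
qed

lemma homotopic_paths_const_left:
 assumes "path_in S p" "x = pathstart p"
 shows "homotopic_paths S ((%_. x) +++ p) p"
proof (rule homotopic_paths_sym)
 have "continuous_on {0..1} (%t::real. if t \<le> 1/2 then 0 else 2 * t - 1)"
  by (rule continuous_on_cases_1) (auto intro!: continuous_intros)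
 thus "homotopic_paths S p ((%_. x) +++ p)"
  using assms
  by (intro homotopic_paths_reparametrize[where f = "%t. if t \<le> 1/2 then 0 else 2 * t - 1"])
   (auto simp: path_in_def joinpaths_def pathstart_def)
qed

lemma homotopic_paths_inverse_right:
 assumes "path_in S p" "x = pathstart p"
 shows "homotopic_paths S (p +++ reversepath p) (%_. x)"
proof -
 have p: "continuous_on {0..1} p" and im: "p t \<in> S" if "t \<in> {0..1}" for t
  using assms that by (auto simp: path_in_def path_def path_image_def)
 have p: "continuous_on {0..1} p" using assms by (auto simp: path_in_def path_def)
 let ?A = "unit_sq"
 \<comment> \<open>At stage \<open>fst y\<close> the path runs along \<open>p\<close> up to time
   \<open>fst y\<close> and returns; the second factor is a tent with peak 1.\<close>
 define f :: "real \<times> real => real" where "f y = fst y * (if snd y \<le> 1/2 then 2 * snd y else 2 - 2 * snd y)" for y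
 have "continuous_on ?A (%y. if snd y \<le> 1/2 then 2 * snd y else 2 - 2 * snd y :: real)"
  by (rule continuous_on_cases_le) (auto intro!: continuous_intros)
 hence f: "continuous_on ?A f" unfolding f_def by (intro continuous_intros)
 have f01: "f y \<in> {0..1}" if "y \<in> ?A" for y
  using that by (auto simp: f_def mult_le_one)
 have "homotopic_paths S (%_. x) (p +++ reversepath p)"
  unfolding homotopic_paths
 proof (intro exI[of _ "p \<circ> f"] conjI ballI)
  show "continuous_on ?A (p \<circ> f)"
   using f f01 p by (intro continuous_on_compose) (auto intro: continuous_on_subset)
  show "p \<circ> f \<in> ?A \<rightarrow> S" using f01 im by auto
 qed (auto simp: f_def assms pathstart_def pathfinish_def joinpaths_def reversepath_def algebra_simps)
 thus ?thesis by (rule homotopic_paths_sym)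
qed

lemma loop_class_eqI: "homotopic_paths S p q ==> loop_class S p = loop_class S q"
 unfolding loop_class_def by (intro Collect_cong) (meson homotopic_paths_trans homotopic_paths_sym)

lemma loop_class_eqD:
 assumes "loop_class S p = loop_class S q" "path_in S q"
 shows "homotopic_paths S p q"
proof -
 have "q \<in> loop_class S q" using assms by (simp add: loop_class_def path_in_def)
 hence "q \<in> loop_class S p" unfolding assms(1) .
 thus ?thesis by (simp add: loop_class_def)
qed

lemma path_in_join [simp]:
 "path_in S p ==> path_in S q ==> pathfinish p = pathstart q ==> path_in S (p +++ q)"
 by (simp add: path_in_def subset_path_image_join)

lemma path_in_reverse [simp]: "path_in S (reversepath p) \<longleftrightarrow> path_in S p"
 by (simp add: path_in_def)

lemma path_in_const [simp]: "path_in S (%_. x) \<longleftrightarrow> x \<in> S"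
 by (auto simp: path_in_def path_def path_image_def)

lemma path_ends_const [simp]: "pathstart (%_. x) = x" "pathfinish (%_. x) = x"
 by (simp_all add: pathstart_def pathfinish_def)

lemma loops_iff: "p \<in> loops S x \<longleftrightarrow> path_in S p \<and> pathstart p = x \<and> pathfinish p = x"
 by (auto simp: loops_def path_in_def)

lemma path_in_endpoints: "path_in S p ==> pathstart p \<in> S" "path_in S p ==> pathfinish p \<in> S"
 by (auto simp: path_in_def)

lemma loop_class_nonempty: "path_in S p ==> loop_class S p ~= {}"
 using homotopic_paths_refl[of S p] by (auto simp: loop_class_def path_in_def simp del: homotopic_paths_refl)

lemma pi1_mult:
 assumes "path_in S p" "path_in S q" "pathfinish p = pathstart q"
 shows "loop_class S p \<otimes>\<^bsub>fundamental_group S x\<^esub> loop_class S q = loop_class S (p +++ q)"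
proof -
 have "loop_class S (p' +++ q') = loop_class S (p +++ q)" if "p' \<in> loop_class S p" "q' \<in> loop_class S q" for p' q'
  using that assms by (intro loop_class_eqI[symmetric] homotopic_paths_join) (auto simp: loop_class_def)
 note eq = this
 have ne: "loop_class S p ~= {}" "loop_class S q ~= {}" using assms by (simp_all add: loop_class_nonempty)
 have "(\<Union>p'\<in>loop_class S p. \<Union>q'\<in>loop_class S q. loop_class S (p' +++ q')) = loop_class S (p +++ q)"
  by (intro SUP_eq_const ne eq)
 thus ?thesis by (simp add: fundamental_group_def)
qed

lemma pi1_carrier: "carrier (fundamental_group S x) = loop_class S ` loops S x"
 by (simp add: fundamental_group_def)

lemma pi1_one: "\<one>\<^bsub>fundamental_group S x\<^esub> = loop_class S (%_. x)"
 by (simp add: fundamental_group_def)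

lemma homotopic_paths_assoc':
 assumes "path_in S p" "path_in S q" "path_in S r" "pathfinish p = pathstart q" "pathfinish q = pathstart r"
 shows "homotopic_paths S ((p +++ q) +++ r) (p +++ (q +++ r))"
 using assms by (intro homotopic_paths_sym[OF homotopic_paths_assoc]) (auto simp: path_in_def)

lemma pi1_group:
 assumes "x \<in> S"
 shows "group (fundamental_group S x)"
proof (rule groupI)
 fix a b assume "a \<in> carrier (fundamental_group S x)" "b \<in> carrier (fundamental_group S x)"
 then obtain p q where "p \<in> loops S x" "q \<in> loops S x" "a = loop_class S p" "b = loop_class S q"
  by (auto simp: pi1_carrier)
 thus "a \<otimes>\<^bsub>fundamental_group S x\<^esub> b \<in> carrier (fundamental_group S x)"
  by (auto simp: pi1_carrier loops_iff pi1_mult)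
next
 show "\<one>\<^bsub>fundamental_group S x\<^esub> \<in> carrier (fundamental_group S x)"
  using assms by (auto simp: pi1_carrier pi1_one loops_iff)
next
 fix a b c assume "a \<in> carrier (fundamental_group S x)" "b \<in> carrier (fundamental_group S x)" "c \<in> carrier (fundamental_group S x)"
 then obtain p q r where "p \<in> loops S x" "q \<in> loops S x" "r \<in> loops S x"
   "a = loop_class S p" "b = loop_class S q" "c = loop_class S r"
  by (auto simp: pi1_carrier)
 thus "a \<otimes>\<^bsub>fundamental_group S x\<^esub> b \<otimes>\<^bsub>fundamental_group S x\<^esub> c = a \<otimes>\<^bsub>fundamental_group S x\<^esub> (b \<otimes>\<^bsub>fundamental_group S x\<^esub> c)"
  by (simp add: loops_iff pi1_mult loop_class_eqI homotopic_paths_assoc')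
next
 fix a assume "a \<in> carrier (fundamental_group S x)"
 then obtain p where p: "p \<in> loops S x" "a = loop_class S p" by (auto simp: pi1_carrier)
 thus "\<one>\<^bsub>fundamental_group S x\<^esub> \<otimes>\<^bsub>fundamental_group S x\<^esub> a = a"
  using assms by (simp add: loops_iff pi1_mult pi1_one loop_class_eqI homotopic_paths_const_left)
 have "loop_class S (reversepath p +++ p) = loop_class S (%_. x)"
  using p homotopic_paths_inverse_right[of S "reversepath p" x] by (intro loop_class_eqI) (simp add: loops_iff)
 thus "\<exists>y\<in>carrier (fundamental_group S x). y \<otimes>\<^bsub>fundamental_group S x\<^esub> a = \<one>\<^bsub>fundamental_group S x\<^esub>"
  using p by (intro bexI[of _ "loop_class S (reversepath p)"])
   (auto simp: loops_iff pi1_mult pi1_one pi1_carrier)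
qed

lemma pi1_inv:
 assumes "p \<in> loops S x"
 shows "inv\<^bsub>fundamental_group S x\<^esub> loop_class S p = loop_class S (reversepath p)"
proof -
 have x: "x \<in> S" using assms path_in_endpoints by (auto simp: loops_iff)
 interpret group "fundamental_group S x" by (rule pi1_group[OF x])
 have "loop_class S (reversepath p +++ p) = loop_class S (%_. x)"
  using assms homotopic_paths_inverse_right[of S "reversepath p" x] by (intro loop_class_eqI) (simp add: loops_iff)
 thus ?thesis using assms
  by (intro inv_equality) (auto simp: loops_iff pi1_mult pi1_one pi1_carrier)
qed

definition induced_map :: "'b::topological_space set => ('a::topological_space => 'b) => (real => 'a) set => (real => 'b) set" where
 "induced_map T f a = (\<Union>p\<in>a. loop_class T (f \<circ> p))"

lemma path_in_compose:
 "[|path_in S p; continuous_on S f; f \<in> S \<rightarrow> T|] ==> path_in T (f \<circ> p)"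
 by (auto simp: path_in_def path_image_compose intro!: path_continuous_image elim: continuous_on_subset)

lemma induced_map_class:
 assumes "path_in S p" "continuous_on S f" "f \<in> S \<rightarrow> T"
 shows "induced_map T f (loop_class S p) = loop_class T (f \<circ> p)"
proof -
 have "loop_class T (f \<circ> q) = loop_class T (f \<circ> p)" if "q \<in> loop_class S p" for q
  using that assms by (intro loop_class_eqI[symmetric] homotopic_paths_continuous_image[of S p q]) (auto simp: loop_class_def)
 moreover have "loop_class S p ~= {}" using assms by (simp add: loop_class_nonempty)
 ultimately show ?thesis unfolding induced_map_def by (intro SUP_eq_const)
qed

lemma induced_map_hom:
 assumes f: "continuous_on S f" "f \<in> S \<rightarrow> T" and x: "x \<in> S" "y = f x"
 shows "group_hom (fundamental_group S x) (fundamental_group T y) (induced_map T f)"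
proof -
 have "y \<in> T" using f x by auto
 show ?thesis
 proof (intro group_hom.intro group_hom_axioms.intro pi1_group x \<open>y \<in> T\<close> homI)
  fix a assume "a \<in> carrier (fundamental_group S x)"
  then obtain p where p: "p \<in> loops S x" "a = loop_class S p" by (auto simp: pi1_carrier)
  hence "f \<circ> p \<in> loops T y"
   using path_in_compose[of S p f T] f x by (simp add: loops_iff pathstart_compose pathfinish_compose)
  thus "induced_map T f a \<in> carrier (fundamental_group T y)"
   using p f induced_map_class[of S p f T] by (simp add: pi1_carrier loops_iff)
  fix b assume "b \<in> carrier (fundamental_group S x)"
  then obtain q where q: "q \<in> loops S x" "b = loop_class S q" by (auto simp: pi1_carrier)
  have "path_in T (f \<circ> p)" "path_in T (f \<circ> q)" using p q f by (auto simp: loops_iff intro!: path_in_compose)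
  moreover have "f \<circ> (p +++ q) = (f \<circ> p) +++ (f \<circ> q)" by (rule path_compose_join)
  ultimately show "induced_map T f (a \<otimes>\<^bsub>fundamental_group S x\<^esub> b) = induced_map T f a \<otimes>\<^bsub>fundamental_group T y\<^esub> induced_map T f b"
   using p q f by (simp add: loops_iff pi1_mult induced_map_class pathstart_compose pathfinish_compose)
 qed
qed

section \<open>Subpaths, and loops obtained by closing paths up\<close>

definition subp :: "real => real => (real => 'a) => real => 'a" where
 "subp u v g = (%t. g (u + (v - u) * t))"

lemma subp_ends [simp]: "pathstart (subp u v g) = g u" "pathfinish (subp u v g) = g v"
 by (simp_all add: subp_def pathstart_def pathfinish_def)

lemma subp_parameter:
 assumes "u \<le> v" "t \<in> {0..1::real}"
 shows "u + (v - u) * t \<in> {u..v}"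
 using assms mult_left_le[of t "v - u"] mult_nonneg_nonneg[of "v - u" t] by auto

lemma path_in_subp:
 assumes "path_in S g" "0 \<le> u" "u \<le> v" "v \<le> 1" "g ` {u..v} \<subseteq> T"
 shows "path_in T (subp u v g)"
proof -
 have "continuous_on {0..1} g" using assms by (simp add: path_in_def path_def)
 moreover have "continuous_on {0..1} (%t::real. u + (v - u) * t)" by (intro continuous_intros)
 moreover have "(%t. u + (v - u) * t) ` {0..1} \<subseteq> {0..1}"
 proof clarify
  fix t :: real assume "t \<in> {0..1}"
  hence "u + (v - u) * t \<in> {u..v}" by (rule subp_parameter[OF assms(3)])
  thus "u + (v - u) * t \<in> {0..1}" using assms(2,4) by auto
 qed
 ultimately have "continuous_on {0..1} (subp u v g)"
  unfolding subp_def by (rule continuous_on_compose2)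
 moreover have "subp u v g ` {0..1} \<subseteq> T"
 proof clarify
  fix t :: real assume "t \<in> {0..1}"
  hence "u + (v - u) * t \<in> {u..v}" by (rule subp_parameter[OF assms(3)])
  thus "subp u v g t \<in> T" using assms(5) by (auto simp: subp_def)
 qed
 ultimately show ?thesis by (simp add: path_in_def path_def path_image_def)
qed

lemma homotopic_subp_join:
 assumes g: "path_in S g" and uvw: "0 \<le> u" "u \<le> v" "v \<le> w" "w \<le> 1"
 shows "homotopic_paths S (subp u w g) (subp u v g +++ subp v w g)"
proof (cases "u = w")
 case True
 have "g u \<in> S" using g uvw by (auto simp: path_in_def path_image_def)
 moreover have "subp u w g = (%_. g u)" "subp u v g +++ subp v w g = (%_. g u)"
  using True uvw by (auto simp: subp_def joinpaths_def)
 ultimately show ?thesis by (simp add: path_def)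
next
 case False
 hence uw: "w - u > 0" using uvw by simp
 have "path_in S (subp u w g)"
  using g uvw by (intro path_in_subp[OF g]) (auto simp: path_in_def path_image_def)
 \<comment> \<open>The parameter change that covers \<open>{u..v}\<close> in the first half and
   \<open>{v..w}\<close> in the second. The case \<open>u = w\<close> was split off because of the
   division by \<open>w - u\<close>.\<close>
 define f where "f t = (if t \<le> 1/2 then (v - u) / (w - u) * (2 * t) else ((v - u) + (w - v) * (2 * t - 1)) / (w - u))" for t
 have "continuous_on {0..1} f" unfolding f_def
  using uw by (intro continuous_on_cases_1) (auto intro!: continuous_intros)
 moreover have "f t \<in> {0..1}" if "t \<in> {0..1}" for t
 proof (cases "t \<le> 1/2")
  case True
  hence "(v - u) * (2 * t) \<le> (v - u) * 1" using uvw by (intro mult_left_mono) auto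
  thus ?thesis using True that uvw uw by (auto simp: f_def divide_simps)
 next
  case False
  hence "(w - v) * (2 * t - 1) \<le> (w - v) * 1" using uvw that by (intro mult_left_mono) auto
  moreover have "0 \<le> (w - v) * (2 * t - 1)" using False uvw by auto
  ultimately show ?thesis using False that uvw uw by (auto simp: f_def divide_simps)
 qed
 moreover have "f 0 = 0" "f 1 = 1" using uw by (auto simp: f_def)
 moreover have "(subp u v g +++ subp v w g) t = subp u w g (f t)" for t
  using uw by (auto simp: f_def subp_def joinpaths_def)
 ultimately show ?thesis using \<open>path_in S (subp u w g)\<close>
  by (intro homotopic_paths_reparametrize[where f = f]) (auto simp: path_in_def)
qed

text \<open>A choice of paths from the base point turns every path into a loop, compatibly with composition.\<close>

locale based_paths =
 fixes S :: "'a::topological_space set" and x :: 'a and c :: "'a => real => 'a"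
 assumes base: "x \<in> S"
  and c_path: "y \<in> S ==> path_in S (c y) \<and> pathstart (c y) = x \<and> pathfinish (c y) = y"
  and c_base: "c x = (%_. x)"
begin

abbreviation "\<pi> \<equiv> fundamental_group S x"

sublocale pi: group \<pi> by (rule pi1_group[OF base])

definition wd :: "(real => 'a) => (real => 'a) set" where
 "wd p = loop_class S (c (pathstart p) +++ (p +++ reversepath (c (pathfinish p))))"

lemma wd_loop_in:
 assumes "path_in S p"
 shows "c (pathstart p) +++ (p +++ reversepath (c (pathfinish p))) \<in> loops S x"
 using assms c_path[of "pathstart p"] c_path[of "pathfinish p"] by (simp add: loops_iff path_in_endpoints)

lemma wd_closed [simp]: "path_in S p ==> wd p \<in> carrier \<pi>"
 using wd_loop_in by (auto simp: wd_def pi1_carrier)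

lemma wd_homotopic:
 assumes "homotopic_paths S p q"
 shows "wd p = wd q"
proof -
 have e: "pathstart p = pathstart q" "pathfinish p = pathfinish q"
  using assms homotopic_paths_imp_pathstart homotopic_paths_imp_pathfinish by blast+
 have pq: "path_in S p" "path_in S q"
  using homotopic_paths_imp_path[OF assms] homotopic_paths_imp_subset[OF assms] by (auto simp: path_in_def)
 thus ?thesis unfolding wd_def e
  using c_path[of "pathstart q"] c_path[of "pathfinish q"] assms e path_in_endpoints[OF pq(2)]
  by (intro loop_class_eqI homotopic_paths_join) (auto simp: path_in_def)
qed

lemma wd_join:
 assumes pq: "path_in S p" "path_in S q" "pathfinish p = pathstart q"
 shows "wd (p +++ q) = wd p \<otimes>\<^bsub>\<pi>\<^esub> wd q"
proof -
 let ?a = "c (pathstart p)" and ?b = "c (pathstart q)" and ?d = "c (pathfinish q)"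
 have ab: "path_in S ?a" "path_in S ?b" "path_in S ?d" "pathfinish ?a = pathstart p" "pathfinish ?b = pathstart q"
  "pathfinish ?d = pathfinish q" "pathstart ?a = x" "pathstart ?b = x" "pathstart ?d = x"
  using c_path[OF path_in_endpoints(1)[OF pq(1)]] c_path[OF path_in_endpoints(1)[OF pq(2)]]
   c_path[OF path_in_endpoints(2)[OF pq(2)]] by simp_all
 let ?r = "q +++ reversepath ?d"
 have "homotopic_paths S (reversepath ?b +++ (?b +++ ?r)) ((reversepath ?b +++ ?b) +++ ?r)"
  using ab pq by (intro homotopic_paths_sym[OF homotopic_paths_assoc']) simp_all
 also have "homotopic_paths S ... ((%_. pathstart q) +++ ?r)"
  using ab pq homotopic_paths_inverse_right[of S "reversepath ?b" "pathstart q"]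
  by (intro homotopic_paths_join) (simp_all add: path_in_def[symmetric])
 also have "homotopic_paths S ... ?r" using ab pq by (intro homotopic_paths_const_left) simp_all
 finally have 1: "homotopic_paths S (reversepath ?b +++ (?b +++ ?r)) ?r" .
 have "homotopic_paths S ((p +++ reversepath ?b) +++ (?b +++ ?r)) (p +++ (reversepath ?b +++ (?b +++ ?r)))"
  using ab pq by (intro homotopic_paths_assoc') simp_all
 also have "homotopic_paths S ... (p +++ ?r)"
  by (rule homotopic_paths_join[OF _ 1]) (use ab pq in \<open>simp_all add: path_in_def[symmetric]\<close>)
 also have "homotopic_paths S ... ((p +++ q) +++ reversepath ?d)"
  using ab pq by (intro homotopic_paths_sym[OF homotopic_paths_assoc']) simp_all
 finally have 2: "homotopic_paths S ((p +++ reversepath ?b) +++ (?b +++ ?r)) ((p +++ q) +++ reversepath ?d)" .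
 have "homotopic_paths S ((?a +++ (p +++ reversepath ?b)) +++ (?b +++ ?r)) (?a +++ ((p +++ reversepath ?b) +++ (?b +++ ?r)))"
  using ab pq by (intro homotopic_paths_assoc') simp_all
 also have "homotopic_paths S ... (?a +++ ((p +++ q) +++ reversepath ?d))"
  by (rule homotopic_paths_join[OF _ 2]) (use ab pq in \<open>simp_all add: path_in_def[symmetric]\<close>)
 finally have "loop_class S ((?a +++ (p +++ reversepath ?b)) +++ (?b +++ ?r)) = wd (p +++ q)"
  unfolding wd_def using pq by (intro loop_class_eqI) simp
 moreover have "wd p \<otimes>\<^bsub>\<pi>\<^esub> wd q = loop_class S ((?a +++ (p +++ reversepath ?b)) +++ (?b +++ ?r))"
  unfolding wd_def using ab pq by (subst pi1_mult) simp_all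
 ultimately show ?thesis by simp
qed

lemma wd_loop:
 assumes "p \<in> loops S x"
 shows "wd p = loop_class S p"
proof -
 have p: "path_in S p" "pathstart p = x" "pathfinish p = x" using assms by (auto simp: loops_iff)
 have r: "reversepath (%_. x) = (%_. x)" by (simp add: reversepath_def)
 have "homotopic_paths S ((%_. x) +++ (p +++ (%_. x))) (p +++ (%_. x))"
  using p base by (intro homotopic_paths_const_left) simp_all
 also have "homotopic_paths S ... p" using p by (intro homotopic_paths_const_right) simp_all
 finally show ?thesis unfolding wd_def p c_base r by (rule loop_class_eqI)
qed

lemma wd_const [simp]:
 assumes "y \<in> S"
 shows "wd (%_. y) = \<one>\<^bsub>\<pi>\<^esub>"
proof -
 have "wd (%_. y) = wd ((%_. y) +++ (%_. y))"
  using assms by (intro wd_homotopic homotopic_paths_sym[OF homotopic_paths_const_right]) simp_all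
 also have "... = wd (%_. y) \<otimes>\<^bsub>\<pi>\<^esub> wd (%_. y)" using assms by (intro wd_join) simp_all
 finally show ?thesis using assms pi.r_cancel_one' by simp
qed

lemma wd_reverse:
 assumes "path_in S p"
 shows "wd (reversepath p) = inv\<^bsub>\<pi>\<^esub> wd p"
proof -
 have "wd (reversepath p +++ p) = wd (%_. pathfinish p)"
  using assms homotopic_paths_inverse_right[of S "reversepath p" "pathfinish p"] by (intro wd_homotopic) simp
 hence "wd (reversepath p) \<otimes>\<^bsub>\<pi>\<^esub> wd p = \<one>\<^bsub>\<pi>\<^esub>"
  using assms by (simp add: wd_join path_in_endpoints)
 thus ?thesis using assms by (intro pi.inv_equality[symmetric]) simp_all
qed

lemma carrier_wd: "a \<in> carrier \<pi> ==> \<exists>p\<in>loops S x. a = wd p"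
 using wd_loop by (auto simp: pi1_carrier)

lemma wd_subp_join:
 assumes "path_in S g" "0 \<le> u" "u \<le> v" "v \<le> w" "w \<le> 1"
 shows "wd (subp u w g) = wd (subp u v g) \<otimes>\<^bsub>\<pi>\<^esub> wd (subp v w g)"
proof -
 have "wd (subp u w g) = wd (subp u v g +++ subp v w g)"
  by (rule wd_homotopic[OF homotopic_subp_join[OF assms]])
 also have "... = wd (subp u v g) \<otimes>\<^bsub>\<pi>\<^esub> wd (subp v w g)"
  using assms by (intro wd_join path_in_subp[of S g]) (auto simp: path_in_def path_image_def)
 finally show ?thesis .
qed

text \<open>The generation half of van Kampen's theorem: \<open>wd\<close> is multiplicative, and a
  path subdivides into pieces that lie in small sets. Bisection by \<open>Bolzano\<close> takes the
  place of an explicit partition.\<close>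

lemma generated_locally:
 assumes K: "subgroup K \<pi>"
  and loc: "!!y. y \<in> S ==> \<exists>U. open U \<and> y \<in> U \<and> (\<forall>p. path_in (S \<inter> U) p \<longrightarrow> wd p \<in> K)"
  and p: "path_in S p"
 shows "wd p \<in> K"
proof -
 have cont: "continuous_on {0..1} p" and im: "!!t. t \<in> {0..1} ==> p t \<in> S"
  using p by (auto simp: path_in_def path_def path_image_def)
 have "(0::real) \<le> 1 \<longrightarrow> wd (subp 0 1 p) \<in> K" if "(0::real) \<le> 1"
 proof -
  define P where "P a b \<longleftrightarrow> (0 \<le> a \<and> a \<le> b \<and> b \<le> 1 \<longrightarrow> wd (subp a b p) \<in> K)" for a b
  have "P 0 1"
  proof (rule Bolzano)
   fix a b e assume "P a b" "P b e" "a \<le> b" "b \<le> e"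
   thus "P a e" using wd_subp_join[OF p, of a b e] subgroup.m_closed[OF K] by (auto simp: P_def)
  next
   fix t :: real assume t: "0 \<le> t" "t \<le> 1"
   obtain U where U: "open U" "p t \<in> U" "!!q. path_in (S \<inter> U) q ==> wd q \<in> K"
    using loc[OF im[of t]] t by auto
   obtain A where A: "open A" "A \<inter> {0..1} = p -` U \<inter> {0..1}"
    using cont U(1) unfolding continuous_on_open_invariant by blast
   hence "t \<in> A" using t U(2) by auto
   then obtain d where d: "d > 0" "ball t d \<subseteq> A" using A(1) open_contains_ball by blast
   show "\<exists>d>0. \<forall>a b. a \<le> t \<and> t \<le> b \<and> b - a < d \<longrightarrow> P a b"
   proof (intro exI[of _ d] conjI d(1) allI impI)
    fix a b assume ab: "a \<le> t \<and> t \<le> b \<and> b - a < d"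
    show "P a b" unfolding P_def
    proof
     assume ab01: "0 \<le> a \<and> a \<le> b \<and> b \<le> 1"
     have "p ` {a..b} \<subseteq> S \<inter> U"
     proof
      fix y assume "y \<in> p ` {a..b}"
      then obtain r where r: "r \<in> {a..b}" "y = p r" by blast
      hence "r \<in> ball t d" using ab by (auto simp: dist_real_def)
      hence "r \<in> A \<inter> {0..1}" using d(2) r ab01 by auto
      thus "y \<in> S \<inter> U" using A(2) r im ab01 by auto
     qed
     hence "path_in (S \<inter> U) (subp a b p)"
      using p ab01 by (intro path_in_subp[OF p]) auto
     thus "wd (subp a b p) \<in> K" by (rule U(3))
    qed
   qed
  qed simp
  thus ?thesis by (simp add: P_def)
 qed
 thus ?thesis by (simp add: subp_def)
qed

end

lemma based_paths_exist:
 assumes "path_connected S" "x \<in> S"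
 obtains c where "based_paths S x c"
proof -
 have "\<exists>g. path_in S g \<and> pathstart g = x \<and> pathfinish g = y" if "y \<in> S" for y
  using assms that by (auto simp: path_connected_def path_in_def)
 then obtain c where c: "!!y. y \<in> S ==> path_in S (c y) \<and> pathstart (c y) = x \<and> pathfinish (c y) = y"
  by metis
 have "based_paths S x (c(x := (%_. x)))" using c assms(2) by unfold_locales auto
 thus thesis using that by blast
qed

subsection \<open>Homomorphisms from locally multiplicative functions\<close>

lemma homotopic_pathsE:
 assumes "homotopic_paths S p q"
 obtains h where "continuous_on unit_sq h" "h \<in> unit_sq \<rightarrow> S"
  "!!t. t \<in> {0..1::real} ==> h (0, t) = p t" "!!t. t \<in> {0..1} ==> h (1, t) = q t"
  "!!t. t \<in> {0..1::real} ==> h (t, 0) = p 0" "!!t. t \<in> {0..1} ==> h (t, 1) = p 1"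
proof -
 from assms show thesis
  unfolding homotopic_paths
 proof (elim exE conjE)
  fix h assume "continuous_on unit_sq h" "h \<in> unit_sq \<rightarrow> S"
   "\<forall>x\<in>{0..1}. h (0, x) = p x" "\<forall>x\<in>{0..1}. h (1, x) = q x"
   "\<forall>t\<in>{0..1::real}. pathstart (h \<circ> Pair t) = pathstart p \<and> pathfinish (h \<circ> Pair t) = pathfinish p"
  thus thesis by (intro that[of h]) (simp_all add: pathstart_def pathfinish_def)
 qed
qed

text \<open>A cocycle with values in \<open>Q\<close>: it is multiplicative near each point, with no
  condition on points far apart. Following it along paths is parallel transport, and its holonomy
  gives homomorphisms out of a fundamental group of which no presentation is known.\<close>

locale local_transport = group Q for Q :: "('q, 'm) monoid_scheme" (structure) +
 fixes S :: "'a::topological_space set" and T :: "'a => 'a => 'q"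
 assumes T_local: "z \<in> S ==> \<exists>U. open U \<and> z \<in> U \<and>
  (\<forall>a\<in>S \<inter> U. \<forall>b\<in>S \<inter> U. T a b \<in> carrier Q \<and> (\<forall>c\<in>S \<inter> U. T a b \<otimes> T b c = T a c))"
begin

abbreviation moves :: "('p => 'a) => ('p => 'q) => 'p set => bool" where
 "moves H l C \<equiv> \<forall>a\<in>C. \<forall>b\<in>C. T (H a) (H b) \<in> carrier Q \<and> l a \<otimes> T (H a) (H b) = l b"

text \<open>A parallel section of the cocycle pulled back along \<open>H\<close>, in other words a
  developing map on \<open>D\<close>.\<close>

definition potential :: "'p::topological_space set => ('p => 'a) => ('p => 'q) => bool" where
 "potential D H l \<longleftrightarrow> (\<forall>p\<in>D. l p \<in> carrier Q) \<and>
   (\<forall>p\<in>D. \<exists>W. open W \<and> p \<in> W \<and> (moves H l (D \<inter> W)))"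

lemma potentialI:
 assumes "!!p. p \<in> D ==> l p \<in> carrier Q"
  "!!p. p \<in> D ==> \<exists>W. open W \<and> p \<in> W \<and> (moves H l (D \<inter> W))"
 shows "potential D H l"
 using assms by (simp add: potential_def)

lemma potentialD:
 assumes "potential D H l"
 shows "p \<in> D ==> l p \<in> carrier Q"
  "p \<in> D ==> \<exists>W. open W \<and> p \<in> W \<and> (moves H l (D \<inter> W))"
 using assms by (simp_all add: potential_def)

lemma potential_cong:
 assumes "potential D H l" and eq: "!!p. p \<in> D ==> H p = H' p" and eql: "!!p. p \<in> D ==> l p = l' p"
 shows "potential D H' l'"
proof (rule potentialI)
 fix p assume p: "p \<in> D"
 thus "l' p \<in> carrier Q" using potentialD(1)[OF assms(1)] eql by metis
 obtain W where "open W" "p \<in> W" "moves H l (D \<inter> W)"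
  using potentialD(2)[OF assms(1) p] by blast
 thus "\<exists>W. open W \<and> p \<in> W \<and> (moves H' l' (D \<inter> W))"
  using eq eql by (intro exI[of _ W]) simp
qed

text \<open>The transport cancels in the quotient of two parallel sections, which is therefore
  locally constant.\<close>

lemma potential_unique:
 assumes D: "connected D" and l: "potential D H l" and l': "potential D H l'" and ab: "a \<in> D" "b \<in> D"
 shows "l' a \<otimes> inv (l a) = l' b \<otimes> inv (l b)"
proof (rule connected_local_const[OF D ab, where f = "%p. l' p \<otimes> inv (l p)"], rule ballI)
 fix p assume p: "p \<in> D"
 obtain W where W: "open W" "p \<in> W" "!!a b. a \<in> D \<inter> W ==> b \<in> D \<inter> W ==> T (H a) (H b) \<in> carrier Q \<and> l a \<otimes> T (H a) (H b) = l b"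
  using potentialD(2)[OF l p] by blast
 obtain W' where W': "open W'" "p \<in> W'" "!!a b. a \<in> D \<inter> W' ==> b \<in> D \<inter> W' ==> l' a \<otimes> T (H a) (H b) = l' b"
  using potentialD(2)[OF l' p] by blast
 have "l' p \<otimes> inv (l p) = l' q \<otimes> inv (l q)" if q: "q \<in> D" "q \<in> W \<inter> W'" for q
 proof -
  have t: "T (H p) (H q) \<in> carrier Q" "l q = l p \<otimes> T (H p) (H q)" "l' q = l' p \<otimes> T (H p) (H q)"
   using W(3)[of p q] W'(3)[of p q] W(2) W'(2) p q by auto
  show ?thesis unfolding t(2,3)
   using t(1) potentialD(1)[OF l p] potentialD(1)[OF l' p] by (simp add: m_assoc inv_mult_group)
 qed
 thus "eventually (%q. l' p \<otimes> inv (l p) = l' q \<otimes> inv (l q)) (at p within D)"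
  unfolding eventually_at_topological using W(1,2) W'(1,2) by (intro exI[of _ "W \<inter> W'"]) auto
qed

lemma potential_left:
 assumes "potential D H l" "c \<in> carrier Q"
 shows "potential D H (%p. c \<otimes> l p)"
proof (rule potentialI)
 fix p assume p: "p \<in> D"
 show "c \<otimes> l p \<in> carrier Q" using potentialD(1)[OF assms(1) p] assms(2) by simp
 obtain W where W: "open W" "p \<in> W" "!!a b. a \<in> D \<inter> W ==> b \<in> D \<inter> W ==> T (H a) (H b) \<in> carrier Q \<and> l a \<otimes> T (H a) (H b) = l b"
  using potentialD(2)[OF assms(1) p] by blast
 have "T (H a) (H b) \<in> carrier Q \<and> c \<otimes> l a \<otimes> T (H a) (H b) = c \<otimes> l b" if "a \<in> D \<inter> W" "b \<in> D \<inter> W" for a b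
  using W(3)[OF that] potentialD(1)[OF assms(1), of a] assms(2) that by (simp add: m_assoc)
 thus "\<exists>W. open W \<and> p \<in> W \<and> (\<forall>a\<in>D \<inter> W. \<forall>b\<in>D \<inter> W. T (H a) (H b) \<in> carrier Q \<and> c \<otimes> l a \<otimes> T (H a) (H b) = c \<otimes> l b)"
  using W(1,2) by blast
qed

lemma potential_compose:
 assumes l: "potential D H l" and e: "continuous_on D' e" "e \<in> D' \<rightarrow> D"
 shows "potential D' (H \<circ> e) (l \<circ> e)"
proof (rule potentialI)
 fix p assume p: "p \<in> D'"
 hence ep: "e p \<in> D" using e by auto
 show "(l \<circ> e) p \<in> carrier Q" using potentialD(1)[OF l ep] by simp
 obtain W where W: "open W" "e p \<in> W" "!!a b. a \<in> D \<inter> W ==> b \<in> D \<inter> W ==> T (H a) (H b) \<in> carrier Q \<and> l a \<otimes> T (H a) (H b) = l b"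
  using potentialD(2)[OF l ep] by blast
 obtain A where A: "open A" "A \<inter> D' = e -` W \<inter> D'"
  using e(1) W(1) unfolding continuous_on_open_invariant by blast
 have "e a \<in> D \<inter> W" if "a \<in> D' \<inter> A" for a using that A(2) e(2) by auto
 thus "\<exists>W. open W \<and> p \<in> W \<and> (moves (H \<circ> e) (l \<circ> e) (D' \<inter> W))"
  using A p W by (intro exI[of _ A]) auto
qed

lemma potential_subset: "potential D H l ==> D' \<subseteq> D ==> potential D' H l"
 using potential_compose[of D H l D' "%x. x"] by (auto simp: comp_def)

lemma potential_local:
 assumes H: "H \<in> D \<rightarrow> S \<inter> U" and z: "z \<in> S \<inter> U"
  and U: "!!a b c. a \<in> S \<inter> U ==> b \<in> S \<inter> U ==> c \<in> S \<inter> U ==> T a b \<in> carrier Q \<and> T a b \<otimes> T b c = T a c"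
 shows "potential D H (%p. T z (H p))"
proof (rule potentialI)
 fix p assume "p \<in> D"
 thus "T z (H p) \<in> carrier Q" using U[OF z _ z] H by auto
 have "T (H a) (H b) \<in> carrier Q \<and> T z (H a) \<otimes> T (H a) (H b) = T z (H b)" if "a \<in> D" "b \<in> D" for a b
  using U[OF z, of "H a" "H b"] U[of "H a" "H b" z] H that z by auto
 thus "\<exists>W. open W \<and> p \<in> W \<and> (\<forall>a\<in>D \<inter> W. \<forall>b\<in>D \<inter> W. T (H a) (H b) \<in> carrier Q \<and> T z (H a) \<otimes> T (H a) (H b) = T z (H b))"
  by (intro exI[of _ UNIV]) auto
qed

lemma potential_locally_exists:
 assumes H: "continuous_on D H" "H \<in> D \<rightarrow> S" and p: "p \<in> D"
 obtains A l where "open A" "p \<in> A" "potential (D \<inter> A) H l"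
proof -
 have z: "H p \<in> S" using H p by auto
 obtain U where U: "open U" "H p \<in> U"
  "!!a b c. a \<in> S \<inter> U ==> b \<in> S \<inter> U ==> c \<in> S \<inter> U ==> T a b \<in> carrier Q \<and> T a b \<otimes> T b c = T a c"
  using T_local[OF z] by blast
 obtain A where A: "open A" "A \<inter> D = H -` U \<inter> D"
  using H(1) U(1) unfolding continuous_on_open_invariant by blast
 have "potential (D \<inter> A) H (%q. T (H p) (H q))"
  by (rule potential_local[of H _ U]) (use A H U z in auto)
 thus thesis using that A U(2) p by blast
qed

text \<open>After one section is multiplied by a constant, the two agree on the connected overlap.
  Near a point of both pieces, values on different pieces are compared by passing through that
  point, which is allowed because \<open>T\<close> is multiplicative there.\<close>

lemma potential_glue:
 assumes H: "continuous_on (D1 \<union> D2) H" "H \<in> D1 \<union> D2 \<rightarrow> S" and cl: "closed D1" "closed D2"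
  and con: "connected (D1 \<inter> D2)" "D1 \<inter> D2 ~= {}" and l: "potential D1 H l1" "potential D2 H l2"
 shows "\<exists>l. potential (D1 \<union> D2) H l"
proof -
 obtain w where w: "w \<in> D1" "w \<in> D2" using con(2) by blast
 define c where "c = l1 w \<otimes> inv (l2 w)"
 have c: "c \<in> carrier Q" using potentialD(1)[OF l(1) w(1)] potentialD(1)[OF l(2) w(2)] by (simp add: c_def)
 define l where "l p = (if p \<in> D1 then l1 p else c \<otimes> l2 p)" for p
 have eq: "l p = c \<otimes> l2 p" if "p \<in> D2" for p
 proof (cases "p \<in> D1")
  case True
  have "potential (D1 \<inter> D2) H l1" "potential (D1 \<inter> D2) H l2" using l by (auto intro: potential_subset)
  hence "l1 p \<otimes> inv (l2 p) = c"
   unfolding c_def using potential_unique[OF con(1), of H l2 l1 p w] True that w by auto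
  hence "c \<otimes> l2 p = l1 p \<otimes> inv (l2 p) \<otimes> l2 p" by simp
  thus ?thesis
   using True potentialD(1)[OF l(1) True] potentialD(1)[OF l(2) that] by (simp add: l_def m_assoc)
 qed (simp add: l_def)
 have p1: "potential D1 H l" by (rule potential_cong[OF l(1)]) (simp_all add: l_def)
 have p2: "potential D2 H l" by (rule potential_cong[OF potential_left[OF l(2) c]]) (simp_all add: eq)
 have "potential (D1 \<union> D2) H l"
 proof (rule potentialI)
  fix p assume p: "p \<in> D1 \<union> D2"
  thus "l p \<in> carrier Q" using p1 p2 potentialD(1) by auto
  consider "p \<in> D1" "p \<notin> D2" | "p \<in> D2" "p \<notin> D1" | "p \<in> D1" "p \<in> D2" using p by blast
  thus "\<exists>W. open W \<and> p \<in> W \<and> (moves H l ((D1 \<union> D2) \<inter> W))"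
  proof cases
   case 1
   then obtain W where "open W" "p \<in> W" "moves H l (D1 \<inter> W)"
    using potentialD(2)[OF p1] by blast
   thus ?thesis using 1 cl by (intro exI[of _ "W - D2"]) (auto intro: open_Diff)
  next
   case 2
   then obtain W where "open W" "p \<in> W" "moves H l (D2 \<inter> W)"
    using potentialD(2)[OF p2] by blast
   thus ?thesis using 2 cl by (intro exI[of _ "W - D1"]) (auto intro: open_Diff)
  next
   case 3
   obtain W1 where W1: "open W1" "p \<in> W1" "!!a b. a \<in> D1 \<inter> W1 ==> b \<in> D1 \<inter> W1 ==> T (H a) (H b) \<in> carrier Q \<and> l a \<otimes> T (H a) (H b) = l b"
    using potentialD(2)[OF p1 3(1)] by blast
   obtain W2 where W2: "open W2" "p \<in> W2" "!!a b. a \<in> D2 \<inter> W2 ==> b \<in> D2 \<inter> W2 ==> T (H a) (H b) \<in> carrier Q \<and> l a \<otimes> T (H a) (H b) = l b"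
    using potentialD(2)[OF p2 3(2)] by blast
   have HpS: "H p \<in> S" using H(2) p by auto
   obtain U where U: "open U" "H p \<in> U"
    "!!a b c. a \<in> S \<inter> U ==> b \<in> S \<inter> U ==> c \<in> S \<inter> U ==> T a b \<in> carrier Q \<and> T a b \<otimes> T b c = T a c"
    using T_local[OF HpS] by blast
   obtain A where A: "open A" "A \<inter> (D1 \<union> D2) = H -` U \<inter> (D1 \<union> D2)"
    using H(1) U(1) unfolding continuous_on_open_invariant by blast
   let ?W = "W1 \<inter> W2 \<inter> A"
   have to_p: "l a \<otimes> T (H a) (H p) = l p" "l p \<otimes> T (H p) (H a) = l a" "H a \<in> S \<inter> U" "l a \<in> carrier Q"
    if aW: "a \<in> (D1 \<union> D2) \<inter> ?W" for a
   proof -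
    have "H a \<in> S" using H(2) aW by auto
    moreover have "H a \<in> U" using A(2) aW by auto
    ultimately show "H a \<in> S \<inter> U" by simp
    consider "a \<in> D1 \<inter> W1" | "a \<in> D2 \<inter> W2" using aW by blast
    hence "l a \<otimes> T (H a) (H p) = l p \<and> l p \<otimes> T (H p) (H a) = l a \<and> l a \<in> carrier Q"
    proof cases
     case 1
     thus ?thesis using W1(3)[of a p] W1(3)[of p a] W1(2) 3 potentialD(1)[OF p1] by simp
    next
     case 2
     thus ?thesis using W2(3)[of a p] W2(3)[of p a] W2(2) 3 potentialD(1)[OF p2] by simp
    qed
    thus "l a \<otimes> T (H a) (H p) = l p" "l p \<otimes> T (H p) (H a) = l a" "l a \<in> carrier Q" by simp_all
   qed
   have "T (H a) (H b) \<in> carrier Q \<and> l a \<otimes> T (H a) (H b) = l b" if ab: "a \<in> (D1 \<union> D2) \<inter> ?W" "b \<in> (D1 \<union> D2) \<inter> ?W" for a b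
   proof -
    have Hp: "H p \<in> S \<inter> U" using HpS U by blast
    note u = U(3)[OF to_p(3)[OF ab(1)] Hp to_p(3)[OF ab(2)]] U(3)[OF Hp to_p(3)[OF ab(2)] Hp]
     U(3)[OF to_p(3)[OF ab(1)] to_p(3)[OF ab(2)] Hp]
    have "l a \<otimes> T (H a) (H b) = (l a \<otimes> T (H a) (H p)) \<otimes> T (H p) (H b)"
     using u to_p(4)[OF ab(1)] by (simp add: m_assoc)
    also have "... = l b" using to_p(1)[OF ab(1)] to_p(2)[OF ab(2)] by simp
    finally show ?thesis using u by simp
   qed
   thus ?thesis using W1 W2 A p U(2) by (intro exI[of _ ?W]) auto
  qed
 qed
 thus ?thesis by blast
qed

text \<open>Two nested bisections. Around a fixed first coordinate, sections over thin rectangles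
  are glued upwards to one over a thin strip; the strips are then glued sideways. All overlaps are
  segments, hence connected.\<close>

lemma potential_square_exists:
 fixes H :: "real \<times> real => 'a"
 assumes H: "continuous_on unit_sq H" "H \<in> unit_sq \<rightarrow> S"
 shows "\<exists>l. potential unit_sq H l"
proof -
 have sub: "continuous_on D H" "H \<in> D \<rightarrow> S" if "D \<subseteq> unit_sq" for D
  using that H by (auto intro: continuous_on_subset)
 define P where "P a b \<longleftrightarrow> (0 \<le> a \<and> a \<le> b \<and> b \<le> 1 \<longrightarrow> (\<exists>l. potential ({a..b} \<times> {0..1}) H l))" for a b
 have "P 0 1"
 proof (rule Bolzano)
  fix a b c :: real assume P: "P a b" "P b c" and abc: "a \<le> b" "b \<le> c"
  show "P a c" unfolding P_def
  proof
   assume "0 \<le> a \<and> a \<le> c \<and> c \<le> 1"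
   hence e: "0 \<le> a" "c \<le> 1" "{a..c} \<times> {0..1} = {a..b} \<times> {0..1} \<union> {b..c} \<times> {0..1::real}"
    "({a..b} \<times> {0..1}) \<inter> ({b..c} \<times> {0..1::real}) = {b} \<times> {0..1}" using abc by auto
   show "\<exists>l. potential ({a..c} \<times> {0..1}) H l"
    unfolding e(3)
   proof -
    obtain l1 l2 where l: "potential ({a..b} \<times> {0..1}) H l1" "potential ({b..c} \<times> {0..1}) H l2"
     using P e(1,2) abc unfolding P_def by (metis order_trans)
    show "\<exists>l. potential ({a..b} \<times> {0..1} \<union> {b..c} \<times> {0..1}) H l"
    proof (rule potential_glue[OF _ _ _ _ _ _ l])
      have "{a..b} \<times> {0..1} \<union> {b..c} \<times> {0..1} \<subseteq> unit_sq" using e(1,2) abc by auto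
      thus "continuous_on ({a..b} \<times> {0..1} \<union> {b..c} \<times> {0..1}) H"
       "H \<in> {a..b} \<times> {0..1} \<union> {b..c} \<times> {0..1} \<rightarrow> S" by (rule sub)+
      show "connected (({a..b} \<times> {0..1}) \<inter> ({b..c} \<times> {0..1::real}))"
       unfolding e(4) by (intro connected_Times) auto
      show "({a..b} \<times> {0..1}) \<inter> ({b..c} \<times> {0..1::real}) ~= {}" unfolding e(4) by simp
    qed (auto intro!: closed_Times)
   qed
  qed
 next
  fix s :: real assume s: "0 \<le> s" "s \<le> 1"
  \<comment> \<open>The width \<open>e\<close> is quantified inside, since gluing two pieces has to
    pass to the smaller of their widths.\<close>
  define R where "R c d \<longleftrightarrow> (0 \<le> c \<and> c \<le> d \<and> d \<le> 1 \<longrightarrow> (\<exists>e>0. \<exists>l. potential (({s - e..s + e} \<inter> {0..1}) \<times> {c..d}) H l))" for c d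
  have "R 0 1"
  proof (rule Bolzano)
   fix a b c :: real assume R: "R a b" "R b c" and abc: "a \<le> b" "b \<le> c"
   show "R a c" unfolding R_def
   proof
    assume ac: "0 \<le> a \<and> a \<le> c \<and> c \<le> 1"
    obtain e1 l1 e2 l2 where l: "e1 > 0" "potential (({s - e1..s + e1} \<inter> {0..1}) \<times> {a..b}) H l1"
     "e2 > 0" "potential (({s - e2..s + e2} \<inter> {0..1}) \<times> {b..c}) H l2"
     using R ac abc unfolding R_def by auto
    define e where "e = min e1 e2"
    let ?I = "{s - e..s + e} \<inter> {0..1}"
    have e: "e > 0" "s \<in> ?I" using l s by (auto simp: e_def)
    have l': "potential (?I \<times> {a..b}) H l1" "potential (?I \<times> {b..c}) H l2"
     by (rule potential_subset[OF l(2)] potential_subset[OF l(4)]; auto simp: e_def)+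
    have un: "?I \<times> {a..c} = ?I \<times> {a..b} \<union> ?I \<times> {b..c}" "(?I \<times> {a..b}) \<inter> (?I \<times> {b..c}) = ?I \<times> {b}"
     using abc by auto
    have "convex ?I" by (intro convex_Int convex_real_interval)
    hence con: "connected (?I \<times> {b})" by (intro connected_Times convex_connected) auto
    have "\<exists>l. potential (?I \<times> {a..b} \<union> ?I \<times> {b..c}) H l"
    proof (rule potential_glue[OF _ _ _ _ _ _ l'])
     have "?I \<times> {a..b} \<union> ?I \<times> {b..c} \<subseteq> unit_sq" using ac abc by auto
     thus "continuous_on (?I \<times> {a..b} \<union> ?I \<times> {b..c}) H" "H \<in> ?I \<times> {a..b} \<union> ?I \<times> {b..c} \<rightarrow> S"
      by (rule sub)+
     show "connected ((?I \<times> {a..b}) \<inter> (?I \<times> {b..c}))" unfolding un(2) by (rule con)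
     show "(?I \<times> {a..b}) \<inter> (?I \<times> {b..c}) ~= {}" unfolding un(2) using e(2) by blast
    qed (auto intro!: closed_Times closed_Int)
    thus "\<exists>e>0. \<exists>l. potential (({s - e..s + e} \<inter> {0..1}) \<times> {a..c}) H l"
     unfolding un(1)[symmetric] using e(1) by blast
   qed
  next
   fix t :: real assume t: "0 \<le> t" "t \<le> 1"
   obtain A l where A: "open A" "(s, t) \<in> A" "potential (unit_sq \<inter> A) H l"
    using potential_locally_exists[OF H, of "(s, t)"] s t by auto
   obtain U V where UV: "open U" "open V" "s \<in> U" "t \<in> V" "U \<times> V \<subseteq> A"
    using open_prod_elim[OF A(1,2)] by (metis mem_Sigma_iff)
   obtain d where d: "d > 0" "ball t d \<subseteq> V" using UV open_contains_ball by blast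
   obtain e where e: "e > 0" "ball s e \<subseteq> U" using UV open_contains_ball by blast
   show "\<exists>d>0. \<forall>a b. a \<le> t \<and> t \<le> b \<and> b - a < d \<longrightarrow> R a b"
   proof (intro exI[of _ d] conjI d(1) allI impI)
    fix a b assume ab: "a \<le> t \<and> t \<le> b \<and> b - a < d"
    have "{s - e/2..s + e/2} \<subseteq> ball s e" using e(1) by (auto simp: dist_real_def)
    moreover have "{a..b} \<subseteq> ball t d" using ab by (auto simp: dist_real_def)
    ultimately have sA: "{s - e/2..s + e/2} \<times> {a..b} \<subseteq> A" using UV d(2) e(2) by blast
    show "R a b" unfolding R_def
    proof (intro impI exI[of _ "e/2"] conjI exI[of _ l] potential_subset[OF A(3)])
     assume "0 \<le> a \<and> a \<le> b \<and> b \<le> 1"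
     thus "({s - e/2..s + e/2} \<inter> {0..1}) \<times> {a..b} \<subseteq> unit_sq \<inter> A"
      using sA by force
    qed (use e(1) in simp)
   qed
  qed simp
  then obtain e l where el: "e > 0" "potential (({s - e..s + e} \<inter> {0..1}) \<times> {0..1}) H l"
   unfolding R_def by auto
  show "\<exists>d>0. \<forall>a b. a \<le> s \<and> s \<le> b \<and> b - a < d \<longrightarrow> P a b"
  proof (intro exI[of _ e] conjI el(1) allI impI)
   fix a b assume "a \<le> s \<and> s \<le> b \<and> b - a < e"
   thus "P a b" unfolding P_def
    by (intro impI exI[of _ l] potential_subset[OF el(2)]) auto
  qed
 qed simp
 thus ?thesis by (simp add: P_def)
qed

definition monodromy :: "(real => 'a) => 'q" where
 "monodromy g = (SOME q. \<exists>l. potential {0..1} g l \<and> q = inv (l 0) \<otimes> l 1)"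

text \<open>A path is treated as a homotopy that does not depend on the first coordinate of the
  square.\<close>

lemma potential_path_exists:
 assumes "path_in S g"
 shows "\<exists>l. potential {0..1} g l"
proof -
 have g: "continuous_on {0..1} g" "g \<in> {0..1} \<rightarrow> S"
  using assms by (auto simp: path_in_def path_def path_image_def)
 have "continuous_on unit_sq (%p::real \<times> real. g (snd p))"
  by (rule continuous_on_compose2[OF g(1)]) (auto intro!: continuous_intros)
 moreover have "(%p::real \<times> real. g (snd p)) \<in> unit_sq \<rightarrow> S" using g(2) by auto
 ultimately obtain l where l: "potential unit_sq (%p::real \<times> real. g (snd p)) l"
  using potential_square_exists by blast
 have "potential {0..1} ((%p. g (snd p)) \<circ> Pair (0::real)) (l \<circ> Pair 0)"
  by (rule potential_compose[OF l]) (auto intro!: continuous_intros)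
 thus ?thesis by (auto simp: comp_def)
qed

lemma monodromy_eq:
 assumes "potential {0..1} g l"
 shows "monodromy g = inv (l 0) \<otimes> l 1"
proof -
 have uniq: "q = inv (l 0) \<otimes> l 1" if "potential {0..1} g l'" "q = inv (l' 0) \<otimes> l' 1" for q l'
 proof -
  have c: "l 0 \<in> carrier Q" "l 1 \<in> carrier Q" "l' 0 \<in> carrier Q" "l' 1 \<in> carrier Q"
   using potentialD(1)[OF assms] potentialD(1)[OF that(1)] by auto
  have "l 0 \<otimes> inv (l' 0) = l 1 \<otimes> inv (l' 1)"
   using potential_unique[OF _ that(1) assms, of 0 1] by simp
  hence "inv (l 0) \<otimes> (l 0 \<otimes> inv (l' 0)) \<otimes> l' 1 = inv (l 0) \<otimes> (l 1 \<otimes> inv (l' 1)) \<otimes> l' 1" by simp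
  thus ?thesis using c that(2) by (simp add: m_assoc)
 qed
 show ?thesis unfolding monodromy_def
 proof (rule some_equality)
  show "\<exists>l'. potential {0..1} g l' \<and> inv (l 0) \<otimes> l 1 = inv (l' 0) \<otimes> l' 1" using assms by blast
 qed (use uniq in blast)
qed

lemma monodromy_closed: "path_in S g ==> monodromy g \<in> carrier Q"
 using potential_path_exists[of g] monodromy_eq[of g] potentialD(1) by force

lemma monodromy_local:
 assumes p: "path_in (S \<inter> U) p"
  and U: "!!a b c. a \<in> S \<inter> U ==> b \<in> S \<inter> U ==> c \<in> S \<inter> U ==> T a b \<in> carrier Q \<and> T a b \<otimes> T b c = T a c"
 shows "monodromy p = T (pathstart p) (pathfinish p)"
proof -
 have im: "p \<in> {0..1} \<rightarrow> S \<inter> U" "p 0 \<in> S \<inter> U" "p 1 \<in> S \<inter> U" using p by (auto simp: path_in_def path_image_def)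
 have "potential {0..1} p (%t. T (p 0) (p t))" by (rule potential_local[OF im(1,2) U])
 hence "monodromy p = inv (T (p 0) (p 0)) \<otimes> T (p 0) (p 1)" by (rule monodromy_eq)
 also have "T (p 0) (p 0) = \<one>" using U[OF im(2,2,2)] l_cancel_one[of "T (p 0) (p 0)" "T (p 0) (p 0)"] by blast
 finally show ?thesis using U[OF im(2,3,3)] by (simp add: pathstart_def pathfinish_def)
qed

lemma monodromy_trivial:
 assumes p: "path_in S p"
  and U: "!!t. t \<in> {0..1} ==> \<exists>U. open U \<and> p t \<in> U \<and> (\<forall>a\<in>S \<inter> U. \<forall>b\<in>S \<inter> U. T a b = \<one>)"
 shows "monodromy p = \<one>"
proof -
 have pp: "continuous_on {0..1} p" "p \<in> {0..1} \<rightarrow> S" using p by (auto simp: path_in_def path_def path_image_def)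
 have "potential {0..1} p (%_. \<one>)"
 proof (rule potentialI)
  fix t :: real assume t: "t \<in> {0..1}"
  obtain U where U: "open U" "p t \<in> U" "\<forall>a\<in>S \<inter> U. \<forall>b\<in>S \<inter> U. T a b = \<one>" using assms(2)[OF t] by blast
  obtain A where A: "open A" "A \<inter> {0..1} = p -` U \<inter> {0..1}"
   using pp(1) U(1) unfolding continuous_on_open_invariant by blast
  have "p a \<in> S \<inter> U" if "a \<in> {0..1} \<inter> A" for a using that A(2) pp(2) by auto
  hence "T (p a) (p b) = \<one>" if "a \<in> {0..1} \<inter> A" "b \<in> {0..1} \<inter> A" for a b using U(3) that by blast
  thus "\<exists>W. open W \<and> t \<in> W \<and> (\<forall>a\<in>{0..1} \<inter> W. \<forall>b\<in>{0..1} \<inter> W. T (p a) (p b) \<in> carrier Q \<and> \<one> \<otimes> T (p a) (p b) = \<one>)"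
   using A t U(2) by (intro exI[of _ A]) auto
 qed simp
 thus ?thesis by (simp add: monodromy_eq)
qed

lemma monodromy_join:
 assumes pq: "path_in S p" "path_in S q" "pathfinish p = pathstart q"
 shows "monodromy (p +++ q) = monodromy p \<otimes> monodromy q"
proof -
 obtain l where l: "potential {0..1} (p +++ q) l" using potential_path_exists[OF path_in_join[OF pq]] by blast
 have "potential {0..1} ((p +++ q) \<circ> (%t. t / 2)) (l \<circ> (%t. t / 2))"
  by (rule potential_compose[OF l]) (auto intro!: continuous_intros)
 hence "potential {0..1} p (l \<circ> (%t. t / 2))" by (rule potential_cong) (auto simp: joinpaths_def)
 hence p: "monodromy p = inv (l 0) \<otimes> l (1/2)" using monodromy_eq by fastforce
 have "potential {0..1} ((p +++ q) \<circ> (%t. (t + 1) / 2)) (l \<circ> (%t. (t + 1) / 2))"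
  by (rule potential_compose[OF l]) (auto intro!: continuous_intros)
 hence "potential {0..1} q (l \<circ> (%t. (t + 1) / 2))"
  by (rule potential_cong) (use pq(3) in \<open>auto simp: joinpaths_def pathstart_def pathfinish_def field_simps\<close>)
 hence q: "monodromy q = inv (l (1/2)) \<otimes> l 1" using monodromy_eq by fastforce
 have c: "l 0 \<in> carrier Q" "l (1/2) \<in> carrier Q" "l 1 \<in> carrier Q" using potentialD(1)[OF l] by auto
 show ?thesis unfolding p q monodromy_eq[OF l] using c by (simp add: m_assoc)
qed

lemma monodromy_homotopic:
 assumes "homotopic_paths S p q"
 shows "monodromy p = monodromy q"
proof -
 obtain h where h: "continuous_on unit_sq h" "h \<in> unit_sq \<rightarrow> S"
  "!!t. t \<in> {0..1::real} ==> h (0, t) = p t" "!!t. t \<in> {0..1} ==> h (1, t) = q t"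
  "!!t. t \<in> {0..1::real} ==> h (t, 0) = p 0" "!!t. t \<in> {0..1} ==> h (t, 1) = p 1"
  by (rule homotopic_pathsE[OF assms]) blast
 obtain l where l: "potential unit_sq h l" using potential_square_exists[OF h(1,2)] by blast
 \<comment> \<open>On the two sides where the end points are fixed the homotopy is constant, and a
   parallel section over a constant map is constant.\<close>
 have side: "l (0, y) = l (1, y)" if y: "y \<in> {0..1}" and const: "!!t. t \<in> {0..1} ==> h (t, y) = z" for y z
 proof -
  have z: "z \<in> S" using const[of 0] h(2) y by auto
  have "potential {0..1} (h \<circ> (%t. (t, y))) (l \<circ> (%t. (t, y)))"
   by (rule potential_compose[OF l]) (use y in \<open>auto intro!: continuous_intros\<close>)
  hence 1: "potential {0..1} (%_::real. z) (l \<circ> (%t. (t, y)))"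
   by (rule potential_cong) (use const in auto)
  obtain U where "open U" "z \<in> U"
   and U: "!!a b c. a \<in> S \<inter> U ==> b \<in> S \<inter> U ==> c \<in> S \<inter> U ==> T a b \<in> carrier Q \<and> T a b \<otimes> T b c = T a c"
   using T_local[OF z] by blast
  hence "potential {0..1} (%_::real. z) (%_. T z z)" using z by (intro potential_local[of _ _ U]) auto
  from potential_unique[OF _ this 1, of 0 1] have "l (0, y) \<otimes> inv T z z = l (1, y) \<otimes> inv T z z" by simp
  thus ?thesis using potentialD(1)[OF l] y U[of z z z] z \<open>z \<in> U\<close> by simp
 qed
 have edge: "potential {0..1} g (l \<circ> Pair t)" if "t \<in> {0..1}" "!!x. x \<in> {0..1} ==> h (t, x) = g x" for t g
 proof -
  have "potential {0..1} (h \<circ> Pair t) (l \<circ> Pair t)"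
   by (rule potential_compose[OF l]) (use that in \<open>auto intro!: continuous_intros\<close>)
  thus ?thesis by (rule potential_cong) (use that in auto)
 qed
 have "monodromy p = inv (l (0, 0)) \<otimes> l (0, 1)" using monodromy_eq[OF edge[OF _ h(3)]] by simp
 moreover have "monodromy q = inv (l (1, 0)) \<otimes> l (1, 1)" using monodromy_eq[OF edge[OF _ h(4)]] by simp
 moreover have "l (0, 0) = l (1, 0)" "l (0, 1) = l (1, 1)"
  using h(5,6) side[of 0 "p 0"] side[of 1 "p 1"] by simp_all
 ultimately show ?thesis by simp
qed

theorem monodromy_hom:
 assumes "x \<in> S"
 shows "\<exists>f\<in>hom (fundamental_group S x) Q. \<forall>p\<in>loops S x. f (loop_class S p) = monodromy p"
proof -
 define f where "f a = monodromy (SOME p. p \<in> a)" for a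
 have f: "f (loop_class S p) = monodromy p" if "p \<in> loops S x" for p
 proof -
  have "(SOME p'. p' \<in> loop_class S p) \<in> loop_class S p"
   using that loop_class_nonempty[of S p] by (intro some_in_eq[THEN iffD2]) (auto simp: loops_iff)
  thus ?thesis unfolding f_def by (intro monodromy_homotopic[symmetric]) (simp add: loop_class_def)
 qed
 have "f \<in> hom (fundamental_group S x) Q"
 proof (rule homI)
  fix a assume "a \<in> carrier (fundamental_group S x)"
  then obtain p where p: "p \<in> loops S x" "a = loop_class S p" by (auto simp: pi1_carrier)
  thus "f a \<in> carrier Q" using f monodromy_closed by (auto simp: loops_iff)
  fix b assume "b \<in> carrier (fundamental_group S x)"
  then obtain q where q: "q \<in> loops S x" "b = loop_class S q" by (auto simp: pi1_carrier)
  have "p +++ q \<in> loops S x" using p q by (auto simp: loops_iff)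
  thus "f (a \<otimes>\<^bsub>fundamental_group S x\<^esub> b) = f a \<otimes> f b"
   using p q f by (simp add: loops_iff pi1_mult monodromy_join)
 qed
 thus ?thesis using f by blast
qed

end

section \<open>Complements of graphs of functions\<close>

subsection \<open>Moving punctures\<close>

text \<open>Moves each puncture \<open>c i\<close> to \<open>c' i\<close> and fixes the points at distance at least \<open>d\<close> from all
 punctures.\<close>

definition push :: "nat => real => (nat => complex) => (nat => complex) => complex => complex" where
 "push n d c c' y = y + (\<Sum>i\<in>{1..n}. of_real (max 0 (1 - norm (y - c i) / d)) * (c' i - c i))"

lemma push_id: "(!!i. i \<in> {1..n} ==> c' i = c i) ==> push n d c c' y = y"
 by (simp add: push_def)

text \<open>The separation \<open>3 * d\<close> leaves at most one active summand. If
  \<open>y\<close> is within \<open>d\<close> of \<open>c i\<close>, it is at distance at least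
  \<open>2 * d\<close> from every other puncture, and it and that puncture move by less than
  \<open>d\<close> each. At \<open>c i\<close> itself a collision would mean that
  \<open>y - c i\<close>, of length \<open>l\<close>, equals \<open>l / d\<close> times a
  displacement shorter than \<open>d\<close>.\<close>

lemma push_avoids:
 assumes d: "d > 0" and sep: "!!i j. i \<in> {1..n} ==> j \<in> {1..n} ==> i ~= j ==> norm (c i - c j) \<ge> 3 * d"
  and close: "!!i. i \<in> {1..n} ==> norm (c' i - c i) < d" and y: "!!i. i \<in> {1..n} ==> y ~= c i"
  and k: "k \<in> {1..n}"
 shows "push n d c c' y ~= c' k"
proof (cases "\<exists>i\<in>{1..n}. norm (y - c i) < d")
 case True
 then obtain i where i: "i \<in> {1..n}" "norm (y - c i) < d" by blast
 have far: "norm (y - c j) \<ge> 2 * d" if "j \<in> {1..n}" "j ~= i" for j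
 proof -
  have "norm (c i - c j) \<le> norm (y - c i) + norm (y - c j)"
   using norm_triangle_ineq[of "c i - y" "y - c j"] by (simp add: norm_minus_commute)
  thus ?thesis using sep[OF i(1) that(1)] that i(2) by auto
 qed
 have "(\<Sum>j\<in>{1..n}. of_real (max 0 (1 - norm (y - c j) / d)) * (c' j - c j)) =
   (\<Sum>j\<in>{1..n}. if j = i then of_real (1 - norm (y - c i) / d) * (c' i - c i) else (0::complex))"
 proof (rule sum.cong)
  fix j assume j: "j \<in> {1..n}"
  show "of_real (max 0 (1 - norm (y - c j) / d)) * (c' j - c j) =
   (if j = i then of_real (1 - norm (y - c i) / d) * (c' i - c i) else 0)"
  proof (cases "j = i")
   case True
   have "norm (y - c i) / d \<le> 1" using i(2) d by simp
   thus ?thesis using True by (simp add: max_def)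
  next
   case False
   have "1 - norm (y - c j) / d \<le> 0" using far[OF j False] d by (simp add: field_simps)
   thus ?thesis using False by (simp add: max_absorb1)
  qed
 qed simp
 hence p: "push n d c c' y = y + of_real (1 - norm (y - c i) / d) * (c' i - c i)"
  using i(1) by (simp add: push_def)
 show ?thesis
 proof (cases "k = i")
  case True
  have r: "norm (y - c i) > 0" using y i(1) by simp
  have e: "push n d c c' y - c' k = (y - c i) - of_real (norm (y - c i) / d) * (c' i - c i)"
   unfolding p True by (simp add: algebra_simps)
  have "norm (of_real (norm (y - c i) / d) * (c' i - c i)) = norm (y - c i) / d * norm (c' i - c i)"
   using d by (simp add: norm_mult norm_divide)
  also have "... < norm (y - c i) / d * d" using r d close[OF i(1)] by (intro mult_strict_left_mono) auto
  also have "... = norm (y - c i)" using d by simp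
  finally have "y - c i ~= of_real (norm (y - c i) / d) * (c' i - c i)" by auto
  thus ?thesis using e by auto
 next
  case False
  have "norm (of_real (1 - norm (y - c i) / d) * (c' i - c i)) = (1 - norm (y - c i) / d) * norm (c' i - c i)"
   using i(2) d unfolding norm_mult norm_of_real by simp
  also have "... \<le> 1 * norm (c' i - c i)" using d by (intro mult_right_mono) auto
  finally have 1: "norm (push n d c c' y - y) < d" using close[OF i(1)] by (simp add: p)
  have "norm (y - c k) \<le> norm (push n d c c' y - y) + norm (c' k - c k) + norm (push n d c c' y - c' k)"
   using norm_triangle_ineq[of "y - push n d c c' y" "push n d c c' y - c k"]
    norm_triangle_ineq[of "push n d c c' y - c' k" "c' k - c k"] by (simp add: norm_minus_commute)
  hence "norm (push n d c c' y - c' k) > 0" using far[OF k False] 1 close[OF k] by linarith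
  thus ?thesis by auto
 qed
next
 case False
 hence far: "norm (y - c j) \<ge> d" if "j \<in> {1..n}" for j using that by force
 have "max 0 (1 - norm (y - c j) / d) = 0" if "j \<in> {1..n}" for j
  using far[OF that] d by (simp add: field_simps)
 hence p: "push n d c c' y = y" by (simp add: push_def)
 have "norm (y - c k) \<le> norm (y - c' k) + norm (c' k - c k)"
  using norm_triangle_ineq[of "y - c' k" "c' k - c k"] by simp
 hence "norm (y - c' k) > 0" using far[OF k] close[OF k] by linarith
 thus ?thesis using p by auto
qed

lemma continuous_on_push:
 assumes "d > 0" "!!i. i \<in> {1..n} ==> continuous_on D (c i)" "!!i. i \<in> {1..n} ==> continuous_on D (c' i)" "continuous_on D y"
 shows "continuous_on D (%p. push n d (%i. c i p) (%i. c' i p) (y p))"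
 unfolding push_def using assms by (auto intro!: continuous_intros)

fun push_seq :: "nat => real => (nat => nat => complex) => nat => complex => complex" where
 "push_seq n d cs 0 y = y"
| "push_seq n d cs (Suc k) y = push n d (cs k) (cs (Suc k)) (push_seq n d cs k y)"

lemma push_seq_id: "(!!i k. k < N ==> i \<in> {1..n} ==> cs (Suc k) i = cs k i) ==> push_seq n d cs N y = y"
proof (induction N)
 case (Suc N)
 hence "push_seq n d cs N y = y" by simp
 moreover have "push n d (cs N) (cs (Suc N)) y = y" using Suc.prems by (intro push_id) blast
 ultimately show ?case by simp
qed simp

lemma push_seq_transport:
 assumes d: "d > 0" and sep: "!!k i j p. p \<in> D ==> k \<le> N ==> i \<in> {1..n} ==> j \<in> {1..n} ==> i ~= j ==> norm (cs k i p - cs k j p) \<ge> 3 * d"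
  and close: "!!k i p. p \<in> D ==> k < N ==> i \<in> {1..n} ==> norm (cs (Suc k) i p - cs k i p) < d"
  and cont: "!!k i. k \<le> N ==> i \<in> {1..n} ==> continuous_on D (cs k i)"
  and y: "continuous_on D y" "!!p i. p \<in> D ==> i \<in> {1..n} ==> y p ~= cs 0 i p"
  and k: "k \<le> N"
 shows "continuous_on D (%p. push_seq n d (%k i. cs k i p) k (y p)) \<and>
   (\<forall>p\<in>D. \<forall>i\<in>{1..n}. push_seq n d (%k i. cs k i p) k (y p) ~= cs k i p)"
 using k
proof (induction k)
 case 0 thus ?case using y by simp
next
 case (Suc k)
 hence IH: "continuous_on D (%p. push_seq n d (%k i. cs k i p) k (y p))"
   "!!p i. p \<in> D ==> i \<in> {1..n} ==> push_seq n d (%k i. cs k i p) k (y p) ~= cs k i p" by auto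
 have "continuous_on D (%p. push_seq n d (%k i. cs k i p) (Suc k) (y p))"
  using continuous_on_push[OF d _ _ IH(1), of n "cs k" "cs (Suc k)"] cont Suc.prems by simp
 moreover have "push_seq n d (%k i. cs k i p) (Suc k) (y p) ~= cs (Suc k) i p" if "p \<in> D" "i \<in> {1..n}" for p i
  using push_avoids[OF d, of n "%i. cs k i p" "%i. cs (Suc k) i p" "push_seq n d (%k i. cs k i p) k (y p)" i]
   sep[OF that(1), of k] close[OF that(1), of k] IH(2)[OF that(1)] that Suc.prems by simp
 ultimately show ?case by blast
qed

text \<open>Compactness of the square bounds the mutual distances from below, and uniform continuity
  gives a time step during which every puncture moves by less than \<open>d\<close>.\<close>

lemma moving_configuration_constants:
 fixes c :: "nat => real \<times> real => complex"
 assumes cont: "!!i. i \<in> {1..n} ==> continuous_on unit_sq (c i)"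
  and dist: "!!p i j. p \<in> unit_sq ==> i \<in> {1..n} ==> j \<in> {1..n} ==> i ~= j ==> c i p ~= c j p"
 obtains d N where "d > 0" "N > (0::nat)"
  "!!p i j. p \<in> unit_sq ==> i \<in> {1..n} ==> j \<in> {1..n} ==> i ~= j ==> norm (c i p - c j p) \<ge> 3 * d"
  "!!t t' s i. t \<in> {0..1} ==> t' \<in> {0..1} ==> s \<in> {0..1} ==> i \<in> {1..n} ==> \<bar>t - t'\<bar> \<le> 1 / real N ==> norm (c i (t, s) - c i (t', s)) < d"
proof -
 let ?D = "unit_sq"
 have cpt: "compact ?D" by (intro compact_Times) auto
 have "\<exists>d>0. \<forall>p\<in>?D. norm (c i p - c j p) \<ge> 3 * d" if "i \<in> {1..n}" "j \<in> {1..n}" "i ~= j" for i j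
 proof -
  have "continuous_on ?D (%p. norm (c i p - c j p))" using cont that by (intro continuous_intros) auto
  then obtain p where p: "p \<in> ?D" "\<forall>q\<in>?D. norm (c i p - c j p) \<le> norm (c i q - c j q)"
   using continuous_attains_inf[OF cpt, of "%p. norm (c i p - c j p)"] by auto
  thus ?thesis using dist[OF p(1) that] by (intro exI[of _ "norm (c i p - c j p) / 3"]) auto
 qed
 then obtain e where e: "!!i j. i \<in> {1..n} ==> j \<in> {1..n} ==> i ~= j ==> e i j > 0 \<and> (\<forall>p\<in>?D. norm (c i p - c j p) \<ge> 3 * e i j)"
  by metis
 \<comment> \<open>The element 1 keeps the set nonempty when there are fewer than two
   punctures.\<close>
 define d where "d = Min (insert 1 ((%(i, j). e i j) ` {(i, j). i \<in> {1..n} \<and> j \<in> {1..n} \<and> i ~= j}))"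
 have fin: "finite (insert 1 ((%(i, j). e i j) ` {(i, j). i \<in> {1..n} \<and> j \<in> {1..n} \<and> i ~= j}))"
  by (rule finite.insertI, rule finite_imageI, rule finite_subset[of _ "{1..n} \<times> {1..n}"]) auto
 have d: "d > 0" unfolding d_def using fin e by (subst Min_gr_iff) auto
 have de: "d \<le> e i j" if "i \<in> {1..n}" "j \<in> {1..n}" "i ~= j" for i j
  unfolding d_def using fin that by (intro Min_le) auto
 have "\<exists>r>0. \<forall>p\<in>?D. \<forall>q\<in>?D. dist p q < r \<longrightarrow> norm (c i p - c i q) < d" if "i \<in> {1..n}" for i
 proof -
  have "uniformly_continuous_on ?D (c i)" by (rule compact_uniformly_continuous[OF cont[OF that] cpt])
  then obtain r where r: "r > 0" "\<forall>p\<in>?D. \<forall>q\<in>?D. dist q p < r \<longrightarrow> dist (c i q) (c i p) < d"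
   using d unfolding uniformly_continuous_on_def by meson
  show ?thesis by (intro exI[of _ r] conjI r(1)) (use r(2) in \<open>simp add: dist_norm\<close>)
 qed
 then obtain r where r: "!!i. i \<in> {1..n} ==> r i > 0 \<and> (\<forall>p\<in>?D. \<forall>q\<in>?D. dist p q < r i \<longrightarrow> norm (c i p - c i q) < d)"
  by metis
 define r0 where "r0 = Min (insert 1 (r ` {1..n}))"
 have r0: "r0 > 0" unfolding r0_def using r by (subst Min_gr_iff) auto
 have rr: "r0 \<le> r i" if "i \<in> {1..n}" for i unfolding r0_def using that by (intro Min_le) auto
 obtain N where N: "N > 0" "1 / real N < r0" using nat_approx_posE[OF r0] by (metis zero_less_Suc)
 show thesis
 proof (rule that[OF d N(1)])
  fix p i j assume "p \<in> ?D" "i \<in> {1..n}" "j \<in> {1..n}" "i ~= j"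
  thus "norm (c i p - c j p) \<ge> 3 * d" using e[of i j] de[of i j] by (smt (verit))
 next
  fix t t' s i assume a: "t \<in> {0..1}" "t' \<in> {0..1}" "s \<in> {0..1::real}" "i \<in> {1..n}" "\<bar>t - t'\<bar> \<le> 1 / real N"
  have "dist (t, s) (t', s) = \<bar>t - t'\<bar>" by (simp add: dist_prod_def dist_real_def)
  hence "dist (t, s) (t', s) < r i" using a N rr[OF a(4)] by linarith
  thus "norm (c i (t, s) - c i (t', s)) < d" using r[OF a(4)] a by auto
 qed
qed

section \<open>Transport between fibres and the split extension of fundamental groups\<close>

locale root_fibration =
 fixes B :: "'b::topological_space set" and b :: "nat => 'b => complex" and n :: nat
 assumes b_cont: "i \<in> {1..n} ==> continuous_on B (b i)"
  and b_distinct: "x \<in> B ==> i \<in> {1..n} ==> j \<in> {1..n} ==> i ~= j ==> b i x ~= b j x"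
begin

definition E :: "('b \<times> complex) set" where
 "E = {(x, y). x \<in> B \<and> (\<forall>i\<in>{1..n}. y ~= b i x)}"

definition F :: "'b => complex set" where
 "F x = {y. \<forall>i\<in>{1..n}. y ~= b i x}"

text \<open>The sum of the moduli makes the real part exceed that of every root. The difference from
  each root then stays in the right half plane and has winding number 0 along every loop.\<close>

definition \<sigma> :: "'b => complex" where
 "\<sigma> x = of_real (1 + (\<Sum>i\<in>{1..n}. norm (b i x)))"

lemma E_iff: "(x, y) \<in> E \<longleftrightarrow> x \<in> B \<and> y \<in> F x"
 by (auto simp: E_def F_def)

lemma Re_b_less_\<sigma>: "i \<in> {1..n} ==> Re (b i x) < Re (\<sigma> x)"
proof -
 assume i: "i \<in> {1..n}"
 have "Re (b i x) \<le> norm (b i x)" by (rule complex_Re_le_cmod)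
 also have "... \<le> (\<Sum>i\<in>{1..n}. norm (b i x))" using i by (intro member_le_sum) auto
 finally show ?thesis by (simp add: \<sigma>_def)
qed

lemma \<sigma>_in_F: "\<sigma> x \<in> F x"
 unfolding F_def
proof (intro CollectI ballI notI)
 fix i assume "i \<in> {1..n}" "\<sigma> x = b i x"
 thus False using Re_b_less_\<sigma>[of i x] by simp
qed

lemma \<sigma>_cont: "continuous_on B \<sigma>"
 unfolding \<sigma>_def using b_cont by (intro continuous_intros) auto

text \<open>The homotopy frozen at time \<open>k / N\<close>. As \<open>k\<close> grows it is
  released in \<open>N\<close> stages, each of which moves the roots by less than the radius of a
  push.\<close>

abbreviation stop :: "(real \<times> real => 'b) => nat => nat => real => real => 'b" where
 "stop H N k t s \<equiv> H (min t (real k / real N), s)"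

lemma transport_time:
 fixes H :: "real \<times> real => 'b"
 assumes H: "continuous_on unit_sq H" "H \<in> unit_sq \<rightarrow> B"
 obtains d N where "d > 0" "N > (0::nat)"
  "!!k i. i \<in> {1..n} ==> continuous_on unit_sq (%(t, s). b i (stop H N k t s))"
  "!!t s k i j. t \<in> {0..1} ==> s \<in> {0..1} ==> i \<in> {1..n} ==> j \<in> {1..n} ==> i ~= j ==>
    norm (b i (stop H N k t s) - b j (stop H N k t s)) \<ge> 3 * d"
  "!!t s k i. t \<in> {0..1} ==> s \<in> {0..1} ==> i \<in> {1..n} ==>
    norm (b i (stop H N (Suc k) t s) - b i (stop H N k t s)) < d"
proof -
 let ?D = "unit_sq"
 have cb: "continuous_on ?D (%p. b i (H p))" if "i \<in> {1..n}" for i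
  using H by (intro continuous_on_compose2[OF b_cont[OF that] H(1)]) auto
 obtain d N where dN: "d > 0" "N > (0::nat)"
  "!!p i j. p \<in> ?D ==> i \<in> {1..n} ==> j \<in> {1..n} ==> i ~= j ==> norm (b i (H p) - b j (H p)) \<ge> 3 * d"
  "!!t t' s i. t \<in> {0..1} ==> t' \<in> {0..1} ==> s \<in> {0..1} ==> i \<in> {1..n} ==> \<bar>t - t'\<bar> \<le> 1 / real N ==> norm (b i (H (t, s)) - b i (H (t', s))) < d"
  by (rule moving_configuration_constants[of n "%i p. b i (H p)", OF cb]) (use b_distinct H(2) in blast)+
 have m: "min t (real k / real N) \<in> {0..1}" if "t \<in> {0..1}" for t k using that by auto
 show thesis
 proof (rule that[OF dN(1,2)])
  fix k i assume i: "i \<in> {1..n}"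
  have "continuous_on ?D (%p. (min (fst p) (real k / real N), snd p))" by (intro continuous_intros)
  hence "continuous_on ?D (%p. b i (H (min (fst p) (real k / real N), snd p)))"
   by (rule continuous_on_compose2[OF cb[OF i]]) auto
  thus "continuous_on ?D (%(t, s). b i (stop H N k t s))" by (simp add: case_prod_unfold)
 next
  fix t s :: real and k i j :: nat assume "t \<in> {0..1}" "s \<in> {0..1}" "i \<in> {1..n}" "j \<in> {1..n}" "i ~= j"
  thus "norm (b i (stop H N k t s) - b j (stop H N k t s)) \<ge> 3 * d"
   using m by (intro dN(3)) auto
 next
  fix t s :: real and k i :: nat assume "t \<in> {0..1}" "s \<in> {0..1}" "i \<in> {1..n}"
  note a = this
  have "real (Suc k) / real N - real k / real N = 1 / real N" by (simp add: add_divide_distrib)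
  moreover have "0 \<le> 1 / real N" by simp
  ultimately have "\<bar>min t (real (Suc k) / real N) - min t (real k / real N)\<bar> \<le> 1 / real N" by linarith
  thus "norm (b i (stop H N (Suc k) t s) - b i (stop H N k t s)) < d"
   using m a by (intro dN(4)) auto
 qed
qed

text \<open>The initial values are pushed through the stages. A push between equal configurations is
  the identity, so the lift is stationary wherever \<open>H\<close> is.\<close>

lemma lift_homotopy:
 fixes H :: "real \<times> real => 'b"
 assumes H: "continuous_on unit_sq H" "H \<in> unit_sq \<rightarrow> B"
  and y: "continuous_on {0..1} y" "!!s. s \<in> {0..1} ==> y s \<in> F (H (0, s))"
 obtains Y where "continuous_on unit_sq Y" "!!p. p \<in> unit_sq ==> Y p \<in> F (H p)"
  "!!s. s \<in> {0..1} ==> Y (0, s) = y s"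
  "!!t s. t \<in> {0..1} ==> s \<in> {0..1} ==> (!!t'. t' \<in> {0..1} ==> H (t', s) = H (0, s)) ==> Y (t, s) = y s"
proof -
 let ?D = "unit_sq"
 obtain d N where dN: "d > 0" "N > (0::nat)"
  "!!k i. i \<in> {1..n} ==> continuous_on unit_sq (%(t, s). b i (stop H N k t s))"
  "!!t s k i j. t \<in> {0..1} ==> s \<in> {0..1} ==> i \<in> {1..n} ==> j \<in> {1..n} ==> i ~= j ==>
    norm (b i (stop H N k t s) - b j (stop H N k t s)) \<ge> 3 * d"
  "!!t s k i. t \<in> {0..1} ==> s \<in> {0..1} ==> i \<in> {1..n} ==>
    norm (b i (stop H N (Suc k) t s) - b i (stop H N k t s)) < d"
  using transport_time[OF H] by blast
 define cs where "cs k i = (%(t, s). b i (stop H N k t s))" for k i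
 define Y where "Y p = push_seq n d (%k i. cs k i p) N (y (snd p))" for p
 have "continuous_on ?D (%p. y (snd p))" by (rule continuous_on_compose2[OF y(1)]) (auto intro!: continuous_intros)
 hence "continuous_on ?D Y \<and> (\<forall>p\<in>?D. \<forall>i\<in>{1..n}. Y p ~= cs N i p)"
  unfolding Y_def using dN y(2) by (intro push_seq_transport[where N = N]) (auto simp: cs_def F_def)
 moreover have "cs N i p = b i (H p)" if "p \<in> ?D" for i p using that dN(2) by (auto simp: cs_def)
 ultimately have YF: "continuous_on ?D Y" "!!p. p \<in> ?D ==> Y p \<in> F (H p)" by (auto simp: F_def)
 have Yy: "Y (t, s) = y s" if "t \<in> {0..1}" "s \<in> {0..1}" "!!t'. t' \<in> {0..t} ==> H (t', s) = H (0, s)" for t s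
 proof -
  have "stop H N k t s = H (0, s)" for k using that by (intro that(3)) auto
  thus ?thesis unfolding Y_def by (subst push_seq_id) (auto simp: cs_def simp del: of_nat_Suc)
 qed
 show thesis
 proof (rule that[of Y, OF YF])
  show "Y (0, s) = y s" if "s \<in> {0..1}" for s using that by (intro Yy) auto
  show "Y (t, s) = y s" if "t \<in> {0..1}" "s \<in> {0..1}" "!!t'. t' \<in> {0..1} ==> H (t', s) = H (0, s)" for t s
   using that(1,2) by (intro Yy that(3)) auto
 qed
qed

text \<open>The stages run backwards and carry the fibre over \<open>H (t, s)\<close> to the one
  over \<open>H (0, s)\<close>. The maps depend on \<open>H\<close> alone, so that several sections
  over the same homotopy can be transported by the same maps; \<open>fibre_injects\<close> needs
  two.\<close>

lemma transport_back:
 fixes H :: "real \<times> real => 'b"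
 assumes H: "continuous_on unit_sq H" "H \<in> unit_sq \<rightarrow> B"
 obtains \<Theta> where "!!Y. continuous_on unit_sq Y ==> (!!p. p \<in> unit_sq ==> Y p \<in> F (H p)) ==>
    continuous_on unit_sq (%p. \<Theta> p (Y p)) \<and> (\<forall>t\<in>{0..1}. \<forall>s\<in>{0..1}. \<Theta> (t, s) (Y (t, s)) \<in> F (H (0, s)))"
  "!!t s y. t \<in> {0..1} ==> s \<in> {0..1} ==> (!!t'. t' \<in> {0..t} ==> H (t', s) = H (0, s)) ==> \<Theta> (t, s) y = y"
proof -
 let ?D = "unit_sq"
 obtain d N where dN: "d > 0" "N > (0::nat)"
  "!!k i. i \<in> {1..n} ==> continuous_on unit_sq (%(t, s). b i (stop H N k t s))"
  "!!t s k i j. t \<in> {0..1} ==> s \<in> {0..1} ==> i \<in> {1..n} ==> j \<in> {1..n} ==> i ~= j ==>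
    norm (b i (stop H N k t s) - b j (stop H N k t s)) \<ge> 3 * d"
  "!!t s k i. t \<in> {0..1} ==> s \<in> {0..1} ==> i \<in> {1..n} ==>
    norm (b i (stop H N (Suc k) t s) - b i (stop H N k t s)) < d"
  using transport_time[OF H] by blast
 \<comment> \<open>Stage \<open>k\<close> is frozen at time \<open>(N - k) / N\<close>, so stage
   \<open>N\<close> belongs to the fibre over time 0.\<close>
 define cs where "cs k i = (%(t, s). b i (stop H N (N - k) t s))" for k i
 define \<Theta> where "\<Theta> p y = push_seq n d (%k i. cs k i p) N y" for p y
 have close: "norm (cs (Suc k) i p - cs k i p) < d" if "p \<in> ?D" "k < N" "i \<in> {1..n}" for k i p
 proof -
  have "N - k = Suc (N - Suc k)" using that by simp
  thus ?thesis using dN(5)[of "fst p" "snd p" i "N - Suc k"] that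
   by (auto simp: cs_def case_prod_unfold norm_minus_commute)
 qed
 have c0: "cs 0 i p = b i (H p)" if "p \<in> ?D" for i p using that dN(2) by (auto simp: cs_def)
 have cN: "cs N i (t, s) = b i (H (0, s))" if "t \<in> {0..1}" for i t s using that by (simp add: cs_def)
 show thesis
 proof (rule that[of \<Theta>])
  fix Y assume Y: "continuous_on ?D Y" "!!p. p \<in> ?D ==> Y p \<in> F (H p)"
  have "continuous_on ?D (%p. \<Theta> p (Y p)) \<and> (\<forall>p\<in>?D. \<forall>i\<in>{1..n}. \<Theta> p (Y p) ~= cs N i p)"
   unfolding \<Theta>_def using dN(1,3,4) Y close c0
   by (intro push_seq_transport[where N = N]) (auto simp: cs_def F_def simp del: of_nat_Suc of_nat_diff)
  thus "continuous_on ?D (%p. \<Theta> p (Y p)) \<and> (\<forall>t\<in>{0..1}. \<forall>s\<in>{0..1}. \<Theta> (t, s) (Y (t, s)) \<in> F (H (0, s)))"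
   using cN by (auto simp: F_def)
 next
  fix t s y assume a: "t \<in> {0..1}" "s \<in> {0..1}" "!!t'. t' \<in> {0..t} ==> H (t', s) = H (0, s)"
  have "stop H N k t s = H (0, s)" for k using a by (intro a(3)) auto
  thus "\<Theta> (t, s) y = y" unfolding \<Theta>_def by (intro push_seq_id) (simp add: cs_def del: of_nat_Suc of_nat_diff)
 qed
qed

context
 fixes x0 :: 'b
 assumes x0: "x0 \<in> B"
begin

definition "\<pi>F = fundamental_group (F x0) (\<sigma> x0)"
definition "\<pi>E = fundamental_group E (x0, \<sigma> x0)"
definition "\<pi>B = fundamental_group B x0"
definition "fib_i = induced_map E (Pair x0)"
definition "fib_p = induced_map B (fst :: 'b \<times> complex => 'b)"
definition "fib_s = induced_map E (%x. (x, \<sigma> x))"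

lemma Pair_maps: "continuous_on (F x0) (Pair x0)" "Pair x0 \<in> F x0 \<rightarrow> E"
 using x0 by (auto simp: E_iff intro!: continuous_intros)

lemma fst_maps: "continuous_on E fst" "fst \<in> E \<rightarrow> B"
 by (auto simp: E_iff intro!: continuous_intros)

lemma section_maps: "continuous_on B (%x. (x, \<sigma> x))" "(%x. (x, \<sigma> x)) \<in> B \<rightarrow> E"
 using \<sigma>_cont \<sigma>_in_F by (auto simp: E_iff intro!: continuous_intros)

text \<open>Exactness at the total space: a null homotopy of the projected loop is lifted, starting
  from the loop itself, and ends in the fibre.\<close>

lemma fib_p_surjects_from_fibre:
 assumes g: "g \<in> loops E (x0, \<sigma> x0)" and null: "homotopic_paths B (fst \<circ> g) (%_. x0)"
 shows "\<exists>f\<in>loops (F x0) (\<sigma> x0). homotopic_paths E g (Pair x0 \<circ> f)"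
proof -
 have gp: "path_in E g" "g 0 = (x0, \<sigma> x0)" "g 1 = (x0, \<sigma> x0)" using g by (auto simp: loops_iff pathstart_def pathfinish_def)
 have gE: "fst (g s) \<in> B \<and> snd (g s) \<in> F (fst (g s))" if "s \<in> {0..1}" for s
 proof -
  have "g s \<in> E" using gp(1) that unfolding path_in_def path_image_def by blast
  thus ?thesis using E_iff[of "fst (g s)" "snd (g s)"] by simp
 qed
 have cg: "continuous_on {0..1} g" using gp by (simp add: path_in_def path_def)
 obtain H where H: "continuous_on unit_sq H" "H \<in> unit_sq \<rightarrow> B"
  "!!t. t \<in> {0..1::real} ==> H (0, t) = fst (g t)" "!!t. t \<in> {0..1} ==> H (1, t) = x0"
  "!!t. t \<in> {0..1::real} ==> H (t, 0) = x0" "!!t. t \<in> {0..1} ==> H (t, 1) = x0"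
  by (rule homotopic_pathsE[OF null]) (use gp in \<open>simp add: comp_def\<close>)
 obtain Y where Y: "continuous_on unit_sq Y" "!!p. p \<in> unit_sq ==> Y p \<in> F (H p)"
  "!!s. s \<in> {0..1} ==> Y (0, s) = snd (g s)"
  "!!t s. t \<in> {0..1} ==> s \<in> {0..1} ==> (!!t'. t' \<in> {0..1} ==> H (t', s) = H (0, s)) ==> Y (t, s) = snd (g s)"
  by (rule lift_homotopy[OF H(1,2), of "%s. snd (g s)"]) (use cg gE H(3) in \<open>auto intro!: continuous_intros\<close>)
 have side: "Y (t, 0) = \<sigma> x0" "Y (t, 1) = \<sigma> x0" if "t \<in> {0..1}" for t
  using Y(4)[OF that, of 0] Y(4)[OF that, of 1] H(5,6) gp by simp_all
 define f where "f s = Y (1, s)" for s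
 have "homotopic_paths E g (Pair x0 \<circ> f)"
  unfolding homotopic_paths
 proof (intro exI[of _ "%p. (H p, Y p)"] conjI ballI)
  show "continuous_on unit_sq (%p. (H p, Y p))" using H(1) Y(1) by (intro continuous_intros)
  show "(%p. (H p, Y p)) \<in> unit_sq \<rightarrow> E" using H(2) Y(2) by (auto simp: E_iff)
 qed (use H Y(3) side gp in \<open>auto simp: f_def pathstart_def pathfinish_def\<close>)
 moreover have "f \<in> loops (F x0) (\<sigma> x0)"
 proof -
  have "continuous_on {0..1} f" unfolding f_def
   by (rule continuous_on_compose2[OF Y(1)]) (auto intro!: continuous_intros)
  moreover have "f s \<in> F x0" if "s \<in> {0..1}" for s using Y(2)[of "(1, s)"] H(4)[OF that] that by (simp add: f_def)
  ultimately show ?thesis using side[of 1]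
   by (auto simp: loops_iff path_in_def path_def path_image_def pathstart_def pathfinish_def f_def)
 qed
 ultimately show ?thesis by blast
qed

text \<open>A null homotopy in \<open>E\<close> projects to a square \<open>H\<close> in the base
  that is constant on its boundary but may wrap around a nontrivial sphere. Transporting its fibre
  coordinate back along \<open>H\<close> joins \<open>f\<close> to a path \<open>l\<close> that need
  not be constant. The section over the same \<open>H\<close> is transported by the same maps: it
  also ends in \<open>l\<close>, and it starts from the constant path.\<close>

lemma fibre_injects:
 assumes f: "f \<in> loops (F x0) (\<sigma> x0)" and null: "homotopic_paths E (Pair x0 \<circ> f) (%_. (x0, \<sigma> x0))"
 shows "homotopic_paths (F x0) f (%_. \<sigma> x0)"
proof -
 have f01: "f 0 = \<sigma> x0" "f 1 = \<sigma> x0" using f by (auto simp: loops_iff pathstart_def pathfinish_def)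
 obtain h where h: "continuous_on unit_sq h" "h \<in> unit_sq \<rightarrow> E"
  "!!t. t \<in> {0..1::real} ==> h (0, t) = (x0, f t)" "!!t. t \<in> {0..1} ==> h (1, t) = (x0, \<sigma> x0)"
  "!!t. t \<in> {0..1::real} ==> h (t, 0) = (x0, \<sigma> x0)" "!!t. t \<in> {0..1} ==> h (t, 1) = (x0, \<sigma> x0)"
  by (rule homotopic_pathsE[OF null]) (use f01 in \<open>simp add: comp_def\<close>)
 define H where "H p = fst (h p)" for p
 have H: "continuous_on unit_sq H" "H \<in> unit_sq \<rightarrow> B"
  unfolding H_def using h(1,2) fst_maps(2) by (auto intro!: continuous_intros)
 have H0: "H (0, s) = x0" "H (1, s) = x0" "H (s, 0) = x0" "H (s, 1) = x0" if "s \<in> {0..1}" for s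
  using h that by (simp_all add: H_def)
 obtain \<Theta> where T: "!!Y. continuous_on unit_sq Y ==> (!!p. p \<in> unit_sq ==> Y p \<in> F (H p)) ==>
    continuous_on unit_sq (%p. \<Theta> p (Y p)) \<and> (\<forall>t\<in>{0..1}. \<forall>s\<in>{0..1}. \<Theta> (t, s) (Y (t, s)) \<in> F (H (0, s)))"
  "!!t s y. t \<in> {0..1} ==> s \<in> {0..1} ==> (!!t'. t' \<in> {0..t} ==> H (t', s) = H (0, s)) ==> \<Theta> (t, s) y = y"
  by (rule transport_back[OF H]) blast
 have id0: "\<Theta> (0, s) y = y" if "s \<in> {0..1}" for s y using that by (intro T(2)) auto
 have id1: "\<Theta> (t, s) y = y" if "t \<in> {0..1}" "s \<in> {0, 1}" for t s y
  using that H0 by (intro T(2)) auto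
 define l where "l s = \<Theta> (1, s) (\<sigma> x0)" for s
 have hom: "homotopic_paths (F x0) (%s. Y (0, s)) l"
  if Y: "continuous_on unit_sq Y" "!!p. p \<in> unit_sq ==> Y p \<in> F (H p)"
   "!!s. s \<in> {0..1} ==> Y (1, s) = \<sigma> x0" "!!t. t \<in> {0..1} ==> Y (t, 0) = \<sigma> x0" "!!t. t \<in> {0..1} ==> Y (t, 1) = \<sigma> x0" for Y
  unfolding homotopic_paths
 proof (intro exI[of _ "%p. \<Theta> p (Y p)"] conjI ballI)
  show "continuous_on unit_sq (%p. \<Theta> p (Y p))" using T(1)[OF Y(1,2)] by blast
  show "(%p. \<Theta> p (Y p)) \<in> unit_sq \<rightarrow> F x0" using T(1)[OF Y(1,2)] H0 by auto
 qed (use id0 id1 Y(3-5) in \<open>auto simp: l_def pathstart_def pathfinish_def\<close>)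
 have "homotopic_paths (F x0) (%s. snd (h (0, s))) l"
 proof (rule hom[of "%p. snd (h p)"])
  show "snd (h p) \<in> F (H p)" if "p \<in> unit_sq" for p
   using h(2) that E_iff[of "fst (h p)" "snd (h p)"] by (auto simp: H_def)
 qed (use h in \<open>auto intro!: continuous_intros\<close>)
 moreover have "homotopic_paths (F x0) f (%s. snd (h (0, s)))"
  using f h(3) by (intro homotopic_paths_eq) (auto simp: loops_iff path_in_def)
 moreover have "homotopic_paths (F x0) (%s. \<sigma> (H (0, s))) l"
 proof (rule hom[of "%p. \<sigma> (H p)"])
  show "continuous_on unit_sq (%p. \<sigma> (H p))"
   using H by (intro continuous_on_compose2[OF \<sigma>_cont H(1)]) auto
 qed (use H0 \<sigma>_in_F in auto)
 moreover have "homotopic_paths (F x0) (%_. \<sigma> x0) (%s. \<sigma> (H (0, s)))"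
  using \<sigma>_in_F H0 by (intro homotopic_paths_eq) (auto simp: path_def path_image_def)
 ultimately show ?thesis by (meson homotopic_paths_sym homotopic_paths_trans)
qed

theorem fibration_split_extension: "split_extension \<pi>F \<pi>E \<pi>B fib_i fib_p fib_s"
proof (intro split_extension.intro split_extension_axioms.intro)
 have i: "group_hom \<pi>F \<pi>E fib_i" unfolding \<pi>F_def \<pi>E_def fib_i_def
  using Pair_maps \<sigma>_in_F by (intro induced_map_hom) auto
 show "group_hom \<pi>F \<pi>E fib_i" by (rule i)
 show "group_hom \<pi>E \<pi>B fib_p" unfolding \<pi>B_def \<pi>E_def fib_p_def
  using fst_maps \<sigma>_in_F x0 by (intro induced_map_hom) (auto simp: E_iff)
 show "group_hom \<pi>B \<pi>E fib_s" unfolding \<pi>B_def \<pi>E_def fib_s_def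
  using section_maps x0 by (intro induced_map_hom) auto
 interpret i: group_hom \<pi>F \<pi>E fib_i by (rule i)
 have ic: "fib_i (loop_class (F x0) f) = loop_class E (Pair x0 \<circ> f)" if "f \<in> loops (F x0) (\<sigma> x0)" for f
  unfolding fib_i_def using that Pair_maps by (intro induced_map_class[of "F x0"]) (auto simp: loops_iff)
 have pc: "fib_p (loop_class E g) = loop_class B (fst \<circ> g)" if "path_in E g" for g
  unfolding fib_p_def using that fst_maps by (intro induced_map_class[of E]) auto
 have sc: "fib_s (loop_class B g) = loop_class E ((%x. (x, \<sigma> x)) \<circ> g)" if "g \<in> loops B x0" for g
  unfolding fib_s_def using that section_maps by (intro induced_map_class[of B]) (auto simp: loops_iff)
 show "inj_on fib_i (carrier \<pi>F)"
  unfolding i.inj_on_one_iff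
 proof (intro allI impI)
  fix u assume u: "u \<in> carrier \<pi>F" "fib_i u = \<one>\<^bsub>\<pi>E\<^esub>"
  then obtain f where f: "f \<in> loops (F x0) (\<sigma> x0)" "u = loop_class (F x0) f"
   by (auto simp: \<pi>F_def pi1_carrier)
  have "loop_class E (Pair x0 \<circ> f) = loop_class E (%_. (x0, \<sigma> x0))"
   using u ic[OF f(1)] f(2) by (simp add: \<pi>E_def pi1_one)
  hence "homotopic_paths E (Pair x0 \<circ> f) (%_. (x0, \<sigma> x0))"
   using x0 \<sigma>_in_F by (intro loop_class_eqD) (auto simp: E_iff)
  thus "u = \<one>\<^bsub>\<pi>F\<^esub>" using fibre_injects[OF f(1)] f(2)
   by (simp add: \<pi>F_def pi1_one loop_class_eqI)
 qed
 fix h assume "h \<in> carrier \<pi>B"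
 then obtain g where g: "g \<in> loops B x0" "h = loop_class B g" by (auto simp: \<pi>B_def pi1_carrier)
 have "path_in E ((%x. (x, \<sigma> x)) \<circ> g)" using g section_maps by (auto simp: loops_iff intro!: path_in_compose)
 hence "fib_p (fib_s h) = loop_class B (fst \<circ> ((%x. (x, \<sigma> x)) \<circ> g))" using sc[OF g(1)] g(2) pc by simp
 also have "fst \<circ> ((%x. (x, \<sigma> x)) \<circ> g) = g" by auto
 finally show "fib_p (fib_s h) = h" by (simp add: g)
next
 fix u assume "u \<in> carrier \<pi>F"
 then obtain f where f: "f \<in> loops (F x0) (\<sigma> x0)" "u = loop_class (F x0) f"
  by (auto simp: \<pi>F_def pi1_carrier)
 have "path_in E (Pair x0 \<circ> f)" using f Pair_maps by (auto simp: loops_iff intro!: path_in_compose)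
 hence "fib_p (fib_i u) = loop_class B (fst \<circ> (Pair x0 \<circ> f))"
  using f Pair_maps fst_maps by (simp add: fib_i_def fib_p_def induced_map_class loops_iff)
 also have "fst \<circ> (Pair x0 \<circ> f) = (%_. x0)" by auto
 finally show "fib_p (fib_i u) = \<one>\<^bsub>\<pi>B\<^esub>" by (simp add: \<pi>B_def pi1_one)
next
 fix a assume a: "a \<in> carrier \<pi>E" "fib_p a = \<one>\<^bsub>\<pi>B\<^esub>"
 then obtain g where g: "g \<in> loops E (x0, \<sigma> x0)" "a = loop_class E g" by (auto simp: \<pi>E_def pi1_carrier)
 have "loop_class B (fst \<circ> g) = loop_class B (%_. x0)"
  using a g fst_maps by (simp add: fib_p_def \<pi>B_def pi1_one induced_map_class loops_iff)
 hence "homotopic_paths B (fst \<circ> g) (%_. x0)" using x0 by (intro loop_class_eqD) simp_all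
 then obtain f where f: "f \<in> loops (F x0) (\<sigma> x0)" "homotopic_paths E g (Pair x0 \<circ> f)"
  using fib_p_surjects_from_fibre[OF g(1)] by blast
 have "a = loop_class E (Pair x0 \<circ> f)" unfolding g(2) by (rule loop_class_eqI[OF f(2)])
 also have "... = fib_i (loop_class (F x0) f)"
  unfolding fib_i_def using f Pair_maps by (intro induced_map_class[symmetric, of "F x0"]) (auto simp: loops_iff)
 finally show "a \<in> fib_i ` carrier \<pi>F" using f by (auto simp: \<pi>F_def pi1_carrier)
qed

end

end

section \<open>Punctured planes\<close>

lemma convex_homotopic_paths:
 fixes p q :: "real => 'a::real_normed_vector"
 assumes "convex C" "path_in C p" "path_in C q" "pathstart q = pathstart p" "pathfinish q = pathfinish p"
 shows "homotopic_paths C p q"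
 using convex_imp_simply_connected[OF assms(1)] assms(2-5)
 unfolding simply_connected_eq_homotopic_paths path_in_def by blast

lemma path_in_linepath: "convex C ==> a \<in> C ==> b \<in> C ==> path_in C (linepath a b)"
 by (simp add: path_in_def closed_segment_subset)

lemma path_in_subset: "path_in S p ==> S \<subseteq> T ==> path_in T p"
 by (auto simp: path_in_def)

locale punctured_plane =
 fixes c :: "nat => complex" and n :: nat and y0 :: complex
 assumes Re_inj: "inj_on (%i. Re (c i)) {1..n}"
  and base_generic: "i \<in> {1..n} ==> Re y0 ~= Re (c i)"
begin

definition "F = {y. \<forall>i\<in>{1..n}. y ~= c i}"

lemma \<eta>_exists: "\<exists>e>0. \<forall>i\<in>{1..n}. \<forall>j\<in>{1..n}. i ~= j \<longrightarrow> 2 * e \<le> \<bar>Re (c i) - Re (c j)\<bar>"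
proof -
 let ?M = "insert 1 ((%(i, j). \<bar>Re (c i) - Re (c j)\<bar>) ` {(i, j). i \<in> {1..n} \<and> j \<in> {1..n} \<and> i ~= j})"
 have fin: "finite ?M"
  by (rule finite.insertI, rule finite_imageI, rule finite_subset[of _ "{1..n} \<times> {1..n}"]) auto
 have "Re (c i) ~= Re (c j)" if "i \<in> {1..n}" "j \<in> {1..n}" "i ~= j" for i j
  using inj_onD[OF Re_inj] that by blast
 hence pos: "m > 0" if "m \<in> ?M" for m using that by auto
 show ?thesis
 proof (intro exI[of _ "Min ?M / 2"] conjI ballI impI)
  have "Min ?M \<in> ?M" using fin by (intro Min_in) auto
  hence "Min ?M > 0" by (rule pos)
  thus "Min ?M / 2 > 0" by simp
  fix i j assume "i \<in> {1..n}" "j \<in> {1..n}" "i ~= j"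
  hence "\<bar>Re (c i) - Re (c j)\<bar> \<in> ?M" by auto
  from Min_le[OF fin this] show "2 * (Min ?M / 2) \<le> \<bar>Re (c i) - Re (c j)\<bar>" by simp
 qed
qed

definition "\<eta> = (SOME e. e > 0 \<and> (\<forall>i\<in>{1..n}. \<forall>j\<in>{1..n}. i ~= j \<longrightarrow> 2 * e \<le> \<bar>Re (c i) - Re (c j)\<bar>))"

lemma \<eta>: "\<eta> > 0" "i \<in> {1..n} ==> j \<in> {1..n} ==> i ~= j ==> 2 * \<eta> \<le> \<bar>Re (c i) - Re (c j)\<bar>"
 using someI_ex[OF \<eta>_exists] unfolding \<eta>_def[symmetric] by blast+

text \<open>The plane slit along the vertical rays below the punctures is contractible, and the half strips
 \<open>V i\<close> cover the slits.\<close>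

definition U0 :: "complex set" where
 "U0 = {z. \<forall>i\<in>{1..n}. Re z = Re (c i) \<longrightarrow> Im (c i) < Im z}"

definition V :: "nat => complex set" where
 "V i = {z. \<bar>Re z - Re (c i)\<bar> < \<eta> \<and> Im z < Im (c i)}"

lemma V_eq: "V i = {z. Re z > Re (c i) - \<eta>} \<inter> {z. Re z < Re (c i) + \<eta>} \<inter> {z. Im z < Im (c i)}"
 by (auto simp: V_def)

lemma V_convex: "convex (V i)"
 unfolding V_eq by (intro convex_Int convex_halfspace_Re_gt convex_halfspace_Re_lt convex_halfspace_Im_lt)

lemma V_open: "open (V i)"
 unfolding V_eq by (intro open_Int open_halfspace_Re_gt open_halfspace_Re_lt open_halfspace_Im_lt)

lemma V_disjoint: "i \<in> {1..n} ==> j \<in> {1..n} ==> z \<in> V i ==> z \<in> V j ==> i = j"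
 using \<eta>(2)[of i j] unfolding V_def mem_Collect_eq by linarith

lemma V_subset: "i \<in> {1..n} ==> V i \<subseteq> F"
 unfolding F_def
proof clarify
 fix j assume "i \<in> {1..n}" "c j \<in> V i" "j \<in> {1..n}"
 thus False using \<eta>(1) \<eta>(2)[of i j] unfolding V_def mem_Collect_eq by (cases "i = j") (simp, linarith)
qed

lemma U0_subset: "U0 \<subseteq> F"
 by (force simp: U0_def F_def)

lemma U0_open: "open U0"
proof -
 have "U0 = (\<Inter>i\<in>{1..n}. {z. Re z < Re (c i)} \<union> {z. Re z > Re (c i)} \<union> {z. Im z > Im (c i)})"
  by (auto simp: U0_def)
 thus ?thesis
  by (simp add: open_INT open_Un open_halfspace_Re_gt open_halfspace_Re_lt open_halfspace_Im_gt)
qed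

lemma F_cases:
 assumes "y \<in> F"
 obtains "y \<in> U0" | i where "i \<in> {1..n}" "y \<in> V i" "Re y = Re (c i)"
proof (cases "y \<in> U0")
 case False
 then obtain i where i: "i \<in> {1..n}" "Re y = Re (c i)" "\<not> Im (c i) < Im y" by (auto simp: U0_def)
 hence "Im y ~= Im (c i)" using assms[unfolded F_def] complex_eq_iff[of y "c i"] by blast
 thus thesis using i \<eta>(1) by (intro that(2)[of i]) (auto simp: V_def)
qed (use that in auto)

text \<open>The slits point downwards, so moving straight up never meets one. The set is pushed into
  a half plane above all punctures, which is then contracted linearly.\<close>

lemma U0_simply_connected: "simply_connected U0"
proof (rule contractible_imp_simply_connected)
 define K where "K = (\<Sum>i\<in>{1..n}. \<bar>Im (c i)\<bar>)"
 have K: "Im (c i) \<le> K" if "i \<in> {1..n}" for i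
 proof -
  have "\<bar>Im (c i)\<bar> \<le> K" unfolding K_def using that by (intro member_le_sum) auto
  thus ?thesis by linarith
 qed
 have K0: "K \<ge> 0" unfolding K_def by (intro sum_nonneg) auto
 \<comment> \<open>The modulus of \<open>Im z\<close> lifts every point, however low, above the
   height \<open>K\<close>.\<close>
 define f where "f z = z + \<i> * of_real (\<bar>Im z\<bar> + K + 1)" for z
 have PU: "{z. Im z > K} \<subseteq> U0" using K by (force simp: U0_def)
 have cf: "continuous_on U0 f" unfolding f_def by (intro continuous_intros)
 have "homotopic_with_canon (%_. True) U0 U0 id f"
 proof (rule homotopic_with_linear[OF _ cf])
  fix z assume z: "z \<in> U0"
  show "closed_segment (id z) (f z) \<subseteq> U0"
  proof
   fix w assume "w \<in> closed_segment (id z) (f z)"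
   then obtain u where u: "0 \<le> u" "w = (1 - u) *\<^sub>R z + u *\<^sub>R f z" by (auto simp: closed_segment_def)
   have "Re w = Re z" "Im w = Im z + u * (\<bar>Im z\<bar> + K + 1)" using u(2) by (simp_all add: f_def algebra_simps)
   moreover have "0 \<le> u * (\<bar>Im z\<bar> + K + 1)" using u(1) K0 by (intro mult_nonneg_nonneg) auto
   ultimately show "w \<in> U0" using z by (force simp: U0_def)
  qed
 qed (auto simp: id_def)
 moreover have "homotopic_with_canon (%_. True) U0 U0 f (%_. \<i> * of_real (K + 1))"
 proof (rule homotopic_with_linear[OF cf])
  fix z assume z: "z \<in> U0"
  have "f z \<in> {z. Im z > K}" by (simp add: f_def)
  hence "closed_segment (f z) (\<i> * of_real (K + 1)) \<subseteq> {z. Im z > K}"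
   by (intro closed_segment_subset convex_halfspace_Im_gt) auto
  thus "closed_segment (f z) (\<i> * of_real (K + 1)) \<subseteq> U0" using PU by blast
 qed (intro continuous_intros)
 ultimately show "contractible U0" unfolding contractible_def using homotopic_with_trans by blast
qed

lemma U0_homotopic: "path_in U0 p ==> path_in U0 q ==> pathstart q = pathstart p ==> pathfinish q = pathfinish p ==> homotopic_paths U0 p q"
 using U0_simply_connected unfolding simply_connected_eq_homotopic_paths path_in_def by blast

lemma y0_U0: "y0 \<in> U0"
 using base_generic by (auto simp: U0_def)

text \<open>A point left of the slit, with \<open>w'\<close> its mirror image on the right, one unit
  below the puncture. The segment between them crosses the slit from left to right, hence
  counterclockwise around the puncture, and closes up to the meridian \<open>x i\<close>.\<close>

definition w :: "nat => complex" where "w i = c i - of_real (\<eta> / 2) - \<i>"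
definition w' :: "nat => complex" where "w' i = c i + of_real (\<eta> / 2) - \<i>"

lemma w_V: "w i \<in> V i" "w' i \<in> V i" "Re (w i) < Re (c i)" "Re (w' i) > Re (c i)"
 using \<eta>(1) by (simp_all add: w_def w'_def V_def)

lemma V_U0: "i \<in> {1..n} ==> z \<in> V i ==> Re z ~= Re (c i) ==> z \<in> U0"
 unfolding U0_def
proof clarify
 fix j assume a: "i \<in> {1..n}" "z \<in> V i" "Re z ~= Re (c i)" "j \<in> {1..n}" "Re z = Re (c j)"
 hence "j ~= i" by auto
 hence False using a \<eta>(1) \<eta>(2)[of i j] unfolding V_def mem_Collect_eq by linarith
 thus "Im (c j) < Im z" ..
qed

definition \<kappa>0 :: "complex => real => complex" where
 "\<kappa>0 y = (if y = y0 then (%_. y0) else (SOME g. path_in U0 g \<and> pathstart g = y0 \<and> pathfinish g = y))"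

lemma \<kappa>0: "y \<in> U0 ==> path_in U0 (\<kappa>0 y) \<and> pathstart (\<kappa>0 y) = y0 \<and> pathfinish (\<kappa>0 y) = y"
proof (cases "y = y0")
 case True thus ?thesis using y0_U0 by (simp add: \<kappa>0_def)
next
 case False
 assume "y \<in> U0"
 hence "\<exists>g. path_in U0 g \<and> pathstart g = y0 \<and> pathfinish g = y"
  using simply_connected_imp_path_connected[OF U0_simply_connected] y0_U0
  by (auto simp: path_connected_def path_in_def)
 from someI_ex[OF this] show ?thesis using False by (simp add: \<kappa>0_def)
qed

text \<open>Points of a slit are reached from its left side, so a slit is reckoned to the left half
  of its strip: leaving it to the right counts as a crossing, leaving it to the left does
  not.\<close>

definition \<kappa> :: "complex => real => complex" where
 "\<kappa> y = (if y \<in> U0 then \<kappa>0 y else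
   (let i = (SOME i. i \<in> {1..n} \<and> y \<in> V i) in \<kappa>0 (w i) +++ linepath (w i) y))"

lemma \<kappa>_U0: "y \<in> U0 ==> \<kappa> y = \<kappa>0 y" by (simp add: \<kappa>_def)

lemma \<kappa>_slit:
 assumes "i \<in> {1..n}" "y \<in> V i" "Re y = Re (c i)"
 shows "\<kappa> y = \<kappa>0 (w i) +++ linepath (w i) y"
proof -
 have "(SOME i. i \<in> {1..n} \<and> y \<in> V i) = i" using assms V_disjoint by (intro some_equality) blast+
 moreover have "y \<notin> U0" using assms by (force simp: V_def U0_def)
 ultimately show ?thesis by (simp add: \<kappa>_def)
qed

lemma w_U0: "i \<in> {1..n} ==> w i \<in> U0" "i \<in> {1..n} ==> w' i \<in> U0"
 using V_U0[of i "w i"] V_U0[of i "w' i"] w_V[of i] by auto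

lemma \<kappa>_path: "y \<in> F ==> path_in F (\<kappa> y) \<and> pathstart (\<kappa> y) = y0 \<and> pathfinish (\<kappa> y) = y"
proof (erule F_cases)
 assume "y \<in> U0"
 thus ?thesis using \<kappa>0[of y] path_in_subset[OF _ U0_subset] by (simp add: \<kappa>_U0)
next
 fix i assume i: "i \<in> {1..n}" "y \<in> V i" "Re y = Re (c i)"
 have "path_in F (linepath (w i) y)"
  by (rule path_in_subset[OF path_in_linepath[OF V_convex w_V(1) i(2)] V_subset[OF i(1)]])
 moreover have "path_in F (\<kappa>0 (w i))" using \<kappa>0[OF w_U0(1)[OF i(1)]] path_in_subset[OF _ U0_subset] by blast
 ultimately show ?thesis unfolding \<kappa>_slit[OF i] using \<kappa>0[OF w_U0(1)[OF i(1)]] by simp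
qed

sublocale based_paths F y0 \<kappa>
proof
 show "y0 \<in> F" using y0_U0 U0_subset by blast
 show "\<kappa> y0 = (%_. y0)" using y0_U0 by (simp add: \<kappa>_U0 \<kappa>0_def)
qed (rule \<kappa>_path)

lemma wd_U0:
 assumes p: "path_in U0 p"
 shows "wd p = \<one>\<^bsub>\<pi>\<^esub>"
proof -
 note e = \<kappa>0[OF path_in_endpoints(1)[OF p]] \<kappa>0[OF path_in_endpoints(2)[OF p]]
 have "homotopic_paths U0 (\<kappa>0 (pathstart p) +++ (p +++ reversepath (\<kappa>0 (pathfinish p)))) (%_. y0)"
  using e p y0_U0 by (intro U0_homotopic) simp_all
 hence "homotopic_paths F (\<kappa>0 (pathstart p) +++ (p +++ reversepath (\<kappa>0 (pathfinish p)))) (%_. y0)"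
  by (rule homotopic_paths_subset[OF _ U0_subset])
 thus ?thesis
  unfolding wd_def pi1_one using path_in_endpoints[OF p] by (simp add: \<kappa>_U0 loop_class_eqI)
qed

definition x :: "nat => (real => complex) set" where "x i = wd (linepath (w i) (w' i))"

lemma V_path: "i \<in> {1..n} ==> path_in (V i) p ==> path_in F p"
 by (rule path_in_subset[OF _ V_subset])

lemma linepath_V: "a \<in> V i ==> b \<in> V i ==> path_in (V i) (linepath a b)"
 by (rule path_in_linepath[OF V_convex])

lemma x_closed: "x \<in> {1..n} \<rightarrow> carrier \<pi>"
 unfolding x_def using V_path linepath_V w_V by (intro Pi_I wd_closed) blast

lemma wd_triangle:
 assumes i: "i \<in> {1..n}" and p: "path_in (V i) p" and a: "a \<in> V i"
 shows "wd (linepath a (pathfinish p)) = wd (linepath a (pathstart p)) \<otimes>\<^bsub>\<pi>\<^esub> wd p"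
proof -
 note V = path_in_endpoints[OF p]
 have "homotopic_paths (V i) (linepath a (pathfinish p)) (linepath a (pathstart p) +++ p)"
  using V a p linepath_V by (intro convex_homotopic_paths[OF V_convex]) simp_all
 hence "wd (linepath a (pathfinish p)) = wd (linepath a (pathstart p) +++ p)"
  by (intro wd_homotopic homotopic_paths_subset[OF _ V_subset[OF i]])
 also have "... = wd (linepath a (pathstart p)) \<otimes>\<^bsub>\<pi>\<^esub> wd p"
  using V_path[OF i] linepath_V V a p by (intro wd_join) auto
 finally show ?thesis .
qed

lemma wd_spoke:
 assumes i: "i \<in> {1..n}" and a: "a \<in> V i"
 shows "wd (linepath (w i) a) = (if Re a > Re (c i) then x i else \<one>\<^bsub>\<pi>\<^esub>)"
proof -
 have half: "wd (linepath b a) = \<one>\<^bsub>\<pi>\<^esub>" if "b \<in> V i" "convex C" "a \<in> C" "b \<in> C" "!!z. z \<in> C ==> Re z ~= Re (c i)" for b C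
 proof (rule wd_U0)
  have "path_in (V i \<inter> C) (linepath b a)" using that a by (intro path_in_linepath convex_Int V_convex) auto
  thus "path_in U0 (linepath b a)" by (rule path_in_subset) (use V_U0[OF i] that in blast)
 qed
 consider "Re a < Re (c i)" | "Re a = Re (c i)" | "Re a > Re (c i)" by linarith
 thus ?thesis
 proof cases
  case 1
  thus ?thesis using half[of "w i" "{z. Re z < Re (c i)}"] w_V by (simp add: convex_halfspace_Re_lt)
 next
  case 2
  let ?L = "linepath (w i) a" and ?k = "\<kappa>0 (w i)"
  have L: "path_in F ?L" "path_in F ?k" "pathstart ?k = y0" "pathfinish ?k = w i"
   using V_path[OF i linepath_V[OF w_V(1) a]] \<kappa>0[OF w_U0(1)[OF i]] path_in_subset[OF _ U0_subset] by blast+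
  have "homotopic_paths F (?k +++ (?L +++ reversepath (?k +++ ?L))) ((?k +++ ?L) +++ reversepath (?k +++ ?L))"
   using L by (intro homotopic_paths_sym[OF homotopic_paths_assoc']) simp_all
  also have "homotopic_paths F ... (%_. y0)" using L by (intro homotopic_paths_inverse_right) simp_all
  finally have "wd ?L = \<one>\<^bsub>\<pi>\<^esub>" unfolding wd_def pi1_one
   by (simp add: \<kappa>_slit[OF i a 2] \<kappa>_U0[OF w_U0(1)[OF i]] loop_class_eqI)
  thus ?thesis using 2 by simp
 next
  case 3
  have "wd (linepath (w' i) a) = \<one>\<^bsub>\<pi>\<^esub>"
   using half[of "w' i" "{z. Re z > Re (c i)}"] w_V 3 by (simp add: convex_halfspace_Re_gt)
  thus ?thesis using wd_triangle[OF i linepath_V[OF w_V(2) a] w_V(1)] 3 funcset_mem[OF x_closed i]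
   by (simp add: x_def[symmetric])
 qed
qed

text \<open>The half strip is convex, so a path in it is determined up to homotopy by its ends, and
  its class by the sides of the slit on which they lie.\<close>

lemma wd_V:
 assumes i: "i \<in> {1..n}" and p: "path_in (V i) p"
 shows "wd p = inv\<^bsub>\<pi>\<^esub> (if Re (pathstart p) > Re (c i) then x i else \<one>\<^bsub>\<pi>\<^esub>) \<otimes>\<^bsub>\<pi>\<^esub>
   (if Re (pathfinish p) > Re (c i) then x i else \<one>\<^bsub>\<pi>\<^esub>)"
 using wd_triangle[OF i p w_V(1)] wd_spoke[OF i path_in_endpoints(1)[OF p]] wd_spoke[OF i path_in_endpoints(2)[OF p]]
  funcset_mem[OF x_closed i] V_path[OF i p] pi.inv_solve_left[of "if Re (pathstart p) > Re (c i) then x i else \<one>\<^bsub>\<pi>\<^esub>" "wd p"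
   "if Re (pathfinish p) > Re (c i) then x i else \<one>\<^bsub>\<pi>\<^esub>"] by (auto split: if_splits)

theorem generated_by_x: "carrier \<pi> = generate \<pi> (x ` {1..n})"
proof
 let ?K = "generate \<pi> (x ` {1..n})"
 have K: "subgroup ?K \<pi>" using x_closed by (intro pi.generate_is_subgroup) auto
 show "carrier \<pi> \<subseteq> ?K"
 proof
  fix a assume "a \<in> carrier \<pi>"
  then obtain p where p: "p \<in> loops F y0" "a = wd p" using carrier_wd by blast
  have "wd p \<in> ?K"
  proof (rule generated_locally[OF K])
   show "path_in F p" using p by (simp add: loops_iff)
   fix y assume "y \<in> F"
   thus "\<exists>U. open U \<and> y \<in> U \<and> (\<forall>p. path_in (F \<inter> U) p \<longrightarrow> wd p \<in> ?K)"
   proof (rule F_cases)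
    assume "y \<in> U0"
    moreover have "wd p \<in> ?K" if "path_in (F \<inter> U0) p" for p
     using wd_U0[OF path_in_subset[OF that]] subgroup.one_closed[OF K] by simp
    ultimately show ?thesis using U0_open by blast
   next
    fix i assume i: "i \<in> {1..n}" "y \<in> V i"
    have "x i \<in> ?K" using i by (intro generate.incl) auto
    hence "wd p \<in> ?K" if "path_in (F \<inter> V i) p" for p
     unfolding wd_V[OF i(1) path_in_subset[OF that Int_lower2]]
     by (intro subgroup.m_closed[OF K] subgroup.m_inv_closed[OF K]) (simp_all add: generate.one)
    thus ?thesis using V_open i(2) by blast
   qed
  qed
  thus "a \<in> ?K" using p by simp
 qed
 show "?K \<subseteq> carrier \<pi>" using subgroup.subset[OF K] .
qed

text \<open>The other half of van Kampen's theorem: a cocycle that jumps by \<open>g i\<close>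
  across the \<open>i\<close>-th slit has the required homomorphism as its monodromy. Together with
  \<open>generated_by_x\<close> this says that the meridians generate freely.\<close>

theorem hom_exists:
 fixes Q :: "('q, 'z) monoid_scheme" (structure)
 assumes "group Q" and g: "g \<in> {1..n} \<rightarrow> carrier Q"
 shows "\<exists>f\<in>hom \<pi> Q. \<forall>i\<in>{1..n}. f (x i) = g i"
proof -
 interpret Q: group Q by fact
 \<comment> \<open>The jump function: \<open>g i\<close> on the right half of the strip
   \<open>V i\<close>, and trivial elsewhere.\<close>
 define s where "s z = (if \<exists>i\<in>{1..n}. z \<in> V i \<and> Re z > Re (c i) then g (THE i. i \<in> {1..n} \<and> z \<in> V i) else \<one>)" for z
 define T where "T a b = (if \<exists>i\<in>{1..n}. a \<in> V i \<and> b \<in> V i then inv (s a) \<otimes> s b else \<one>)" for a b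
 have the: "(THE i. i \<in> {1..n} \<and> z \<in> V i) = i" if "i \<in> {1..n}" "z \<in> V i" for z i
  using that V_disjoint by (intro the_equality) blast+
 have s: "s z = (if Re z > Re (c i) then g i else \<one>)" if "i \<in> {1..n}" "z \<in> V i" for z i
 proof -
  have "(\<exists>j\<in>{1..n}. z \<in> V j \<and> Re z > Re (c j)) \<longleftrightarrow> Re z > Re (c i)"
   using that V_disjoint by blast
  thus ?thesis unfolding s_def the[OF that] by simp
 qed
 have sc: "s z \<in> carrier Q" for z
 proof (cases "\<exists>i\<in>{1..n}. z \<in> V i")
  case True thus ?thesis using s g by auto
 next
  case False hence "s z = \<one>" unfolding s_def by meson
  thus ?thesis by simp
 qed
 have T_V: "T a b = inv (s a) \<otimes> s b" if "i \<in> {1..n}" "a \<in> V i" "b \<in> V i" for a b i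
  using that unfolding T_def by (simp only: if_P bexI)
 \<comment> \<open>\<open>T\<close> is not trivial on all of \<open>U0\<close>: points of one strip
   on different sides of its slit are related by a jump. A convex subset of \<open>U0\<close>
   contains no such pair, as the segment joining them would meet the slit.\<close>
 have T_convex: "T a b = \<one>" if W: "convex W" "W \<subseteq> U0" "a \<in> W" "b \<in> W" for a b W
 proof (cases "\<exists>i\<in>{1..n}. a \<in> V i \<and> b \<in> V i")
  case True
  then obtain i where i: "i \<in> {1..n}" "a \<in> V i" "b \<in> V i" by blast
  have no: "Re z ~= Re (c i)" if "z \<in> closed_segment a b" for z
  proof -
   have "z \<in> W" "z \<in> V i"
    using that closed_segment_subset[OF W(3,4,1)] closed_segment_subset[OF i(2,3) V_convex] by blast+
   thus ?thesis using W(2) i(1) by (force simp: U0_def V_def)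
  qed
  have "connected (Re ` closed_segment a b)" by (intro connected_continuous_image continuous_intros connected_segment)
  hence "is_interval (Re ` closed_segment a b)" by (simp add: is_interval_connected_1)
  moreover have "Re a \<in> Re ` closed_segment a b" "Re b \<in> Re ` closed_segment a b" "Re (c i) \<notin> Re ` closed_segment a b"
   by (rule imageI, simp)+ (metis imageE no)
  ultimately have "Re a > Re (c i) \<longleftrightarrow> Re b > Re (c i)"
   unfolding is_interval_1 by (metis linorder_cases less_imp_le)
  hence "s a = s b" using s[OF i(1,2)] s[OF i(1,3)] by simp
  thus ?thesis using T_V[OF i] sc by simp
 next
  case False thus ?thesis unfolding T_def by (simp only: if_not_P simp_thms if_False)
 qed
 have U0_nbhd: "\<exists>U. open U \<and> y \<in> U \<and> (\<forall>a\<in>F \<inter> U. \<forall>b\<in>F \<inter> U. T a b = \<one>)" if "y \<in> U0" for y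
 proof -
  obtain d where d: "d > 0" "ball y d \<subseteq> U0" using U0_open \<open>y \<in> U0\<close> open_contains_ball by blast
  hence "T a b = \<one>" if "a \<in> ball y d" "b \<in> ball y d" for a b
   using T_convex[OF convex_ball] that by blast
  thus ?thesis using d(1) by (intro exI[of _ "ball y d"]) simp
 qed
 interpret L: local_transport Q F T
 proof (intro local_transport.intro local_transport_axioms.intro Q.is_group)
  fix y assume "y \<in> F"
  thus "\<exists>U. open U \<and> y \<in> U \<and> (\<forall>a\<in>F \<inter> U. \<forall>b\<in>F \<inter> U. T a b \<in> carrier Q \<and> (\<forall>c\<in>F \<inter> U. T a b \<otimes> T b c = T a c))"
  proof (rule F_cases)
   assume "y \<in> U0"
   from U0_nbhd[OF this] show ?thesis
   proof (elim exE conjE)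
    fix U assume "open U" "y \<in> U" "\<forall>a\<in>F \<inter> U. \<forall>b\<in>F \<inter> U. T a b = \<one>"
    thus ?thesis by (intro exI[of _ U]) simp
   qed
  next
   fix i assume i: "i \<in> {1..n}" "y \<in> V i"
   have "inv (s a) \<otimes> s b \<otimes> (inv (s b) \<otimes> s d) = inv (s a) \<otimes> s d" for a b d
    using sc Q.m_assoc[symmetric, of "s b" "inv (s b)" "s d"] by (simp add: Q.m_assoc)
   thus ?thesis using V_open i sc by (intro exI[of _ "V i"]) (simp add: T_V[OF i(1)])
  qed
 qed
 obtain f where f: "f \<in> hom \<pi> Q" "!!p. p \<in> loops F y0 ==> f (loop_class F p) = L.monodromy p"
  using L.monodromy_hom[OF base] by blast
 have U0_mono: "L.monodromy p = \<one>" if "path_in U0 p" for p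
 proof (rule L.monodromy_trivial[OF path_in_subset[OF that U0_subset]])
  fix t :: real assume "t \<in> {0..1}"
  hence "p t \<in> U0" using that by (auto simp: path_in_def path_image_def)
  thus "\<exists>U. open U \<and> p t \<in> U \<and> (\<forall>a\<in>F \<inter> U. \<forall>b\<in>F \<inter> U. T a b = \<one>)" by (rule U0_nbhd)
 qed
 have "f (x i) = g i" if i: "i \<in> {1..n}" for i
 proof -
  let ?L = "linepath (w i) (w' i)"
  note LV = linepath_V[OF w_V(1,2), of i]
  note k = \<kappa>0[OF w_U0(1)[OF i]] \<kappa>0[OF w_U0(2)[OF i]]
  have kF: "path_in F (\<kappa>0 (w i))" "path_in F (\<kappa>0 (w' i))" using k path_in_subset[OF _ U0_subset] by blast+
  have "f (x i) = L.monodromy (\<kappa>0 (w i) +++ (?L +++ reversepath (\<kappa>0 (w' i))))"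
   using f(2)[OF wd_loop_in[OF V_path[OF i LV]]] i w_U0 by (simp add: x_def wd_def \<kappa>_U0)
  \<comment> \<open>The tails run inside \<open>U0\<close>, where the monodromy is trivial.\<close>
  also have "... = L.monodromy ?L"
   using k kF V_path[OF i LV] L.monodromy_closed[of ?L]
   by (simp add: L.monodromy_join U0_mono)
  also have "... = T (w i) (w' i)"
   using L.monodromy_local[of "V i" ?L] path_in_subset[OF LV, of "F \<inter> V i"] V_subset[OF i] sc
   by (simp add: T_V[OF i] Q.m_assoc Q.inv_solve_left)
  also have "... = g i" using s[OF i w_V(1)] s[OF i w_V(2)] w_V[of i] funcset_mem[OF g i] T_V[OF i w_V(1,2)] by auto
  finally show ?thesis .
 qed
 thus ?thesis using f(1) by blast
qed

end

subsection \<open>Winding numbers\<close>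

lemma winding_number_mult:
 assumes p: "path_in (- {0}) p" and q: "path_in (- {0}) q"
 shows "winding_number (%t. p t * q t) 0 = winding_number p 0 + winding_number q 0"
proof -
 obtain f where f: "path f" "pathfinish f - pathstart f = 2 * of_real pi * \<i> * winding_number p 0"
  "!!t. t \<in> {0..1} ==> p t = 0 + exp (f t)"
  by (rule winding_number_as_continuous_log[of p 0]) (use p in \<open>auto simp: path_in_def\<close>)
 obtain g where g: "path g" "pathfinish g - pathstart g = 2 * of_real pi * \<i> * winding_number q 0"
  "!!t. t \<in> {0..1} ==> q t = 0 + exp (g t)"
  by (rule winding_number_as_continuous_log[of q 0]) (use q in \<open>auto simp: path_in_def\<close>)
 have "winding_number (%t. p t * q t) 0 = winding_number (exp \<circ> (%t. f t + g t)) 0"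
  using f(3) g(3) by (intro winding_number_cong) (simp add: exp_add)
 also have "... = (pathfinish (%t. f t + g t) - pathstart (%t. f t + g t)) / (2 * of_real pi * \<i>)"
  using f(1) g(1) by (intro winding_number_compose_exp) (simp add: path_def continuous_on_add)
 also have "pathfinish (%t. f t + g t) - pathstart (%t. f t + g t) = 2 * of_real pi * \<i> * (winding_number p 0 + winding_number q 0)"
  using f(2) g(2) by (simp add: pathstart_def pathfinish_def algebra_simps)
 finally show ?thesis by simp
qed

lemma winding_number_scale:
 assumes "path_in (- {0}) p" "a ~= 0"
 shows "winding_number (%t. a * p t) 0 = winding_number p 0"
 using winding_number_mult[of "%_. a" p] winding_number_constI[of a 0 "%_. a"] assms by simp

lemma winding_number_half_plane:
 assumes "path p" "pathfinish p = pathstart p" "!!t. t \<in> {0..1} ==> Re (p t) > 0"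
 shows "winding_number p 0 = 0"
 by (rule winding_number_zero_outside[of p "{z. Re z > 0}"])
  (use assms in \<open>auto simp: convex_halfspace_Re_gt path_image_def\<close>)

lemma winding_number_homotopic:
 assumes "homotopic_paths S p q" "continuous_on S f" "f \<in> S \<rightarrow> - {0::complex}"
 shows "winding_number (f \<circ> p) 0 = winding_number (f \<circ> q) 0"
 by (rule winding_number_homotopic_paths, rule homotopic_paths_continuous_image[OF assms])

lemma winding_number_join_compose:
 assumes "path_in S p" "path_in S q" "pathfinish p = pathstart q" "continuous_on S f" "f \<in> S \<rightarrow> - {0::complex}"
 shows "winding_number (f \<circ> (p +++ q)) 0 = winding_number (f \<circ> p) 0 + winding_number (f \<circ> q) 0"
 using path_in_compose[OF assms(1,4,5)] path_in_compose[OF assms(2,4,5)] assms(3)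
 unfolding path_compose_join path_in_def
 by (intro winding_number_join) (auto simp: pathstart_compose pathfinish_compose)

lemma winding_number_reverse_compose:
 assumes "path_in S p" "continuous_on S f" "f \<in> S \<rightarrow> - {0::complex}"
 shows "winding_number (f \<circ> reversepath p) 0 = - winding_number (f \<circ> p) 0"
 using path_in_compose[OF assms]
 unfolding path_compose_reversepath path_in_def by (intro winding_number_reversepath) auto

lemma winding_number_conjugate:
 assumes "path_in S d" "path_in S g" "pathfinish d = pathstart g" "pathfinish g = pathstart g"
  "continuous_on S f" "f \<in> S \<rightarrow> - {0::complex}"
 shows "winding_number (f \<circ> (d +++ (g +++ reversepath d))) 0 = winding_number (f \<circ> g) 0"
 using assms by (simp add: winding_number_join_compose winding_number_reverse_compose)

lemma (in group) lcs_degree_one_mult: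
 "g \<in> carrier G ==> h \<in> carrier G ==> lcs_degree_one G (g \<otimes> h) = lcs_degree_one G g \<oplus>\<^bsub>lcs_lie G\<^esub> lcs_degree_one G h"
 by (simp add: lcs_degree_one_eq lcs_homog_mult)

lemma (in group) lcs_degree_one_closed: "g \<in> carrier G ==> lcs_degree_one G g \<in> carrier (lcs_lie G)"
 by (simp add: lcs_degree_one_eq lcs_homog_one_closed)

lemma (in group) lcs_degree_one_one: "lcs_degree_one G \<one> = \<zero>\<^bsub>lcs_lie G\<^esub>"
proof -
 interpret L: lie_ring "lcs_lie G" by (rule lcs_lie_lie_ring)
 have "lcs_degree_one G \<one> \<oplus>\<^bsub>lcs_lie G\<^esub> lcs_degree_one G \<one> = lcs_degree_one G \<one>"
  using lcs_degree_one_mult[of \<one> \<one>] by simp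
 thus ?thesis using lcs_degree_one_closed[of \<one>] L.add.l_cancel_one by auto
qed

section \<open>Winding numbers and the abelianized fibre group\<close>

context punctured_plane
begin

abbreviation wn :: "nat => (real => complex) => complex" where
 "wn j p \<equiv> winding_number ((%z. z - c j) \<circ> p) 0"

lemma circlepath_F:
 assumes i: "i \<in> {1..n}" and e: "0 < \<epsilon>" "\<epsilon> < \<eta>"
 shows "path_in F (circlepath (c i) \<epsilon>)"
proof -
 have "c j \<notin> sphere (c i) \<epsilon>" if j: "j \<in> {1..n}" for j
 proof (cases "j = i")
  case False
  have "2 * \<eta> \<le> norm (c i - c j)" using \<eta>(2)[OF i j] False abs_Re_le_cmod[of "c i - c j"] by auto
  thus ?thesis using e by (auto simp: dist_norm)
 qed (use e in simp)
 thus ?thesis using e by (auto simp: path_in_def F_def path_image_circlepath)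
qed

text \<open>The circle is cut at the parameters 5/8 and 7/8. The lower arc between them stays in the
  half strip and crosses the slit from left to right; the rest avoids all slits.\<close>

lemma wd_circlepath:
 assumes i: "i \<in> {1..n}" and e: "0 < \<epsilon>" "\<epsilon> < \<eta>"
 shows "wd (circlepath (c i) \<epsilon>) = x i"
proof -
 let ?g = "circlepath (c i) \<epsilon>"
 note g = circlepath_F[OF assms]
 have Re: "Re (?g t) = Re (c i) + \<epsilon> * cos (2 * pi * t)" and Im: "Im (?g t) = Im (c i) + \<epsilon> * sin (2 * pi * t)" for t
 proof -
  have "exp (2 * of_real pi * \<i> * of_real t) = cis (2 * pi * t)" by (simp add: cis_conv_exp mult_ac)
  thus "Re (?g t) = Re (c i) + \<epsilon> * cos (2 * pi * t)" "Im (?g t) = Im (c i) + \<epsilon> * sin (2 * pi * t)"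
   by (simp_all add: circlepath)
 qed
 have U0: "?g t \<in> U0" if t: "cos (2 * pi * t) = 0 ==> sin (2 * pi * t) > 0" for t
  unfolding U0_def
 proof (intro CollectI ballI impI)
  fix j assume j: "j \<in> {1..n}" "Re (?g t) = Re (c j)"
  have "\<bar>Re (?g t) - Re (c i)\<bar> \<le> \<epsilon>" using e by (simp add: Re abs_mult mult_left_le)
  hence "j = i" using j \<eta>(2)[OF i j(1)] e by linarith
  thus "Im (c j) < Im (?g t)" using j t e by (simp add: Re Im)
 qed
 have neg: "sin (2 * pi * t) < 0" if "t \<in> {5/8..7/8}" for t
  using that pi_gt_zero by (intro sin_lt_zero) (auto simp: field_simps)
 have left: "cos (2 * pi * t) < 0" if "t \<in> {1/2..5/8}" for t
 proof -
  have "cos (2 * pi * t - pi) > 0"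
   using that pi_gt_zero by (intro cos_gt_zero_pi) (auto simp: field_simps)
  thus ?thesis by (simp add: cos_diff)
 qed
 have right: "cos (2 * pi * t) > 0" if "t \<in> {7/8..1}" for t
 proof -
  have "cos (2 * pi * t - 2 * pi) > 0"
   using that pi_gt_zero by (intro cos_gt_zero_pi) (auto simp: field_simps)
  thus ?thesis by (simp add: cos_diff)
 qed
 have "path_in U0 (subp 0 (5/8) ?g)"
 proof (rule path_in_subp[OF g], simp_all, clarify)
  fix t :: real assume t: "t \<in> {0..5/8}"
  show "?g t \<in> U0"
  proof (rule U0)
   assume z: "cos (2 * pi * t) = 0"
   hence "t \<le> 1/2" using left[of t] t by force
   hence "0 \<le> sin (2 * pi * t)" using t pi_gt_zero by (intro sin_ge_zero) (auto simp: field_simps)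
   moreover have "sin (2 * pi * t) ~= 0" using z sin_cos_squared_add[of "2 * pi * t"] by auto
   ultimately show "sin (2 * pi * t) > 0" by simp
  qed
 qed
 hence 1: "wd (subp 0 (5/8) ?g) = \<one>\<^bsub>\<pi>\<^esub>" by (rule wd_U0)
 have "path_in U0 (subp (7/8) 1 ?g)"
 proof (rule path_in_subp[OF g], simp_all, clarify)
  fix t :: real assume t: "t \<in> {7/8..1}"
  show "?g t \<in> U0" using right[OF t] by (intro U0) simp
 qed
 hence 3: "wd (subp (7/8) 1 ?g) = \<one>\<^bsub>\<pi>\<^esub>" by (rule wd_U0)
 have "path_in (V i) (subp (5/8) (7/8) ?g)"
 proof (rule path_in_subp[OF g], simp_all, clarify)
  fix t :: real assume t: "t \<in> {5/8..7/8}"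
  have "\<bar>\<epsilon> * cos (2 * pi * t)\<bar> \<le> \<epsilon>" using e by (simp add: abs_mult mult_left_le)
  thus "?g t \<in> V i" using neg[OF t] e unfolding V_def mem_Collect_eq Re Im
   by (simp add: mult_pos_neg)
 qed
 from wd_V[OF i this] have 2: "wd (subp (5/8) (7/8) ?g) = x i"
  using left[of "5/8"] right[of "7/8"] e funcset_mem[OF x_closed i] by (simp add: Re zero_less_mult_iff)
 have "wd ?g = wd (subp 0 1 ?g)" by (simp add: subp_def)
 also have "... = wd (subp 0 (5/8) ?g) \<otimes>\<^bsub>\<pi>\<^esub> wd (subp (5/8) 1 ?g)" by (rule wd_subp_join[OF g]) auto
 also have "wd (subp (5/8) 1 ?g) = wd (subp (5/8) (7/8) ?g) \<otimes>\<^bsub>\<pi>\<^esub> wd (subp (7/8) 1 ?g)"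
  by (rule wd_subp_join[OF g]) auto
 finally show ?thesis using 1 2 3 funcset_mem[OF x_closed i] by simp
qed

lemma winding_map: "j \<in> {1..n} ==> continuous_on F (%z. z - c j)" "j \<in> {1..n} ==> (%z. z - c j) \<in> F \<rightarrow> - {0}"
 by (auto simp: F_def intro!: continuous_intros)

lemma winding_x:
 assumes i: "i \<in> {1..n}" and j: "j \<in> {1..n}" and p: "p \<in> loops F y0" "loop_class F p = x i"
 shows "wn j p = (if j = i then 1 else 0)"
proof -
 have e: "0 < \<eta> / 2" "\<eta> / 2 < \<eta>" using \<eta>(1) by auto
 let ?g = "circlepath (c i) (\<eta> / 2)" and ?f = "%z. z - c j"
 note g = circlepath_F[OF i e]
 let ?k = "\<kappa> (c i + \<eta> / 2)"
 have k: "path_in F ?k \<and> pathstart ?k = y0 \<and> pathfinish ?k = c i + \<eta> / 2"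
  using path_in_endpoints(1)[OF g] by (intro \<kappa>_path) simp
 have "loop_class F p = loop_class F (?k +++ (?g +++ reversepath ?k))"
  using p(2) wd_circlepath[OF i e] by (simp add: wd_def)
 hence "homotopic_paths F p (?k +++ (?g +++ reversepath ?k))"
  using k g by (intro loop_class_eqD) simp_all
 hence "winding_number (?f \<circ> p) 0 = winding_number (?f \<circ> (?k +++ (?g +++ reversepath ?k))) 0"
  by (rule winding_number_homotopic[OF _ winding_map[OF j]])
 also have "... = winding_number (?f \<circ> ?g) 0"
  by (rule winding_number_conjugate[OF _ g _ _ winding_map[OF j]]) (use k in simp_all)
 also have "... = winding_number ?g (c j)" unfolding winding_number_offset[of ?g] comp_def ..
 also have "... = (if j = i then 1 else 0)"
 proof (cases "j = i")
  case False
  have "2 * \<eta> \<le> norm (c i - c j)" using \<eta>(2)[OF i j] False abs_Re_le_cmod[of "c i - c j"] by auto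
  hence "c j \<notin> cball (c i) (\<eta> / 2)" using e by (auto simp: dist_norm)
  hence "winding_number ?g (c j) = 0"
   using e by (intro winding_number_zero_outside[of _ "cball (c i) (\<eta> / 2)"]) (auto simp: path_image_circlepath)
  thus ?thesis using False by simp
 qed (use e winding_number_circlepath_centre in simp)
 finally show ?thesis .
qed

text \<open>Class and winding numbers are both additive under products and inverses, and they match
  on meridians by \<open>winding_x\<close>, so the claim follows along the generation by
  meridians.\<close>

theorem degree_one_winding:
 assumes p: "p \<in> loops F y0" and k: "!!j. j \<in> {1..n} ==> wn j p = of_int (k j)"
 shows "degree_one_map \<pi> {1..n} x (\<Sum>j\<in>{1..n}. zscale (k j) (fl_gen j)) = lcs_degree_one \<pi> (loop_class F p)"
proof -
 interpret L: lie_ring "lcs_lie \<pi>" by (rule pi.lcs_lie_lie_ring)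
 note One_nat_def [simp del]
 note D = pi.degree_one_map[OF x_closed]
 let ?D = "degree_one_map \<pi> {1..n} x" and ?S = "%k. \<Sum>j\<in>{1..n}. zscale (k j) (fl_gen j)"
 \<comment> \<open>All loops of a class are quantified, as a group element does not single one out.
   The coefficients are existential here; at the end they are compared with the given ones, both
   being the same winding numbers.\<close>
 let ?P = "%a. a \<in> carrier \<pi> \<and> (\<forall>p\<in>loops F y0. loop_class F p = a \<longrightarrow>
  (\<exists>k. (\<forall>j\<in>{1..n}. wn j p = of_int (k j)) \<and> ?D (?S k) = lcs_degree_one \<pi> a))"
 have inc: "?P (x i)" if i: "i \<in> {1..n}" for i
 proof (intro conjI ballI impI funcset_mem[OF x_closed i])
  fix p assume p: "p \<in> loops F y0" "loop_class F p = x i"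
  have "?S (%j. if j = i then 1 else 0) = (\<Sum>j\<in>{1..n}. if j = i then fl_gen i else 0)"
   by (intro sum.cong) auto
  also have "... = fl_gen i" using i by simp
  finally have "?D (?S (%j. if j = i then 1 else 0)) = lcs_degree_one \<pi> (x i)"
   using D(2)[OF i] by (simp add: pi.lcs_degree_one_eq)
  thus "\<exists>k. (\<forall>j\<in>{1..n}. wn j p = of_int (k j)) \<and> ?D (?S k) = lcs_degree_one \<pi> (x i)"
   using winding_x[OF i _ p] by (intro exI[of _ "%j. if j = i then 1 else 0"]) auto
 qed
 have all: "?P a" if "a \<in> generate \<pi> (x ` {1..n})" for a
  using that
 proof (induction a rule: generate.induct)
  case one
  show ?case
  proof (intro conjI ballI impI)
   fix p assume p: "p \<in> loops F y0" "loop_class F p = \<one>\<^bsub>\<pi>\<^esub>"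
   have "homotopic_paths F p (%_. y0)" using p(2) base by (intro loop_class_eqD) (simp_all add: pi1_one)
   hence "wn j p = 0" if "j \<in> {1..n}" for j
    using winding_number_homotopic[OF _ winding_map[OF that], of p "%_. y0"] winding_number_constI[of "y0 - c j" 0 "%_. y0 - c j"]
     base that by (auto simp: comp_def F_def)
   thus "\<exists>k. (\<forall>j\<in>{1..n}. wn j p = of_int (k j)) \<and> ?D (?S k) = lcs_degree_one \<pi> \<one>\<^bsub>\<pi>\<^esub>"
    by (intro exI[of _ "%_. 0"]) (simp add: D pi.lcs_degree_one_one del: One_nat_def)
  qed simp
 next
  case (incl h)
  then obtain i where i: "i \<in> {1..n}" "h = x i" by blast
  show ?case unfolding i(2) by (rule inc[OF i(1)])
 next
  case (inv h)
  then obtain i where i: "i \<in> {1..n}" "h = x i" by blast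
  have hc: "h \<in> carrier \<pi>" using funcset_mem[OF x_closed i(1)] i(2) by simp
  show ?case
  proof (intro conjI ballI impI)
   fix p assume p: "p \<in> loops F y0" "loop_class F p = inv\<^bsub>\<pi>\<^esub> h"
   have r: "reversepath p \<in> loops F y0" "loop_class F (reversepath p) = h"
    using p hc pi1_inv[OF p(1)] by (simp_all add: loops_iff)
   then obtain k where k: "\<forall>j\<in>{1..n}. wn j (reversepath p) = of_int (k j)" "?D (?S k) = lcs_degree_one \<pi> h"
    using mp[OF bspec[OF conjunct2[OF inc[OF i(1)]] r(1)]] r(2) unfolding i(2) by blast
   have "wn j p = of_int (- k j)" if "j \<in> {1..n}" for j
    using k(1) that winding_number_reverse_compose[OF _ winding_map[OF that], of p] p(1)
    by (simp add: loops_iff minus_equation_iff)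
   moreover have "?S (%j. - k j) = - ?S k" by (simp add: zscale_neg sum_negf)
   hence "?D (?S (%j. - k j)) = \<ominus>\<^bsub>lcs_lie \<pi>\<^esub> lcs_degree_one \<pi> h" by (simp add: D k(2))
   moreover have "lcs_degree_one \<pi> (inv\<^bsub>\<pi>\<^esub> h) \<oplus>\<^bsub>lcs_lie \<pi>\<^esub> lcs_degree_one \<pi> h = \<zero>\<^bsub>lcs_lie \<pi>\<^esub>"
    using pi.lcs_degree_one_mult[of "inv\<^bsub>\<pi>\<^esub> h" h] hc by (simp add: pi.lcs_degree_one_one)
   hence "lcs_degree_one \<pi> (inv\<^bsub>\<pi>\<^esub> h) = \<ominus>\<^bsub>lcs_lie \<pi>\<^esub> lcs_degree_one \<pi> h"
    using hc by (intro L.minus_equality[symmetric]) (simp_all add: pi.lcs_degree_one_closed)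
   ultimately show "\<exists>k. (\<forall>j\<in>{1..n}. wn j p = of_int (k j)) \<and> ?D (?S k) = lcs_degree_one \<pi> (inv\<^bsub>\<pi>\<^esub> h)"
    by (intro exI[of _ "%j. - k j"]) simp
  qed (use hc in simp)
 next
  case (eng a b)
  then obtain q r where qr: "q \<in> loops F y0" "a = loop_class F q" "r \<in> loops F y0" "b = loop_class F r"
   by (auto simp: pi1_carrier)
  obtain k where k: "\<forall>j\<in>{1..n}. wn j q = of_int (k j)" "?D (?S k) = lcs_degree_one \<pi> a"
   using mp[OF bspec[OF conjunct2[OF eng.IH(1)] qr(1)]] qr(2) by blast
  obtain l where l: "\<forall>j\<in>{1..n}. wn j r = of_int (l j)" "?D (?S l) = lcs_degree_one \<pi> b"
   using mp[OF bspec[OF conjunct2[OF eng.IH(2)] qr(3)]] qr(4) by blast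
  have ab: "a \<in> carrier \<pi>" "b \<in> carrier \<pi>" using eng.IH by auto
  show ?case
  proof (intro conjI ballI impI)
   fix p assume p: "p \<in> loops F y0" "loop_class F p = a \<otimes>\<^bsub>\<pi>\<^esub> b"
   have "loop_class F p = loop_class F (q +++ r)" using p(2) qr by (simp add: loops_iff pi1_mult)
   hence "homotopic_paths F p (q +++ r)" using qr by (intro loop_class_eqD) (simp_all add: loops_iff)
   hence "wn j p = of_int (k j + l j)" if "j \<in> {1..n}" for j
    using winding_number_homotopic[OF _ winding_map[OF that], of p "q +++ r"] k l that qr
     winding_number_join_compose[OF _ _ _ winding_map[OF that], of q r] by (simp add: loops_iff)
   moreover have "?S (%j. k j + l j) = ?S k + ?S l" by (simp add: zscale_add sum.distrib)
   hence "?D (?S (%j. k j + l j)) = lcs_degree_one \<pi> (a \<otimes>\<^bsub>\<pi>\<^esub> b)"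
    using ab by (simp add: D k(2) l(2) pi.lcs_degree_one_mult)
   ultimately show "\<exists>k. (\<forall>j\<in>{1..n}. wn j p = of_int (k j)) \<and> ?D (?S k) = lcs_degree_one \<pi> (a \<otimes>\<^bsub>\<pi>\<^esub> b)"
    by (intro exI[of _ "%j. k j + l j"]) simp
  qed (use ab in simp)
 qed
 have "loop_class F p \<in> generate \<pi> (x ` {1..n})"
  using p generated_by_x by (auto simp: pi1_carrier)
 from mp[OF bspec[OF conjunct2[OF all[OF this]] p]]
 obtain l where l: "\<forall>j\<in>{1..n}. wn j p = of_int (l j)"
  "?D (?S l) = lcs_degree_one \<pi> (loop_class F p)" by blast
 have "?S k = ?S l" by (intro sum.cong) (use l(1) k in auto)
 thus ?thesis using l(2) by simp
qed

end

subsection \<open>The monodromy of the root fibration on first homology\<close>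

lemma square_boundary_homotopic:
 fixes H :: "real \<times> real => 'a::topological_space"
 assumes H: "continuous_on unit_sq H" "H \<in> unit_sq \<rightarrow> S"
 shows "homotopic_paths S ((%t. H (t, 0)) +++ (%s. H (1, s))) ((%s. H (0, s)) +++ (%t. H (t, 1)))"
proof -
 let ?D = "unit_sq"
 have pD: "path_in ?D (%t. (t, c))" "path_in ?D (%t. (c, t))" if "c \<in> {0..1}" for c :: real
  using that by (auto simp: path_in_def path_def path_image_def intro!: continuous_intros)
 have ends: "pathstart (%t. (t, c)) = (0::real, c)" "pathfinish (%t. (t, c)) = (1::real, c)" "pathstart (%t. (c, t)) = (c, 0::real)" "pathfinish (%t. (c, t)) = (c, 1::real)" for c :: real
  by (simp_all add: pathstart_def pathfinish_def)
 have "homotopic_paths ?D ((%t. (t, 0)) +++ (%s. (1, s))) ((%s. (0, s)) +++ (%t. (t, 1)))"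
  by (rule convex_homotopic_paths, intro convex_Times convex_real_interval)
   (auto intro!: path_in_join pD simp: ends)
 from homotopic_paths_continuous_image[OF this H] show ?thesis
  unfolding path_compose_join by (simp only: comp_def)
qed

context root_fibration
begin

lemma F_path_connected: "path_connected (F x)"
proof -
 have "F x = - ((%i. b i x) ` {1..n})" by (auto simp: F_def)
 thus ?thesis by (simp add: path_connected_complement_countable countable_finite)
qed

lemma E_path_connected:
 assumes "path_connected B"
 shows "path_connected E"
 unfolding path_connected_component
proof (intro ballI)
 fix e e' assume e: "e \<in> E" "e' \<in> E"
 have fib: "path_component E d (fst d, \<sigma> (fst d))" if d: "d \<in> E" for d
 proof -
  obtain x y where xy: "d = (x, y)" "x \<in> B" "y \<in> F x" using d E_iff by (metis surj_pair)
  have "path_connected (Pair x ` F x)"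
   by (intro path_connected_continuous_image F_path_connected continuous_intros)
  moreover have "Pair x ` F x \<subseteq> E" using xy by (auto simp: E_iff)
  ultimately have "path_component E (x, y) (x, \<sigma> x)"
   using xy \<sigma>_in_F unfolding path_connected_component by (meson imageI path_component_of_subset)
  thus ?thesis using xy by simp
 qed
 have "path_connected ((%x. (x, \<sigma> x)) ` B)"
  by (intro path_connected_continuous_image assms continuous_intros \<sigma>_cont)
 moreover have "(%x. (x, \<sigma> x)) ` B \<subseteq> E" using \<sigma>_in_F by (auto simp: E_iff)
 moreover have "fst e \<in> B" "fst e' \<in> B" using e by (auto simp: E_def)
 ultimately have "path_component E (fst e, \<sigma> (fst e)) (fst e', \<sigma> (fst e'))"
  unfolding path_connected_component by (meson imageI path_component_of_subset)
 thus "path_component E e e'" using fib[OF e(1)] fib[OF e(2)]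
  by (meson path_component_sym path_component_trans)
qed

lemma root_winding_map:
 assumes "j \<in> {1..n}"
 shows "continuous_on E (%(x, y). y - b j x)" "(%(x, y). y - b j x) \<in> E \<rightarrow> - {0}"
proof -
 have "continuous_on E (%d. snd d - b j (fst d))"
  by (intro continuous_intros continuous_on_compose2[OF b_cont[OF assms] continuous_on_fst[OF continuous_on_id]])
   (auto simp: E_def)
 thus "continuous_on E (%(x, y). y - b j x)" by (simp add: case_prod_unfold)
qed (use assms in \<open>auto simp: E_def\<close>)

text \<open>The loop \<open>p\<close> acts on the meridian \<open>x\<^sub>q\<close> through the torus swept out by a small circle around the
 \<open>q\<close>-th root: up to conjugation in the fibre, a translate of \<open>p\<close> commutes with \<open>x\<^sub>q\<close>.\<close>

theorem lcs_lie_root_fibration: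
 fixes \<rho> :: "(nat => (real => 'b) set set) => nat free_lie => nat free_lie"
 assumes x0: "x0 \<in> B" and con: "path_connected B"
  and gen: "inj_on (%i. Re (b i x0)) {1..n}"
  and \<rho>: "\<rho> \<in> lie_hom (lcs_lie (fundamental_group B x0)) (Der (free_lie {1..n}))"
  and act: "!!p q W. p \<in> loops B x0 ==> q \<in> {1..n} ==>
   (!!j. j \<in> {1..n} - {q} ==> winding_number (%t. b q (p t) - b j (p t)) 0 = of_int (W j)) ==>
   \<rho> (lcs_degree_one (fundamental_group B x0) (loop_class B p)) (fl_gen q) =
    fl_br (fl_gen q) (\<Sum>j\<in>{1..n} - {q}. zscale (W j) (fl_gen j))"
 shows "lie_isomorphic (lcs_lie (fundamental_group E (x0, \<sigma> x0)))
  (lie_semidirect (lcs_lie (fundamental_group B x0)) (free_lie {1..n}) \<rho>)"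
proof -
 note One_nat_def [simp del]
 interpret P: punctured_plane "%i. b i x0" n "\<sigma> x0"
  by unfold_locales (use gen Re_b_less_\<sigma> in \<open>auto simp: less_imp_neq[symmetric] simp del: One_nat_def\<close>)
 have PF: "P.F = F x0" by (simp add: P.F_def F_def)
 interpret X: split_extension "\<pi>F x0" "\<pi>E x0" "\<pi>B x0" "fib_i x0" fib_p fib_s
  by (rule fibration_split_extension[OF x0])
 have e0: "(x0, \<sigma> x0) \<in> E" using x0 \<sigma>_in_F by (simp add: E_iff)
 obtain c where "based_paths E (x0, \<sigma> x0) c" using based_paths_exist[OF E_path_connected[OF con] e0] by blast
 then interpret T: based_paths E "(x0, \<sigma> x0)" c .
 have "lie_isomorphic (lcs_lie (\<pi>E x0)) (lie_semidirect (lcs_lie (\<pi>B x0)) (free_lie {1..n}) \<rho>)"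
 proof (rule X.lcs_lie_split_extension)
  show "P.x \<in> {1..n} \<rightarrow> carrier (\<pi>F x0)" using P.x_closed by (simp add: \<pi>F_def[OF x0] PF)
  show "carrier (\<pi>F x0) = generate (\<pi>F x0) (P.x ` {1..n})" using P.generated_by_x by (simp add: \<pi>F_def[OF x0] PF)
  show "\<rho> \<in> lie_hom (lcs_lie (\<pi>B x0)) (Der (free_lie {1..n}))" using \<rho> by (simp add: \<pi>B_def[OF x0])
  fix v :: "nat => int fps endo"
  show "\<exists>f\<in>hom (\<pi>F x0) fps_units. \<forall>q\<in>{1..n}. f (P.x q) = 1 + fps_single 1 (v q)"
   unfolding \<pi>F_def[OF x0] PF[symmetric] by (rule P.hom_exists[OF fps_units_group]) simp
 next
  fix h q assume h: "h \<in> carrier (\<pi>B x0)" and q: "q \<in> {1..n}"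
  obtain p where p: "p \<in> loops B x0" "h = loop_class B p" using h by (auto simp: \<pi>B_def[OF x0] pi1_carrier)
  have pB: "path_in B p" "pathstart p = x0" "pathfinish p = x0" "p 0 = x0" "p 1 = x0"
   using p by (auto simp: loops_iff pathstart_def pathfinish_def)
  have pt: "p t \<in> B" if "t \<in> {0..1}" for t using pB(1) that by (auto simp: path_in_def path_image_def)
  have bp: "continuous_on {0..1} (%t. b j (p t))" if "j \<in> {1..n}" for j
   using pB(1) by (intro continuous_on_compose2[OF b_cont[OF that], of _ p]) (auto simp: path_in_def path_def path_image_def)
  have "\<exists>e>0. \<forall>t\<in>{0..1}. e < norm (b q (p t) - b j (p t))" if j: "j \<in> {1..n} - {q}" for j
  proof -
   have "continuous_on {0..1} (%t. norm (b q (p t) - b j (p t)))" using bp j q by (intro continuous_intros) auto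
   then obtain t where t: "t \<in> {0..1}" "\<forall>s\<in>{0..1}. norm (b q (p t) - b j (p t)) \<le> norm (b q (p s) - b j (p s))"
    using continuous_attains_inf[of "{0..1}" "%t. norm (b q (p t) - b j (p t))"] by auto
   have "0 < norm (b q (p t) - b j (p t))" using b_distinct[OF pt[OF t(1)] q, of j] j by auto
   moreover from this have "norm (b q (p t) - b j (p t)) / 2 < norm (b q (p s) - b j (p s))" if "s \<in> {0..1}" for s
    using bspec[OF t(2) that] by linarith
   ultimately show ?thesis by (intro exI[of _ "norm (b q (p t) - b j (p t)) / 2"]) simp
  qed
  then obtain e where e: "!!j. j \<in> {1..n} - {q} ==> e j > 0 \<and> (\<forall>t\<in>{0..1}. e j < norm (b q (p t) - b j (p t)))" by metis
  \<comment> \<open>Small enough for the circle over \<open>x0\<close> to represent the meridian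
    \<open>x q\<close>, and smaller than the distance from the \<open>q\<close>-th root to all
    others along \<open>p\<close>, so that the torus \<open>H\<close> avoids the roots.\<close>
  define \<epsilon> where "\<epsilon> = Min (insert (P.\<eta> / 2) (e ` ({1..n} - {q})))"
  have "\<epsilon> > 0" unfolding \<epsilon>_def using e P.\<eta>(1) by (subst Min_gr_iff) auto
  moreover have "\<epsilon> \<le> P.\<eta> / 2" unfolding \<epsilon>_def by (intro Min_le) auto
  ultimately have \<epsilon>: "\<epsilon> > 0" "\<epsilon> < P.\<eta>" using P.\<eta>(1) by auto
  have \<epsilon>j: "\<epsilon> < norm (b q (p t) - b j (p t))" if "j \<in> {1..n} - {q}" "t \<in> {0..1}" for j t
  proof -
   have "\<epsilon> \<le> e j" unfolding \<epsilon>_def using that by (intro Min_le) auto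
   thus ?thesis using bspec[OF conjunct2[OF e[OF that(1)]] that(2)] by linarith
  qed
  define H where "H = (%(t, s). (p t, b q (p t) + \<epsilon> * exp (2 * of_real pi * \<i> * of_real s)))"
  have Hc: "continuous_on unit_sq H"
  proof -
   have fst01: "continuous_on unit_sq (fst :: real \<times> real => real)" "fst ` unit_sq \<subseteq> {0..1}"
    by (intro continuous_intros) force
   have "continuous_on {0..1} p" using pB(1) by (simp add: path_in_def path_def)
   from continuous_on_compose2[OF this fst01]
   have "continuous_on unit_sq (%d::real \<times> real. p (fst d))" .
   moreover from continuous_on_compose2[OF bp[OF q] fst01]
   have "continuous_on unit_sq (%d::real \<times> real. b q (p (fst d)))" .
   ultimately show ?thesis unfolding H_def case_prod_unfold by (intro continuous_intros)
  qed
  have HE: "H \<in> unit_sq \<rightarrow> E"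
  proof (intro funcsetI, clarify)
   fix t s :: real assume ts: "t \<in> {0..1}" "s \<in> {0..1}"
   let ?u = "\<epsilon> * exp (2 * of_real pi * \<i> * of_real s)"
   have u: "norm ?u = \<epsilon>" using \<epsilon> by (simp add: norm_mult)
   have "b q (p t) + ?u ~= b j (p t)" if j: "j \<in> {1..n}" for j
   proof (cases "j = q")
    case False
    hence "\<epsilon> < norm (b q (p t) - b j (p t))" using \<epsilon>j ts j by blast
    hence "?u ~= - (b q (p t) - b j (p t))" using u by (metis less_irrefl norm_minus_cancel)
    thus ?thesis by (auto simp: add_eq_0_iff algebra_simps)
   qed (use u \<epsilon> in auto)
   thus "H (t, s) \<in> E" using pt[OF ts(1)] by (simp add: H_def E_def)
  qed
  \<comment> \<open>The boundary of the square \<open>H\<close> consists of the translate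
    \<open>a\<close> of \<open>p\<close> and the small circle \<open>z\<close>, each occurring on
    two opposite sides. So \<open>a\<close> and \<open>z\<close> commute up to homotopy.\<close>
  define a where "a = (%t. (p t, b q (p t) + \<epsilon>))"
  define z where "z = Pair x0 \<circ> circlepath (b q x0) \<epsilon>"
  have za: "homotopic_paths E (a +++ z) (z +++ a)"
   using square_boundary_homotopic[OF Hc HE] pB(4,5) by (simp add: H_def a_def z_def circlepath comp_def mult_ac)
  have zE: "path_in E z"
   unfolding z_def using P.circlepath_F[OF q \<epsilon>] Pair_maps[OF x0] by (intro path_in_compose) (simp_all add: PF)
  have aE: "path_in E a"
  proof -
   have "path_in unit_sq (%t::real. (t, 0::real))"
    by (auto simp: path_in_def path_def path_image_def intro!: continuous_intros)
   from path_in_compose[OF this Hc HE] show ?thesis by (simp add: H_def a_def comp_def)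
  qed
  have ends: "pathstart a = (x0, b q x0 + \<epsilon>)" "pathfinish a = (x0, b q x0 + \<epsilon>)" "pathstart z = (x0, b q x0 + \<epsilon>)" "pathfinish z = (x0, b q x0 + \<epsilon>)"
   using pB(4,5) by (simp_all add: a_def z_def pathstart_def pathfinish_def circlepath)
  let ?k = "P.\<kappa> (b q x0 + \<epsilon>)"
  define d where "d = Pair x0 \<circ> ?k"
  have k: "path_in (F x0) ?k \<and> pathstart ?k = \<sigma> x0 \<and> pathfinish ?k = b q x0 + \<epsilon>"
   using path_in_endpoints(1)[OF P.circlepath_F[OF q \<epsilon>]] unfolding PF[symmetric] by (intro P.\<kappa>_path) simp
  have dE: "path_in E d" "pathstart d = (x0, \<sigma> x0)" "pathfinish d = (x0, b q x0 + \<epsilon>)"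
   using k Pair_maps[OF x0] by (auto simp: d_def pathstart_compose pathfinish_compose intro!: path_in_compose)
  let ?l = "d +++ (a +++ reversepath d)"
  let ?E = "\<pi>E x0"
  have lE: "?l \<in> loops E (x0, \<sigma> x0)" using dE aE ends by (simp add: loops_iff)
  have wdl: "loop_class E ?l = T.wd d \<otimes>\<^bsub>?E\<^esub> (T.wd a \<otimes>\<^bsub>?E\<^esub> inv\<^bsub>?E\<^esub> T.wd d)"
   using T.wd_loop[OF lE] dE aE ends by (simp add: T.wd_join T.wd_reverse \<pi>E_def[OF x0])
  have "fib_i x0 (P.x q) = loop_class E (Pair x0 \<circ> (?k +++ (circlepath (b q x0) \<epsilon> +++ reversepath ?k)))"
   unfolding P.wd_circlepath[OF q \<epsilon>, symmetric] P.wd_def fib_i_def[OF x0] using k P.circlepath_F[OF q \<epsilon>] Pair_maps[OF x0]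
   by (subst induced_map_class[of P.F]) (simp_all add: PF)
  also have "Pair x0 \<circ> (?k +++ (circlepath (b q x0) \<epsilon> +++ reversepath ?k)) = d +++ (z +++ reversepath d)"
   by (simp add: d_def z_def path_compose_join path_compose_reversepath)
  also have "loop_class E ... = T.wd (d +++ (z +++ reversepath d))"
   using dE zE ends by (intro T.wd_loop[symmetric]) (simp add: loops_iff)
  also have "... = T.wd d \<otimes>\<^bsub>?E\<^esub> (T.wd z \<otimes>\<^bsub>?E\<^esub> inv\<^bsub>?E\<^esub> T.wd d)"
   using dE zE ends by (simp add: T.wd_join T.wd_reverse \<pi>E_def[OF x0])
  finally have x: "fib_i x0 (P.x q) = T.wd d \<otimes>\<^bsub>?E\<^esub> (T.wd z \<otimes>\<^bsub>?E\<^esub> inv\<^bsub>?E\<^esub> T.wd d)" .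
  have cl: "T.wd a \<in> carrier ?E" "T.wd z \<in> carrier ?E" "T.wd d \<in> carrier ?E"
   using aE zE dE by (simp_all add: \<pi>E_def[OF x0])
  have comm: "T.wd a \<otimes>\<^bsub>?E\<^esub> T.wd z = T.wd z \<otimes>\<^bsub>?E\<^esub> T.wd a"
   using T.wd_homotopic[OF za] aE zE ends by (simp add: T.wd_join \<pi>E_def[OF x0])
  \<comment> \<open>The based form of \<open>a\<close>: it lies over \<open>p\<close> and commutes
    with the image of the meridian \<open>x q\<close>.\<close>
  define u where "u = loop_class E ?l"
  have uc: "u \<in> carrier ?E" unfolding u_def wdl using cl by simp
  let ?X = "fib_i x0 (P.x q)"
  have "u \<otimes>\<^bsub>?E\<^esub> ?X = T.wd d \<otimes>\<^bsub>?E\<^esub> (T.wd a \<otimes>\<^bsub>?E\<^esub> T.wd z) \<otimes>\<^bsub>?E\<^esub> inv\<^bsub>?E\<^esub> T.wd d"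
   unfolding u_def wdl x using cl by (simp add: X.i.H.m_assoc X.i.H.inv_solve_left)
  moreover have "?X \<otimes>\<^bsub>?E\<^esub> u = T.wd d \<otimes>\<^bsub>?E\<^esub> (T.wd z \<otimes>\<^bsub>?E\<^esub> T.wd a) \<otimes>\<^bsub>?E\<^esub> inv\<^bsub>?E\<^esub> T.wd d"
   unfolding u_def wdl x using cl by (simp add: X.i.H.m_assoc X.i.H.inv_solve_left)
  ultimately have uX: "u \<otimes>\<^bsub>?E\<^esub> ?X = ?X \<otimes>\<^bsub>?E\<^esub> u" by (simp add: comm)
  have "fib_p u = loop_class B (fst \<circ> ?l)"
   unfolding u_def fib_p_def[OF x0] using lE fst_maps[OF x0] by (intro induced_map_class[of E]) (simp_all add: loops_iff)
  also have "fst \<circ> ?l = (%_. x0) +++ (p +++ (%_. x0))"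
   unfolding path_compose_join path_compose_reversepath by (simp add: d_def a_def comp_def reversepath_def)
  also have "loop_class B ... = h" unfolding p(2)
  proof (rule loop_class_eqI)
   have "homotopic_paths B ((%_. x0) +++ (p +++ (%_. x0))) (p +++ (%_. x0))"
    using pB x0 by (intro homotopic_paths_const_left) simp_all
   also have "homotopic_paths B ... p" using pB by (intro homotopic_paths_const_right) simp_all
   finally show "homotopic_paths B ((%_. x0) +++ (p +++ (%_. x0))) p" .
  qed
  finally have pu: "fib_p u = h" .
  have sc: "fib_s h \<in> carrier ?E" using h by simp
  have "fib_p (u \<otimes>\<^bsub>?E\<^esub> inv\<^bsub>?E\<^esub> fib_s h) = \<one>\<^bsub>\<pi>B x0\<^esub>"
   using uc sc h pu X.p_s[OF h] by simp
  \<comment> \<open>Thus \<open>u\<close> is the product of \<open>k\<close> and \<open>s h\<close>.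
    As \<open>u\<close> commutes with the meridian, conjugating the meridian by \<open>s h\<close>
    is conjugating it by \<open>k^-1\<close>.\<close>
  then obtain k where k: "k \<in> carrier (\<pi>F x0)" "fib_i x0 k = u \<otimes>\<^bsub>?E\<^esub> inv\<^bsub>?E\<^esub> fib_s h"
   using X.kernel_p[of "u \<otimes>\<^bsub>?E\<^esub> inv\<^bsub>?E\<^esub> fib_s h"] uc sc by auto
  obtain f where f: "f \<in> loops (F x0) (\<sigma> x0)" "k = loop_class (F x0) f"
   using k(1) by (auto simp: \<pi>F_def[OF x0] pi1_carrier)
  let ?s = "(%x. (x, \<sigma> x)) \<circ> p"
  have sE: "path_in E ?s" using pB(1) section_maps[OF x0] by (intro path_in_compose)
  have fE: "path_in E (Pair x0 \<circ> f)" using f Pair_maps[OF x0] by (intro path_in_compose) (auto simp: loops_iff)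
  have ends2: "pathfinish (Pair x0 \<circ> f) = pathstart ?s"
   using f pB by (simp add: loops_iff pathstart_compose pathfinish_compose)
  have "u = fib_i x0 k \<otimes>\<^bsub>?E\<^esub> fib_s h" unfolding k(2) using uc sc by (simp add: X.i.H.m_assoc)
  also have "fib_i x0 k = loop_class E (Pair x0 \<circ> f)"
   unfolding f(2) fib_i_def[OF x0] using f Pair_maps[OF x0] by (intro induced_map_class[of "F x0"]) (simp_all add: loops_iff)
  also have "fib_s h = loop_class E ?s"
   unfolding p(2) fib_s_def[OF x0] using pB section_maps[OF x0] by (intro induced_map_class[of B]) simp_all
  also have "loop_class E (Pair x0 \<circ> f) \<otimes>\<^bsub>?E\<^esub> loop_class E ?s = loop_class E ((Pair x0 \<circ> f) +++ ?s)"
   unfolding \<pi>E_def[OF x0] by (rule pi1_mult[OF fE sE ends2])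
  finally have "homotopic_paths E ?l ((Pair x0 \<circ> f) +++ ?s)"
   unfolding u_def using fE sE ends2 by (intro loop_class_eqD) simp_all
  note hom = this
  \<comment> \<open>Winding around the \<open>j\<close>-th root is additive along the product of
    \<open>k\<close> and the section over \<open>p\<close>, and the section contributes nothing. So
    the number for \<open>f\<close> is that of \<open>u\<close>, which is that of
    \<open>a\<close>.\<close>
  have wf: "winding_number ((%y. y - b j x0) \<circ> f) 0 = winding_number (%t. b q (p t) + \<epsilon> - b j (p t)) 0" if j: "j \<in> {1..n}" for j
  proof -
   let ?g = "%(x, y). y - b j x"
   note g = root_winding_map[OF j]
   have "winding_number (?g \<circ> ((Pair x0 \<circ> f) +++ ?s)) 0 = winding_number (?g \<circ> ?l) 0"
    by (rule winding_number_homotopic[OF hom g, symmetric])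
   also have "... = winding_number (?g \<circ> a) 0"
    using dE aE ends by (intro winding_number_conjugate[OF _ _ _ _ g]) simp_all
   also have "winding_number (?g \<circ> ((Pair x0 \<circ> f) +++ ?s)) 0 = winding_number (?g \<circ> (Pair x0 \<circ> f)) 0 + winding_number (?g \<circ> ?s) 0"
    by (rule winding_number_join_compose[OF fE sE ends2 g])
   also have "winding_number (?g \<circ> ?s) 0 = 0"
   proof (rule winding_number_half_plane)
    show "path (?g \<circ> ?s)" using path_in_compose[OF sE g] by (simp add: path_in_def)
    fix t :: real assume "t \<in> {0..1}"
    show "Re ((?g \<circ> ?s) t) > 0" using Re_b_less_\<sigma>[OF j, of "p t"] by simp
   qed (use pB in \<open>simp add: pathstart_def pathfinish_def\<close>)
   finally show ?thesis by (simp add: comp_def a_def)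
  qed
  have "\<exists>W::int. winding_number (%t. b q (p t) - b j (p t)) 0 = of_int W" if j: "j \<in> {1..n} - {q}" for j
  proof -
   have "path (%t. b q (p t) - b j (p t))" using bp q j by (simp add: path_def continuous_on_diff)
   moreover have "0 \<notin> path_image (%t. b q (p t) - b j (p t))"
    using \<epsilon>j[OF j] \<epsilon> by (force simp: path_image_def)
   ultimately have "winding_number (%t. b q (p t) - b j (p t)) 0 \<in> \<int>"
    using pB by (intro integer_winding_number) (simp_all add: pathstart_def pathfinish_def)
   thus ?thesis by (elim Ints_cases) blast
  qed
  then obtain W :: "nat => int" where W: "!!j. j \<in> {1..n} - {q} ==> winding_number (%t. b q (p t) - b j (p t)) 0 = of_int (W j)"
   by metis
  \<comment> \<open>For \<open>j = q\<close> the distance vector from the root to \<open>a\<close>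
    is the constant \<open>\<epsilon>\<close>, which has no winding.\<close>
  define W' where "W' j = (if j = q then 0 else W j)" for j
  have wW: "winding_number ((%y. y - b j x0) \<circ> f) 0 = of_int (W' j)" if j: "j \<in> {1..n}" for j
  proof (cases "j = q")
   case True
   thus ?thesis unfolding wf[OF j] W'_def using \<epsilon> by (simp add: winding_number_constI[of \<epsilon>])
  next
   case False
   hence j': "j \<in> {1..n} - {q}" using j by blast
   have "winding_number (%t. b q (p t) + \<epsilon> - b j (p t)) 0 = winding_number (%t. b q (p t) - b j (p t)) 0"
   proof (rule winding_number_nearby_loops_eq)
    show "path (%t. b q (p t) - b j (p t))" "path (%t. b q (p t) + \<epsilon> - b j (p t))"
     unfolding path_def using bp q j by (intro continuous_intros; simp)+
    show "norm (b q (p t) + \<epsilon> - b j (p t) - (b q (p t) - b j (p t))) < norm (b q (p t) - b j (p t) - 0)" if "t \<in> {0..1}" for t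
     using \<epsilon>j[OF j' that] \<epsilon> by simp
   qed (use pB in \<open>simp_all add: pathstart_def pathfinish_def\<close>)
   thus ?thesis using W[OF j'] False by (simp add: wf[OF j] W'_def)
  qed
  let ?L = "\<Sum>j\<in>{1..n}. zscale (W' j) (fl_gen j) :: nat free_lie"
  have L: "?L = (\<Sum>j\<in>{1..n} - {q}. zscale (W j) (fl_gen j))"
  proof -
   have "?L = (\<Sum>j\<in>{1..n} - {q}. zscale (W' j) (fl_gen j))"
    using q by (subst sum.remove[of _ q]) (simp_all add: W'_def)
   also have "... = (\<Sum>j\<in>{1..n} - {q}. zscale (W j) (fl_gen j))" by (intro sum.cong) (auto simp: W'_def)
   finally show ?thesis .
  qed
  show "\<exists>k\<in>carrier (\<pi>F x0). \<exists>l\<in>carrier (free_lie {1..n}).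
    fib_s h \<otimes>\<^bsub>?E\<^esub> fib_i x0 (P.x q) \<otimes>\<^bsub>?E\<^esub> inv\<^bsub>?E\<^esub> fib_s h =
     fib_i x0 (inv\<^bsub>\<pi>F x0\<^esub> k \<otimes>\<^bsub>\<pi>F x0\<^esub> P.x q \<otimes>\<^bsub>\<pi>F x0\<^esub> k) \<and>
    degree_one_map (\<pi>F x0) {1..n} P.x l = lcs_degree_one (\<pi>F x0) k \<and>
    \<rho> (lcs_degree_one (\<pi>B x0) h) (fl_gen q) = fl_br (fl_gen q) l"
  proof (intro bexI[of _ k] bexI[of _ ?L] conjI k(1))
   have Xc: "P.x q \<in> carrier (\<pi>F x0)" using funcset_mem[OF P.x_closed q] by (simp add: \<pi>F_def[OF x0] PF)
   hence XE: "?X \<in> carrier ?E" by simp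
   have inv: "inv\<^bsub>?E\<^esub> (u \<otimes>\<^bsub>?E\<^esub> inv\<^bsub>?E\<^esub> fib_s h) = fib_s h \<otimes>\<^bsub>?E\<^esub> inv\<^bsub>?E\<^esub> u"
    using uc sc by (simp add: X.i.H.inv_mult_group)
   have "fib_i x0 (inv\<^bsub>\<pi>F x0\<^esub> k \<otimes>\<^bsub>\<pi>F x0\<^esub> P.x q \<otimes>\<^bsub>\<pi>F x0\<^esub> k)
    = fib_s h \<otimes>\<^bsub>?E\<^esub> (inv\<^bsub>?E\<^esub> u \<otimes>\<^bsub>?E\<^esub> (?X \<otimes>\<^bsub>?E\<^esub> u)) \<otimes>\<^bsub>?E\<^esub> inv\<^bsub>?E\<^esub> fib_s h"
    using k(1) Xc XE uc sc by (simp add: k(2) inv X.i.H.m_assoc)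
   also have "inv\<^bsub>?E\<^esub> u \<otimes>\<^bsub>?E\<^esub> (?X \<otimes>\<^bsub>?E\<^esub> u) = ?X"
    unfolding uX[symmetric] using uc XE by (simp add: X.i.H.inv_solve_left')
   finally show "fib_s h \<otimes>\<^bsub>?E\<^esub> fib_i x0 (P.x q) \<otimes>\<^bsub>?E\<^esub> inv\<^bsub>?E\<^esub> fib_s h =
     fib_i x0 (inv\<^bsub>\<pi>F x0\<^esub> k \<otimes>\<^bsub>\<pi>F x0\<^esub> P.x q \<otimes>\<^bsub>\<pi>F x0\<^esub> k)" by simp
   show "degree_one_map (\<pi>F x0) {1..n} P.x ?L = lcs_degree_one (\<pi>F x0) k"
    using P.degree_one_winding[of f W'] f wW unfolding \<pi>F_def[OF x0] PF by blast
   show "\<rho> (lcs_degree_one (\<pi>B x0) h) (fl_gen q) = fl_br (fl_gen q) ?L"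
    unfolding L p(2) \<pi>B_def[OF x0] by (rule act[OF p(1) q W])
   show "?L \<in> carrier (free_lie {1..n})"
   proof -
    have z: "zscale m (fl_gen j) \<in> carrier (free_lie {1..n})" if "j \<in> {1..n}" for m j
    proof -
     have "((+) (fl_gen j) ^^ m) 0 \<in> carrier (free_lie {1..n})" for m
      using that by (induction m) simp_all
     thus ?thesis unfolding zscale_def diff_conv_add_uminus by (intro free_lie_closed)
    qed
    have sums: "sum f A \<in> carrier (free_lie {1..n})" if "finite A" "!!j. j \<in> A ==> f j \<in> carrier (free_lie {1..n})" for f :: "nat => nat free_lie" and A
     using that by (induction A rule: finite_induct) simp_all
    show ?thesis by (intro sums z) simp_all
   qed
  qed
 qed
 thus ?thesis by (simp add: \<pi>E_def[OF x0] \<pi>B_def[OF x0])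
qed

end

section \<open>Loops in configuration spaces\<close>

lemma continuous_on_coordinate: "continuous_on S (%f. f i)"
 by (rule continuous_on_subset[OF continuous_on_product_coordinates]) simp

text \<open>The simplex of a loop is a cycle because both of its faces are the constant simplex at
  the base point, so the induced map can be computed on it directly. This supplies the premise in
  \<open>extends_homology_map\<close> for the image of a loop under the root map.\<close>

lemma hom_induced_hurewicz:
 assumes f: "continuous_on S f" "f \<in> S \<rightarrow> T" and p: "p \<in> loops S x"
 shows "hom_induced 1 (top_of_set S) {} (top_of_set T) {} f (hurewicz S p) = hurewicz T (f \<circ> p)"
proof -
 let ?m = "\<lambda>x\<in>standard_simplex 1. p (x 1)"
 let ?X = "subtopology (powertop_real UNIV) (standard_simplex 1)"
 have pS: "path_in S p" "p 0 = p 1" using p by (auto simp: loops_iff pathstart_def pathfinish_def)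
 have "continuous_map ?X (top_of_set {0..1}) (%x. x 1)"
  by (auto simp: continuous_map_in_subtopology standard_simplex_def intro!: continuous_map_from_subtopology continuous_map_product_projection)
 moreover have "continuous_map (top_of_set {0..1}) (top_of_set S) p"
  using pS(1) by (auto simp: path_in_def path_def path_image_def)
 ultimately have "continuous_map ?X (top_of_set S) (p \<circ> (%x. x 1))" by (rule continuous_map_compose)
 hence "continuous_map ?X (top_of_set S) ?m" by (rule continuous_map_eq) simp
 hence m: "singular_simplex 1 (top_of_set S) ?m" by (simp add: singular_simplex_def)
 have face: "singular_face 1 k ?m = (\<lambda>x\<in>standard_simplex 0. p 0)" if "k \<le> 1" for k
 proof
  fix x :: "nat => real"
  show "singular_face 1 k ?m x = (\<lambda>x\<in>standard_simplex 0. p 0) x"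
  proof (cases "x \<in> standard_simplex 0")
   case True
   hence "simplical_face k x \<in> standard_simplex 1" "x 0 = 1" "x 1 = 0"
    using simplical_face_in_standard_simplex[of 1 k x] that by (auto simp: standard_simplex_def)
   thus ?thesis using True that pS(2) by (cases "k = 0") (auto simp: singular_face_def simplical_face_def)
  qed (simp add: singular_face_def)
 qed
 have "chain_boundary 1 (frag_of ?m) = 0"
  using face[of 0] face[of 1] by (simp add: chain_boundary_of)
 hence "singular_relcycle 1 (top_of_set S) {} (frag_of ?m)"
  using m by (simp add: singular_cycle singular_chain_of)
 moreover have "simplex_map 1 f ?m = (\<lambda>x\<in>standard_simplex 1. (f \<circ> p) (x 1))"
  by (auto simp: simplex_map_def)
 moreover have "continuous_map (top_of_set S) (top_of_set T) f" using f by auto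
 ultimately show ?thesis unfolding hurewicz_def
  using hom_induced_chain_map[of "top_of_set S" "top_of_set T" f "{}" "{}" 1 "frag_of ?m"] by simp
qed

lemma loop_around_point:
 assumes A: "finite A" "a \<in> A" and y: "y \<notin> A"
 obtains g where "g \<in> loops (- A) y"
  "!!a'. a' \<in> A ==> winding_number (%t. g t - a') 0 = (if a' = a then 1 else 0)"
proof -
 obtain d where d: "d > 0" "!!a'. a' \<in> A ==> a' ~= a ==> d \<le> dist a a'"
  using finite_set_avoid[OF A(1), of a] by auto
 define C where "C = circlepath a (d / 2)"
 have CA: "path_in (- A) C" unfolding C_def path_in_def using d
  by (force simp: path_image_circlepath)
 have "path_connected (- A)" using A(1) by (intro path_connected_complement_countable) (auto simp: countable_finite)
 moreover have "a + d / 2 \<in> - A" using path_in_endpoints(1)[OF CA] by (simp add: C_def)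
 ultimately have "\<exists>k. path_in (- A) k \<and> pathstart k = y \<and> pathfinish k = a + d / 2"
  using y unfolding path_connected_def path_in_def conj_assoc by blast
 then obtain k where k: "path_in (- A) k" "pathstart k = y" "pathfinish k = a + d / 2" by blast
 have ends: "pathstart C = a + d / 2" "pathfinish C = a + d / 2" by (simp_all add: C_def)
 show thesis
 proof (rule that[of "k +++ (C +++ reversepath k)"])
  show "k +++ (C +++ reversepath k) \<in> loops (- A) y" using k CA ends by (simp add: loops_iff)
  fix a' assume a': "a' \<in> A"
  have "winding_number ((%z. z - a') \<circ> (k +++ (C +++ reversepath k))) 0 = winding_number ((%z. z - a') \<circ> C) 0"
   by (rule winding_number_conjugate[OF k(1) CA]) (use k ends a' in \<open>auto intro!: continuous_intros\<close>)
  also have "... = winding_number C a'" unfolding winding_number_offset[of C] comp_def ..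
  also have "... = (if a' = a then 1 else 0)"
  proof (cases "a' = a")
   case False
   hence "a' \<notin> cball a (d / 2)" using d(1) d(2)[OF a'] by auto
   hence "winding_number C a' = 0" unfolding C_def
    using d(1) by (intro winding_number_zero_outside[of _ "cball a (d / 2)"]) (auto simp: path_image_circlepath)
   thus ?thesis using False by simp
  qed (use d(1) in \<open>simp add: C_def winding_number_circlepath_centre\<close>)
  finally show "winding_number (%t. (k +++ (C +++ reversepath k)) t - a') 0 = (if a' = a then 1 else 0)"
   by (simp add: comp_def)
 qed
qed

text \<open>Strand \<open>j\<close> travels once around the position of strand \<open>i\<close>
  while all other strands rest.\<close>

lemma represents_A_exists:
 assumes w: "w \<in> Conf n" and ij: "1 \<le> i" "i < j" "j \<le> n"
 obtains p where "p \<in> loops (Conf n) w" "represents_A n i j p"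
proof -
 let ?A = "w ` ({1..n} - {j})"
 have inj: "inj_on w {1..n}" and ext: "w \<in> extensional {1..n}" using w by (auto simp: Conf_def)
 have "w j \<notin> ?A" using inj_onD[OF inj, of j] ij by force
 moreover have "w i \<in> ?A" using ij by auto
 ultimately obtain g where g: "g \<in> loops (- ?A) (w j)"
  "!!a. a \<in> ?A ==> winding_number (%t. g t - a) 0 = (if a = w i then 1 else 0)"
  using loop_around_point[of ?A "w i" "w j"] by blast
 have gw: "winding_number (%t. g t - w k) 0 = (if k = i then 1 else 0)" if "k \<in> {1..n} - {j}" for k
  using g(2)[of "w k"] that inj_onD[OF inj, of k i] ij by auto
 have gA: "path_in (- ?A) g" using g(1) by (simp add: loops_iff)
 define p where "p = (%s. w(j := g s))"
 have "path p" unfolding path_def p_def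
 proof (rule continuous_on_coordinatewise_then_product)
  show "continuous_on {0..1} (%s. (w(j := g s)) l)" for l
   using gA by (cases "l = j") (auto simp: path_in_def path_def)
 qed
 moreover have "p s \<in> Conf n" if "s \<in> {0..1}" for s
 proof -
  have "g s \<in> - ?A" using gA that unfolding path_in_def path_image_def by blast
  hence new: "g s ~= w a" if "a \<in> {1..n}" "a ~= j" for a using that by blast
  have "inj_on (w(j := g s)) {1..n}"
  proof (rule inj_onI)
   fix a b assume "a \<in> {1..n}" "b \<in> {1..n}" "(w(j := g s)) a = (w(j := g s)) b"
   thus "a = b" using new[of a] new[of b] inj_onD[OF inj, of a b] by (auto split: if_splits)
  qed
  thus ?thesis using ext ij by (auto simp: Conf_def p_def extensional_def)
 qed
 ultimately have "path_in (Conf n) p" by (auto simp: path_in_def path_image_def)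
 hence "p \<in> loops (Conf n) w" using g(1) by (simp add: loops_iff p_def pathstart_def pathfinish_def)
 moreover have "represents_A n i j p" unfolding represents_A_def
 proof (intro allI impI)
  fix k l assume kl: "1 \<le> k \<and> k < l \<and> l \<le> n"
  consider "l = j" | "k = j" | "l ~= j" "k ~= j" by blast
  thus "winding_number (%s. p s l - p s k) 0 = (if k = i \<and> l = j then 1 else 0)"
  proof cases
   case 1 thus ?thesis using gw[of k] kl by (simp add: p_def)
  next
   case 2
   have "path_in (- {0}) ((%z. z - w l) \<circ> g)"
    by (rule path_in_compose[OF gA]) (use kl 2 in \<open>force intro!: continuous_intros\<close>)+
   hence "path_in (- {0}) (%t. g t - w l)" by (simp add: comp_def)
   thus ?thesis using winding_number_scale[of "%t. g t - w l" "-1"] gw[of l] kl 2 ij by (simp add: p_def)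
  next
   case 3
   have "winding_number (%s. p s l - p s k) 0 = 0"
    using inj_onD[OF inj, of k l] kl 3 by (intro winding_number_constI[of "w l - w k"]) (auto simp: p_def)
   thus ?thesis using 3 by simp
  qed
 qed
 ultimately show thesis using that by blast
qed

text \<open>For loops in a configuration space the winding number is an integer; real part and floor
  only change its type.\<close>

definition pair_winding :: "(real => nat => complex) => nat => nat => int" where
 "pair_winding q a b = \<lfloor>Re (winding_number (%s. q s b - q s a) 0)\<rfloor>"

lemma pair_map:
 assumes "a \<in> {1..n}" "b \<in> {1..n}" "a ~= b"
 shows "continuous_on (Conf n) (%w. w b - w a)" "(%w. w b - w a) \<in> Conf n \<rightarrow> - {0}"
proof -
 show "(%w. w b - w a) \<in> Conf n \<rightarrow> - {0}"
 proof
  fix w assume "w \<in> Conf n"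
  thus "w b - w a \<in> - {0}" using inj_onD[of w "{1..n}" a b] assms by (auto simp: Conf_def)
 qed
qed (intro continuous_intros continuous_on_coordinate)

lemma pair_winding:
 assumes q: "q \<in> loops (Conf n) w" and ab: "a \<in> {1..n}" "b \<in> {1..n}" "a ~= b"
 shows "winding_number (%s. q s b - q s a) 0 = of_int (pair_winding q a b)"
  "pair_winding q b a = pair_winding q a b"
  "pair_winding (reversepath q) a b = - pair_winding q a b"
  "r \<in> loops (Conf n) w ==> pair_winding (q +++ r) a b = pair_winding q a b + pair_winding r a b"
proof -
 have int: "winding_number (%s. q s b - q s a) 0 = of_int (pair_winding q a b)"
  if q: "q \<in> loops (Conf n) w" for q
 proof -
  have "path_in (- {0}) ((%w. w b - w a) \<circ> q)" using q by (intro path_in_compose[OF _ pair_map[OF ab]]) (simp_all add: loops_iff)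
  hence "winding_number (%s. q s b - q s a) 0 \<in> \<int>"
   using q by (intro integer_winding_number) (auto simp: path_in_def comp_def loops_iff pathstart_def pathfinish_def)
  thus ?thesis by (elim Ints_cases) (simp add: pair_winding_def)
 qed
 show "winding_number (%s. q s b - q s a) 0 = of_int (pair_winding q a b)" by (rule int[OF q])
 have q': "path_in (Conf n) q" "pathfinish q = w" "pathstart q = w" using q by (auto simp: loops_iff)
 have "path_in (- {0}) (%s. q s b - q s a)" using path_in_compose[OF q'(1) pair_map[OF ab]] by (simp add: comp_def)
 from winding_number_scale[OF this, of "-1"] show "pair_winding q b a = pair_winding q a b" by (simp add: pair_winding_def)
 have "complex_of_int (pair_winding (reversepath q) a b) = of_int (- pair_winding q a b)"
  using winding_number_reverse_compose[OF q'(1) pair_map[OF ab]] int[of q] int[of "reversepath q"] q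
  by (simp add: comp_def loops_iff)
 thus "pair_winding (reversepath q) a b = - pair_winding q a b" by (simp only: of_int_eq_iff)
 assume r: "r \<in> loops (Conf n) w"
 have "complex_of_int (pair_winding (q +++ r) a b) = of_int (pair_winding q a b + pair_winding r a b)"
  using winding_number_join_compose[OF q'(1) _ _ pair_map[OF ab], of r] int[of q] int[of r] int[of "q +++ r"] q r
  by (simp add: comp_def loops_iff)
 thus "pair_winding (q +++ r) a b = pair_winding q a b + pair_winding r a b" by (simp only: of_int_eq_iff)
qed

lemma represents_A_pair_winding:
 assumes "represents_A n i j p" "1 \<le> a" "a < b" "b \<le> n"
 shows "pair_winding p a b = (if a = i \<and> b = j then 1 else 0)"
 using assms by (simp add: represents_A_def pair_winding_def)

text \<open>With a single point there is no pair whose generator could absorb a loop, so this case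
  is settled by a straight line homotopy.\<close>

lemma Conf_one_loop_trivial:
 assumes q: "q \<in> loops (Conf 1) w"
 shows "loop_class (Conf 1) q = loop_class (Conf 1) (%_. w)"
proof (rule loop_class_eqI)
 have c1: "continuous_on {0..1} (%s. q s 1)"
  by (rule continuous_on_product_then_coordinatewise) (use q in \<open>simp add: loops_iff path_in_def path_def\<close>)
 have qC: "q s \<in> Conf 1" if "s \<in> {0..1}" for s using q that by (auto simp: loops_iff path_in_def path_image_def)
 have w: "w \<in> Conf 1" "q 0 = w" "q 1 = w" using q path_in_endpoints[of "Conf 1" q] by (auto simp: loops_iff pathstart_def pathfinish_def)
 have eq: "f = g" if "f \<in> Conf 1" "g \<in> Conf 1" "f 1 = g 1" for f g
  using that by (intro extensionalityI[of f "{1..1}" g]) (auto simp: Conf_def)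
 let ?h = "%(t::real, s::real). \<lambda>i\<in>{1..1::nat}. (1 - t) *\<^sub>R q s 1 + t *\<^sub>R w 1"
 have hC: "?h d \<in> Conf 1" for d by (auto simp: Conf_def case_prod_unfold)
 show "homotopic_paths (Conf 1) q (%_. w)" unfolding homotopic_paths
 proof (intro exI[of _ ?h] conjI ballI)
  have "continuous_on unit_sq (%d::real \<times> real. q (snd d) 1)"
   by (rule continuous_on_compose2[OF c1]) (auto intro!: continuous_intros)
  hence "continuous_on unit_sq (%d. (1 - fst d) *\<^sub>R q (snd d) 1 + fst d *\<^sub>R w 1)"
   by (intro continuous_intros)
  hence "continuous_on unit_sq (%d. if i \<in> {1..1::nat} then (1 - fst d) *\<^sub>R q (snd d) 1 + fst d *\<^sub>R w 1 else undefined)" for i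
   by (cases "i \<in> {1..1}") (simp_all only: if_True if_False simp_thms continuous_on_const)
  thus "continuous_on unit_sq ?h"
   unfolding case_prod_unfold restrict_def by (intro continuous_on_coordinatewise_then_product)
  show "?h \<in> unit_sq \<rightarrow> Conf 1" using hC by blast
  show "?h (0, s) = q s" "?h (1, s) = w" if "s \<in> {0..1}" for s
   by (rule eq[OF hC]; use qC[OF that] w(1) in simp)+
  show "pathstart (?h \<circ> Pair t) = pathstart q" "pathfinish (?h \<circ> Pair t) = pathfinish q" for t
   unfolding pathstart_def pathfinish_def comp_def w(2,3)
   by (rule eq[OF hC w(1)]; simp add: w(2,3) algebra_simps flip: scaleR_add_left)+
 qed
qed

text \<open>The values of \<open>\<theta>\<close> are prescribed on loops representing some
  \<open>A\<close>. Both sides are additive, and composing with such loops or their inverses lowers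
  the total winding, so a loop without winding remains. If there are at least two points, composing
  that loop with a representative of \<open>A\<close> with indices 1 and 2 gives another
  representative of the same generator, with the same value; hence its own value is zero.\<close>

theorem inf_pure_braid_action_winding:
 assumes \<theta>: "inf_pure_braid_action n w \<theta>" and w: "w \<in> Conf n" and k: "k \<in> {1..n}" and q: "q \<in> loops (Conf n) w"
 shows "\<theta> (lcs_degree_one (fundamental_group (Conf n) w) (loop_class (Conf n) q)) (fl_gen k) =
  fl_br (fl_gen k) (\<Sum>j\<in>{1..n} - {k}. zscale (pair_winding q j k) (fl_gen j))"
proof -
 note One_nat_def [simp del]
 let ?G = "fundamental_group (Conf n) w" and ?F = "free_lie {1..n} :: nat free_lie ring"
 interpret G: group ?G by (rule pi1_group[OF w])
 interpret L: lie_ring "lcs_lie ?G" by (rule G.lcs_lie_lie_ring)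
 have \<theta>h: "\<theta> \<in> lie_hom (lcs_lie ?G) (Der ?F)" using \<theta> by (simp add: inf_pure_braid_action_def)
 define D where "D q = \<theta> (lcs_degree_one ?G (loop_class (Conf n) q)) (fl_gen k)" for q
 define R where "R q = fl_br (fl_gen k) (\<Sum>j\<in>{1..n} - {k}. zscale (pair_winding q j k) (fl_gen j))" for q
 have gk: "fl_gen k \<in> carrier ?F" using k by simp
 have cls: "loop_class (Conf n) q \<in> carrier ?G" if "q \<in> loops (Conf n) w" for q
  using that by (simp add: pi1_carrier)
 have D_join: "D (q +++ r) = D q + D r" if "q \<in> loops (Conf n) w" "r \<in> loops (Conf n) w" for q r
 proof -
  have "loop_class (Conf n) (q +++ r) = loop_class (Conf n) q \<otimes>\<^bsub>?G\<^esub> loop_class (Conf n) r"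
   using that by (simp add: pi1_mult loops_iff)
  hence "D (q +++ r) = \<theta> (lcs_degree_one ?G (loop_class (Conf n) q) \<oplus>\<^bsub>lcs_lie ?G\<^esub> lcs_degree_one ?G (loop_class (Conf n) r)) (fl_gen k)"
   using that cls by (simp add: D_def G.lcs_degree_one_mult)
  also have "... = D q + D r"
   using lie_homD(2)[OF \<theta>h] that cls gk by (simp add: G.lcs_degree_one_closed Der_simps D_def)
  finally show ?thesis .
 qed
 have D_one: "D (%_. w) = 0"
 proof -
  have "D ((%_. w) +++ (%_. w)) = D (%_. w) + D (%_. w)" using w by (intro D_join) (simp_all add: loops_iff)
  moreover have "(%_. w) +++ (%_. w) = (%_. w)" by (simp add: joinpaths_def)
  ultimately show ?thesis by simp
 qed
 have D_rev: "D (reversepath q) = - D q" if q: "q \<in> loops (Conf n) w" for q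
 proof -
  have "loop_class (Conf n) (q +++ reversepath q) = loop_class (Conf n) (%_. w)"
   using q by (intro loop_class_eqI homotopic_paths_inverse_right) (simp_all add: loops_iff)
  hence "D (q +++ reversepath q) = 0" using D_one by (simp add: D_def)
  thus ?thesis using D_join[OF q, of "reversepath q"] q by (simp add: loops_iff add_eq_0_iff)
 qed
 have R_join: "R (q +++ r) = R q + R r" if "q \<in> loops (Conf n) w" "r \<in> loops (Conf n) w" for q r
 proof -
  have "(\<Sum>j\<in>{1..n} - {k}. zscale (pair_winding (q +++ r) j k) (fl_gen j)) =
    (\<Sum>j\<in>{1..n} - {k}. zscale (pair_winding q j k) (fl_gen j) + zscale (pair_winding r j k) (fl_gen j))"
   using that k by (intro sum.cong) (simp_all add: pair_winding(4) zscale_add)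
  thus ?thesis by (simp add: R_def sum.distrib fl_br_add_right)
 qed
 have R_rev: "R (reversepath q) = - R q" if q: "q \<in> loops (Conf n) w" for q
 proof -
  have "(\<Sum>j\<in>{1..n} - {k}. zscale (pair_winding (reversepath q) j k) (fl_gen j)) =
    - (\<Sum>j\<in>{1..n} - {k}. zscale (pair_winding q j k) (fl_gen j))"
   unfolding sum_negf[symmetric] using q k by (intro sum.cong) (simp_all add: pair_winding(3) zscale_neg)
  moreover have "fl_br (fl_gen k) (- v) = - fl_br (fl_gen k) v" for v :: "nat free_lie"
   using fl_br_add_right[of "fl_gen k" v "- v"] fl_br_add_right[of "fl_gen k" 0 0] by (simp add: add_eq_0_iff)
  ultimately show ?thesis by (simp add: R_def)
 qed
 have DA: "D p = (if k \<in> {i, j} then fl_br (fl_gen k) (fl_gen i + fl_gen j) else 0)"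
  if "p \<in> loops (Conf n) w" "represents_A n i j p" "1 \<le> i" "i < j" "j \<le> n" for i j p
  using \<theta> that k by (simp add: inf_pure_braid_action_def D_def plus_free_lie_def zero_free_lie_def)
 have RA: "R p = D p" if p: "p \<in> loops (Conf n) w" "represents_A n i j p" "1 \<le> i" "i < j" "j \<le> n" for i j p
 proof -
  have pw: "pair_winding p l k = (if {l, k} = {i, j} then 1 else 0)" if "l \<in> {1..n} - {k}" for l
  proof (cases "l < k")
   case True
   thus ?thesis using represents_A_pair_winding[OF p(2), of l k] that k p(4) by (auto simp: doubleton_eq_iff)
  next
   case False
   thus ?thesis using represents_A_pair_winding[OF p(2), of k l] pair_winding(2)[OF p(1), of k l] that k p(4)
    by (auto simp: doubleton_eq_iff)
  qed
  let ?S = "\<Sum>l\<in>{1..n} - {k}. zscale (pair_winding p l k) (fl_gen l) :: nat free_lie"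
  have S: "?S = (\<Sum>l\<in>{1..n} - {k}. if l = m then fl_gen m else 0)" if "!!l. l \<in> {1..n} - {k} ==> {l, k} = {i, j} \<longleftrightarrow> l = m" for m
   using that by (intro sum.cong) (simp_all add: pw)
  consider "k = i" | "k = j" | "k ~= i" "k ~= j" by blast
  thus ?thesis
  proof cases
   case 1
   have "?S = fl_gen j" using p 1 by (subst S[of j]) (auto simp: doubleton_eq_iff)
   thus ?thesis using 1 DA[OF p] by (simp add: R_def fl_br_add_right)
  next
   case 2
   have "?S = fl_gen i" using p 2 by (subst S[of i]) (auto simp: doubleton_eq_iff)
   thus ?thesis using 2 DA[OF p] by (simp add: R_def fl_br_add_right)
  next
   case 3
   have "?S = 0" using 3 by (intro sum.neutral) (auto simp: pw doubleton_eq_iff)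
   moreover have "fl_br (fl_gen k) 0 = 0" using fl_br_add_right[of "fl_gen k" 0 0] by simp
   ultimately show ?thesis using 3 DA[OF p] by (simp add: R_def)
  qed
 qed
 let ?I = "{(a, b). 1 \<le> a \<and> a < b \<and> b \<le> n}"
 have fin: "finite ?I" by (rule finite_subset[of _ "{1..n} \<times> {1..n}"]) auto
 define N where "N q = (\<Sum>(a, b)\<in>?I. nat \<bar>pair_winding q a b\<bar>)" for q
 have "D q = R q" using q
 proof (induction "N q" arbitrary: q rule: less_induct)
  case less
  show ?case
  proof (cases "\<forall>(a, b)\<in>?I. pair_winding q a b = 0")
   case True
   hence 0: "pair_winding q a b = 0" if "1 \<le> a" "a < b" "b \<le> n" for a b using that by auto
   have "pair_winding q j k = 0" if "j \<in> {1..n} - {k}" for j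
    using 0[of j k] 0[of k j] pair_winding(2)[OF less.prems, of k j] that k by (cases "j < k") auto
   hence "(\<Sum>j\<in>{1..n} - {k}. zscale (pair_winding q j k) (fl_gen j)) = (0 :: nat free_lie)"
    by (intro sum.neutral) simp
   hence R0: "R q = 0" using fl_br_add_right[of "fl_gen k" 0 0] by (simp add: R_def)
   show ?thesis
   proof (cases "n \<ge> 2")
    case True
    obtain p where p: "p \<in> loops (Conf n) w" "represents_A n 1 2 p" using represents_A_exists[OF w, of 1 2] True by auto
    have pq: "p +++ q \<in> loops (Conf n) w" using p(1) less.prems by (simp add: loops_iff)
    have "represents_A n 1 2 (p +++ q)" unfolding represents_A_def
    proof (intro allI impI)
     fix a b assume ab: "1 \<le> a \<and> a < b \<and> b \<le> n"
     thus "winding_number (%s. (p +++ q) s b - (p +++ q) s a) 0 = (if a = 1 \<and> b = 2 then 1 else 0)"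
      using pair_winding(1)[OF pq, of a b] pair_winding(4)[OF p(1) _ _ _ less.prems, of a b] 0[of a b]
       represents_A_pair_winding[OF p(2), of a b] by auto
    qed
    hence "D (p +++ q) = D p" using DA[OF pq] DA[OF p] True by simp
    thus ?thesis using D_join[OF p(1) less.prems] R0 by simp
   next
    case False
    hence "n = 1" using k by simp
    hence "loop_class (Conf n) q = loop_class (Conf n) (%_. w)"
     using Conf_one_loop_trivial[of q w] less.prems by simp
    thus ?thesis using D_one R0 by (simp add: D_def)
   qed
  next
   case False
   then obtain i j where ij: "1 \<le> i" "i < j" "j \<le> n" "pair_winding q i j ~= 0" by auto
   obtain p where p: "p \<in> loops (Conf n) w" "represents_A n i j p" using represents_A_exists[OF w ij(1-3)] by blast
   \<comment> \<open>The sign is opposite to the winding of \<open>q\<close> around this pair, so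
     that one winding number moves towards zero and the others stay.\<close>
   define r where "r = (if pair_winding q i j > 0 then reversepath p else p)"
   have r: "r \<in> loops (Conf n) w" "D r = R r"
    using p(1) RA[OF p ij(1-3)] D_rev[OF p(1)] R_rev[OF p(1)] by (auto simp: r_def loops_iff)
   have qr: "q +++ r \<in> loops (Conf n) w" using r(1) less.prems by (simp add: loops_iff)
   have pw: "pair_winding (q +++ r) a b = pair_winding q a b + (if a = i \<and> b = j then if pair_winding q i j > 0 then - 1 else 1 else 0)"
    if "1 \<le> a" "a < b" "b \<le> n" for a b
    using pair_winding(4)[OF less.prems _ _ _ r(1), of a b] pair_winding(3)[OF p(1), of a b]
     represents_A_pair_winding[OF p(2) that] that by (auto simp: r_def)
   have "N (q +++ r) < N q" unfolding N_def
   proof (rule sum_strict_mono_ex1[OF fin])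
    show "\<forall>x\<in>?I. (case x of (a, b) => nat \<bar>pair_winding (q +++ r) a b\<bar>) \<le> (case x of (a, b) => nat \<bar>pair_winding q a b\<bar>)"
     using ij(4) by (auto simp: pw)
    show "\<exists>x\<in>?I. (case x of (a, b) => nat \<bar>pair_winding (q +++ r) a b\<bar>) < (case x of (a, b) => nat \<bar>pair_winding q a b\<bar>)"
     using ij by (intro bexI[of _ "(i, j)"]) (auto simp: pw)
   qed
   from less.hyps[OF this qr] show ?thesis
    using D_join[OF less.prems r(1)] R_join[OF less.prems r(1)] r(2) by simp
  qed
 qed
 thus ?thesis by (simp add: D_def R_def)
qed

section \<open>Invariance of the lower central series Lie algebra\<close>

lemma lie_isomorphic_trans:
 assumes "lie_isomorphic K L" "lie_isomorphic L M"
 shows "lie_isomorphic K M"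
proof -
 obtain f g where f: "f \<in> lie_hom K L" "bij_betw f (carrier K) (carrier L)"
  and g: "g \<in> lie_hom L M" "bij_betw g (carrier L) (carrier M)" using assms by (auto simp: lie_isomorphic_def)
 show ?thesis using lie_hom_compose[OF f(1) g(1)] bij_betw_trans[OF f(2) g(2)] by (auto simp: lie_isomorphic_def)
qed

lemma lcs_map_inverse:
 assumes h: "group_hom G H h" and g: "group_hom H G g" and gh: "!!a. a \<in> carrier G ==> g (h a) = a"
  and x: "x \<in> carrier (lcs_lie G)"
 shows "lcs_map H G g (lcs_map G H h x) = x"
proof -
 interpret h: group_hom G H h by fact
 interpret g: group_hom H G g by fact
 show ?thesis using x
 proof (induction x rule: h.G.lcs_lie_induct)
  case zero
  thus ?case by (simp add: h.lcs_map_zero g.lcs_map_zero)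
 next
  case (homog k a)
  thus ?case
   using h.hom_lower_central by (simp add: h.lcs_map_homog g.lcs_map_homog gh)
 next
  case (add x y)
  thus ?case by (simp add: h.lcs_map_add g.lcs_map_add h.lcs_map_closed)
 qed
qed

lemma lcs_lie_iso:
 assumes G: "group G" "group H" and h: "h \<in> iso G H"
 shows "lie_isomorphic (lcs_lie G) (lcs_lie H)"
proof -
 let ?g = "inv_into (carrier G) h"
 have bij: "bij_betw h (carrier G) (carrier H)" and "h \<in> hom G H" using h by (auto simp: iso_def)
 then interpret h: group_hom G H h using G by (simp add: group_hom_def group_hom_axioms_def)
 have "?g \<in> iso H G" by (rule h.G.iso_set_sym[OF h])
 then interpret g: group_hom H G ?g using G by (simp add: group_hom_def group_hom_axioms_def iso_def)
 have "bij_betw (lcs_map G H h) (carrier (lcs_lie G)) (carrier (lcs_lie H))"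
 proof (rule bij_betw_byWitness[where f' = "lcs_map H G ?g"])
  show "\<forall>a\<in>carrier (lcs_lie G). lcs_map H G ?g (lcs_map G H h a) = a"
   using bij by (intro ballI lcs_map_inverse[OF h.group_hom_axioms g.group_hom_axioms]) (simp_all add: bij_betw_inv_into_left)
  show "\<forall>a\<in>carrier (lcs_lie H). lcs_map G H h (lcs_map H G ?g a) = a"
   using bij by (intro ballI lcs_map_inverse[OF g.group_hom_axioms h.group_hom_axioms]) (simp_all add: bij_betw_inv_into_right)
 qed (use h.lcs_map_closed g.lcs_map_closed in auto)
 thus ?thesis using h.lcs_map_lie_hom by (auto simp: lie_isomorphic_def)
qed

lemma base_point_change:
 assumes con: "path_connected S" and xy: "x \<in> S" "y \<in> S"
 shows "\<exists>h. h \<in> iso (fundamental_group S x) (fundamental_group S y)"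
proof -
 obtain c where "based_paths S y c" using based_paths_exist[OF con xy(2)] by blast
 then interpret C: based_paths S y c .
 obtain d where "based_paths S x d" using based_paths_exist[OF con xy(1)] by blast
 then interpret D: based_paths S x d .
 have cx: "path_in S (c x)" "pathstart (c x) = y" "pathfinish (c x) = x" using C.c_path[OF xy(1)] by auto
 let ?h = "%a. C.wd (SOME p. p \<in> a)"
 have h: "?h (loop_class S p) = C.wd p" if "path_in S p" for p
 proof -
  have "(SOME p'. p' \<in> loop_class S p) \<in> loop_class S p"
   using loop_class_nonempty[OF that] by (simp add: some_in_eq)
  thus ?thesis by (intro C.wd_homotopic[symmetric]) (simp add: loop_class_def)
 qed
 have wd1: "C.wd (c x) = \<one>\<^bsub>C.\<pi>\<^esub>"
 proof -
  have "homotopic_paths S ((%_. y) +++ (c x +++ reversepath (c x))) (c x +++ reversepath (c x))"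
   using cx xy by (intro homotopic_paths_const_left) simp_all
  also have "homotopic_paths S ... (%_. y)" using cx by (intro homotopic_paths_inverse_right) simp_all
  finally show ?thesis unfolding C.wd_def cx C.c_base pi1_one by (rule loop_class_eqI)
 qed
 have "?h \<in> hom D.\<pi> C.\<pi>"
 proof (rule homI)
  fix a assume "a \<in> carrier D.\<pi>"
  then obtain p where p: "p \<in> loops S x" "a = loop_class S p" by (auto simp: pi1_carrier)
  thus "?h a \<in> carrier C.\<pi>" using h[of p] by (simp add: loops_iff)
  fix b assume "b \<in> carrier D.\<pi>"
  then obtain q where q: "q \<in> loops S x" "b = loop_class S q" by (auto simp: pi1_carrier)
  show "?h (a \<otimes>\<^bsub>D.\<pi>\<^esub> b) = ?h a \<otimes>\<^bsub>C.\<pi>\<^esub> ?h b"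
   using p q h[of p] h[of q] h[of "p +++ q"] by (simp add: loops_iff pi1_mult C.wd_join)
 qed
 moreover have "inj_on ?h (carrier D.\<pi>)"
 proof (rule inj_onI)
  fix a b assume "a \<in> carrier D.\<pi>" "b \<in> carrier D.\<pi>" and e: "?h a = ?h b"
  then obtain p q where pq: "p \<in> loops S x" "a = loop_class S p" "q \<in> loops S x" "b = loop_class S q"
   by (auto simp: pi1_carrier)
  hence "loop_class S (c x +++ (p +++ reversepath (c x))) = loop_class S (c x +++ (q +++ reversepath (c x)))"
   using e h[of p] h[of q] by (simp add: C.wd_def loops_iff)
  hence "homotopic_paths S (c x +++ (p +++ reversepath (c x))) (c x +++ (q +++ reversepath (c x)))"
   using cx pq by (intro loop_class_eqD) (simp_all add: loops_iff)
  hence "D.wd (c x +++ (p +++ reversepath (c x))) = D.wd (c x +++ (q +++ reversepath (c x)))"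
   by (rule D.wd_homotopic)
  hence "D.wd (c x) \<otimes>\<^bsub>D.\<pi>\<^esub> (a \<otimes>\<^bsub>D.\<pi>\<^esub> D.wd (reversepath (c x))) = D.wd (c x) \<otimes>\<^bsub>D.\<pi>\<^esub> (b \<otimes>\<^bsub>D.\<pi>\<^esub> D.wd (reversepath (c x)))"
   using cx pq D.wd_loop[OF pq(1)] D.wd_loop[OF pq(3)] by (simp add: D.wd_join loops_iff)
  thus "a = b" using \<open>a \<in> carrier D.\<pi>\<close> \<open>b \<in> carrier D.\<pi>\<close> cx by simp
 qed
 moreover have "b \<in> ?h ` carrier D.\<pi>" if b: "b \<in> carrier C.\<pi>" for b
 proof -
  obtain q where q: "q \<in> loops S y" "b = loop_class S q" using b by (auto simp: pi1_carrier)
  let ?p = "reversepath (c x) +++ (q +++ c x)"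
  have p: "?p \<in> loops S x" using cx q by (simp add: loops_iff)
  have "C.wd ?p = b" using cx q wd1 C.wd_loop[OF q(1)] b by (simp add: C.wd_join C.wd_reverse loops_iff)
  thus ?thesis using h[of ?p] p
   by (intro image_eqI[of _ _ "loop_class S ?p"]) (auto simp: pi1_carrier loops_iff)
 qed
 ultimately have "?h \<in> iso D.\<pi> C.\<pi>" using hom_in_carrier[of ?h D.\<pi> C.\<pi>] by (auto simp: iso_def bij_betw_def)
 thus ?thesis by blast
qed

lemma homeomorphism_iso:
 assumes hom: "homeomorphism S T f g" and x: "x \<in> S"
 shows "induced_map T f \<in> iso (fundamental_group S x) (fundamental_group T (f x))"
proof -
 have f: "continuous_on S f" "f \<in> S \<rightarrow> T" and g: "continuous_on T g" "g \<in> T \<rightarrow> S"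
  and gf: "!!a. a \<in> S ==> g (f a) = a" and fg: "!!b. b \<in> T ==> f (g b) = b"
  using hom by (auto simp: homeomorphism_def)
 interpret F: group_hom "fundamental_group S x" "fundamental_group T (f x)" "induced_map T f"
  by (rule induced_map_hom[OF f x]) simp
 interpret G: group_hom "fundamental_group T (f x)" "fundamental_group S x" "induced_map S g"
  by (rule induced_map_hom[OF g]) (use f x gf in auto)
 have inv: "induced_map A k (induced_map B h a) = a"
  if h: "continuous_on A h" "h \<in> A \<rightarrow> B" and k: "continuous_on B k" "k \<in> B \<rightarrow> A" and kh: "!!a. a \<in> A ==> k (h a) = a"
   and a: "a \<in> carrier (fundamental_group A z)"
  for A :: "'c::topological_space set" and B :: "'d::topological_space set" and h k z a
 proof -
  obtain p where p: "p \<in> loops A z" "a = loop_class A p" using a by (auto simp: pi1_carrier)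
  have pA: "path_in A p" using p by (simp add: loops_iff)
  have "induced_map A k (induced_map B h a) = loop_class A (k \<circ> (h \<circ> p))"
   using induced_map_class[OF pA h] induced_map_class[OF path_in_compose[OF pA h] k] p(2) by simp
  also have "... = a" unfolding p(2)
  proof (intro loop_class_eqI[symmetric] homotopic_paths_eq)
   show "p t = (k \<circ> (h \<circ> p)) t" if "t \<in> {0..1}" for t
   proof -
    have "p t \<in> A" using pA that unfolding path_in_def path_image_def by blast
    thus ?thesis using kh[of "p t"] by simp
   qed
  qed (use pA in \<open>simp_all add: path_in_def\<close>)
  finally show ?thesis .
 qed
 have "bij_betw (induced_map T f) (carrier (fundamental_group S x)) (carrier (fundamental_group T (f x)))"
  using inv[OF f g gf] inv[OF g f fg] by (intro bij_betw_byWitness[where f' = "induced_map S g"]) auto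
 thus ?thesis using F.homh by (simp add: iso_def)
qed

theorem lcs_lie_homeomorphism:
 assumes hom: "homeomorphism S T f g" and con: "path_connected T" and xy: "x \<in> S" "y \<in> T"
 shows "lie_isomorphic (lcs_lie (fundamental_group S x)) (lcs_lie (fundamental_group T y))"
proof -
 have fx: "f x \<in> T" using hom xy by (auto simp: homeomorphism_def)
 obtain h where h: "h \<in> iso (fundamental_group T (f x)) (fundamental_group T y)"
  using base_point_change[OF con fx xy(2)] by blast
 note grp = pi1_group[OF xy(1)] pi1_group[OF fx] pi1_group[OF xy(2)]
 show ?thesis
  using lie_isomorphic_trans lcs_lie_iso[OF grp(1,2) homeomorphism_iso[OF hom xy(1)]] lcs_lie_iso[OF grp(2,3) h] .
qed

text \<open>The real part of \<open>(1 - \<i> s) c\<close> is \<open>Re c + s Im c\<close>, which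
  takes equal values at two distinct points for at most one \<open>s\<close>. Finitely many values
  are excluded; quotients with denominator 0 merely enlarge the excluded set.\<close>

lemma generic_rotation:
 fixes c :: "nat => complex"
 assumes "inj_on c {1..n}"
 obtains \<omega> where "\<omega> ~= 0" "inj_on (%i. Re (\<omega> * c i)) {1..n}"
proof -
 let ?B = "(%(i, j). (Re (c j) - Re (c i)) / (Im (c i) - Im (c j))) ` ({1..n} \<times> {1..n})"
 obtain s :: real where s: "s \<notin> ?B" using ex_new_if_finite[OF infinite_UNIV_char_0, of ?B] by auto
 show thesis
 proof (rule that)
  show "Complex 1 (- s) ~= 0" by (simp add: complex_eq_iff)
  show "inj_on (%i. Re (Complex 1 (- s) * c i)) {1..n}"
  proof (rule inj_onI)
   fix i j assume ij: "i \<in> {1..n}" "j \<in> {1..n}" and "Re (Complex 1 (- s) * c i) = Re (Complex 1 (- s) * c j)"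
   hence e: "s * (Im (c i) - Im (c j)) = Re (c j) - Re (c i)" by (simp add: algebra_simps)
   have "Im (c i) = Im (c j)"
   proof (rule ccontr)
    assume "Im (c i) ~= Im (c j)"
    hence "s = (Re (c j) - Re (c i)) / (Im (c i) - Im (c j))" using e by (simp add: field_simps)
    thus False using s ij by (auto intro!: image_eqI[of _ _ "(i, j)"])
   qed
   hence "c i = c j" using e by (simp add: complex_eq_iff)
   thus "i = j" using inj_onD[OF assms] ij by blast
  qed
 qed
qed

theorem lcs_lie_punctured_plane:
 fixes c :: "nat => complex"
 assumes c: "inj_on c {1..n}" and y: "y \<in> - c ` {1..n}"
 shows "lie_isomorphic (lcs_lie (fundamental_group (- c ` {1..n}) y)) (free_lie {1..n})"
proof -
 obtain \<omega> where \<omega>: "\<omega> ~= 0" "inj_on (%i. Re (\<omega> * c i)) {1..n}" using generic_rotation[OF c] by blast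
 define y0 where "y0 = complex_of_real (1 + (\<Sum>i\<in>{1..n}. norm (\<omega> * c i)))"
 interpret P: punctured_plane "%i. \<omega> * c i" n y0
 proof
  fix i assume i: "i \<in> {1..n}"
  have "Re (\<omega> * c i) \<le> norm (\<omega> * c i)" by (rule complex_Re_le_cmod)
  also have "... \<le> (\<Sum>i\<in>{1..n}. norm (\<omega> * c i))" using i by (intro member_le_sum) auto
  finally show "Re y0 ~= Re (\<omega> * c i)" by (simp add: y0_def)
 qed (rule \<omega>(2))
 have PF: "P.F = - (%i. \<omega> * c i) ` {1..n}" by (auto simp: P.F_def)
 have "homeomorphism (- c ` {1..n}) P.F ((*) \<omega>) ((*) (inverse \<omega>))"
 proof (rule homeomorphismI)
  show "(*) \<omega> ` (- c ` {1..n}) \<subseteq> P.F" using \<omega>(1) by (auto simp: P.F_def)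
  show "(*) (inverse \<omega>) ` P.F \<subseteq> - c ` {1..n}"
  proof
   fix z assume "z \<in> (*) (inverse \<omega>) ` P.F"
   hence "\<omega> * z \<in> P.F" using \<omega>(1) by (auto simp: mult.assoc[symmetric])
   thus "z \<in> - c ` {1..n}" by (auto simp: P.F_def)
  qed
 qed (use \<omega>(1) in \<open>auto intro!: continuous_intros simp: mult.assoc[symmetric]\<close>)
 moreover have "path_connected P.F"
  unfolding PF by (intro path_connected_complement_countable) (auto simp: countable_finite)
 ultimately have "lie_isomorphic (lcs_lie (fundamental_group (- c ` {1..n}) y)) (lcs_lie P.\<pi>)"
  by (rule lcs_lie_homeomorphism[OF _ _ y P.base])
 moreover have "lie_isomorphic (lcs_lie P.\<pi>) (free_lie {1..n})"
 proof (rule P.pi.lcs_lie_free[OF P.x_closed P.generated_by_x])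
  fix v :: "nat => int fps endo"
  show "\<exists>f\<in>hom P.\<pi> fps_units. \<forall>q\<in>{1..n}. f (P.x q) = 1 + fps_single 1 (v q)"
   by (rule P.hom_exists[OF fps_units_group]) simp
 qed
 ultimately show ?thesis by (rule lie_isomorphic_trans)
qed

section \<open>Toric arrangements and root fibrations\<close>

lemma torus_carrier:
 "t \<in> carrier (torus \<Gamma>) \<longleftrightarrow> t \<in> extensional (carrier \<Gamma>) \<and> (\<forall>a\<in>carrier \<Gamma>. t a ~= 0) \<and>
   (\<forall>a\<in>carrier \<Gamma>. \<forall>b\<in>carrier \<Gamma>. t (a \<otimes>\<^bsub>\<Gamma>\<^esub> b) = t a * t b)"
 by (auto simp: torus_def nonzero_complex_group_def hom_def)

section \<open>Coordinates on a character lattice\<close>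

locale lattice = comm_group \<Gamma> for \<Gamma> :: "'g monoid" (structure) +
 fixes j :: nat and e :: "nat => 'g"
 assumes basis: "lattice_basis \<Gamma> j e" and j: "1 \<le> j"
begin

definition lin :: "(nat => int) => 'g" where "lin c = (\<Otimes>i\<in>{1..j}. e i [^] c i)"

lemma e_closed: "i \<in> {1..j} ==> e i \<in> carrier \<Gamma>"
 using basis by (auto simp: lattice_basis_def)

lemma lin_add: "lin (%i. c i + d i) = lin c \<otimes> lin d"
proof -
 have "lin (%i. c i + d i) = (\<Otimes>i\<in>{1..j}. e i [^] c i \<otimes> e i [^] d i)"
  unfolding lin_def using e_closed by (intro finprod_cong) (auto simp: int_pow_mult simp_implies_def)
 also have "... = lin c \<otimes> lin d" unfolding lin_def using e_closed by (intro finprod_multf) auto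
 finally show ?thesis .
qed

lemma lin_cong: "(!!i. i \<in> {1..j} ==> c i = d i) ==> lin c = lin d"
 unfolding lin_def using e_closed by (intro finprod_cong) (auto simp: simp_implies_def)

lemma lin_inj: "lin c = lin d ==> i \<in> {1..j} ==> c i = d i"
proof -
 assume cd: "lin c = lin d" and i: "i \<in> {1..j}"
 have "lin (restrict c {1..j}) = lin (restrict d {1..j})"
  using cd lin_cong[of "restrict c {1..j}" c] lin_cong[of "restrict d {1..j}" d] by simp
 moreover have "inj_on lin ({1..j} \<rightarrow>\<^sub>E UNIV)"
  using basis unfolding lattice_basis_def bij_betw_def lin_def[abs_def] by blast
 ultimately have "restrict c {1..j} = restrict d {1..j}" by (auto dest!: inj_onD)
 thus "c i = d i" using i by (metis restrict_apply')
qed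

lemma lin_surj: "a \<in> carrier \<Gamma> ==> \<exists>c. a = lin c"
 using basis by (auto simp: lattice_basis_def lin_def bij_betw_def)

lemma lin_unit: "i \<in> {1..j} ==> lin (%k. if k = i then 1 else 0) = e i"
proof -
 assume i: "i \<in> {1..j}"
 have "lin (%k. if k = i then 1 else 0) = (\<Otimes>k\<in>{1..j}. if i = k then e k else \<one>)"
  unfolding lin_def using e_closed by (intro finprod_cong) (auto simp: simp_implies_def)
 also have "... = e i" using i e_closed by (intro finprod_singleton) auto
 finally show ?thesis .
qed

text \<open>The exponent of \<open>e j\<close>, the direction complementary to \<open>K\<close>. The
  chosen \<open>c\<close> is determined only on \<open>{1..j}\<close>, which contains
  \<open>j\<close>.\<close>

definition lst :: "'g => int" where "lst a = (SOME c. a = lin c) j"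

lemma lst_lin: "lst (lin c) = c j"
proof -
 have "lin c = lin (SOME d. lin c = lin d)" by (rule someI[of _ c]) simp
 from lin_inj[OF this] j show ?thesis by (simp add: lst_def)
qed

lemma lst_mult: "a \<in> carrier \<Gamma> ==> b \<in> carrier \<Gamma> ==> lst (a \<otimes> b) = lst a + lst b"
 using lin_surj[of a] lin_surj[of b] by (auto simp: lst_lin simp flip: lin_add)

lemma lst_e: "i \<in> {1..j} ==> lst (e i) = (if i = j then 1 else 0)"
 using lst_lin[of "%k. if k = i then 1 else 0"] lin_unit[of i] by auto

lemma lst_inv: "a \<in> carrier \<Gamma> ==> lst (inv a) = - lst a"
 using lst_mult[of a "inv a"] lst_mult[of \<one> \<one>] by simp

lemma lst_pow: "a \<in> carrier \<Gamma> ==> lst (a [^] (m::int)) = m * lst a"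
proof -
 assume a: "a \<in> carrier \<Gamma>"
 have nat: "lst (a [^] (k::nat)) = int k * lst a" for k
 proof (induction k)
  case 0 thus ?case using lst_mult[of \<one> \<one>] by simp
 next
  case (Suc k) thus ?case using a by (simp add: lst_mult distrib_right)
 qed
 show ?thesis
 proof (cases m rule: int_cases2)
  case (nonneg k) thus ?thesis using nat[of k] by (simp add: int_pow_int)
 next
  case (nonpos k) thus ?thesis using nat[of k] a by (simp add: int_pow_neg_int lst_inv)
 qed
qed

end

lemma torus_powi:
 assumes "group \<Gamma>" "t \<in> carrier (torus \<Gamma>)" "a \<in> carrier \<Gamma>"
 shows "t (a [^]\<^bsub>\<Gamma>\<^esub> (m::int)) = t a powi m" "t \<one>\<^bsub>\<Gamma>\<^esub> = 1"
proof -
 interpret group \<Gamma> by fact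
 have mult: "t (b \<otimes>\<^bsub>\<Gamma>\<^esub> c) = t b * t c" "t b ~= 0" if "b \<in> carrier \<Gamma>" "c \<in> carrier \<Gamma>" for b c
  using assms(2) that by (auto simp: torus_carrier)
 show one: "t \<one>\<^bsub>\<Gamma>\<^esub> = 1" using mult(1)[of "\<one>\<^bsub>\<Gamma>\<^esub>" "\<one>\<^bsub>\<Gamma>\<^esub>"] mult(2)[of "\<one>\<^bsub>\<Gamma>\<^esub>" "\<one>\<^bsub>\<Gamma>\<^esub>"] by simp
 have nat: "t (a [^]\<^bsub>\<Gamma>\<^esub> (k::nat)) = t a ^ k" for k
  by (induction k) (simp_all add: one mult assms(3) mult.commute)
 have inv: "t (inv\<^bsub>\<Gamma>\<^esub> b) = inverse (t b)" if "b \<in> carrier \<Gamma>" for b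
  using mult(1)[of b "inv\<^bsub>\<Gamma>\<^esub> b"] that one by (intro inverse_unique[symmetric]) simp
 show "t (a [^]\<^bsub>\<Gamma>\<^esub> m) = t a powi m"
  using assms(3) by (cases m rule: int_cases2) (simp_all add: int_pow_int int_pow_neg_int nat inv power_int_minus)
qed

section \<open>One step of the tower: the complement as a root fibration\<close>

locale toric_step = lattice \<Gamma> j e for \<Gamma> :: "'g monoid" (structure) and j e +
 fixes K :: "'g set" and Y :: "('g => complex) set" and \<A> :: "('g => complex) set set"
  and n :: nat and \<mu> :: "nat => complex" and m :: "nat => nat => int"
 assumes adm: "admissible \<Gamma> K Y" and coord: "adapted_coordinates \<Gamma> j Y e"
  and TM: "TM_ideal \<Gamma> Y \<A>" and roots: "root_presentation \<Gamma> j Y \<A> n e \<mu> m"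
begin

abbreviation "T \<equiv> carrier (torus \<Gamma>)"
abbreviation "\<Gamma>' \<equiv> \<Gamma>\<lparr>carrier := K\<rparr>"
abbreviation "T' \<equiv> carrier (torus \<Gamma>')"
abbreviation "\<A>Y \<equiv> subarrangement \<Gamma> Y \<A>"
abbreviation "\<A>' \<equiv> quotient_arrangement \<Gamma> K Y \<A>"
abbreviation "M \<equiv> arr_complement \<Gamma> \<A>"
abbreviation "M' \<equiv> arr_complement \<Gamma>' \<A>'"
abbreviation "b \<equiv> root_map j n e \<mu> m"

lemma K: "subgroup K \<Gamma>" "Y = {t \<in> T. \<forall>a\<in>K. t a = 1}"
 using adm by (auto simp: admissible_def)

lemma K_closed: "a \<in> K ==> a \<in> carrier \<Gamma>"
 using subgroup.subset[OF K(1)] by blast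

text \<open>\<open>K\<close> and the basis are linked only through the subgroup \<open>Y\<close>.
  The point of the torus that sends \<open>a\<close> to the power of 2 with exponent
  \<open>lst a\<close> lies in \<open>Y\<close>, so it is trivial on \<open>K\<close>, and 2 has
  infinite order.\<close>

lemma lst_K: assumes "a \<in> K" shows "lst a = 0"
proof -
 define t where "t = (\<lambda>a\<in>carrier \<Gamma>. (2::complex) powi lst a)"
 have tT: "t \<in> T" by (auto simp: torus_carrier t_def lst_mult power_int_add)
 moreover have "t (e k) = 1" if "k \<in> {1..<j}" for k
  using that e_closed[of k] lst_e[of k] by (simp add: t_def)
 ultimately have "t \<in> Y" using coord by (simp add: adapted_coordinates_def)
 hence "t a = 1" using assms K(2) by blast
 hence "(2::complex) powi lst a = 1" using K_closed[OF assms] by (simp add: t_def)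
 hence "norm ((2::complex) powi lst a) = 1" by simp
 hence one: "(2::real) powi lst a = 1" by (simp add: norm_power_int)
 have pow: "k = 0" if "(2::real) ^ k = 1" for k using power_inject_exp[of "2::real" k 0] that by simp
 show ?thesis
  using one by (cases "lst a" rule: int_cases2) (auto simp: power_int_minus dest!: pow)
qed

text \<open>Writing \<open>a = g i \<otimes> k\<close>, with \<open>g 1\<close> a generator of the
  complement \<open>L\<close>, gives \<open>lst a = i * lst (g 1)\<close>. The factor
  \<open>lst (g 1)\<close> is nonzero because \<open>lst (e j) = 1\<close>, so \<open>i = 0\<close>.
  Thus \<open>K\<close> is the kernel of \<open>lst\<close>.\<close>

lemma K_lst: assumes a: "a \<in> carrier \<Gamma>" "lst a = 0" shows "a \<in> K"
proof -
 obtain L where L: "subgroup L \<Gamma>" "L <#> K = carrier \<Gamma>" "\<Gamma>\<lparr>carrier := L\<rparr> \<cong> integer_group"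
  using adm by (auto simp: admissible_def)
 then obtain \<phi> where \<phi>: "\<phi> \<in> iso (\<Gamma>\<lparr>carrier := L\<rparr>) integer_group" by (auto simp: is_iso_def)
 have Lc: "l \<in> carrier \<Gamma>" if "l \<in> L" for l using subgroup.subset[OF L(1)] that by blast
 interpret GL: group "\<Gamma>\<lparr>carrier := L\<rparr>" by (rule subgroup.subgroup_is_group[OF L(1) is_group])
 have h: "\<phi> (x \<otimes> y) = \<phi> x + \<phi> y" if "x \<in> L" "y \<in> L" for x y
  using \<phi> that by (auto simp: iso_def hom_def)
 have bij: "bij_betw \<phi> L UNIV" using \<phi> by (simp add: iso_def)
 define g where "g = inv_into L \<phi>"
 have g: "g i \<in> L" "\<phi> (g i) = i" for i
  using bij unfolding g_def by (auto simp: bij_betw_def intro: inv_into_into f_inv_into_f)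
 have gl: "g (\<phi> l) = l" if "l \<in> L" for l using bij that by (simp add: g_def bij_betw_inv_into_left)
 have g_add: "g (i + k) = g i \<otimes> g k" for i k
  using gl[of "g i \<otimes> g k"] h[of "g i" "g k"] g subgroup.m_closed[OF L(1)] by simp
 have lg_add: "lst (g (i + k)) = lst (g i) + lst (g k)" for i k using g Lc by (simp add: g_add lst_mult)
 have lg: "lst (g i) = i * lst (g 1)" for i
 proof (induction i rule: int_induct[of _ 0])
  case base thus ?case using lg_add[of 0 0] by simp
 next
  case (step1 i) thus ?case using lg_add[of i 1] by (simp add: algebra_simps)
 next
  case (step2 i) thus ?case using lg_add[of "i - 1" 1] by (simp add: algebra_simps)
 qed
 have dec: "\<exists>i. \<exists>k\<in>K. c = g i \<otimes> k \<and> lst c = i * lst (g 1)" if c: "c \<in> carrier \<Gamma>" for c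
 proof -
  obtain l k where lk: "l \<in> L" "k \<in> K" "c = l \<otimes> k" using c unfolding L(2)[symmetric] set_mult_def by blast
  hence "c = g (\<phi> l) \<otimes> k" "lst c = \<phi> l * lst (g 1)"
   using gl[OF lk(1)] lg[of "\<phi> l"] Lc K_closed lst_K by (simp_all add: lst_mult)
  thus ?thesis using lk(2) by blast
 qed
 have "lst (g 1) ~= 0"
 proof
  assume "lst (g 1) = 0"
  hence "lst (e j) = 0" using dec[of "e j"] e_closed[of j] j by auto
  thus False using lst_e[of j] j by simp
 qed
 moreover obtain i k where ik: "k \<in> K" "a = g i \<otimes> k" "lst a = i * lst (g 1)" using dec[OF a(1)] by blast
 ultimately have "i = 0" using a(2) by simp
 moreover have "g 0 = \<one>"
  using g_add[of 0 0] g(1)[of 0] Lc[of "g 0"] by (simp add: l_cancel_one)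
 ultimately show ?thesis using ik K_closed by simp
qed

lemma e_K: "k \<in> {1..<j} ==> e k \<in> K"
 using e_closed[of k] lst_e[of k] by (intro K_lst) auto

text \<open>The projection onto \<open>K\<close> along \<open>e j\<close>; together with
  \<open>lst\<close> it splits the lattice.\<close>

definition kap :: "'g => 'g" where "kap a = a \<otimes> e j [^] (- lst a)"

lemma ej: "e j \<in> carrier \<Gamma>" "lst (e j) = 1"
 using e_closed[of j] lst_e[of j] j by auto

lemma kap_K: "a \<in> carrier \<Gamma> ==> kap a \<in> K"
 unfolding kap_def using ej by (intro K_lst) (simp_all add: lst_mult lst_pow)

lemma kap_mult: "a \<in> carrier \<Gamma> ==> c \<in> carrier \<Gamma> ==> kap (a \<otimes> c) = kap a \<otimes> kap c"
proof -
 assume ac: "a \<in> carrier \<Gamma>" "c \<in> carrier \<Gamma>"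
 have "e j [^] (- lst (a \<otimes> c)) = e j [^] (- lst a) \<otimes> e j [^] (- lst c)"
  using ac ej by (simp add: lst_mult flip: int_pow_mult)
 thus ?thesis unfolding kap_def using ac ej by (simp add: m_ac)
qed

lemma kap_inverse: "a \<in> carrier \<Gamma> ==> kap a \<otimes> e j [^] lst a = a"
 unfolding kap_def using ej by (simp add: m_assoc flip: int_pow_mult)

lemma kap_id: "a \<in> K ==> kap a = a"
 unfolding kap_def using K_closed lst_K by simp

lemma kap_e: "kap (e j) = \<one>"
 unfolding kap_def using ej by (simp add: int_pow_neg)

lemma T'_iff: "s \<in> T' \<longleftrightarrow> s \<in> extensional K \<and> (\<forall>a\<in>K. s a ~= 0) \<and> (\<forall>a\<in>K. \<forall>b\<in>K. s (a \<otimes> b) = s a * s b)"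
 by (simp add: torus_carrier)

lemma restrict_T': "t \<in> T ==> restrict t K \<in> T'"
 using subgroup.m_closed[OF K(1)] K_closed by (auto simp: torus_carrier)

text \<open>The point of the torus with restriction \<open>s\<close> to \<open>K\<close> and last
  coordinate \<open>y\<close>. It inverts the trivialisation of the projection along
  \<open>Y\<close>.\<close>

definition ext :: "('g => complex) => complex => 'g => complex" where
 "ext s y = (\<lambda>a\<in>carrier \<Gamma>. s (kap a) * y powi lst a)"

lemma ext_T: "s \<in> T' ==> y ~= 0 ==> ext s y \<in> T"
 by (auto simp: torus_carrier ext_def kap_K kap_mult lst_mult power_int_add)

lemma restrict_ext: "s \<in> T' ==> restrict (ext s y) K = s"
 by (intro extensionalityI[of _ K]) (auto simp: T'_iff ext_def K_closed kap_id lst_K)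

lemma ext_e: "s \<in> T' ==> ext s y (e j) = y"
proof -
 assume s: "s \<in> T'"
 have "s (\<one> \<otimes> \<one>) = s \<one> * s \<one>" "s \<one> ~= 0" using s subgroup.one_closed[OF K(1)] unfolding T'_iff by blast+
 thus ?thesis by (simp add: ext_def ej kap_e)
qed

lemma ext_restrict: "t \<in> T ==> ext (restrict t K) (t (e j)) = t"
proof -
 assume t: "t \<in> T"
 show ?thesis
 proof (rule extensionalityI[of _ "carrier \<Gamma>"])
  fix a assume a: "a \<in> carrier \<Gamma>"
  have "t a = t (kap a \<otimes> e j [^] lst a)" using kap_inverse[OF a] by simp
  also have "... = t (kap a) * t (e j) powi lst a"
   using t a ej K_closed[OF kap_K[OF a]] torus_powi(1)[OF is_group t ej(1)] by (simp add: torus_carrier)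
  finally show "ext (restrict t K) (t (e j)) a = t a" using a by (simp add: ext_def kap_K)
 qed (use t in \<open>auto simp: ext_def torus_carrier\<close>)
qed

text \<open>Two points with the same restriction to \<open>K\<close> differ by an element of
  \<open>Y\<close>, so a union of cosets of \<open>Y\<close> contains both or neither.\<close>

lemma saturated:
 assumes H: "H \<in> \<A>Y" and t: "t \<in> T" and eq: "restrict t K \<in> (%t. restrict t K) ` H"
 shows "t \<in> H"
proof -
 obtain t' where t': "t' \<in> H" "restrict t K = restrict t' K" using eq by blast
 obtain C where C: "C \<subseteq> rcosets\<^bsub>torus \<Gamma>\<^esub> Y" "H = \<Union>C" using H by (auto simp: subarrangement_def)
 then obtain a where a: "a \<in> T" "Y #>\<^bsub>torus \<Gamma>\<^esub> a \<in> C" "t' \<in> Y #>\<^bsub>torus \<Gamma>\<^esub> a" using t'(1) by (auto simp: RCOSETS_def)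
 then obtain y where y: "y \<in> Y" "t' = y \<otimes>\<^bsub>torus \<Gamma>\<^esub> a" by (auto simp: r_coset_def)
 define z where "z = (\<lambda>c\<in>carrier \<Gamma>. t c / a c)"
 have "z \<in> T" using t a(1) by (auto simp: z_def torus_carrier)
 moreover have "z c = 1" if c: "c \<in> K" for c
 proof -
  have "t c = t' c" using t'(2) c by (metis restrict_apply')
  also have "t' c = y c * a c" using y(2) K_closed[OF c] by (simp add: torus_def)
  also have "y c = 1" using y(1) K(2) c by blast
  finally show ?thesis using a(1) K_closed[OF c] by (simp add: z_def torus_carrier)
 qed
 ultimately have "z \<in> Y" using K(2) by blast
 moreover have "t = z \<otimes>\<^bsub>torus \<Gamma>\<^esub> a"
 proof -
  have "z \<otimes>\<^bsub>torus \<Gamma>\<^esub> a = (\<lambda>c\<in>carrier \<Gamma>. z c * a c)" by (simp add: torus_def)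
  thus ?thesis using t a(1)
   by (intro extensionalityI[of _ "carrier \<Gamma>"]) (auto simp: torus_carrier z_def)
 qed
 ultimately have "t \<in> Y #>\<^bsub>torus \<Gamma>\<^esub> a" by (auto simp: r_coset_def)
 thus ?thesis using a(2) C(2) by blast
qed

lemma Union_\<A>Y: "t \<in> T ==> t \<in> \<Union>\<A>Y \<longleftrightarrow> restrict t K \<in> \<Union>\<A>'"
 using saturated by (auto simp: quotient_arrangement_def)

lemma card_quotient: "card \<A>' = card \<A>Y"
 unfolding quotient_arrangement_def
proof (rule card_image, rule inj_onI)
 fix H1 H2 assume H: "H1 \<in> \<A>Y" "H2 \<in> \<A>Y" "(%t. restrict t K) ` H1 = (%t. restrict t K) ` H2"
 have sub: "H \<subseteq> T" if H: "H \<in> \<A>Y" for H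
 proof
  fix t assume "t \<in> H"
  moreover obtain C where "C \<subseteq> rcosets\<^bsub>torus \<Gamma>\<^esub> Y" "H = \<Union>C" using H by (auto simp: subarrangement_def)
  ultimately obtain a y where "a \<in> T" "y \<in> Y" "t = y \<otimes>\<^bsub>torus \<Gamma>\<^esub> a" by (auto simp: RCOSETS_def r_coset_def)
  moreover from this have "y \<in> T" using K(2) by blast
  ultimately show "t \<in> T" by (auto simp: torus_carrier) (auto simp: torus_def)
 qed
 have "t \<in> H2" if "t \<in> H1" for t using saturated[OF H(2), of t] sub[OF H(1)] that unfolding H(3)[symmetric] by blast
 moreover have "t \<in> H1" if "t \<in> H2" for t using saturated[OF H(1), of t] sub[OF H(2)] that unfolding H(3) by blast
 ultimately show "H1 = H2" by blast
qed

abbreviation "rt i \<equiv> root_monomial j e (\<mu> i) (m i)"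

lemma rt_restrict: "t \<in> T ==> rt i (restrict t K) = rt i t"
 unfolding root_monomial_def using e_K by simp

lemma rt_nonzero: "s \<in> T' ==> i \<in> {1..n - 1} ==> rt i s ~= 0"
proof -
 assume s: "s \<in> T'" and i: "i \<in> {1..n - 1}"
 have "\<exists>N>0. \<mu> i ^ N = 1" using roots i unfolding root_presentation_def by blast
 then obtain N where "N > 0" "\<mu> i ^ N = 1" by blast
 hence "\<mu> i ~= 0" by (auto simp: power_0_left)
 moreover have "s (e k) powi m i k ~= 0" if "k \<in> {1..<j}" for k using s e_K[OF that] by (auto simp: T'_iff)
 ultimately show ?thesis by (auto simp: root_monomial_def)
qed

lemma transversal: "\<A> - \<A>Y = (%i. {t \<in> T. t (e j) = rt i t}) ` {1..n - 1}"
 "inj_on (%i. {t \<in> T. t (e j) = rt i t}) {1..n - 1}"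
 using roots by (auto simp: root_presentation_def bij_betw_def)

lemma M_iff: "t \<in> M \<longleftrightarrow> t \<in> T \<and> restrict t K \<in> M' \<and> (\<forall>i\<in>{1..n - 1}. t (e j) ~= rt i (restrict t K))"
proof (cases "t \<in> T")
 case True
 have "\<A>Y \<subseteq> \<A>" by (auto simp: subarrangement_def)
 hence "t \<in> \<Union>\<A> \<longleftrightarrow> t \<in> \<Union>\<A>Y \<or> t \<in> \<Union>(\<A> - \<A>Y)" by blast
 also have "t \<in> \<Union>(\<A> - \<A>Y) \<longleftrightarrow> (\<exists>i\<in>{1..n - 1}. t (e j) = rt i t)"
  unfolding transversal(1) using True by blast
 finally show ?thesis
  using True Union_\<A>Y[OF True] restrict_T'[OF True] rt_restrict[OF True] by (auto simp: arr_complement_def)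
qed (simp add: arr_complement_def)

text \<open>If two roots coincided over \<open>s\<close>, the point above would lie on two distinct
  members outside \<open>\<A>Y\<close>. The TM condition puts the component of their intersection
  through that point into a member of \<open>\<A>Y\<close>, and then \<open>s\<close> would lie on
  the quotient arrangement.\<close>

lemma rt_distinct:
 assumes s: "s \<in> M'" and ik: "i \<in> {1..n - 1}" "k \<in> {1..n - 1}" "i ~= k"
 shows "rt i s ~= rt k s"
proof
 assume eq: "rt i s = rt k s"
 have sT: "s \<in> T'" using s by (simp add: arr_complement_def)
 define t where "t = ext s (rt i s)"
 have t: "t \<in> T" "restrict t K = s" "t (e j) = rt i s"
  using sT rt_nonzero[OF sT ik(1)] by (simp_all add: t_def ext_T restrict_ext ext_e)
 let ?H = "%i. {t \<in> T. t (e j) = rt i t}"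
 have H: "?H i \<in> \<A> - \<A>Y" "?H k \<in> \<A> - \<A>Y" "?H i ~= ?H k"
  using ik inj_onD[OF transversal(2)] by (auto simp: transversal(1))
 have tH: "t \<in> ?H i \<inter> ?H k" using t eq rt_restrict[OF t(1)] by auto
 let ?X = "connected_component_set (?H i \<inter> ?H k) t"
 have "?X \<in> components (?H i \<inter> ?H k)" using tH by (rule componentsI)
 with bspec[OF mp[OF bspec[OF bspec[OF conjunct1[OF TM[unfolded TM_ideal_def]] H(1)] H(2)] H(3)]]
 obtain H3 where "H3 \<in> \<A>Y" "?X \<subseteq> H3" by meson
 moreover have "t \<in> ?X" unfolding mem_Collect_eq connected_component_refl_eq by (rule tH)
 ultimately have "t \<in> \<Union>\<A>Y" by blast
 hence "s \<in> \<Union>\<A>'" using Union_\<A>Y[OF t(1)] t(2) by simp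
 thus False using s by (simp add: arr_complement_def)
qed

lemma b_simps: "i \<in> {1..n} ==> b s i = (if i = 1 then 0 else rt (i - 1) s)"
 by (simp add: root_map_def)

lemma b_distinct: "s \<in> M' ==> i \<in> {1..n} ==> k \<in> {1..n} ==> i ~= k ==> b s i ~= b s k"
proof -
 assume a: "s \<in> M'" "i \<in> {1..n}" "k \<in> {1..n}" "i ~= k"
 hence sT: "s \<in> T'" by (simp add: arr_complement_def)
 have pred: "l - 1 \<in> {1..n - 1}" if "l \<in> {1..n}" "l ~= 1" for l using that by auto
 show ?thesis
 proof (cases "i = 1"; cases "k = 1")
  assume "i ~= 1" "k ~= 1"
  moreover from this have "i - 1 ~= k - 1" using a by auto
  ultimately show ?thesis using rt_distinct[OF a(1) pred[OF a(2)] pred[OF a(3)]] b_simps[OF a(2)] b_simps[OF a(3)] by simp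
 next
  assume "i = 1" "k ~= 1"
  thus ?thesis using rt_nonzero[OF sT pred[OF a(3)]] b_simps[OF a(2)] b_simps[OF a(3)] by simp
 next
  assume "i ~= 1" "k = 1"
  thus ?thesis using rt_nonzero[OF sT pred[OF a(2)]] b_simps[OF a(2)] b_simps[OF a(3)] by simp
 qed (use a in simp)
qed

lemma b_Conf: "s \<in> M' ==> b s \<in> Conf n"
 unfolding Conf_def
proof (intro CollectI conjI inj_onI)
 show "b s \<in> extensional {1..n}" by (simp add: root_map_def)
qed (use b_distinct in blast)

lemma rt_continuous: "continuous_on M' (rt i)"
proof -
 have "continuous_on M' (%s. s (e k) powi m i k)" if k: "k \<in> {1..<j}" for k
 proof (rule continuous_on_power_int)
  show "continuous_on M' (%s. s (e k))" by (rule continuous_on_coordinate)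
 qed (use e_K[OF k] in \<open>auto simp: arr_complement_def T'_iff\<close>)
 thus ?thesis unfolding root_monomial_def[abs_def]
  by (intro continuous_on_mult continuous_on_const continuous_on_prod) blast
qed

lemma b_continuous: "continuous_on M' b"
proof (rule continuous_on_coordinatewise_then_product)
 fix i show "continuous_on M' (%s. b s i)"
  using rt_continuous[of "i - 1"] by (cases "i \<in> {1..n}"; cases "i = 1") (auto simp: root_map_def)
qed

context
 fixes \<omega> :: complex
 assumes \<omega>: "\<omega> ~= 0" and n: "1 \<le> n"
begin

lemma fibration: "root_fibration M' (%i s. \<omega> * b s i) n"
proof
 fix i assume "i \<in> {1..n}"
 show "continuous_on M' (%s. \<omega> * b s i)"
  by (intro continuous_intros continuous_on_product_then_coordinatewise[OF b_continuous])
qed (use \<omega> b_distinct in auto)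

text \<open>The first root is 0 and expresses that the last coordinate is nonzero; the others
  express that the point avoids the members outside \<open>\<A>Y\<close>. The factor
  \<open>\<omega>\<close> only rescales the fibre.\<close>

lemma complement_homeomorphism:
 "homeomorphism M (root_fibration.E M' (%i s. \<omega> * b s i) n)
   (%t. (restrict t K, \<omega> * t (e j))) (%(s, y). ext s (y / \<omega>))"
proof -
 interpret R: root_fibration M' "%i s. \<omega> * b s i" n by (rule fibration)
 have nz: "t (e j) ~= 0" if "t \<in> T" for t using that ej by (auto simp: torus_carrier)
 have E: "(s, y) \<in> R.E \<longleftrightarrow> s \<in> M' \<and> y ~= 0 \<and> (\<forall>i\<in>{1..n - 1}. y / \<omega> ~= rt i s)" for s y
 proof -
  have "(\<forall>i\<in>{1..n}. y ~= \<omega> * b s i) \<longleftrightarrow> y ~= 0 \<and> (\<forall>i\<in>{1..n - 1}. y ~= \<omega> * rt i s)"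
  proof (intro iffI conjI ballI)
   assume a: "\<forall>i\<in>{1..n}. y ~= \<omega> * b s i"
   show "y ~= 0" using bspec[OF a, of 1] n by (simp add: b_simps)
   show "y ~= \<omega> * rt i s" if "i \<in> {1..n - 1}" for i
   proof -
    have "Suc i \<in> {1..n}" using that n unfolding atLeastAtMost_iff by linarith
    from bspec[OF a this] this that show ?thesis by (simp add: b_simps)
   qed
  next
   fix i assume a: "y ~= 0 \<and> (\<forall>i\<in>{1..n - 1}. y ~= \<omega> * rt i s)" and i: "i \<in> {1..n}"
   show "y ~= \<omega> * b s i"
   proof (cases "i = 1")
    case False
    hence "i - 1 \<in> {1..n - 1}" using i by auto
    thus ?thesis using a False b_simps[OF i] by auto
   qed (use a b_simps[OF i] in simp)
  qed
  thus ?thesis using \<omega> by (auto simp: R.E_def field_simps)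
 qed
 have M'T: "s \<in> T'" if "s \<in> M'" for s using that by (simp add: arr_complement_def)
 show ?thesis
 proof (rule homeomorphismI)
  have "continuous_on M (%t. restrict t K a)" for a
   by (cases "a \<in> K") (auto intro: continuous_on_subset[OF continuous_on_product_coordinates])
  hence "continuous_on M (%t. restrict t K)" by (rule continuous_on_coordinatewise_then_product)
  moreover have "continuous_on M (%t. t (e j))" by (rule continuous_on_coordinate)
  ultimately show "continuous_on M (%t. (restrict t K, \<omega> * t (e j)))"
   by (intro continuous_on_Pair continuous_on_mult continuous_on_const)
  show "continuous_on R.E (%(s, y). ext s (y / \<omega>))" unfolding case_prod_unfold
  proof (rule continuous_on_coordinatewise_then_product)
   fix a
   have "continuous_on R.E (%d. fst d (kap a) * (snd d / \<omega>) powi lst a)"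
   proof (intro continuous_intros)
    show "continuous_on R.E (%d. fst d (kap a))"
     by (rule continuous_on_product_then_coordinatewise[OF continuous_on_fst[OF continuous_on_id]])
   qed (use \<omega> E in auto)
   thus "continuous_on R.E (%d. ext (fst d) (snd d / \<omega>) a)"
    by (cases "a \<in> carrier \<Gamma>") (simp_all add: ext_def)
  qed
  show "(%t. (restrict t K, \<omega> * t (e j))) ` M \<subseteq> R.E" using \<omega> nz by (auto simp: M_iff E)
  show "(%(s, y). ext s (y / \<omega>)) ` R.E \<subseteq> M"
   using \<omega> M'T by (auto simp: M_iff E ext_T restrict_ext ext_e)
  show "(%(s, y). ext s (y / \<omega>)) (restrict t K, \<omega> * t (e j)) = t" if "t \<in> M" for t
   using that \<omega> ext_restrict[of t] by (simp add: M_iff)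
  show "(restrict ((%(s, y). ext s (y / \<omega>)) d) K, \<omega> * (%(s, y). ext s (y / \<omega>)) d (e j)) = d" if "d \<in> R.E" for d
   using that \<omega> E M'T by (cases d) (simp add: restrict_ext ext_e)
 qed
qed

end

end

context toric_step
begin

text \<open>Subtraction of naturals is truncated, so \<open>card \<A>'\<close> must not exceed
  \<open>card \<A>\<close>. Were \<open>\<A>\<close> infinite, removing the finitely many members
  outside \<open>\<A>Y\<close> would leave an infinite set, and both cardinalities would be
  0.\<close>

lemma rank_positive:
 assumes "n = 1 + card \<A> - card \<A>'"
 shows "1 \<le> n"
proof -
 have sub: "\<A>Y \<subseteq> \<A>" by (auto simp: subarrangement_def)
 have "card \<A>Y \<le> card \<A>"
 proof (cases "finite \<A>")
  case True thus ?thesis by (rule card_mono[OF _ sub])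
 next
  case False
  have "finite (\<A> - \<A>Y)" unfolding transversal(1) by simp
  hence "infinite \<A>Y" using False by (metis finite_Diff2)
  thus ?thesis by simp
 qed
 thus ?thesis using assms card_quotient by simp
qed

theorem complement_lcs_lie:
 assumes n: "1 \<le> n" and x0: "x0 \<in> M'" and z: "z \<in> M" and con: "path_connected M'"
  and \<beta>: "extends_homology_map M' x0 (Conf n) (b x0) b \<beta>" and \<theta>: "inf_pure_braid_action n (b x0) \<theta>"
 shows "path_connected M"
  "lie_isomorphic (lcs_lie (fundamental_group M z))
   (lie_semidirect (lcs_lie (fundamental_group M' x0)) (free_lie {1..n}) (\<theta> \<circ> \<beta>))"
proof -
 have "inj_on (b x0) {1..n}" using b_Conf[OF x0] by (simp add: Conf_def)
 then obtain \<omega> where \<omega>: "\<omega> ~= 0" "inj_on (%i. Re (\<omega> * b x0 i)) {1..n}" using generic_rotation by blast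
 interpret R: root_fibration M' "%i s. \<omega> * b s i" n by (rule fibration[OF \<omega>(1) n])
 note hom = complement_homeomorphism[OF \<omega>(1) n]
 note Econ = R.E_path_connected[OF con]
 have "M = (%(s, y). ext s (y / \<omega>)) ` R.E" "continuous_on R.E (%(s, y). ext s (y / \<omega>))"
  using hom unfolding homeomorphism_def by auto
 thus "path_connected M" using path_connected_continuous_image[OF _ Econ] by metis
 have e0: "(x0, R.\<sigma> x0) \<in> R.E" using x0 R.\<sigma>_in_F by (simp add: R.E_iff)
 have \<beta>h: "\<beta> \<in> lie_hom (lcs_lie (fundamental_group M' x0)) (lcs_lie (fundamental_group (Conf n) (b x0)))"
  using \<beta> by (simp add: extends_homology_map_def)
 have \<theta>h: "\<theta> \<in> lie_hom (lcs_lie (fundamental_group (Conf n) (b x0))) (Der (free_lie {1..n}))"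
  using \<theta> by (simp add: inf_pure_braid_action_def)
 have bM: "b \<in> M' \<rightarrow> Conf n" using b_Conf by blast
 have "lie_isomorphic (lcs_lie (fundamental_group R.E (x0, R.\<sigma> x0)))
  (lie_semidirect (lcs_lie (fundamental_group M' x0)) (free_lie {1..n}) (\<theta> \<circ> \<beta>))"
 proof (rule R.lcs_lie_root_fibration[OF x0 con \<omega>(2) lie_hom_compose[OF \<beta>h \<theta>h]])
  fix p q W
  assume p: "p \<in> loops M' x0" and q: "q \<in> {1..n}"
   and W: "!!k. k \<in> {1..n} - {q} ==> winding_number (%t. \<omega> * b (p t) q - \<omega> * b (p t) k) 0 = of_int (W k)"
  have bp: "b \<circ> p \<in> loops (Conf n) (b x0)"
   using p path_in_compose[OF _ b_continuous bM] by (simp add: loops_iff pathstart_compose pathfinish_compose)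
  have "\<beta> (lcs_degree_one (fundamental_group M' x0) (loop_class M' p)) =
    lcs_degree_one (fundamental_group (Conf n) (b x0)) (loop_class (Conf n) (b \<circ> p))"
   using \<beta> p bp hom_induced_hurewicz[OF b_continuous bM p] by (simp add: extends_homology_map_def)
  hence "(\<theta> \<circ> \<beta>) (lcs_degree_one (fundamental_group M' x0) (loop_class M' p)) (fl_gen q) =
    fl_br (fl_gen q) (\<Sum>k\<in>{1..n} - {q}. zscale (pair_winding (b \<circ> p) k q) (fl_gen k))"
   using inf_pure_braid_action_winding[OF \<theta> b_Conf[OF x0] q bp] by simp
  \<comment> \<open>A constant factor does not change a winding number, so the numbers of the
    rescaled fibration are those of the root map.\<close>
  also have "(\<Sum>k\<in>{1..n} - {q}. zscale (pair_winding (b \<circ> p) k q) (fl_gen k)) = (\<Sum>k\<in>{1..n} - {q}. zscale (W k) (fl_gen k) :: nat free_lie)"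
  proof (rule sum.cong)
   fix k assume k: "k \<in> {1..n} - {q}"
   have "path_in (- {0}) ((%w. w q - w k) \<circ> (b \<circ> p))"
    using bp q k by (intro path_in_compose[OF _ pair_map]) (auto simp: loops_iff)
   hence "winding_number (%t. \<omega> * (b (p t) q - b (p t) k)) 0 = winding_number (%t. b (p t) q - b (p t) k) 0"
    using \<omega>(1) by (intro winding_number_scale) (simp_all add: comp_def)
   hence "complex_of_int (W k) = of_int (pair_winding (b \<circ> p) k q)"
    using W[OF k] pair_winding(1)[OF bp, of k q] k q by (simp add: right_diff_distrib)
   thus "zscale (pair_winding (b \<circ> p) k q) (fl_gen k) = zscale (W k) (fl_gen k)" by simp
  qed simp
  finally show "(\<theta> \<circ> \<beta>) (lcs_degree_one (fundamental_group M' x0) (loop_class M' p)) (fl_gen q) =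
    fl_br (fl_gen q) (\<Sum>k\<in>{1..n} - {q}. zscale (W k) (fl_gen k))" .
 qed
 with lcs_lie_homeomorphism[OF hom Econ z e0]
 show "lie_isomorphic (lcs_lie (fundamental_group M z))
   (lie_semidirect (lcs_lie (fundamental_group M' x0)) (free_lie {1..n}) (\<theta> \<circ> \<beta>))"
  by (rule lie_isomorphic_trans)
qed

end

text \<open>The image of a component is connected and finite, hence a point, and the function is
  injective.\<close>

lemma components_finite_image:
 fixes f :: "'a::topological_space => complex"
 assumes f: "continuous_on H f" "inj_on f H" "finite (f ` H)"
 shows "components H = (%t. {t}) ` H"
proof -
 have "connected_component_set H t = {t}" if t: "t \<in> H" for t
 proof -
  let ?C = "connected_component_set H t"
  have CH: "?C \<subseteq> H" by (rule connected_component_subset)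
  have tC: "t \<in> ?C" unfolding mem_Collect_eq connected_component_refl_eq by (rule t)
  have "connected (f ` ?C)"
   by (rule connected_continuous_image[OF continuous_on_subset[OF f(1) CH] connected_connected_component])
  moreover have "finite (f ` ?C)" using f(3) CH by (meson finite_subset image_mono)
  ultimately obtain a where "f ` ?C = {a}" using connected_finite_iff_sing tC by blast
  hence "s = t" if "s \<in> ?C" for s using that tC CH inj_onD[OF f(2)] by (metis imageI singletonD subsetD)
  thus ?thesis using tC by blast
 qed
 thus ?thesis by (auto simp: components_def)
qed

lemma finite_powi_roots: "k ~= 0 ==> finite {y::complex. y ~= 0 \<and> y powi k = 1}"
proof -
 assume k: "k ~= 0"
 have "{y::complex. y ~= 0 \<and> y powi k = 1} \<subseteq> {y. y ^ nat \<bar>k\<bar> = 1}"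
  by (cases k rule: int_cases2) (auto simp: power_int_minus)
 moreover have "1 \<le> nat \<bar>k\<bar>" using k by simp
 ultimately show ?thesis using finite_roots_unity[of "nat \<bar>k\<bar>"] finite_subset by blast
qed

text \<open>The torus is the set of nonzero numbers and each hypersurface a finite set of roots of
  unity, so all members of the arrangement are points. Removing them and the origin from the plane
  leaves \<open>1 + card \<A>\<close> punctures.\<close>

theorem rank_one_complement:
 fixes \<Gamma> :: "'g monoid" (structure)
 assumes comm: "comm_group \<Gamma>" and iso: "\<Gamma> \<cong> product_group {1..1::nat} (%_. integer_group)"
  and ess: "essential_arrangement \<Gamma> \<A>" and z: "z \<in> arr_complement \<Gamma> \<A>"
 shows "path_connected (arr_complement \<Gamma> \<A>)"
  "lie_isomorphic (lcs_lie (fundamental_group (arr_complement \<Gamma> \<A>) z)) (free_lie {1..1 + card \<A>})"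
proof -
 interpret comm_group \<Gamma> by (rule comm)
 let ?Z = "product_group {1..1::nat} (%_. integer_group)"
 let ?T = "carrier (torus \<Gamma>)"
 obtain \<phi> where \<phi>: "\<phi> \<in> iso \<Gamma> ?Z" using iso by (auto simp: is_iso_def)
 define \<nu> where "\<nu> a = \<phi> a 1" for a
 have bij: "bij_betw \<nu> (carrier \<Gamma>) UNIV"
 proof -
  have "bij_betw (%c::nat => int. c 1) ({1..1} \<rightarrow>\<^sub>E UNIV) UNIV"
   by (rule bij_betw_byWitness[where f' = "%k. \<lambda>i\<in>{1..1}. k"]) (auto simp: PiE_def extensional_def fun_eq_iff)
  hence "bij_betw ((%c. c 1) \<circ> \<phi>) (carrier \<Gamma>) UNIV"
   using \<phi> by (intro bij_betw_trans[of \<phi> _ "{1..1} \<rightarrow>\<^sub>E UNIV"]) (auto simp: iso_def)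
  thus ?thesis by (simp add: \<nu>_def[abs_def] comp_def)
 qed
 have \<nu>_mult: "\<nu> (a \<otimes> b) = \<nu> a + \<nu> b" if "a \<in> carrier \<Gamma>" "b \<in> carrier \<Gamma>" for a b
 proof -
  have "\<phi> (a \<otimes> b) = \<phi> a \<otimes>\<^bsub>?Z\<^esub> \<phi> b" using \<phi> that by (auto simp: iso_def hom_def)
  thus ?thesis by (simp add: \<nu>_def)
 qed
 have \<nu>_one: "\<nu> \<one> = 0" using \<nu>_mult[of \<one> \<one>] by simp
 define g where "g = inv_into (carrier \<Gamma>) \<nu>"
 have g: "g k \<in> carrier \<Gamma>" "\<nu> (g k) = k" for k
  using bij unfolding g_def by (auto simp: bij_betw_def intro: inv_into_into f_inv_into_f)
 have g\<nu>: "g (\<nu> a) = a" if "a \<in> carrier \<Gamma>" for a using bij that by (simp add: g_def bij_betw_inv_into_left)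
 have g_add: "g (k + l) = g k \<otimes> g l" for k l
  using g\<nu>[of "g k \<otimes> g l"] \<nu>_mult[of "g k" "g l"] g by simp
 have tg: "t (g k) = t (g 1) powi k" if t: "t \<in> ?T" for t k
 proof -
  have nz: "t (g l) ~= 0" for l using t g by (auto simp: torus_carrier)
  have add: "t (g (k + l)) = t (g k) * t (g l)" for k l using t g by (simp add: g_add torus_carrier)
  show ?thesis
  proof (induction k rule: int_induct[of _ 0])
   case base thus ?case using add[of 0 0] nz[of 0] by simp
  next
   case (step1 i) thus ?case using add[of i 1] nz by (simp add: power_int_add)
  next
   case (step2 i) thus ?case using add[of "i - 1" 1] nz[of 1] by (simp add: power_int_diff field_simps)
  qed
 qed
 define \<Psi> where "\<Psi> y = (\<lambda>a\<in>carrier \<Gamma>. y powi \<nu> a)" for y :: complex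
 have \<Psi>T: "\<Psi> y \<in> ?T" "\<Psi> y (g 1) = y" if "y ~= 0" for y
  using that g by (auto simp: \<Psi>_def torus_carrier \<nu>_mult power_int_add)
 have T\<Psi>: "\<Psi> (t (g 1)) = t" "t (g 1) ~= 0" if t: "t \<in> ?T" for t
 proof -
  show "\<Psi> (t (g 1)) = t"
   using t tg[OF t, symmetric] g\<nu> by (intro extensionalityI[of _ "carrier \<Gamma>"]) (auto simp: \<Psi>_def torus_carrier)
  show "t (g 1) ~= 0" using t g by (auto simp: torus_carrier)
 qed
 obtain X where X: "finite X" "X \<subseteq> carrier \<Gamma> - {\<one>}" "\<A> = arrangement_of \<Gamma> X"
  using ess by (auto simp: essential_arrangement_def)
 define P where "P = (\<Union>a\<in>X. {y. y ~= 0 \<and> y powi \<nu> a = (1::complex)})"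
 have \<nu>X: "\<nu> a ~= 0" if "a \<in> X" for a
 proof
  assume "\<nu> a = 0"
  hence "a = \<one>" using X(2) that g\<nu>[of a] g\<nu>[of \<one>] \<nu>_one by auto
  thus False using X(2) that by blast
 qed
 hence finP: "finite P" unfolding P_def using X(1) by (intro finite_UN_I finite_powi_roots)
 have H: "toric_hypersurface \<Gamma> a = \<Psi> ` {y. y ~= 0 \<and> y powi \<nu> a = 1}" if a: "a \<in> carrier \<Gamma>" for a
 proof (intro equalityI subsetI)
  fix t assume "t \<in> toric_hypersurface \<Gamma> a"
  hence t: "t \<in> ?T" "t a = 1" by (auto simp: toric_hypersurface_def)
  hence "t (g 1) powi \<nu> a = 1" using tg[OF t(1), of "\<nu> a"] g\<nu>[OF a] by simp
  thus "t \<in> \<Psi> ` {y. y ~= 0 \<and> y powi \<nu> a = 1}" using T\<Psi>[OF t(1)] by (intro image_eqI[of _ _ "t (g 1)"]) simp_all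
 qed (use a \<Psi>T in \<open>auto simp: toric_hypersurface_def \<Psi>_def\<close>)
 have \<A>: "\<A> = (%y. {\<Psi> y}) ` P"
 proof -
  have "components (toric_hypersurface \<Gamma> a) = (%y. {\<Psi> y}) ` {y. y ~= 0 \<and> y powi \<nu> a = 1}" if a: "a \<in> X" for a
  proof -
   have ac: "a \<in> carrier \<Gamma>" using a X(2) by blast
   have "(%t. t (g 1)) ` toric_hypersurface \<Gamma> a \<subseteq> {y. y ~= 0 \<and> y powi \<nu> a = 1}"
    unfolding H[OF ac] using \<Psi>T(2) by auto
   hence "finite ((%t. t (g 1)) ` toric_hypersurface \<Gamma> a)" using finite_powi_roots[OF \<nu>X[OF a]] by (rule finite_subset)
   moreover have "inj_on (%t. t (g 1)) (toric_hypersurface \<Gamma> a)"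
    by (rule inj_on_inverseI[of _ \<Psi>]) (simp add: toric_hypersurface_def T\<Psi>)
   moreover have "continuous_on (toric_hypersurface \<Gamma> a) (%t. t (g 1))"
    by (rule continuous_on_coordinate)
   ultimately have "components (toric_hypersurface \<Gamma> a) = (%t. {t}) ` toric_hypersurface \<Gamma> a"
    by (intro components_finite_image[of _ "%t. t (g 1)"])
   thus ?thesis unfolding H[OF ac] by (simp add: image_image)
  qed
  thus ?thesis unfolding X(3) arrangement_of_def P_def by (simp add: image_UN)
 qed
 have "inj_on (%y. {\<Psi> y}) P" by (rule inj_on_inverseI[of _ "%C. the_elem C (g 1)"]) (auto simp: P_def \<Psi>T)
 hence card: "card \<A> = card P" unfolding \<A> by (rule card_image)
 have "0 \<notin> P" by (simp add: P_def)
 hence "card (insert 0 P) = 1 + card \<A>" using finP card by simp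
 then obtain c where c: "bij_betw c {1..1 + card \<A>} (insert 0 P)"
  using ex_bij_betw_nat_finite_1[of "insert 0 P"] finP by auto
 let ?N = "- c ` {1..1 + card \<A>}"
 have N: "?N = - insert 0 P" using c by (simp add: bij_betw_def)
 have M: "arr_complement \<Gamma> \<A> = {t \<in> ?T. t (g 1) \<notin> P}"
 proof -
  have "t \<in> \<Union>\<A> \<longleftrightarrow> t (g 1) \<in> P" if "t \<in> ?T" for t
  proof
   assume "t \<in> \<Union>\<A>"
   then obtain y where "y \<in> P" "t = \<Psi> y" unfolding \<A> by auto
   thus "t (g 1) \<in> P" using \<Psi>T(2)[of y] by (simp add: P_def)
  next
   assume "t (g 1) \<in> P"
   hence "{\<Psi> (t (g 1))} \<in> \<A>" unfolding \<A> by (rule imageI)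
   thus "t \<in> \<Union>\<A>" using T\<Psi>(1)[OF that] by auto
  qed
  thus ?thesis by (auto simp: arr_complement_def)
 qed
 have hom: "homeomorphism (arr_complement \<Gamma> \<A>) ?N (%t. t (g 1)) \<Psi>"
 proof (rule homeomorphismI)
  show "continuous_on (arr_complement \<Gamma> \<A>) (%t. t (g 1))"
   by (rule continuous_on_coordinate)
  show "continuous_on ?N \<Psi>"
  proof (rule continuous_on_coordinatewise_then_product)
   fix a show "continuous_on ?N (%y. \<Psi> y a)"
    unfolding N by (cases "a \<in> carrier \<Gamma>") (auto simp: \<Psi>_def intro!: continuous_intros)
  qed
 qed (unfold M N, use \<Psi>T T\<Psi> in auto)
 have con: "path_connected ?N" by (intro path_connected_complement_countable) (auto simp: countable_finite)
 have "\<Psi> ` ?N = arr_complement \<Gamma> \<A>" "continuous_on ?N \<Psi>" using hom by (auto simp: homeomorphism_def)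
 thus "path_connected (arr_complement \<Gamma> \<A>)" using path_connected_continuous_image[OF _ con] by metis
 have y: "z (g 1) \<in> ?N" using hom z by (auto simp: homeomorphism_def)
 have "inj_on c {1..1 + card \<A>}" using c by (simp add: bij_betw_def)
 from lie_isomorphic_trans[OF lcs_lie_homeomorphism[OF hom con z y] lcs_lie_punctured_plane[OF this y]]
 show "lie_isomorphic (lcs_lie (fundamental_group (arr_complement \<Gamma> \<A>) z)) (free_lie {1..1 + card \<A>})" .
qed

theorem theorem4p1p2:
  fixes r :: nat
    and \<Lambda> :: "nat \<Rightarrow> 'g monoid"
    and Y :: "nat \<Rightarrow> ('g \<Rightarrow> complex) set"
    and \<A> :: "nat \<Rightarrow> ('g \<Rightarrow> complex) set set"
    and M :: "nat \<Rightarrow> ('g \<Rightarrow> complex) set"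
    and n :: "nat \<Rightarrow> nat"
    and e :: "nat \<Rightarrow> nat \<Rightarrow> 'g"
    and \<mu> :: "nat \<Rightarrow> nat \<Rightarrow> complex"
    and m :: "nat \<Rightarrow> nat \<Rightarrow> nat \<Rightarrow> int"
    and b :: "nat \<Rightarrow> ('g \<Rightarrow> complex) \<Rightarrow> nat \<Rightarrow> complex"
    and z :: "nat \<Rightarrow> 'g \<Rightarrow> complex"
    and \<beta> :: "nat \<Rightarrow> (nat \<Rightarrow> (real \<Rightarrow> 'g \<Rightarrow> complex) set set)
                  \<Rightarrow> (nat \<Rightarrow> (real \<Rightarrow> nat \<Rightarrow> complex) set set)"
    and \<theta> :: "nat \<Rightarrow> (nat \<Rightarrow> (real \<Rightarrow> nat \<Rightarrow> complex) set set)
                  \<Rightarrow> nat free_lie \<Rightarrow> nat free_lie"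
  assumes supersolvable: "strictly_supersolvable r \<Lambda> Y \<A>"
    and M: "\<And>j. j \<in> {1..r} \<Longrightarrow> M j = arr_complement (\<Lambda> j) (\<A> j)"
    and base_point: "\<And>j. j \<in> {1..r} \<Longrightarrow> z j \<in> M j"
    and n: "\<And>j. j \<in> {1..r} \<Longrightarrow> n j = fibre_rank \<A> j"
    and coordinates: "\<And>j. j \<in> {2..r} \<Longrightarrow> adapted_coordinates (\<Lambda> j) j (Y (j - 1)) (e j)"
    and roots: "\<And>j. j \<in> {2..r} \<Longrightarrow>
          root_presentation (\<Lambda> j) j (Y (j - 1)) (\<A> j) (n j) (e j) (\<mu> j) (m j)"
    and b: "\<And>j. j \<in> {2..r} \<Longrightarrow> b j = root_map j (n j) (e j) (\<mu> j) (m j)"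
    and \<beta>: "\<And>j. j \<in> {2..r} \<Longrightarrow>
          extends_homology_map (M (j - 1)) (z (j - 1)) (Conf (n j)) (b j (z (j - 1))) (b j) (\<beta> j)"
    and \<theta>: "\<And>j. j \<in> {2..r} \<Longrightarrow> inf_pure_braid_action (n j) (b j (z (j - 1))) (\<theta> j)"
  shows "lie_isomorphic (lcs_lie (fundamental_group (M 1) (z 1))) (free_lie {1..n 1}) \<and>
         (\<forall>j\<in>{2..r}. lie_isomorphic
           (lcs_lie (fundamental_group (M j) (z j)))
           (lie_semidirect (lcs_lie (fundamental_group (M (j - 1)) (z (j - 1))))
              (free_lie {1..n j}) (\<theta> j \<circ> \<beta> j)))"
proof -
 define K where "K j = carrier (\<Lambda> (j - 1))" for j
 have comm: "comm_group (\<Lambda> j)" and iso: "\<Lambda> j \<cong> product_group {1..j} (%_. integer_group)"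
  and ess: "essential_arrangement (\<Lambda> j) (\<A> j)" if "j \<in> {1..r}" for j
  using supersolvable that by (simp_all add: strictly_supersolvable_def)
 have adm: "admissible (\<Lambda> j) (K j) (Y (j - 1))" and sub: "\<Lambda> (j - 1) = (\<Lambda> j)\<lparr>carrier := K j\<rparr>"
  and TM: "TM_ideal (\<Lambda> j) (Y (j - 1)) (\<A> j)"
  and quot: "\<A> (j - 1) = quotient_arrangement (\<Lambda> j) (K j) (Y (j - 1)) (\<A> j)" if "j \<in> {2..r}" for j
  using supersolvable that unfolding K_def strictly_supersolvable_def by blast+
 have r: "1 \<le> r" using supersolvable by (simp add: strictly_supersolvable_def)
 have one: "path_connected (M 1)" "lie_isomorphic (lcs_lie (fundamental_group (M 1) (z 1))) (free_lie {1..n 1})"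
 proof -
  have 1: "1 \<in> {1..r}" using r by simp
  note R = rank_one_complement[OF comm[OF 1] iso[OF 1] ess[OF 1], folded M[OF 1], OF base_point[OF 1]]
  show "path_connected (M 1)" by (rule R(1))
  have "n 1 = 1 + card (\<A> 1)" unfolding n[OF 1] by (simp add: fibre_rank_def)
  thus "lie_isomorphic (lcs_lie (fundamental_group (M 1) (z 1))) (free_lie {1..n 1})" using R(2) by simp
 qed
 \<comment> \<open>Path-connectedness is carried along the tower because each step needs it of its
   base to be free in the choice of base points; the isomorphisms of different steps are independent
   of each other.\<close>
 have step: "path_connected (M j) \<and> lie_isomorphic (lcs_lie (fundamental_group (M j) (z j)))
   (lie_semidirect (lcs_lie (fundamental_group (M (j - 1)) (z (j - 1)))) (free_lie {1..n j}) (\<theta> j \<circ> \<beta> j))"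
  if j: "j \<in> {2..r}" and con: "path_connected (M (j - 1))" for j
 proof -
  have j1: "j \<in> {1..r}" "j - 1 \<in> {1..r}" "j ~= 1" using j by auto
  interpret comm_group "\<Lambda> j" by (rule comm[OF j1(1)])
  interpret S: toric_step "\<Lambda> j" j "e j" "K j" "Y (j - 1)" "\<A> j" "n j" "\<mu> j" "m j"
  proof
   show "lattice_basis (\<Lambda> j) j (e j)" using coordinates[OF j] by (simp add: adapted_coordinates_def)
   show "1 \<le> j" using j by simp
  qed (rule adm[OF j] coordinates[OF j] TM[OF j] roots[OF j])+
  have M': "S.M' = M (j - 1)" unfolding M[OF j1(2)] sub[OF j] quot[OF j] ..
  have "n j = 1 + card (\<A> j) - card S.\<A>'" using n[OF j1(1)] j1(3) unfolding fibre_rank_def quot[OF j] by simp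
  note R = S.complement_lcs_lie[OF S.rank_positive[OF this], unfolded M', OF base_point[OF j1(2)],
    folded M[OF j1(1)], OF base_point[OF j1(1)] con, folded b[OF j], OF \<beta>[OF j] \<theta>[OF j]]
  show ?thesis using R by blast
 qed
 have con: "path_connected (M j)" if "1 \<le> j" "j \<le> r" for j
  using that
 proof (induction j rule: nat_induct_at_least)
  case base
  show ?case by (rule one(1))
 next
  case (Suc j)
  thus ?case using step[of "Suc j"] by auto
 qed
 show ?thesis
 proof (intro conjI ballI)
  fix j assume j: "j \<in> {2..r}"
  thus "lie_isomorphic (lcs_lie (fundamental_group (M j) (z j)))
   (lie_semidirect (lcs_lie (fundamental_group (M (j - 1)) (z (j - 1)))) (free_lie {1..n j}) (\<theta> j \<circ> \<beta> j))"
   using step[OF j con[of "j - 1"]] by auto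
 qed (rule one(2))
qed

end
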